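(* Let $X(\lambda)=(X_1(\lambda),\dots,X_d(\lambda))$ be a vector of functionals $X_i:\mathcal P\to\mathbb R$ such that each $X_i$ does not decrease as a functional on the poset $(\mathcal P,\preccurlyeq)$. Suppose that there exist regularly varying functions $\widetilde a_i(s)$ and $\widetilde b_i(s)>0$ ($i=1,\dots,d$) such that the rescaled random vector $$Z(s)=\bigl(\widetilde b_1(s)(X_1(\widetilde\lambda(s))-\widetilde a_1(s)),\dots,\widetilde b_d(s)(X_d(\widetilde\lambda(s))-\widetilde a_d(s))\bigr)$$ converges in distribution, as $s\to\infty$, to a random vector $Z\in\mathbb R^d$. Assume additionally that for some function $u(s)$ with $u(s)=o(s^{1/4})$ and $u(s)\to\infty$ as $s\to\infty$, and for every $i=1,\dots,d$, $$\widetilde b_i(s)\bigl(\widetilde a_i(s)-\widetilde a_i(s-u(s)\sqrt s)\bigr)\to0,\qquad s\to\infty.$$ Then, if $\Lambda(n)$ is chosen at random from $\mathcal P_n$ with the uniform distribution and $s_n=F\bigl(\pi/\sqrt{6n}\bigr)$, the random vector $$Z_n=\bigl(\widetilde b_1(s_n)(X_1(\Lambda(n))-\widetilde a_1(s_n)),\dots,\widetilde b_d(s_n)(X_d(\Lambda(n))-\widetilde a_d(s_n))\bigr)$$ converges in distribution, as $n\to\infty$, to $Z$.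
   Context: $\mathcal P_n$ is the (finite) set of integer partitions of $n\ge0$, and $\mathcal P=\bigcup_{n\ge0}\mathcal P_n$. For $\lambda\in\mathcal P$, $N(\lambda)$ is the sum of its parts and $C_k(\lambda)$ is the number of parts equal to $k$, $k\ge1$. Let $(\varepsilon_{k,j})_{k,j\ge1}$ be independent standard exponential random variables; for $t>0$ put $\rho_k(t)=\inf\{r\ge0:\varepsilon_{k,r+1}\le kt\}$ and let $\lambda(t)$ be the random partition with $C_k(\lambda(t))=\rho_k(t)$ for all $k\ge1$. For fixed $t$ one has $\mathbb P[\lambda(t)=\lambda]=\mathrm e^{-tN(\lambda)}\prod_{j\ge1}(1-\mathrm e^{-jt})$ for each $\lambda\in\mathcal P$. Let $F(t)=-\sum_{k=1}^\infty\log(1-\mathrm e^{-kt})$, $t>0$; it decreases from $\infty$ at $0$ to $0$ at $\infty$ and $F^{-1}$ is its inverse function. Define $\widetilde\lambda(s)=\lambda(F^{-1}(s))$, $s>0$. The partial order $\preccurlyeq$ on $\mathcal P$: $\mu\preccurlyeq\lambda$ if and only if $\mathbb P[\lambda(t_1)=\lambda,\lambda(t_2)=\mu]>0$ for some $t_1\le t_2$; in other words, $\lambda$ can be obtained from $\mu$ by adding further parts without changing or removing existing ones (i.e. $C_k(\mu)\le C_k(\lambda)$ for all $k$). A function $a:\mathbb R_+\to\mathbb R$ is regularly varying (at infinity) if for some constant $r\in\mathbb R$ one has $a(cs)/a(s)\to c^r$ as $s\to\infty$ for every $c>0$. *)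

theory Defs
  imports "HOL-Probability.Probability"
begin

text \<open>
  An integer partition is the finite multiset of its (positive) parts. Thus the sum of the parts
  \<open>N(p)\<close> is \<^const>\<open>sum_mset\<close>, \<open>C\<^sub>k(p)\<close> is \<open>count p k\<close>, and the order on partitions
  (adding parts without changing or removing existing ones) is \<open>\<subseteq>#\<close>; it is not the
  type class order \<open>\<le>\<close> on multisets.
\<close>

definition partitions :: "nat multiset set" where
  "partitions = {p. 0 \<notin># p}"

definition partitions_of :: "nat \<Rightarrow> nat multiset set" where
  "partitions_of n = {p \<in> partitions. sum_mset p = n}"

text \<open>
  In the next two definitions \<open>e\<close> is a realisation of the array of exponential variables, of which
  only the entries \<open>e k j\<close> with \<open>k, j \<ge> 1\<close> are used. The infimum is taken in the extended natural
  numbers, so that it is \<open>\<infinity>\<close> for the empty set.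
\<close>

definition rho :: "(nat \<Rightarrow> nat \<Rightarrow> real) \<Rightarrow> nat \<Rightarrow> real \<Rightarrow> enat" where
  "rho e k t = (INF r \<in> {r. e k (r + 1) \<le> real k * t}. enat r)"

text \<open>
  For independent standard exponential variables and \<open>t > 0\<close>, almost surely all \<open>rho e k t\<close> are
  finite and only finitely many of them are nonzero. On the exceptional null event no partition has
  these multiplicities, and the empty partition is used instead.
\<close>

definition partition_at :: "(nat \<Rightarrow> nat \<Rightarrow> real) \<Rightarrow> real \<Rightarrow> nat multiset" where
  "partition_at e t =
     (if \<exists>p \<in> partitions. \<forall>k\<ge>1. enat (count p k) = rho e k t
      then (THE p. p \<in> partitions \<and> (\<forall>k\<ge>1. enat (count p k) = rho e k t))
      else {#})"

definition F :: "real \<Rightarrow> real" where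
  "F t = - (\<Sum>k. ln (1 - exp (- (real (Suc k) * t))))"

definition F_inv :: "real \<Rightarrow> real" where
  "F_inv = the_inv_into {0<..} F"

definition partition_tilde :: "(nat \<Rightarrow> nat \<Rightarrow> real) \<Rightarrow> real \<Rightarrow> nat multiset" where
  "partition_tilde e s = partition_at e (F_inv s)"

text \<open>
  Since \<open>x / 0 = 0\<close> and \<open>c powr r > 0\<close>, the following condition forces \<open>a s \<noteq> 0\<close> for all
  sufficiently large \<open>s\<close>.
\<close>

definition regularly_varying :: "(real \<Rightarrow> real) \<Rightarrow> bool" where
  "regularly_varying a \<longleftrightarrow>
     (\<exists>r. \<forall>c>0. ((\<lambda>s. a (c * s) / a s) \<longlongrightarrow> c powr r) at_top)"

text \<open>
  Convergence in distribution: the laws converge weakly when tested against bounded continuous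
  functions. (The library's \<^const>\<open>weak_conv_m\<close> covers only sequences of laws on the real line.)
\<close>

definition weak_limit ::
  "('i \<Rightarrow> 'b::topological_space measure) \<Rightarrow> 'b measure \<Rightarrow> 'i filter \<Rightarrow> bool" where
  "weak_limit P Q net \<longleftrightarrow>
     (\<forall>f :: 'b \<Rightarrow> real. continuous_on UNIV f \<and> bounded (range f) \<longrightarrow>
        ((\<lambda>i. \<integral>x. f x \<partial>P i) \<longlongrightarrow> (\<integral>x. f x \<partial>Q)) net)"

definition rescaled ::
  "('d::finite \<Rightarrow> nat multiset \<Rightarrow> real) \<Rightarrow> ('d \<Rightarrow> real \<Rightarrow> real) \<Rightarrow> ('d \<Rightarrow> real \<Rightarrow> real)
     \<Rightarrow> real \<Rightarrow> nat multiset \<Rightarrow> real ^ 'd" where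
  "rescaled X a b s p = (\<chi> i. b i s * (X i p - a i s))"

end

theory Submission
  imports Defs "HOL-Real_Asymp.Real_Asymp" "HOL-Complex_Analysis.Complex_Analysis"
begin

text \<open>
  Conditionally on its size \<open>m\<close>, \<open>\<lambda>(t)\<close> is uniform on the partitions of \<open>m\<close>, and at
  \<open>t\<^sub>n = \<pi> / \<surd>(6n)\<close> the size has mean close to \<open>n\<close>, standard deviation \<open>\<sigma>\<^sub>n\<close> of order \<open>n\<close> to the
  power \<open>3/4\<close>, and satisfies a local limit theorem. The laws of \<open>\<lambda>(t\<^sub>n + y / \<sigma>\<^sub>n)\<close>, \<open>0 \<le> y \<le> 1\<close>,
  are exponential tilts of the law of \<open>\<lambda>(t\<^sub>n)\<close> and correspond to shifts of \<open>s\<close> by \<open>O(\<surd>s)\<close>, so that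
  monotonicity and the condition on the centering give the same limit \<open>Z\<close> for all of them. Since
  a Laplace transform on an interval determines a measure, the means over the uniform partitions of size
  \<open>m\<close>, averaged over \<open>m\<close> in a window \<open>n + [x \<sigma>\<^sub>n, y \<sigma>\<^sub>n]\<close>, have this limit as well.

  To descend to the single size \<open>n\<close>, uniform partitions of \<open>n\<close> and \<open>n + j\<close> with \<open>j\<close> a small multiple of
  \<open>\<sigma>\<^sub>n\<close> are compared by adding to the former an independent random partition of \<open>j\<close>: a second moment
  computation shows that the sum is nearly uniform. As the functionals increase under additions,
  windows just below and just above \<open>n\<close> enclose the means of \<open>arctan\<close> of the rescaled
  coordinates, and the increments of these control those of continuous functions with
  compact support.
\<close>

section \<open>Uniform partitions and random additions\<close>

text \<open>An addition must leave almost no trace, and a fixed added part would be recognised in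
  the sum. Hence about j t pairs of parts of order 1/t are added, chosen so freely that the expected
  number of pairs shared by two independent choices is of order j^2 t^3. This is small when j is a
  small multiple of t^(-3/2), the order of the standard deviation, and this fixes the scale on which
  sizes can be compared.

  The tilts are one-sided because the hypothesis on the centering looks only at s - u(s) sqrt s,
  that is, at smaller s and larger t; a real segment is enough for analytic continuation.

  Regular variation is assumed without measurability, so a uniform convergence theorem does not
  apply to \<open>b\<close> directly. It is applied to the distance between two quantiles of the law
  of a functional, a difference of monotone functions of s that is asymptotic to a constant divided
  by \<open>b\<close>, and the result is carried over to \<open>b\<close>. This works for a
  nondegenerate limit; for a one-point limit the quantiles reveal no scale, and contiguity of the
  tilted laws takes over.\<close>

lemma finite_partitions_of: "finite (partitions_of n)"
proof -
  have "partitions_of n \<subseteq> (\<lambda>xs. mset xs) ` {xs. set xs \<subseteq> {0..n} \<and> length xs \<le> n}"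
  proof
    fix p assume p: "p \<in> partitions_of n"
    obtain xs where xs: "p = mset xs" by (metis ex_mset)
    have nz: "0 \<notin> set xs" and s: "sum_list xs = n"
      using p by (auto simp: partitions_of_def partitions_def xs sum_mset_sum_list)
    have "length xs \<le> sum_list xs" if "0 \<notin> set xs" for xs :: "nat list"
      using that by (induction xs) auto
    then have "length xs \<le> n" using nz s by auto
    moreover have "set xs \<subseteq> {0..n}" using member_le_sum_list s by fastforce
    ultimately show "p \<in> mset ` {xs. set xs \<subseteq> {0..n} \<and> length xs \<le> n}" using xs by auto
  qed
  then show ?thesis by (rule finite_subset) (intro finite_imageI finite_lists_length_le, simp)
qed

lemma partitions_of_nonempty: "partitions_of n \<noteq> {}"
proof -
  have "(if n = 0 then {#} else {#n#}) \<in> partitions_of n"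
    by (auto simp: partitions_of_def partitions_def)
  then show ?thesis by auto
qed

lemma card_partitions_of_pos: "card (partitions_of n) > 0"
  by (simp add: card_gt_0_iff finite_partitions_of partitions_of_nonempty)

lemma partitions_of_add:
  "S \<in> partitions_of k \<Longrightarrow> p \<in> partitions_of n \<Longrightarrow> p + S \<in> partitions_of (n + k)"
  by (auto simp: partitions_of_def partitions_def)

lemma sum_mset_mono_subset:
  fixes S p :: "nat multiset"
  assumes "S \<subseteq># p"
  shows "sum_mset S \<le> sum_mset p"
  by (metis assms subset_mset.diff_add sum_mset.union le_add2)

text \<open>Removing \<open>S\<close> inverts the addition of \<open>S\<close>, so the partitions
  above \<open>S\<close> are counted by what is left. Applied to unions of two additions, this gives
  the second moment of the density in \<open>partition_mean_addition\<close>.\<close>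

lemma card_partitions_of_containing:
  assumes "S \<in> partitions_of k" "k \<le> m"
  shows "card {p \<in> partitions_of m. S \<subseteq># p} = card (partitions_of (m - k))"
proof -
  have "bij_betw (\<lambda>p. p + S) (partitions_of (m - k)) {p \<in> partitions_of m. S \<subseteq># p}"
  proof (rule bij_betw_byWitness[where f' = "\<lambda>p. p - S"])
    show "(\<lambda>p. p + S) ` partitions_of (m - k) \<subseteq> {p \<in> partitions_of m. S \<subseteq># p}"
      using partitions_of_add[OF assms(1), of _ "m - k"] assms(2) by auto
    show "(\<lambda>p. p - S) ` {p \<in> partitions_of m. S \<subseteq># p} \<subseteq> partitions_of (m - k)"
    proof safe
      fix p assume p: "p \<in> partitions_of m" "S \<subseteq># p"
      then have "sum_mset p = sum_mset (p - S) + sum_mset S"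
        by (metis subset_mset.diff_add sum_mset.union)
      then show "p - S \<in> partitions_of (m - k)"
        using p assms by (auto simp: partitions_of_def partitions_def dest: in_diffD)
    qed
  qed auto
  then show ?thesis by (simp add: bij_betw_same_card)
qed

definition partition_mean :: "nat \<Rightarrow> (nat multiset \<Rightarrow> real) \<Rightarrow> real" where
  "partition_mean n f = (\<Sum>p\<in>partitions_of n. f p) / real (card (partitions_of n))"

lemma integral_uniform_partition:
  "(\<integral>p. f p \<partial>measure_pmf (pmf_of_set (partitions_of n))) = partition_mean n f"
  by (simp add: partition_mean_def integral_pmf_of_set finite_partitions_of partitions_of_nonempty)

lemma partition_mean_mono:
  assumes "\<And>p. p \<in> partitions_of n \<Longrightarrow> f p \<le> g p"
  shows "partition_mean n f \<le> partition_mean n g"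
  unfolding partition_mean_def by (intro divide_right_mono sum_mono) (auto simp: assms)

lemma partition_mean_const: "partition_mean n (\<lambda>_. c) = c"
  using card_partitions_of_pos[of n] by (simp add: partition_mean_def)

lemma partition_mean_add: "partition_mean n (\<lambda>p. f p + g p) = partition_mean n f + partition_mean n g"
  by (simp add: partition_mean_def sum.distrib add_divide_distrib)

lemma partition_mean_diff: "partition_mean n (\<lambda>p. f p - g p) = partition_mean n f - partition_mean n g"
  by (simp add: partition_mean_def sum_subtractf diff_divide_distrib)

lemma partition_mean_cmult: "partition_mean n (\<lambda>p. c * f p) = c * partition_mean n f"
  by (simp add: partition_mean_def sum_distrib_left)

lemma partition_mean_sum:
  "partition_mean n (\<lambda>p. \<Sum>i\<in>I. f i p) = (\<Sum>i\<in>I. partition_mean n (f i))"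
  unfolding partition_mean_def
  by (subst sum.swap) (simp add: sum_divide_distrib)

lemma partition_mean_abs_le: "\<bar>partition_mean n f\<bar> \<le> partition_mean n (\<lambda>p. \<bar>f p\<bar>)"
  by (simp add: partition_mean_def divide_right_mono sum_abs)

text \<open>By Cauchy--Schwarz, with the mean of \<open>h\<close> equal to one.\<close>

lemma partition_mean_density_deviation:
  assumes h1: "partition_mean m h = 1" and h2: "partition_mean m (\<lambda>p. (h p)\<^sup>2) \<le> 1 + c"
    and \<psi>: "\<And>p. p \<in> partitions_of m \<Longrightarrow> \<bar>\<psi> p\<bar> \<le> 1"
  shows "\<bar>partition_mean m (\<lambda>p. \<psi> p * h p) - partition_mean m \<psi>\<bar> \<le> sqrt c"
proof -
  have d: "(\<lambda>p. (h p - 1)\<^sup>2) = (\<lambda>p. (h p)\<^sup>2 + (1 - 2 * h p))"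
    by (auto simp: power2_eq_square algebra_simps)
  have "partition_mean m (\<lambda>p. (h p - 1)\<^sup>2) = partition_mean m (\<lambda>p. (h p)\<^sup>2) - 1"
    unfolding d partition_mean_add partition_mean_diff partition_mean_cmult
    by (simp add: h1 partition_mean_const)
  then have v: "partition_mean m (\<lambda>p. (h p - 1)\<^sup>2) \<le> c" using h2 by simp
  have "\<bar>partition_mean m (\<lambda>p. \<psi> p * h p) - partition_mean m \<psi>\<bar>
      = \<bar>partition_mean m (\<lambda>p. \<psi> p * (h p - 1))\<bar>"
    by (simp add: partition_mean_diff[symmetric] algebra_simps)
  also have "\<dots> \<le> partition_mean m (\<lambda>p. \<bar>\<psi> p * (h p - 1)\<bar>)" by (rule partition_mean_abs_le)
  also have "\<dots> \<le> partition_mean m (\<lambda>p. \<bar>h p - 1\<bar>)"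
    by (intro partition_mean_mono) (simp add: abs_mult mult_left_le_one_le \<psi>)
  also have "\<dots> \<le> sqrt (partition_mean m (\<lambda>p. (h p - 1)\<^sup>2))"
  proof (rule real_le_rsqrt)
    let ?S = "partitions_of m" and ?c = "real (card (partitions_of m))"
    have "(\<Sum>p\<in>?S. \<bar>h p - 1\<bar> * 1)\<^sup>2 \<le> (\<Sum>p\<in>?S. \<bar>h p - 1\<bar>\<^sup>2) * (\<Sum>p\<in>?S. 1\<^sup>2)"
      by (rule Cauchy_Schwarz_ineq_sum)
    then have "(\<Sum>p\<in>?S. \<bar>h p - 1\<bar>)\<^sup>2 \<le> (\<Sum>p\<in>?S. (h p - 1)\<^sup>2) * ?c" by simp
    then show "(partition_mean m (\<lambda>p. \<bar>h p - 1\<bar>))\<^sup>2 \<le> partition_mean m (\<lambda>p. (h p - 1)\<^sup>2)"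
      using card_partitions_of_pos[of m]
      by (simp add: partition_mean_def power_divide power2_eq_square divide_simps)
  qed
  also have "\<dots> \<le> sqrt c" using v by simp
  finally show ?thesis .
qed

text \<open>
  Adding to a uniform partition of \<open>n\<close> an independent element \<open>S\<^sub>x\<close> of a finite family of
  partitions of \<open>j\<close> yields a random partition of \<open>n + j\<close> with density \<open>h\<close> proportional to the
  number of indices \<open>x\<close> with \<open>S\<^sub>x \<subseteq># p\<close>; its second moment counts pairs of overlapping additions.
\<close>

lemma partition_mean_addition:
  fixes S :: "'i \<Rightarrow> nat multiset" and w :: "'i \<Rightarrow> 'i \<Rightarrow> nat"
  assumes fin: "finite \<Omega>" and ne: "\<Omega> \<noteq> {}"
    and S: "\<And>x. x \<in> \<Omega> \<Longrightarrow> S x \<in> partitions_of j"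
    and w: "\<And>x y. x \<in> \<Omega> \<Longrightarrow> y \<in> \<Omega> \<Longrightarrow> sum_mset (S x \<inter># S y) = w x y"
    and second: "(\<Sum>x\<in>\<Omega>. \<Sum>y\<in>\<Omega>. if j \<le> n + w x y then real (card (partitions_of (n + w x y - j))) else 0)
        * real (card (partitions_of (n + j)))
      \<le> (1 + c) * (real (card \<Omega>) * real (card (partitions_of n)))\<^sup>2"
    and \<psi>: "\<And>p. p \<in> partitions_of (n + j) \<Longrightarrow> \<bar>\<psi> p\<bar> \<le> 1"
  shows "\<bar>(\<Sum>x\<in>\<Omega>. partition_mean n (\<lambda>p. \<psi> (p + S x))) / card \<Omega> - partition_mean (n + j) \<psi>\<bar> \<le> sqrt c"
proof -
  let ?m = "n + j"
  let ?N = "\<lambda>k. real (card (partitions_of k))"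
  define h where "h p = ?N ?m / ?N n * real (card {x\<in>\<Omega>. S x \<subseteq># p}) / card \<Omega>" for p
  have pos: "?N k > 0" for k using card_partitions_of_pos by simp
  have O: "real (card \<Omega>) > 0" using fin ne by (simp add: card_gt_0_iff)
  have cnt: "real (card {x\<in>\<Omega>. S x \<subseteq># p}) = (\<Sum>x\<in>\<Omega>. if S x \<subseteq># p then 1 else 0)" for p
    by (simp add: sum.If_cases fin Int_def)
  have cnt2: "(\<Sum>p\<in>partitions_of ?m. if T \<subseteq># p then 1 else 0) = (if k \<le> ?m then ?N (?m - k) else 0)"
    if T: "T \<in> partitions_of k" for T k
  proof (cases "k \<le> ?m")
    case True
    then show ?thesis using card_partitions_of_containing[OF T True]
      by (simp add: sum.If_cases finite_partitions_of Int_def)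
  next
    case False
    have "\<not> T \<subseteq># p" if "p \<in> partitions_of ?m" for p
      using that False T sum_mset_mono_subset[of T p] by (auto simp: partitions_of_def)
    then show ?thesis using False by simp
  qed
  have weighted: "partition_mean ?m (\<lambda>p. \<psi> p * h p) = (\<Sum>x\<in>\<Omega>. partition_mean n (\<lambda>p. \<psi> (p + S x))) / card \<Omega>"
    for \<psi> :: "nat multiset \<Rightarrow> real"
  proof -
    have "(\<Sum>p\<in>partitions_of ?m. \<psi> p * real (card {x\<in>\<Omega>. S x \<subseteq># p}))
        = (\<Sum>p\<in>partitions_of ?m. \<Sum>x\<in>\<Omega>. if S x \<subseteq># p then \<psi> p else 0)"
      unfolding cnt sum_distrib_left by (intro sum.cong refl) auto
    also have "\<dots> = (\<Sum>x\<in>\<Omega>. \<Sum>p\<in>partitions_of ?m. if S x \<subseteq># p then \<psi> p else 0)" by (rule sum.swap)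
    also have "\<dots> = (\<Sum>x\<in>\<Omega>. \<Sum>p\<in>partitions_of n. \<psi> (p + S x))"
    proof (rule sum.cong[OF refl])
      fix x assume x: "x \<in> \<Omega>"
      have "(\<Sum>p\<in>partitions_of ?m. if S x \<subseteq># p then \<psi> p else 0) = (\<Sum>p\<in>{p \<in> partitions_of ?m. S x \<subseteq># p}. \<psi> p)"
        by (simp add: sum.If_cases finite_partitions_of Int_def)
      also have "\<dots> = (\<Sum>p\<in>partitions_of n. \<psi> (p + S x))"
      proof (rule sum.reindex_bij_betw[symmetric], rule bij_betw_byWitness[where f' = "\<lambda>p. p - S x"])
        show "(\<lambda>p. p + S x) ` partitions_of n \<subseteq> {p \<in> partitions_of ?m. S x \<subseteq># p}"
          using partitions_of_add[OF S[OF x]] by auto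
        show "(\<lambda>p. p - S x) ` {p \<in> partitions_of ?m. S x \<subseteq># p} \<subseteq> partitions_of n"
        proof safe
          fix p assume p: "p \<in> partitions_of ?m" "S x \<subseteq># p"
          then have "sum_mset p = sum_mset (p - S x) + sum_mset (S x)"
            by (metis subset_mset.diff_add sum_mset.union)
          then show "p - S x \<in> partitions_of n"
            using p S[OF x] by (auto simp: partitions_of_def partitions_def dest: in_diffD)
        qed
      qed auto
      finally show "(\<Sum>p\<in>partitions_of ?m. if S x \<subseteq># p then \<psi> p else 0) = (\<Sum>p\<in>partitions_of n. \<psi> (p + S x))" .
    qed
    finally have e: "(\<Sum>p\<in>partitions_of ?m. \<psi> p * real (card {x\<in>\<Omega>. S x \<subseteq># p}))
        = (\<Sum>x\<in>\<Omega>. \<Sum>p\<in>partitions_of n. \<psi> (p + S x))" .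
    have "partition_mean ?m (\<lambda>p. \<psi> p * h p)
        = (\<Sum>p\<in>partitions_of ?m. (\<psi> p * real (card {x\<in>\<Omega>. S x \<subseteq># p})) * (?N ?m / ?N n / card \<Omega>)) / ?N ?m"
      unfolding partition_mean_def h_def by (simp add: ac_simps)
    also have "\<dots> = (\<Sum>p\<in>partitions_of ?m. \<psi> p * real (card {x\<in>\<Omega>. S x \<subseteq># p})) / ?N n / card \<Omega>"
      unfolding sum_distrib_right[symmetric] using pos[of ?m] by (simp add: field_simps)
    also have "\<dots> = (\<Sum>x\<in>\<Omega>. partition_mean n (\<lambda>p. \<psi> (p + S x))) / card \<Omega>"
      unfolding e partition_mean_def by (simp add: sum_divide_distrib)
    finally show ?thesis .
  qed
  have h1: "partition_mean ?m h = 1"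
    using weighted[of "\<lambda>_. 1"] O by (simp add: partition_mean_const)
  \<comment> \<open>Both \<open>S x\<close> and \<open>S y\<close> lie in \<open>p\<close> exactly
    when their union does, and the union has total \<open>2 * j - w x y\<close>. What remains of
    \<open>n + j\<close> is \<open>n + w x y - j\<close>, and the condition
    \<open>j \<le> n + w x y\<close> says that the union fits at all.\<close>
  have u: "S x \<union># S y \<in> partitions_of (2 * j - w x y)" "w x y \<le> j" if "x \<in> \<Omega>" "y \<in> \<Omega>" for x y
  proof -
    have "sum_mset (S x \<union># S y) + sum_mset (S x \<inter># S y) = 2 * j"
    proof -
      have "S x \<union># S y + (S x \<inter># S y) = S x + S y"
        by (rule multiset_eqI) (simp add: max_def min_def)
      from arg_cong[OF this, of sum_mset] show ?thesis using S[OF that(1)] S[OF that(2)]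
        by (simp add: partitions_of_def)
    qed
    moreover have "sum_mset (S x \<inter># S y) \<le> sum_mset (S x)"
      by (simp add: sum_mset_mono_subset)
    ultimately show "S x \<union># S y \<in> partitions_of (2 * j - w x y)" "w x y \<le> j"
      using w[OF that] S[OF that(1)] S[OF that(2)] by (auto simp: partitions_of_def partitions_def)
  qed
  have "(\<Sum>p\<in>partitions_of ?m. (real (card {x\<in>\<Omega>. S x \<subseteq># p}))\<^sup>2)
      = (\<Sum>p\<in>partitions_of ?m. \<Sum>x\<in>\<Omega>. \<Sum>y\<in>\<Omega>. if S x \<union># S y \<subseteq># p then 1 else 0)"
    unfolding cnt power2_eq_square sum_product
    by (intro sum.cong refl) auto
  also have "\<dots> = (\<Sum>x\<in>\<Omega>. \<Sum>y\<in>\<Omega>. \<Sum>p\<in>partitions_of ?m. if S x \<union># S y \<subseteq># p then 1 else 0)"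
    by (subst sum.swap, intro sum.cong refl, subst sum.swap) simp
  also have "\<dots> = (\<Sum>x\<in>\<Omega>. \<Sum>y\<in>\<Omega>. if j \<le> n + w x y then ?N (n + w x y - j) else 0)"
  proof (intro sum.cong refl)
    fix x y assume xy: "x \<in> \<Omega>" "y \<in> \<Omega>"
    show "(\<Sum>p\<in>partitions_of ?m. if S x \<union># S y \<subseteq># p then 1 else 0) = (if j \<le> n + w x y then ?N (n + w x y - j) else 0)"
      using cnt2[OF u(1)[OF xy]] u(2)[OF xy] by (auto intro!: arg_cong[where f = "\<lambda>k. card (partitions_of k)"])
  qed
  finally have e2: "(\<Sum>p\<in>partitions_of ?m. (real (card {x\<in>\<Omega>. S x \<subseteq># p}))\<^sup>2)
      = (\<Sum>x\<in>\<Omega>. \<Sum>y\<in>\<Omega>. if j \<le> n + w x y then ?N (n + w x y - j) else 0)" .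
  have "partition_mean ?m (\<lambda>p. (h p)\<^sup>2)
      = (\<Sum>p\<in>partitions_of ?m. (real (card {x\<in>\<Omega>. S x \<subseteq># p}))\<^sup>2) * (?N ?m / ?N n / card \<Omega>)\<^sup>2 / ?N ?m"
    unfolding partition_mean_def h_def sum_distrib_right
    by (intro arg_cong2[where f = "(/)"] sum.cong refl) (simp add: power_mult_distrib power_divide ac_simps)
  also have "\<dots> = (\<Sum>x\<in>\<Omega>. \<Sum>y\<in>\<Omega>. if j \<le> n + w x y then ?N (n + w x y - j) else 0) * ?N ?m / (card \<Omega> * ?N n)\<^sup>2"
    unfolding e2 using pos[of ?m] by (simp add: power_divide power_mult_distrib power2_eq_square)
  also have "\<dots> \<le> 1 + c"
    using second O pos[of n] by (subst pos_divide_le_eq) auto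
  finally have h2: "partition_mean ?m (\<lambda>p. (h p)\<^sup>2) \<le> 1 + c" .
  show ?thesis using partition_mean_density_deviation[OF h1 h2 \<psi>] by (simp add: weighted)
qed

section \<open>A family of additions with equal totals and rare overlaps\<close>

lemma mset_set_inter: "finite A \<Longrightarrow> finite B \<Longrightarrow> mset_set A \<inter># mset_set B = mset_set (A \<inter> B)"
  by (rule multiset_eqI) (simp add: count_mset_set')

text \<open>
  Every part occurs in a pair (small, large) with prescribed sum, so that all members of the family
  have the same total although the small parts range freely over disjoint blocks. The sum of the
  first pair absorbs the remainder.
\<close>

locale complementary_pairs =
  fixes r b B rem :: nat
  assumes r: "r \<ge> 1" and b: "b \<ge> 1" and rb: "r * b \<le> B"
begin

text \<open>A label consists of a block, an offset and a flag for the large part. Small parts lie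
  between \<open>B\<close> and \<open>2 * B\<close>, large ones above \<open>2 * B\<close>; so the
  two kinds never coincide, and a part determines its label.\<close>

definition part :: "nat \<times> nat \<times> bool \<Rightarrow> nat" where
  "part = (\<lambda>(i, v, c). if c then 4 * B + (if i = 0 then rem else 0) - (B + i * b + v) else B + i * b + v)"

definition pair_sum :: "nat \<Rightarrow> nat" where
  "pair_sum i = 4 * B + (if i = 0 then rem else 0)"

definition indices :: "(nat \<Rightarrow> nat) set" where
  "indices = PiE {..<r} (\<lambda>_. {..<b})"

text \<open>Sums and intersections are computed on labels, where block and offset are visible, and
  carried to parts by injectivity of \<open>part\<close>.\<close>

definition labels :: "(nat \<Rightarrow> nat) \<Rightarrow> nat set \<Rightarrow> (nat \<times> nat \<times> bool) set" where
  "labels x I = (\<lambda>(i, c). (i, x i, c)) ` (I \<times> UNIV)"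

definition parts :: "(nat \<Rightarrow> nat) \<Rightarrow> nat multiset" where
  "parts x = mset_set (part ` labels x {..<r})"

lemma block: "i < r \<Longrightarrow> v < b \<Longrightarrow> i * b + v < B"
proof -
  assume "i < r" "v < b"
  then have "i * b + v < (i + 1) * b" by simp
  also have "\<dots> \<le> r * b" using \<open>i < r\<close> by (intro mult_right_mono) auto
  finally show ?thesis using rb by simp
qed

lemma inj_part: "inj_on part ({..<r} \<times> {..<b} \<times> UNIV)"
proof (rule inj_onI)
  fix p p' assume p: "p \<in> {..<r} \<times> {..<b} \<times> UNIV" "p' \<in> {..<r} \<times> {..<b} \<times> UNIV"
    and eq0: "part p = part p'"
  obtain i v c i' v' c' where pp: "p = (i, v, c)" "p' = (i', v', c')" by (metis prod_cases3)
  then have *: "i < r" "v < b" "i' < r" "v' < b" and eq: "part (i, v, c) = part (i', v', c')"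
    using p eq0 by auto
  note bl = block[OF *(1,2)] block[OF *(3,4)]
  have c: "c = c'" using eq bl by (auto simp: part_def split: if_splits)
  have key: "i = i' \<and> v = v'" if "i * b + v = i' * b + v'"
  proof -
    have "i = (i * b + v) div b" "v = (i * b + v) mod b" using * by auto
    moreover have "i' = (i' * b + v') div b" "v' = (i' * b + v') mod b" using * by auto
    ultimately show ?thesis using that by metis
  qed
  define u u' where "u = i * b" and "u' = i' * b"
  \<comment> \<open>The remainder only raises the large parts of block 0. These exceed
    \<open>3 * B - b\<close>, since the offset is below \<open>b\<close>, while the large parts of
    all other blocks are at most \<open>3 * B - b\<close>; no collision is created.\<close>
  have ge: "i = 0 \<and> u = 0 \<or> i \<noteq> 0 \<and> b \<le> u" "i' = 0 \<and> u' = 0 \<or> i' \<noteq> 0 \<and> b \<le> u'"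
    by (cases i; simp add: u_def) (cases i'; simp add: u'_def)
  have "u + v = u' + v'"
    using eq[unfolded part_def prod.case, folded u_def u'_def] c bl[folded u_def u'_def] ge * by (auto split: if_splits)
  then have "i * b + v = i' * b + v'" by (simp add: u_def u'_def)
  then show "p = p'" using key c pp by auto
qed

lemma labels_subset: "x \<in> indices \<Longrightarrow> I \<subseteq> {..<r} \<Longrightarrow> labels x I \<subseteq> {..<r} \<times> {..<b} \<times> UNIV"
  by (auto simp: labels_def indices_def PiE_def Pi_def)

text \<open>The offset \<open>x i\<close> cancels between the small and the large part of a pair, so
  the total depends only on the set of blocks.\<close>

lemma sum_labels:
  assumes x: "x \<in> indices" and I: "I \<subseteq> {..<r}"
  shows "\<Sum> (part ` labels x I) = (\<Sum>i\<in>I. pair_sum i)"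
proof -
  have fI: "finite I" using I finite_subset by auto
  have "\<Sum> (part ` labels x I) = sum part (labels x I)"
    using inj_on_subset[OF inj_part labels_subset[OF x I]] by (simp add: sum.reindex)
  also have "\<dots> = (\<Sum>(i, c)\<in>I \<times> UNIV. part (i, x i, c))"
    unfolding labels_def by (subst sum.reindex) (auto simp: inj_on_def intro!: sum.cong)
  also have "\<dots> = (\<Sum>i\<in>I. \<Sum>c\<in>UNIV. part (i, x i, c))"
    using fI by (simp add: sum.cartesian_product)
  also have "\<dots> = (\<Sum>i\<in>I. pair_sum i)"
  proof (rule sum.cong[OF refl])
    fix i assume i: "i \<in> I"
    then have "x i < b" "i < r" using x I by (auto simp: indices_def PiE_def Pi_def)
    from block[OF this(2,1)] show "(\<Sum>c\<in>UNIV. part (i, x i, c)) = pair_sum i"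
      by (simp add: UNIV_bool part_def pair_sum_def)
  qed
  finally show ?thesis .
qed

lemma finite_labels: "I \<subseteq> {..<r} \<Longrightarrow> finite (labels x I)"
  unfolding labels_def using finite_subset[of I "{..<r}"] by simp

lemma parts_in_partitions_of:
  assumes x: "x \<in> indices"
  shows "parts x \<in> partitions_of (4 * B * r + rem)"
proof -
  have B: "B \<ge> 1" using rb r b by (metis One_nat_def Suc_leI le_zero_eq mult_is_0 not_gr_zero not_one_le_zero)
  have "(\<Sum>i<r. pair_sum i) = 4 * B * r + rem"
    using r by (simp add: pair_sum_def sum.distrib sum.delta)
  moreover have "0 \<notin> part ` labels x {..<r}"
    using labels_subset[OF x subset_refl] block B by (fastforce simp: part_def split: if_splits)
  ultimately show ?thesis
    using sum_labels[OF x subset_refl] finite_labels[of "{..<r}" x]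
    by (simp add: parts_def partitions_of_def partitions_def sum_unfold_sum_mset)
qed

text \<open>By injectivity of \<open>part\<close>, two members share exactly the pairs of those
  blocks in which their choices agree.\<close>

lemma sum_parts_inter:
  assumes x: "x \<in> indices" and y: "y \<in> indices"
  shows "sum_mset (parts x \<inter># parts y) = (\<Sum>i<r. if x i = y i then pair_sum i else 0)"
proof -
  let ?I = "{i \<in> {..<r}. x i = y i}"
  have "part ` labels x {..<r} \<inter> part ` labels y {..<r} = part ` (labels x {..<r} \<inter> labels y {..<r})"
    by (rule inj_on_image_Int[OF inj_part labels_subset[OF x subset_refl] labels_subset[OF y subset_refl], symmetric])
  also have "labels x {..<r} \<inter> labels y {..<r} = labels x ?I"
    by (force simp: labels_def image_iff)
  finally have "sum_mset (parts x \<inter># parts y) = \<Sum> (part ` labels x ?I)"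
    using finite_labels[of "{..<r}"] by (simp add: parts_def mset_set_inter sum_unfold_sum_mset)
  also have "\<dots> = (\<Sum>i\<in>?I. pair_sum i)" by (rule sum_labels[OF x]) auto
  also have "\<dots> = (\<Sum>i<r. if x i = y i then pair_sum i else 0)" by (simp add: sum.If_cases Int_def)
  finally show ?thesis .
qed

lemma finite_indices: "finite indices"
  by (simp add: indices_def finite_PiE)

lemma card_indices: "card indices = b ^ r"
  by (simp add: indices_def card_PiE)

text \<open>The choices in different blocks are independent, so the double sum factorises. In one
  block the choices agree for one offset out of \<open>b\<close>, which multiplies the factor
  \<open>b\<close> by at most \<open>1 + D / b \<le> exp (D / b)\<close>, and there are
  \<open>r\<close> blocks.\<close>

lemma overlap_moment:
  fixes t D :: real
  assumes "\<And>i. exp (t * pair_sum i) \<le> D"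
  shows "(\<Sum>x\<in>indices. \<Sum>y\<in>indices. exp (t * real (\<Sum>i<r. if x i = y i then pair_sum i else 0)))
      \<le> (real (card indices))\<^sup>2 * exp (r * D / b)"
proof -
  have inner: "(\<Sum>y\<in>indices. exp (t * real (\<Sum>i<r. if x i = y i then pair_sum i else 0)))
      \<le> real (card indices) * exp (r * D / b)" if x: "x \<in> indices" for x
  proof -
    have "(\<Sum>y\<in>indices. exp (t * real (\<Sum>i<r. if x i = y i then pair_sum i else 0)))
        = (\<Sum>y\<in>indices. \<Prod>i<r. exp (if x i = y i then t * pair_sum i else 0))"
      by (auto simp: exp_sum[symmetric] sum_distrib_left if_distrib[of "\<lambda>u. t * real u"] if_distrib[of real] intro!: sum.cong)
    also have "\<dots> = (\<Prod>i<r. \<Sum>v<b. exp (if x i = v then t * pair_sum i else 0))"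
      unfolding indices_def by (rule prod_sum_PiE[symmetric]) auto
    also have "\<dots> \<le> (\<Prod>i<r. real b * exp (D / b))"
    proof (rule prod_mono, safe)
      fix i assume i: "i < r"
      then have xi: "x i < b" using x by (auto simp: indices_def PiE_def Pi_def)
      have "(\<Sum>v<b. exp (if x i = v then t * pair_sum i else 0))
          = (\<Sum>v<b. 1 + (if v = x i then exp (t * pair_sum i) - 1 else 0))"
        by (intro sum.cong) auto
      also have "\<dots> = real b + (exp (t * pair_sum i) - 1)" using xi by (simp add: sum.distrib)
      also have "\<dots> \<le> real b * (1 + D / b)" using assms[of i] b by (simp add: distrib_left)
      also have "\<dots> \<le> real b * exp (D / b)" by (intro mult_left_mono exp_ge_add_one_self) auto
      finally show "(\<Sum>v<b. exp (if x i = v then t * pair_sum i else 0)) \<le> real b * exp (D / b)" .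
    qed (auto intro: sum_nonneg)
    also have "\<dots> = real (card indices) * exp (r * D / b)"
      by (simp add: card_indices power_mult_distrib exp_of_nat_mult[symmetric])
    finally show ?thesis .
  qed
  have "(\<Sum>x\<in>indices. \<Sum>y\<in>indices. exp (t * real (\<Sum>i<r. if x i = y i then pair_sum i else 0)))
      \<le> (\<Sum>x\<in>indices. real (card indices) * exp (r * D / b))"
    by (intro sum_mono inner)
  then show ?thesis by (simp add: power2_eq_square mult.assoc)
qed

end

text \<open>With \<open>B\<close> about 1/t there are at most j t / 4 pairs and \<open>b\<close> is
  about \<open>B / r\<close>, so two members share on average \<open>r / b\<close>, at most j^2 t^3
  / 8, pairs; a shared pair costs a factor of at most \<open>exp 16\<close>. The bounds on
  \<open>j\<close> ensure that at least one pair fits (\<open>4 * B \<le> j\<close>) and that each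
  block has at least one offset (\<open>r \<le> B\<close>). The hypothesis \<open>flat\<close> says
  that the tilted counts have no peak much above their value at \<open>n\<close>.\<close>

lemma partition_mean_shift:
  fixes t \<eta> :: real
  assumes t: "0 < t" "t \<le> 1" and \<eta>: "0 \<le> \<eta>"
    and j: "8 / t \<le> real j" "real j \<le> 4 / t\<^sup>2"
    and flat: "\<And>k. real (card (partitions_of k)) * exp (- t * k)
          * (real (card (partitions_of (n + j))) * exp (- t * (n + j)))
        \<le> (1 + \<eta>) * (real (card (partitions_of n)) * exp (- t * n))\<^sup>2"
  shows "\<exists>(\<Omega> :: (nat \<Rightarrow> nat) set) S. finite \<Omega> \<and> \<Omega> \<noteq> {} \<and> (\<forall>x\<in>\<Omega>. S x \<in> partitions_of j) \<and>
    (\<forall>\<psi>. (\<forall>p\<in>partitions_of (n + j). \<bar>\<psi> p\<bar> \<le> 1) \<longrightarrow>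
      \<bar>(\<Sum>x\<in>\<Omega>. partition_mean n (\<lambda>p. \<psi> (p + S x))) / card \<Omega> - partition_mean (n + j) \<psi>\<bar>
        \<le> sqrt ((1 + \<eta>) * exp (exp 16 * (real j)\<^sup>2 * t ^ 3 / 8) - 1))"
proof -
  define B where "B = nat \<lceil>1 / t\<rceil>"
  have B1: "1 / t \<le> real B" "real B \<le> 1 / t + 1"
  proof -
    have "0 \<le> 1 / t" using t by simp
    then have "0 \<le> \<lceil>1 / t\<rceil>" by linarith
    then have "real B = of_int \<lceil>1 / t\<rceil>" by (simp add: B_def)
    then show "1 / t \<le> real B" "real B \<le> 1 / t + 1" by linarith+
  qed
  have tB: "1 \<le> t * B" "t * B \<le> 2" using B1 t by (auto simp: field_simps)
  have Bpos: "B > 0" using tB t by (auto intro: gr0I)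
  define r where "r = j div (4 * B)"
  define rem where "rem = j mod (4 * B)"
  have jr: "j = 4 * B * r + rem" "rem < 4 * B" using Bpos by (auto simp: r_def rem_def)
  have "real (4 * B) \<le> 8 / t" using tB t by (simp add: field_simps)
  then have "4 * B \<le> j" using j by linarith
  then have r1: "r \<ge> 1" using Bpos by (simp add: r_def div_greater_zero_iff Suc_le_eq)
  have "4 * real B * r \<le> j" using jr by (metis le_add1 of_nat_le_iff of_nat_mult of_nat_numeral)
  then have rj: "real r \<le> j / (4 * B)" using Bpos by (simp add: field_simps)
  also have "\<dots> \<le> j * t / 4" using tB Bpos t by (simp add: divide_simps) (metis mult.commute mult_left_mono of_nat_0_le_iff mult.right_neutral mult.assoc)
  finally have rjt: "real r \<le> j * t / 4" .
  also have "\<dots> \<le> 1 / t" using j(2) t by (simp add: power2_eq_square field_simps)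
  finally have rB: "r \<le> B" using B1 by linarith
  define b where "b = B div r"
  have b1: "b \<ge> 1" using rB r1 by (simp add: b_def div_greater_zero_iff Suc_le_eq)
  have rb: "r * b \<le> B" by (simp add: b_def)
  \<comment> \<open>Rounding \<open>B / r\<close> down to \<open>b \<ge> 1\<close> loses at most a
    factor of two.\<close>
  have "B < r * b + r" unfolding b_def using r1 by (metis add.commute add_less_cancel_left less_eq_Suc_le mod_less_divisor mult_div_mod_eq One_nat_def nat_add_left_cancel_less)
  also have "\<dots> \<le> 2 * (r * b)" using b1 by (cases b) auto
  finally have "real B \<le> 2 * (real r * real b)" by (metis less_imp_le of_nat_le_iff of_nat_mult of_nat_numeral)
  then have "real r / b \<le> 2 * (real r)\<^sup>2 / B" using b1 Bpos r1
    by (simp add: divide_simps power2_eq_square)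
  also have "\<dots> \<le> 2 * (j * t / 4)\<^sup>2 * t"
  proof -
    have "2 * (real r)\<^sup>2 / B \<le> 2 * (real r)\<^sup>2 * t" using tB Bpos
      by (simp add: divide_simps) (metis mult.commute mult_left_mono zero_le_power2 mult.right_neutral mult.assoc)
    also have "\<dots> \<le> 2 * (j * t / 4)\<^sup>2 * t" using rjt t by (intro mult_right_mono mult_left_mono power_mono) auto
    finally show ?thesis .
  qed
  also have "\<dots> = (real j)\<^sup>2 * t ^ 3 / 8" by (simp add: power2_eq_square power3_eq_cube)
  finally have rb2: "real r / b \<le> (real j)\<^sup>2 * t ^ 3 / 8" .
  interpret complementary_pairs r b B rem by unfold_locales (use r1 b1 rb in auto)
  let ?N = "\<lambda>k. real (card (partitions_of k))"
  define w where "w x y = (\<Sum>i<r. if x i = y i then pair_sum i else 0)" for x y :: "nat \<Rightarrow> nat"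
  \<comment> \<open>Even with the remainder a pair has total at most \<open>8 * B\<close>, and
    \<open>t * B \<le> 2\<close>.\<close>
  have D: "exp (t * pair_sum i) \<le> exp 16" for i
  proof -
    have "pair_sum i \<le> 8 * B" using jr(2) by (simp add: pair_sum_def)
    then have "real (pair_sum i) \<le> 8 * real B" by linarith
    then have "t * pair_sum i \<le> t * (8 * real B)" using t by (intro mult_left_mono) auto
    then show ?thesis using tB by simp
  qed
  define c where "c = (1 + \<eta>) * exp (exp 16 * (real j)\<^sup>2 * t ^ 3 / 8) - 1"
  have second: "(\<Sum>x\<in>indices. \<Sum>y\<in>indices. if j \<le> n + w x y then ?N (n + w x y - j) else 0) * ?N (n + j)
      \<le> (1 + c) * (real (card indices) * ?N n)\<^sup>2"
  proof -
    \<comment> \<open>For \<open>k = n + w x y - j\<close> one has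
      \<open>k + (n + j) = 2 * n + w x y\<close>. After the exponential weights of \<open>n\<close>
      are cancelled in \<open>flat\<close>, only \<open>exp (t * w x y)\<close> is left, which
      \<open>overlap_moment\<close> averages.\<close>
    have one: "(if j \<le> n + w x y then ?N (n + w x y - j) else 0) * ?N (n + j)
        \<le> (1 + \<eta>) * (?N n)\<^sup>2 * exp (t * w x y)" for x y
    proof (cases "j \<le> n + w x y")
      case True
      let ?k = "n + w x y - j"
      have e: "exp (- t * ?k) * exp (- t * (n + j)) * exp (t * w x y) = (exp (- t * n))\<^sup>2"
        using True by (simp add: power2_eq_square exp_add[symmetric] algebra_simps of_nat_diff)
      have "?N ?k * ?N (n + j) * (exp (- t * n))\<^sup>2
          = (?N ?k * exp (- t * ?k) * (?N (n + j) * exp (- t * (n + j)))) * exp (t * w x y)"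
        unfolding e[symmetric] by (simp add: ac_simps)
      also have "\<dots> \<le> (1 + \<eta>) * (?N n * exp (- t * n))\<^sup>2 * exp (t * w x y)"
        by (intro mult_right_mono flat[of ?k, simplified] flat) auto
      finally have "?N ?k * ?N (n + j) * (exp (- t * n))\<^sup>2 \<le> ((1 + \<eta>) * (?N n)\<^sup>2 * exp (t * w x y)) * (exp (- t * n))\<^sup>2"
        by (simp add: power_mult_distrib ac_simps)
      then show ?thesis using True by (simp del: exp_minus)
    qed (use \<eta> in auto)
    have "(\<Sum>x\<in>indices. \<Sum>y\<in>indices. if j \<le> n + w x y then ?N (n + w x y - j) else 0) * ?N (n + j)
        \<le> (\<Sum>x\<in>indices. \<Sum>y\<in>indices. (1 + \<eta>) * (?N n)\<^sup>2 * exp (t * w x y))"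
      unfolding sum_distrib_right by (intro sum_mono one)
    also have "\<dots> = (1 + \<eta>) * (?N n)\<^sup>2 * (\<Sum>x\<in>indices. \<Sum>y\<in>indices. exp (t * w x y))"
      by (simp add: sum_distrib_left)
    also have "\<dots> \<le> (1 + \<eta>) * (?N n)\<^sup>2 * ((real (card indices))\<^sup>2 * exp (r * exp 16 / b))"
      using overlap_moment[OF D] \<eta> by (intro mult_left_mono) (auto simp: w_def)
    also have "\<dots> \<le> (1 + \<eta>) * (?N n)\<^sup>2 * ((real (card indices))\<^sup>2 * exp (exp 16 * (real j)\<^sup>2 * t ^ 3 / 8))"
      using rb2 \<eta> by (intro mult_left_mono) (auto dest: mult_left_mono[where c = "exp 16"] simp: ac_simps)
    also have "\<dots> = (1 + c) * (real (card indices) * ?N n)\<^sup>2" by (simp add: c_def power_mult_distrib)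
    finally show ?thesis .
  qed
  have "indices \<noteq> {}" using b1 by (auto simp: indices_def PiE_eq_empty_iff lessThan_empty_iff)
  moreover have P: "parts x \<in> partitions_of j" if "x \<in> indices" for x
    using parts_in_partitions_of[OF that] jr by simp
  ultimately show ?thesis
    using finite_indices
      partition_mean_addition[where \<Omega> = indices and S = parts and w = w and n = n and c = c, OF finite_indices _ P _ second]
      sum_parts_inter unfolding c_def[symmetric] w_def
    by (intro exI[of _ indices] exI[of _ parts]) auto
qed

section \<open>The function F and its derivatives\<close>

text \<open>The sum of divisors of \<open>m\<close> over \<open>m\<close>. It is the coefficient of
  \<open>exp (- t * m)\<close> in \<open>F t\<close>: in the expanded logarithms a pair with product
  \<open>m\<close> and second member \<open>k\<close> contributes \<open>k / m\<close>.\<close>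

definition divisor_weight :: "nat \<Rightarrow> real" where
  "divisor_weight m = (\<Sum>k | k dvd m. real k) / real m"

text \<open>Up to the sign of \<open>(-1) ^ i\<close> the derivative of order \<open>i\<close> of
  \<open>F\<close>. For \<open>i \<ge> 1\<close> it is the cumulant of order \<open>i\<close> of the
  size of the random partition at time \<open>t\<close>; in particular \<open>moment 1\<close> is
  its mean and \<open>moment 2\<close> its variance.\<close>

definition moment :: "nat \<Rightarrow> real \<Rightarrow> real" where
  "moment i t = (\<Sum>m. real m ^ i * divisor_weight m * exp (- t * real m))"

lemma divisor_weight_0 [simp]: "divisor_weight 0 = 0"
  by (simp add: divisor_weight_def)

lemma divisor_weight_nonneg: "divisor_weight m \<ge> 0"
  by (simp add: divisor_weight_def sum_nonneg)

lemma divisor_weight_ge_1: "m \<ge> 1 \<Longrightarrow> divisor_weight m \<ge> 1"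
proof -
  assume m: "m \<ge> 1"
  then have "real m \<le> (\<Sum>k | k dvd m. real k)" by (intro member_le_sum) auto
  then show ?thesis using m by (simp add: divisor_weight_def)
qed

text \<open>The power is dominated by one term of the series of \<open>exp (y / 2)\<close>, and half
  of the exponential decay is kept for summation.\<close>

lemma power_exp_bound:
  fixes y :: real assumes "y \<ge> 0" shows "y ^ i * exp (- y) \<le> fact i * 2 ^ i * exp (- (y / 2))"
proof -
  have "(\<lambda>n. (y / 2) ^ n /\<^sub>R fact n) sums exp (y / 2)" by (rule exp_converges)
  then have 1: "summable (\<lambda>n. (y / 2) ^ n /\<^sub>R fact n)" "(\<Sum>n. (y / 2) ^ n /\<^sub>R fact n) = exp (y / 2)"
    by (simp_all only: sums_iff)
  have "(\<Sum>n\<in>{i}. (y / 2) ^ n /\<^sub>R fact n) \<le> (\<Sum>n. (y / 2) ^ n /\<^sub>R fact n)"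
    by (rule sum_le_suminf[OF 1(1)]) (use assms in auto)
  then have "(y / 2) ^ i / fact i \<le> exp (y / 2)" unfolding 1(2) by (simp add: field_simps)
  then have "(y / 2) ^ i \<le> exp (y / 2) * fact i" by (simp only: pos_divide_le_eq fact_gt_zero)
  then have "y ^ i / 2 ^ i \<le> exp (y / 2) * fact i" by (simp only: power_divide)
  then have "y ^ i \<le> exp (y / 2) * fact i * 2 ^ i"
    by (simp only: pos_divide_le_eq zero_less_power zero_less_numeral)
  then have "y ^ i * exp (- y) \<le> exp (y / 2) * fact i * 2 ^ i * exp (- y)" by (intro mult_right_mono) auto
  also have "\<dots> = fact i * 2 ^ i * exp (y / 2 + - y)" by (simp only: exp_add ac_simps)
  also have "y / 2 + - y = - (y / 2)" by simp
  finally show ?thesis .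
qed

text \<open>Absorbing the power by \<open>power_exp_bound\<close> leaves a geometric series of ratio
  \<open>exp (- (x / 2))\<close>, whose sum is at most \<open>2 / x\<close>.\<close>

lemma geometric_moment:
  fixes x :: real assumes x: "x > 0"
  shows "summable (\<lambda>k. real (Suc k) ^ i * exp (- (x * real (Suc k))))"
    and "(\<Sum>k. real (Suc k) ^ i * exp (- (x * real (Suc k)))) \<le> fact i * 2 ^ Suc i / x ^ Suc i"
proof -
  let ?q = "exp (- (x / 2))"
  have g: "(\<lambda>k. ?q ^ k) sums (1 / (1 - ?q))" using x by (intro geometric_sums) simp
  have e: "exp (- (x * real (Suc k) / 2)) = ?q * ?q ^ k" for k
    by (simp add: exp_of_nat_mult[symmetric] exp_add[symmetric] field_simps)
  have le: "real (Suc k) ^ i * exp (- (x * real (Suc k))) \<le> fact i * 2 ^ i / x ^ i * ?q * ?q ^ k" for k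
    using power_exp_bound[of "x * real (Suc k)" i] x
    unfolding e by (simp add: power_mult_distrib field_simps del: of_nat_Suc)
  have s: "(\<lambda>k. fact i * 2 ^ i / x ^ i * ?q * ?q ^ k) sums (fact i * 2 ^ i / x ^ i * ?q * (1 / (1 - ?q)))"
    by (intro sums_mult g)
  show 1: "summable (\<lambda>k. real (Suc k) ^ i * exp (- (x * real (Suc k))))"
    by (rule summable_comparison_test'[OF sums_summable[OF s], of 0]) (use le in auto)
  have "(\<Sum>k. real (Suc k) ^ i * exp (- (x * real (Suc k)))) \<le> fact i * 2 ^ i / x ^ i * ?q * (1 / (1 - ?q))"
    using suminf_le[OF le 1 sums_summable[OF s]] sums_unique[OF s] by simp
  also have "\<dots> = fact i * 2 ^ i / x ^ i * (?q / (1 - ?q))" by simp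
  also have "\<dots> \<le> fact i * 2 ^ i / x ^ i * (2 / x)"
  proof (rule mult_left_mono)
    have "1 + x / 2 \<le> exp (x / 2)" by (rule exp_ge_add_one_self)
    then have "?q * (x / 2) \<le> ?q * (exp (x / 2) - 1)" by (intro mult_left_mono) (linarith, simp)
    also have "\<dots> = 1 - ?q" by (simp add: algebra_simps exp_add[symmetric])
    finally show "?q / (1 - ?q) \<le> 2 / x" using x by (simp add: divide_simps mult.commute)
  qed (use x in simp)
  finally show "(\<Sum>k. real (Suc k) ^ i * exp (- (x * real (Suc k)))) \<le> fact i * 2 ^ Suc i / x ^ Suc i"
    by (simp add: mult.commute mult.left_commute)
qed

lemma inverse_squares: "(\<lambda>n. 1 / (real (Suc n))\<^sup>2) sums (pi\<^sup>2 / 6)"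
  using inverse_squares_sums by (simp only: Suc_eq_plus1 of_nat_power)

text \<open>Here \<open>Suc k\<close> is a part and \<open>Suc j\<close> the index in the
  logarithmic series. The order of summation is chosen as needed: over \<open>j\<close> first it
  gives logarithms, over \<open>k\<close> first closed forms in \<open>t * Suc j\<close>, and along
  constant products the series \<open>moment\<close>.\<close>

definition double_term :: "nat \<Rightarrow> real \<Rightarrow> nat \<times> nat \<Rightarrow> real" where
  "double_term i t = (\<lambda>(j, k). (real (Suc j) * real (Suc k)) ^ i / real (Suc j) * exp (- t * (real (Suc j) * real (Suc k))))"

lemma double_term_nonneg: "double_term i t p \<ge> 0"
  by (auto simp: double_term_def split: prod.split)

lemma double_term_inner:
  assumes t: "t > 0"
  shows "((\<lambda>k. double_term i t (j, k)) has_sum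
    (real (Suc j) ^ i / real (Suc j) * (\<Sum>k. real (Suc k) ^ i * exp (- (t * real (Suc j) * real (Suc k)))))) UNIV"
proof (rule sums_nonneg_imp_has_sum)
  have "(\<lambda>k. real (Suc k) ^ i * exp (- (t * real (Suc j) * real (Suc k)))) sums
      (\<Sum>k. real (Suc k) ^ i * exp (- (t * real (Suc j) * real (Suc k))))"
    using geometric_moment(1)[of "t * real (Suc j)" i] t by (intro summable_sums) auto
  then have "(\<lambda>k. real (Suc j) ^ i / real (Suc j) * (real (Suc k) ^ i * exp (- (t * real (Suc j) * real (Suc k))))) sums
      (real (Suc j) ^ i / real (Suc j) * (\<Sum>k. real (Suc k) ^ i * exp (- (t * real (Suc j) * real (Suc k)))))"
    by (rule sums_mult)
  moreover have "real (Suc j) ^ i / real (Suc j) * (real (Suc k) ^ i * exp (- (t * real (Suc j) * real (Suc k))))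
      = double_term i t (j, k)" for k
    by (simp add: double_term_def power_mult_distrib mult.assoc del: of_nat_Suc)
  ultimately show "(\<lambda>k. double_term i t (j, k)) sums
    (real (Suc j) ^ i / real (Suc j) * (\<Sum>k. real (Suc k) ^ i * exp (- (t * real (Suc j) * real (Suc k)))))"
    by (simp only:)
  show "double_term i t (j, k) \<ge> 0" for k by (rule double_term_nonneg)
qed

lemma double_term_inner_le:
  assumes t: "t > 0"
  shows "real (Suc j) ^ i / real (Suc j) * (\<Sum>k. real (Suc k) ^ i * exp (- (t * real (Suc j) * real (Suc k))))
    \<le> fact i * 2 ^ Suc i / t ^ Suc i * (1 / (real (Suc j))\<^sup>2)"
proof -
  have "real (Suc j) ^ i / real (Suc j) * (\<Sum>k. real (Suc k) ^ i * exp (- (t * real (Suc j) * real (Suc k))))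
      \<le> real (Suc j) ^ i / real (Suc j) * (fact i * 2 ^ Suc i / (t * real (Suc j)) ^ Suc i)"
  proof (rule mult_left_mono)
    have "t * real (Suc j) > 0" using t by simp
    from geometric_moment(2)[OF this]
    show "(\<Sum>k. real (Suc k) ^ i * exp (- (t * real (Suc j) * real (Suc k)))) \<le> fact i * 2 ^ Suc i / (t * real (Suc j)) ^ Suc i" .
  qed simp
  also have "\<dots> = fact i * 2 ^ Suc i / t ^ Suc i * (1 / (real (Suc j))\<^sup>2)"
    using t by (simp add: power_mult_distrib power2_eq_square field_simps del: of_nat_Suc)
  finally show ?thesis .
qed

text \<open>The inner sums are of order \<open>1 / (Suc j) ^ 2\<close>; the sum of inverse squares
  is rounded up to 2.\<close>

lemma double_term_summable:
  assumes t: "t > 0"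
  shows "double_term i t summable_on UNIV"
    and "infsum (double_term i t) UNIV \<le> fact i * 2 ^ (i + 2) / t ^ Suc i"
proof -
  let ?g = "\<lambda>j. real (Suc j) ^ i / real (Suc j) * (\<Sum>k. real (Suc k) ^ i * exp (- (t * real (Suc j) * real (Suc k))))"
  let ?C = "fact i * 2 ^ Suc i / t ^ Suc i"
  have inner: "((\<lambda>k. double_term i t (j, k)) has_sum ?g j) UNIV" for j
    using double_term_inner[OF t] .
  have g0: "?g j \<ge> 0" for j
    using has_sum_nonneg[OF inner[of j]] double_term_nonneg by blast
  have b: "((\<lambda>j. ?C * (1 / (real (Suc j))\<^sup>2)) has_sum (?C * (pi\<^sup>2 / 6))) UNIV"
    using t by (intro sums_nonneg_imp_has_sum sums_mult inverse_squares) auto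
  have le: "?g j \<le> ?C * (1 / (real (Suc j))\<^sup>2)" for j
    using double_term_inner_le[OF t] .
  define g where "g = ?g"
  have gs: "g summable_on UNIV"
    using summable_on_comparison_test[OF has_sum_imp_summable[OF b], of g] le g0 unfolding g_def by blast
  have "double_term i t summable_on Sigma UNIV (\<lambda>_. UNIV)"
    using inner double_term_nonneg by (intro summable_on_SigmaI[OF _ gs]) (auto simp only: g_def)
  then show 1: "double_term i t summable_on UNIV" by (simp only: UNIV_Times_UNIV)
  have "(double_term i t has_sum infsum (double_term i t) UNIV) (Sigma UNIV (\<lambda>_. UNIV))"
    using has_sum_infsum[OF 1] by (simp only: UNIV_Times_UNIV)
  then have "(g has_sum infsum (double_term i t) UNIV) UNIV"
    by (rule has_sum_SigmaD) (simp only: g_def inner)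
  then have "infsum (double_term i t) UNIV \<le> ?C * (pi\<^sup>2 / 6)"
    by (rule has_sum_mono[OF _ b]) (simp only: g_def le)
  also have "\<dots> \<le> ?C * 2"
  proof (intro mult_left_mono)
    have "pi * pi \<le> 3.2 * 3.2" by (intro mult_mono) (use pi_less_4 pi_approx in auto)
    then show "pi\<^sup>2 / 6 \<le> 2" by (simp add: power2_eq_square)
  qed (use t in auto)
  finally show "infsum (double_term i t) UNIV \<le> fact i * 2 ^ (i + 2) / t ^ Suc i" by (simp add: mult.commute mult.left_commute)
qed

text \<open>Grouping the pairs \<open>(j, k)\<close> by their product.\<close>

lemma moment_has_sum:
  assumes t: "t > 0"
  shows "((\<lambda>m. real m ^ i * divisor_weight m * exp (- t * real m)) has_sum infsum (double_term i t) UNIV) UNIV"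
proof -
  let ?h = "\<lambda>(m, k). real m ^ i * (real k / real m) * exp (- t * real m)"
  have "(double_term i t has_sum infsum (double_term i t) UNIV) UNIV"
    using double_term_summable(1)[OF t] by (rule has_sum_infsum)
  also have "?this \<longleftrightarrow> (?h has_sum infsum (double_term i t) UNIV) (Sigma {1..} (\<lambda>m. {k. k dvd m}))"
  proof (rule has_sum_reindex_bij_witness[where j = "\<lambda>(j, k). (Suc j * Suc k, Suc k)" and i = "\<lambda>(m, k). (m div k - 1, k - 1)"])
    fix p assume "p \<in> Sigma {1..} (\<lambda>m :: nat. {k. k dvd m})"
    then obtain m k where p: "p = (m, k)" "m \<ge> 1" "k dvd m" by auto
    then obtain q where q: "m = k * q" by (auto elim: dvdE)
    with p obtain k' q' where "k = Suc k'" "q = Suc q'" by (cases k; cases q) auto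
    with p q show "(case case p of (m, k) \<Rightarrow> (m div k - 1, k - 1) of (j, k) \<Rightarrow> (Suc j * Suc k, Suc k)) = p"
      by (simp add: mult.commute del: mult_Suc mult_Suc_right)
  next
    fix p :: "nat \<times> nat"
    show "(case p of (j, k) \<Rightarrow> (Suc j * Suc k, Suc k)) \<in> Sigma {1..} (\<lambda>m. {k. k dvd m})"
      by (cases p) (auto simp del: mult_Suc mult_Suc_right)
    show "?h (case p of (j, k) \<Rightarrow> (Suc j * Suc k, Suc k)) = double_term i t p"
      by (cases p) (simp add: double_term_def del: of_nat_Suc mult_Suc mult_Suc_right)
    show "(case case p of (j, k) \<Rightarrow> (Suc j * Suc k, Suc k) of (m, k) \<Rightarrow> (m div k - 1, k - 1)) = p"
      by (cases p) (simp del: mult_Suc mult_Suc_right)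
  qed auto
  finally have *: "(?h has_sum infsum (double_term i t) UNIV) (Sigma {1..} (\<lambda>m. {k. k dvd m}))" .
  have "((\<lambda>m. real m ^ i * divisor_weight m * exp (- t * real m)) has_sum infsum (double_term i t) UNIV) {1..}"
  proof (rule has_sum_SigmaD[OF *])
    fix m :: nat assume m: "m \<in> {1..}"
    then show "((\<lambda>k. ?h (m, k)) has_sum real m ^ i * divisor_weight m * exp (- t * real m)) {k. k dvd m}"
      by (intro has_sum_finiteI)
        (auto simp: divisor_weight_def sum_distrib_left sum_distrib_right sum_divide_distrib intro!: sum.cong)
  qed
  also have "?this \<longleftrightarrow> ?thesis"
    by (rule has_sum_cong_neutral) (auto simp: not_less_eq_eq)
  finally show ?thesis .
qed

lemma moment_eq: "t > 0 \<Longrightarrow> moment i t = infsum (double_term i t) UNIV"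
  unfolding moment_def by (rule sums_unique[symmetric, OF has_sum_imp_sums[OF moment_has_sum]])

lemma moment_summable: "t > 0 \<Longrightarrow> summable (\<lambda>m. real m ^ i * divisor_weight m * exp (- t * real m))"
  by (rule sums_summable[OF has_sum_imp_sums[OF moment_has_sum]])

lemma moment_sums: "t > 0 \<Longrightarrow> (\<lambda>m. real m ^ i * divisor_weight m * exp (- t * real m)) sums moment i t"
  unfolding moment_def by (intro summable_sums moment_summable)

lemma moment_upper: "t > 0 \<Longrightarrow> moment i t \<le> fact i * 2 ^ (i + 2) / t ^ Suc i"
  using double_term_summable(2)[of t i] by (simp only: moment_eq)

lemma moment_nonneg: "t > 0 \<Longrightarrow> moment i t \<ge> 0"
  unfolding moment_def
  by (rule suminf_nonneg[OF moment_summable]) (simp_all add: divisor_weight_nonneg)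

text \<open>For a fixed part the sum over \<open>j\<close> is the logarithmic series. All terms are
  nonnegative, so the iterated sum converges and agrees with the double sum.\<close>

lemma
  assumes t: "t > 0"
  shows F_summable: "summable (\<lambda>k. ln (1 - exp (- (real (Suc k) * t))))"
    and F_eq_moment: "F t = moment 0 t"
proof -
  let ?L = "\<lambda>k. - ln (1 - exp (- (real (Suc k) * t)))"
  have inner: "((\<lambda>j. double_term 0 t (j, k)) has_sum ?L k) UNIV" for k
  proof (rule sums_nonneg_imp_has_sum)
    let ?x = "exp (- (real (Suc k) * t))"
    have x: "?x < 1" using t by simp
    have "(\<lambda>n. - ((- (- ?x)) ^ n) / of_nat n) sums ln (1 + - ?x)"
      using x by (intro ln_series') simp
    then have "(\<lambda>n. ?x ^ n / of_nat n) sums ?L k"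
      using sums_minus by fastforce
    then have "(\<lambda>n. ?x ^ Suc n / of_nat (Suc n)) sums ?L k"
      by (subst sums_Suc_iff) simp
    moreover have "?x ^ Suc j / of_nat (Suc j) = double_term 0 t (j, k)" for j
      by (simp only: double_term_def prod.case exp_of_nat_mult[symmetric] power_0) (simp add: algebra_simps)
    ultimately show "(\<lambda>j. double_term 0 t (j, k)) sums ?L k" by simp
  qed (rule double_term_nonneg)
  have "((\<lambda>(k, j). double_term 0 t (j, k)) has_sum moment 0 t) (UNIV \<times> UNIV)"
    using has_sum_infsum[OF double_term_summable(1)[OF t, of 0]]
    by (subst has_sum_swap[symmetric]) (simp add: moment_eq[OF t])
  then have "(?L has_sum moment 0 t) UNIV"
    by (rule has_sum_SigmaD) (use inner in auto)
  then have s: "?L sums moment 0 t" by (rule has_sum_imp_sums)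
  show "summable (\<lambda>k. ln (1 - exp (- (real (Suc k) * t))))"
    using sums_summable[OF s] by (simp add: summable_minus_iff)
  show "F t = moment 0 t"
    using sums_unique[OF s] suminf_minus[OF sums_summable[OF s]] by (simp add: F_def)
qed

section \<open>The mean size compared with pi^2 / (6 t^2)\<close>

lemma sinh_bounds:
  fixes y :: real assumes "y \<ge> 0"
  shows "y \<le> sinh y" "sinh y \<le> y * cosh y"
proof -
  have "sinh 0 - 0 \<le> sinh y - y"
    using assms
  proof (rule DERIV_nonneg_imp_nondecreasing)
    fix x :: real
    have "((\<lambda>x. sinh x - x) has_real_derivative cosh x - 1) (at x)"
      by (auto intro!: derivative_eq_intros)
    then show "\<exists>d. ((\<lambda>x. sinh x - x) has_real_derivative d) (at x) \<and> d \<ge> 0"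
      using cosh_real_ge_1[of x] by fastforce
  qed
  then show "y \<le> sinh y" by simp
  have "0 * cosh 0 - sinh 0 \<le> y * cosh y - sinh y"
    using assms
  proof (rule DERIV_nonneg_imp_nondecreasing)
    fix x :: real assume "0 \<le> x"
    have "((\<lambda>x. x * cosh x - sinh x) has_real_derivative x * sinh x) (at x)"
      by (auto intro!: derivative_eq_intros)
    then show "\<exists>d. ((\<lambda>x. x * cosh x - sinh x) has_real_derivative d) (at x) \<and> d \<ge> 0"
      using \<open>0 \<le> x\<close> by fastforce
  qed
  then show "sinh y \<le> y * cosh y" by simp
qed

lemma exp_quotient_sinh:
  fixes x :: real assumes "0 < x"
  shows "exp (- x) / (1 - exp (- x))\<^sup>2 = 1 / (4 * (sinh (x / 2))\<^sup>2)"
proof -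
  define u v where "u = exp (- (x / 2))" and "v = exp (x / 2)"
  have uv: "v * u = 1" by (simp add: u_def v_def exp_add[symmetric])
  have u2: "exp (- x) = u\<^sup>2" by (simp add: u_def power2_eq_square exp_add[symmetric])
  have "2 * sinh (x / 2) * u = (v - u) * u" by (simp add: sinh_field_def u_def v_def)
  also have "\<dots> = 1 - u\<^sup>2" using uv by (simp add: algebra_simps power2_eq_square)
  finally have "(2 * sinh (x / 2) * u)\<^sup>2 = (1 - u\<^sup>2)\<^sup>2" by (simp only:)
  then have "4 * (sinh (x / 2))\<^sup>2 * exp (- x) = (1 - exp (- x))\<^sup>2"
    by (simp add: u2 power_mult_distrib)
  moreover have "sinh (x / 2) > 0" using assms by simp
  ultimately show ?thesis using assms by (simp add: divide_simps mult.commute)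
qed

text \<open>With S = 2 sinh (x/2) the quotient is 1/S^2. The upper bound is S >= x; conversely sinh
  y <= y cosh y together with cosh^2 = 1 + sinh^2 keeps 1/x^2 - 1/S^2 bounded, so that 1/x^2 is the
  whole singularity at zero.\<close>

lemma exp_quotient_bounds:
  fixes x :: real assumes x: "0 < x"
  shows "1 / x\<^sup>2 - exp (- x) / (1 - exp (- x))\<^sup>2 \<le> 1" "exp (- x) / (1 - exp (- x))\<^sup>2 \<le> 1 / x\<^sup>2"
proof -
  define S where "S = 2 * sinh (x / 2)"
  have S: "x \<le> S" using sinh_bounds(1)[of "x / 2"] x by (simp add: S_def)
  then have "x\<^sup>2 \<le> S\<^sup>2" using x by (intro power_mono) auto
  moreover have q: "exp (- x) / (1 - exp (- x))\<^sup>2 = 1 / S\<^sup>2"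
    unfolding exp_quotient_sinh[OF x] by (simp add: S_def power_mult_distrib)
  ultimately show "exp (- x) / (1 - exp (- x))\<^sup>2 \<le> 1 / x\<^sup>2"
    using x by (simp add: frac_le)
  have "(sinh (x / 2))\<^sup>2 \<le> (x / 2 * cosh (x / 2))\<^sup>2"
    using sinh_bounds(2)[of "x / 2"] x by (intro power_mono) auto
  then have "S\<^sup>2 * 4 \<le> x\<^sup>2 * (4 + S\<^sup>2)"
    by (simp add: S_def power_mult_distrib power_divide cosh_square_eq algebra_simps)
  define P Q where "P = x\<^sup>2" and "Q = S\<^sup>2"
  have PQ: "P > 0" "Q > 0" using x S by (auto simp: P_def Q_def)
  have "Q * 4 \<le> P * 4 + P * Q"
    using \<open>S\<^sup>2 * 4 \<le> x\<^sup>2 * (4 + S\<^sup>2)\<close> by (simp add: P_def Q_def distrib_left)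
  moreover have "0 < P * Q" using PQ by simp
  ultimately have "Q - P \<le> P * Q" by linarith
  then have "(Q - P) / (P * Q) \<le> 1" using PQ by simp
  moreover have "1 / P - 1 / Q = (Q - P) / (P * Q)" using PQ by (simp add: diff_frac_eq)
  ultimately show "1 / x\<^sup>2 - exp (- x) / (1 - exp (- x))\<^sup>2 \<le> 1"
    unfolding q P_def[symmetric] Q_def[symmetric] by linarith
qed

text \<open>Summed over \<open>k\<close> first, the mean is the sum of exp(-x) / (1 - exp(-x))^2
  over x = t, 2t, 3t, ..., which is compared with the sum of 1/x^2, that is, pi^2 / (6 t^2). The
  differences are of order at most min(1, 1/x^2) and add up to O(1/t). This estimate is the origin
  of the value pi / sqrt(6n).\<close>

lemma moment_1_estimate:
  assumes t: "t > 0"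
  shows "\<bar>moment 1 t - pi\<^sup>2 / (6 * t\<^sup>2)\<bar> \<le> 4 / t"
proof -
  let ?f = "\<lambda>j. exp (- (t * real (Suc j))) / (1 - exp (- (t * real (Suc j))))\<^sup>2"
  have inner: "((\<lambda>k. double_term 1 t (j, k)) has_sum ?f j) UNIV" for j
  proof -
    let ?q = "exp (- (t * real (Suc j)))"
    have "(\<lambda>n. of_nat (Suc n) * ?q ^ n) sums (1 / (1 - ?q)\<^sup>2)"
      using t by (intro geometric_deriv_sums) simp
    from sums_mult[OF this, of ?q] have "(\<lambda>n. real (Suc n) * ?q ^ Suc n) sums ?f j"
      by (simp add: ac_simps)
    moreover have "real (Suc n) * ?q ^ Suc n = double_term 1 t (j, n)" for n
      by (simp only: double_term_def prod.case exp_of_nat_mult[symmetric] power_one_right) (simp add: algebra_simps del: of_nat_Suc)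
    ultimately show ?thesis by (intro sums_nonneg_imp_has_sum double_term_nonneg) (simp only:)
  qed
  have "(?f has_sum moment 1 t) UNIV"
    by (rule has_sum_SigmaD[where A = UNIV and B = "\<lambda>_. UNIV" and f = "double_term 1 t"])
      (use has_sum_infsum[OF double_term_summable(1)[OF t, of 1]] in \<open>simp only: moment_eq[OF t] UNIV_Times_UNIV\<close>, rule inner)
  then have f: "?f sums moment 1 t" by (rule has_sum_imp_sums)
  have p: "(\<lambda>j. 1 / (t * real (Suc j))\<^sup>2) sums (pi\<^sup>2 / (6 * t\<^sup>2))"
  proof -
    have "(\<lambda>j. 1 / (real (Suc j))\<^sup>2 / t\<^sup>2) sums (pi\<^sup>2 / 6 / t\<^sup>2)" by (rule sums_divide[OF inverse_squares])
    moreover have "1 / (real (Suc j))\<^sup>2 / t\<^sup>2 = 1 / (t * real (Suc j))\<^sup>2" for j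
      by (simp only: divide_divide_eq_left power_mult_distrib ac_simps)
    ultimately show ?thesis by (simp only: divide_divide_eq_left)
  qed
  have d: "(\<lambda>j. 1 / (t * real (Suc j))\<^sup>2 - ?f j) sums (pi\<^sup>2 / (6 * t\<^sup>2) - moment 1 t)"
    by (rule sums_diff[OF p f])
  \<comment> \<open>The majorant 4 / (1 + x)^2 is made to telescope: with y = 1 + j t it is at most
    4 / (y (y + t)).\<close>
  have lim: "(\<lambda>j. 1 / (1 + real j * t)) \<longlonglongrightarrow> 0" using t by real_asymp
  have tel: "(\<lambda>j. 4 / t * (1 / (1 + real j * t) - 1 / (1 + real (Suc j) * t))) sums (4 / t * (1 - 0))"
    using telescope_sums'[OF lim] by (intro sums_mult) simp
  have le: "1 / (t * real (Suc j))\<^sup>2 - ?f j \<le> 4 / t * (1 / (1 + real j * t) - 1 / (1 + real (Suc j) * t))" for j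
  proof -
    let ?x = "t * real (Suc j)"
    have x: "?x > 0" using t by simp
    have A: "1 / ?x\<^sup>2 - ?f j \<le> 4 / (1 + ?x)\<^sup>2"
    proof (cases "?x < 1")
      case True
      have "(1 + ?x)\<^sup>2 \<le> 2\<^sup>2" using True x by (intro power_mono) auto
      then have "1 \<le> 4 / (1 + ?x)\<^sup>2" using x by (simp add: le_divide_eq)
      with exp_quotient_bounds(1)[OF x] show ?thesis by linarith
    next
      case False
      have "(1 + ?x)\<^sup>2 \<le> (2 * ?x)\<^sup>2" using False x by (intro power_mono) auto
      then have "4 / (2 * ?x)\<^sup>2 \<le> 4 / (1 + ?x)\<^sup>2"
        using x t by (intro divide_left_mono mult_pos_pos zero_less_power add_pos_pos) auto
      then have "1 / ?x\<^sup>2 \<le> 4 / (1 + ?x)\<^sup>2" by (simp add: power_mult_distrib del: of_nat_Suc)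
      moreover have "?f j \<ge> 0" by simp
      ultimately show ?thesis by linarith
    qed
    define y where "y = 1 + real j * t"
    have y: "y > 0" "1 + ?x = y + t" "1 + real (Suc j) * t = y + t"
      using t by (auto simp: y_def algebra_simps intro: add_pos_nonneg)
    have "4 / (1 + ?x)\<^sup>2 \<le> 4 / (y * (y + t))"
      unfolding y(2) power2_eq_square using t y(1)
      by (intro divide_left_mono mult_right_mono mult_pos_pos) auto
    also have "\<dots> = 4 / t * (1 / (1 + real j * t) - 1 / (1 + real (Suc j) * t))"
      unfolding y(3) y_def[symmetric] using t y(1) by (simp add: divide_simps)
    finally show ?thesis using A by linarith
  qed
  define D where "D = pi\<^sup>2 / (6 * t\<^sup>2) - moment 1 t"
  have "D \<le> 4 / t * (1 - 0)" unfolding D_def using le d tel by (rule sums_le)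
  moreover have "D \<ge> 0"
  proof -
    have s: "summable (\<lambda>j. 1 / (t * real (Suc j))\<^sup>2 - ?f j)" using d by (rule sums_summable)
    have "0 \<le> 1 / (t * real (Suc j))\<^sup>2 - ?f j" for j
      using exp_quotient_bounds(2)[of "t * real (Suc j)"] t by (simp del: of_nat_Suc)
    from suminf_nonneg[OF s this] show "D \<ge> 0" unfolding D_def sums_unique[OF d] .
  qed
  ultimately have "\<bar>- D\<bar> \<le> 4 / t" by simp
  then show ?thesis unfolding D_def by (simp only: minus_diff_eq)
qed

text \<open>Only the terms with \<open>B \<le> m < 2 * B\<close> and \<open>B\<close> about 1/t are
  kept. There \<open>t * m \<le> 4\<close>, the divisor weight is at least one, and there are
  \<open>B\<close> such terms.\<close>

lemma moment_lower:
  assumes t: "0 < t" "t \<le> 1"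
  shows "exp (- 4) / t ^ Suc i \<le> moment i t"
proof -
  define B where "B = nat \<lceil>1 / t\<rceil>"
  have B: "1 \<le> t * real B" "t * real B \<le> 2" "B > 0"
  proof -
    have "0 < \<lceil>1 / t\<rceil>" using t by simp
    then have "real B = of_int \<lceil>1 / t\<rceil>" by (simp add: B_def)
    then have *: "1 / t \<le> real B" "real B \<le> 1 / t + 1" by linarith+
    then show 1: "1 \<le> t * real B" "t * real B \<le> 2" using t by (auto simp: field_simps)
    then show "B > 0" by (auto intro: gr0I)
  qed
  have tm: "real B ^ i * exp (- 4) \<le> real m ^ i * divisor_weight m * exp (- t * real m)"
    if m: "m \<in> {B..<2 * B}" for m
  proof -
    have "t * real m \<le> t * (2 * real B)" using m t by (intro mult_left_mono) auto
    then have "exp (- 4) \<le> exp (- t * real m)" using B by simp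
    moreover have "real B ^ i * 1 \<le> real m ^ i * divisor_weight m"
      using m B by (intro mult_mono power_mono divisor_weight_ge_1) auto
    ultimately show ?thesis by (intro mult_mono) (auto simp: divisor_weight_nonneg)
  qed
  have "1 / t \<le> real B" using B t by (simp add: field_simps)
  then have "(1 / t) ^ Suc i \<le> real B ^ Suc i" using t by (intro power_mono) auto
  then have "exp (- 4) * (1 / t) ^ Suc i \<le> exp (- 4) * real B ^ Suc i" by (intro mult_left_mono) auto
  then have "exp (- 4) / t ^ Suc i \<le> exp (- 4) * real B ^ Suc i" by (simp only: power_one_over times_divide_eq_right mult_1_right)
  also have "\<dots> = (\<Sum>m\<in>{B..<2 * B}. real B ^ i * exp (- 4))" by simp
  also have "\<dots> \<le> (\<Sum>m\<in>{B..<2 * B}. real m ^ i * divisor_weight m * exp (- t * real m))"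
    by (intro sum_mono tm)
  also have "\<dots> \<le> moment i t"
    unfolding moment_def using moment_summable[OF t(1)]
    by (intro sum_le_suminf) (auto simp: divisor_weight_nonneg)
  finally show ?thesis .
qed

section \<open>\<open>F\<close> as a decreasing bijection of the positive reals\<close>

lemma moment_antimono:
  assumes "0 < t" "t \<le> t'"
  shows "moment i t' \<le> moment i t"
  unfolding moment_def
proof (rule suminf_le)
  show "summable (\<lambda>m. real m ^ i * divisor_weight m * exp (- t' * real m))"
    "summable (\<lambda>m. real m ^ i * divisor_weight m * exp (- t * real m))"
    by (rule moment_summable, use assms in simp)+
  show "real m ^ i * divisor_weight m * exp (- t' * real m) \<le> real m ^ i * divisor_weight m * exp (- t * real m)" for m
    using assms by (intro mult_left_mono) (auto simp: divisor_weight_nonneg mult_right_mono)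
qed

lemma F_sums: "t > 0 \<Longrightarrow> (\<lambda>m. divisor_weight m * exp (- t * real m)) sums F t"
  using moment_sums[of t 0] F_eq_moment[of t] by simp

lemma F_diff_le:
  assumes t: "0 < t" and x: "0 \<le> x"
  shows "F t - F (t + x) \<le> x * moment 1 t"
proof -
  have s: "(\<lambda>m. divisor_weight m * exp (- t * real m) - divisor_weight m * exp (- (t + x) * real m)) sums (F t - F (t + x))"
    using t x by (intro sums_diff F_sums) auto
  have m: "(\<lambda>m. x * (real m ^ 1 * divisor_weight m * exp (- t * real m))) sums (x * moment 1 t)"
    by (intro sums_mult moment_sums t)
  have le: "divisor_weight m * exp (- t * real m) - divisor_weight m * exp (- (t + x) * real m)
      \<le> x * (real m ^ 1 * divisor_weight m * exp (- t * real m))" for m :: nat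
  proof -
    have "1 - exp (- (x * real m)) \<le> x * real m" using exp_ge_add_one_self[of "- (x * real m)"] by linarith
    then have "divisor_weight m * exp (- t * real m) * (1 - exp (- (x * real m)))
      \<le> divisor_weight m * exp (- t * real m) * (x * real m)"
      by (intro mult_left_mono) (auto simp: divisor_weight_nonneg)
    moreover have "exp (- (t + x) * real m) = exp (- t * real m) * exp (- (x * real m))"
      by (simp add: exp_add[symmetric] algebra_simps)
    ultimately show ?thesis
      by (simp add: algebra_simps)
  qed
  show ?thesis by (rule sums_le[OF le s m])
qed

lemma F_strict_antimono:
  assumes "0 < t" "t < t'" shows "F t' < F t"
proof -
  have s: "(\<lambda>m. divisor_weight m * exp (- t * real m) - divisor_weight m * exp (- t' * real m)) sums (F t - F t')"
    using assms by (intro sums_diff F_sums) auto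
  have nn: "divisor_weight m * exp (- t * real m) - divisor_weight m * exp (- t' * real m) \<ge> 0" for m
  proof -
    have "exp (- t' * real m) \<le> exp (- t * real m)" using assms by (simp add: mult_right_mono)
    from mult_left_mono[OF this divisor_weight_nonneg[of m]] show ?thesis by simp
  qed
  have "0 < divisor_weight 1 * exp (- t * real 1) - divisor_weight 1 * exp (- t' * real 1)"
  proof -
    have "exp (- t' * real 1) < exp (- t * real 1)" using assms by simp
    from mult_strict_left_mono[OF this, of "divisor_weight 1"] divisor_weight_ge_1[of 1] show ?thesis by simp
  qed
  also have "\<dots> = (\<Sum>m\<in>{1}. divisor_weight m * exp (- t * real m) - divisor_weight m * exp (- t' * real m))" by simp
  also have "\<dots> \<le> F t - F t'"
    using sum_le_suminf[OF sums_summable[OF s], of "{1}"] nn sums_unique[OF s] by simp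
  finally show ?thesis by simp
qed

lemma F_antimono: "0 < t \<Longrightarrow> t \<le> t' \<Longrightarrow> F t' \<le> F t"
  using F_strict_antimono[of t t'] by (cases "t = t'") simp_all

lemma F_pos: "0 < t \<Longrightarrow> F t > 0"
  using F_strict_antimono[of t "t + 1"] moment_nonneg[of "t + 1" 0] F_eq_moment[of "t + 1"] by linarith

lemma F_upper: "0 < t \<Longrightarrow> F t \<le> 4 / t"
  using moment_upper[of t 0] F_eq_moment[of t] by simp

lemma F_lower: "0 < t \<Longrightarrow> t \<le> 1 \<Longrightarrow> exp (- 4) / t \<le> F t"
  using moment_lower[of t 0] F_eq_moment[of t] by simp

lemma continuous_on_F: "continuous_on {0<..} F"
proof -
  have "isCont F t" if t: "t > 0" for t
  proof -
    have b: "\<bar>F y - F t\<bar> \<le> \<bar>y - t\<bar> * moment 1 (t / 2)" if y: "y > t / 2" for y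
    proof (cases "y \<le> t")
      case True
      have "F y - F t \<le> (t - y) * moment 1 y" using F_diff_le[of y "t - y"] True y t by simp
      also have "\<dots> \<le> (t - y) * moment 1 (t / 2)" using True y t by (intro mult_left_mono moment_antimono) auto
      finally show ?thesis using F_antimono[of y t] True y t by auto
    next
      case False
      have "F t - F y \<le> (y - t) * moment 1 t" using F_diff_le[of t "y - t"] False y t by simp
      also have "\<dots> \<le> (y - t) * moment 1 (t / 2)" using False y t by (intro mult_left_mono moment_antimono) auto
      finally show ?thesis using F_antimono[of t y] False y t by auto
    qed
    have "((\<lambda>y. \<bar>y - t\<bar> * moment 1 (t / 2)) \<longlongrightarrow> \<bar>t - t\<bar> * moment 1 (t / 2)) (at t)"
      by (intro tendsto_intros)
    moreover have "\<forall>\<^sub>F y in at t. norm (F y - F t) \<le> \<bar>y - t\<bar> * moment 1 (t / 2)"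
    proof -
      have e: "\<forall>\<^sub>F y in at t. y > t / 2"
        by (rule order_tendstoD(1)[OF tendsto_ident_at]) (use t in simp)
      show ?thesis by (rule eventually_mono[OF e]) (simp only: real_norm_def b)
    qed
    ultimately have "((\<lambda>y. F y - F t) \<longlongrightarrow> 0) (at t)"
      using Lim_null_comparison[of "\<lambda>y. F y - F t" "\<lambda>y. \<bar>y - t\<bar> * moment 1 (t / 2)" "at t"] by simp
    then show ?thesis unfolding isCont_def by (rule LIM_zero_cancel)
  qed
  then show ?thesis by (intro continuous_at_imp_continuous_on) auto
qed

lemma F_surj:
  assumes s: "s > 0" shows "\<exists>t>0. F t = s"
proof -
  define t2 where "t2 = 4 / s"
  \<comment> \<open>The bound 1 makes \<open>F_lower\<close> applicable, \<open>t2\<close> makes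
    \<open>t1\<close> a left end point, and the last bound pushes \<open>F t1\<close> above
    \<open>s\<close>.\<close>
  define t1 where "t1 = min (min 1 t2) (exp (- 4) / s)"
  have t: "0 < t1" "t1 \<le> t2" "t1 \<le> 1" "t1 \<le> exp (- 4) / s" using s by (auto simp: t1_def t2_def)
  have "F t2 \<le> s" using F_upper[of t2] s by (simp add: t2_def)
  moreover have "s \<le> F t1"
  proof -
    have "s \<le> exp (- 4) / t1" using t s by (simp add: field_simps)
    then show ?thesis using F_lower[of t1] t by linarith
  qed
  moreover have "continuous_on {t1..t2} F"
    by (rule continuous_on_subset[OF continuous_on_F]) (use t in auto)
  ultimately have "\<exists>x\<ge>t1. x \<le> t2 \<and> F x = s" using t(2) by (intro IVT2')
  then obtain x where "t1 \<le> x" "x \<le> t2" "F x = s" by blast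
  then show ?thesis using t by (intro exI[of _ x]) auto
qed

lemma inj_on_F: "inj_on F {0<..}"
proof (rule linorder_inj_onI)
  fix x y :: real assume "x < y" "x \<in> {0<..}"
  then have "F y < F x" by (intro F_strict_antimono) simp_all
  then show "F x \<noteq> F y" by simp
qed auto

lemma
  assumes s: "s > 0"
  shows F_inv_pos: "F_inv s > 0" and F_F_inv: "F (F_inv s) = s"
proof -
  have im: "s \<in> F ` {0<..}" using F_surj[OF s] by auto
  show "F (F_inv s) = s" unfolding F_inv_def by (rule f_the_inv_into_f[OF inj_on_F im])
  show "F_inv s > 0" unfolding F_inv_def using the_inv_into_into[OF inj_on_F im subset_refl] by simp
qed

lemma F_inv_F: "t > 0 \<Longrightarrow> F_inv (F t) = t"
  unfolding F_inv_def by (rule the_inv_into_f_f[OF inj_on_F]) simp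

lemma F_inv_antimono:
  assumes "0 < s" "s \<le> s'" shows "F_inv s' \<le> F_inv s"
proof (rule ccontr)
  assume "\<not> ?thesis"
  then have "F (F_inv s') < F (F_inv s)" using assms by (intro F_strict_antimono F_inv_pos) auto
  moreover have "F (F_inv s') = s'" "F (F_inv s) = s" using assms by (simp_all add: F_F_inv)
  ultimately show False using assms by linarith
qed

text \<open>
  Both estimates are second order Taylor expansions of \<open>F\<close>, whose first two derivatives
  are \<open>- moment 1\<close> and \<open>moment 2\<close>.
\<close>

lemma F_expand_lower:
  assumes t: "t > 0" "t + x > 0"
  shows "- x * moment 1 t \<le> F (t + x) - F t"
proof -
  have s: "(\<lambda>m. divisor_weight m * exp (- (t + x) * real m) - divisor_weight m * exp (- t * real m)) sums (F (t + x) - F t)"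
    using t by (intro sums_diff F_sums) auto
  have m: "(\<lambda>m. - x * (real m ^ 1 * divisor_weight m * exp (- t * real m))) sums (- x * moment 1 t)"
    by (intro sums_mult moment_sums t)
  have le: "- x * (real m ^ 1 * divisor_weight m * exp (- t * real m)) \<le>
       divisor_weight m * exp (- (t + x) * real m) - divisor_weight m * exp (- t * real m)" for m :: nat
  proof -
    have "divisor_weight m * exp (- t * real m) * (- (x * real m))
      \<le> divisor_weight m * exp (- t * real m) * (exp (- (x * real m)) - 1)"
      using exp_ge_add_one_self[of "- (x * real m)"] by (intro mult_left_mono) (auto simp: divisor_weight_nonneg)
    moreover have "exp (- (t + x) * real m) = exp (- t * real m) * exp (- (x * real m))"
      by (simp add: exp_add[symmetric] algebra_simps)
    ultimately show ?thesis
      by (simp add: algebra_simps)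
  qed
  show ?thesis by (rule sums_le[OF le m s])
qed

lemma exp_second_order:
  fixes y :: real shows "exp y - 1 - y \<le> y\<^sup>2 / 2 * exp \<bar>y\<bar>"
proof -
  obtain z where "\<bar>z\<bar> \<le> \<bar>y\<bar>" "exp y = (\<Sum>m<2. y ^ m / fact m) + exp z / fact 2 * y ^ 2"
    using Maclaurin_exp_le[of y 2] by auto
  moreover have "exp z \<le> exp \<bar>y\<bar>" using \<open>\<bar>z\<bar> \<le> \<bar>y\<bar>\<close> by auto
  then have "exp z / 2 * y\<^sup>2 \<le> exp \<bar>y\<bar> / 2 * y\<^sup>2" by (intro mult_right_mono) auto
  ultimately show ?thesis by (simp add: lessThan_nat_numeral mult.commute)
qed

lemma F_expand_upper:
  assumes t: "\<bar>x\<bar> < t"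
  shows "F (t + x) - F t \<le> - x * moment 1 t + x\<^sup>2 / 2 * moment 2 (t - \<bar>x\<bar>)"
proof -
  have s: "(\<lambda>m. divisor_weight m * exp (- (t + x) * real m) - divisor_weight m * exp (- t * real m)) sums (F (t + x) - F t)"
    using t by (intro sums_diff F_sums) auto
  have m: "(\<lambda>m. - x * (real m ^ 1 * divisor_weight m * exp (- t * real m))
       + x\<^sup>2 / 2 * (real m ^ 2 * divisor_weight m * exp (- (t - \<bar>x\<bar>) * real m)))
      sums (- x * moment 1 t + x\<^sup>2 / 2 * moment 2 (t - \<bar>x\<bar>))"
    using t by (intro sums_add sums_mult moment_sums) auto
  have le: "divisor_weight m * exp (- (t + x) * real m) - divisor_weight m * exp (- t * real m)
      \<le> - x * (real m ^ 1 * divisor_weight m * exp (- t * real m))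
       + x\<^sup>2 / 2 * (real m ^ 2 * divisor_weight m * exp (- (t - \<bar>x\<bar>) * real m))" for m :: nat
  proof -
    have "divisor_weight m * exp (- t * real m) * (exp (- (x * real m)) - 1 + x * real m)
      \<le> divisor_weight m * exp (- t * real m) * ((x * real m)\<^sup>2 / 2 * exp (\<bar>x\<bar> * real m))"
      using exp_second_order[of "- (x * real m)"]
      by (intro mult_left_mono) (auto simp: divisor_weight_nonneg abs_mult)
    moreover have "exp (- (t + x) * real m) = exp (- t * real m) * exp (- (x * real m))"
      "exp (- (t - \<bar>x\<bar>) * real m) = exp (- t * real m) * exp (\<bar>x\<bar> * real m)"
      by (simp_all add: exp_add[symmetric] algebra_simps)
    ultimately show ?thesis
      by (simp add: algebra_simps power_mult_distrib)
  qed
  show ?thesis by (rule sums_le[OF le s m])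
qed

section \<open>The law of the random partition at a fixed time\<close>

text \<open>The infimum is the least admissible index, or \<infinity> if there is none. A prescribed
  finite value thus becomes a condition on finitely many of the variables.\<close>

lemma rho_eq_enat:
  "rho e k t = enat c \<longleftrightarrow> (\<forall>j<c. e k (j + 1) > real k * t) \<and> e k (c + 1) \<le> real k * t"
proof -
  define S where "S = {r. e k (r + 1) \<le> real k * t}"
  have INF: "rho e k t = (INF r \<in> S. enat r)" by (simp add: rho_def S_def)
  show ?thesis
  proof (cases "S = {}")
    case True
    then have "\<not> e k (c + 1) \<le> real k * t" by (auto simp: S_def)
    then show ?thesis unfolding INF True by (simp add: top_enat_def)
  next
    case False
    have "rho e k t = enat (LEAST r. r \<in> S)"
      unfolding INF using False
      by (intro antisym INF_lower INF_greatest) (auto intro: LeastI_ex Least_le)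
    moreover have "(LEAST r. r \<in> S) = c \<longleftrightarrow> c \<in> S \<and> (\<forall>j<c. j \<notin> S)"
      using False by (metis LeastI_ex Least_equality ex_in_conv linorder_not_less not_less_Least)
    ultimately show ?thesis by (auto simp: S_def not_le)
  qed
qed

lemma rho_antimono:
  assumes "t \<le> t'" shows "rho e k t' \<le> rho e k t"
  unfolding rho_def
proof (rule INF_superset_mono)
  show "{r. e k (r + 1) \<le> real k * t} \<subseteq> {r. e k (r + 1) \<le> real k * t'}"
    using mult_left_mono[OF assms, of "real k"] by (auto intro: order_trans)
qed simp

text \<open>The case in which \<open>partition_at\<close> does not take its default value.\<close>

definition valid :: "(nat \<Rightarrow> nat \<Rightarrow> real) \<Rightarrow> real \<Rightarrow> nat multiset \<Rightarrow> bool" where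
  "valid e t p \<longleftrightarrow> p \<in> partitions \<and> (\<forall>k\<ge>1. enat (count p k) = rho e k t)"

lemma valid_unique:
  assumes "valid e t p" "valid e t q" shows "p = q"
proof (rule multiset_eqI)
  fix k
  have "k = 0 \<or> enat (count p k) = enat (count q k)"
    using assms unfolding valid_def by (cases "k = 0") (auto simp: Suc_le_eq)
  moreover have "count p 0 = 0" "count q 0 = 0"
    using assms by (auto simp: valid_def partitions_def not_in_iff)
  ultimately show "count p k = count q k" by auto
qed

lemma valid_iff: "valid e t q \<Longrightarrow> valid e t p \<longleftrightarrow> q = p"
  using valid_unique[of e t q p] by auto

lemma partition_at_valid: "valid e t p \<Longrightarrow> partition_at e t = p"
proof -
  assume v: "valid e t p"
  then have "(THE p. p \<in> partitions \<and> (\<forall>k\<ge>1. enat (count p k) = rho e k t)) = p"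
    unfolding valid_def[symmetric] by (intro the_equality) (simp_all add: valid_unique)
  then show ?thesis using v by (auto simp: partition_at_def valid_def)
qed

lemma partition_at_invalid: "(\<And>p. \<not> valid e t p) \<Longrightarrow> partition_at e t = {#}"
  unfolding partition_at_def valid_def by auto

lemma partition_at_partition: "partition_at e t \<in> partitions"
proof (cases "\<exists>p. valid e t p")
  case True
  then show ?thesis using partition_at_valid by (auto simp: valid_def)
next
  case False
  then show ?thesis using partition_at_invalid[of e t] by (simp add: partitions_def)
qed

lemma valid_mono:
  assumes "t \<le> t'" "valid e t p" "valid e t' q" shows "q \<subseteq># p"
proof (rule mset_subset_eqI)
  fix k
  have "count q 0 = 0" using assms by (auto simp: valid_def partitions_def not_in_iff)
  moreover have "enat (count q k) \<le> enat (count p k)" if "k \<ge> 1"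
    using that assms rho_antimono[OF assms(1), of e k] by (simp add: valid_def)
  ultimately show "count q k \<le> count p k" by (cases "k = 0") auto
qed

lemma sum_count_parts:
  fixes p :: "nat multiset"
  assumes "\<forall>x\<in>#p. 1 \<le> x \<and> x \<le> K"
  shows "(\<Sum>k\<in>{1..K}. k * count p k) = sum_mset p"
  using assms
proof (induction p)
  case (add x p)
  have "(\<Sum>k\<in>{1..K}. k * count (add_mset x p) k) = (\<Sum>k\<in>{1..K}. k * count p k + (if k = x then x else 0))"
    by (intro sum.cong) auto
  also have "\<dots> = (\<Sum>k\<in>{1..K}. k * count p k) + x" using add.prems by (simp add: sum.distrib)
  finally show ?case using add by simp
qed simp

section \<open>The random partition built from independent exponential variables\<close>

locale exponential_array = prob_space +
  fixes \<epsilon> :: "nat \<Rightarrow> nat \<Rightarrow> 'a \<Rightarrow> real"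
  assumes indep: "indep_vars (\<lambda>_. borel) (\<lambda>(k, j). \<epsilon> k j) ({1..} \<times> {1..})"
    and dist: "k \<ge> 1 \<Longrightarrow> j \<ge> 1 \<Longrightarrow> distributed M lborel (\<epsilon> k j) (exponential_density 1)"
begin

definition sample :: "real \<Rightarrow> 'a \<Rightarrow> nat multiset" where
  "sample t \<omega> = partition_at (\<lambda>k j. \<epsilon> k j \<omega>) t"

lemma measurable_\<epsilon> [measurable]: "k \<ge> 1 \<Longrightarrow> j \<ge> 1 \<Longrightarrow> \<epsilon> k j \<in> borel_measurable M"
  using distributed_measurable[OF dist] by simp

lemma prob_gt: "k \<ge> 1 \<Longrightarrow> j \<ge> 1 \<Longrightarrow> x \<ge> 0 \<Longrightarrow> prob (\<epsilon> k j -` {x<..} \<inter> space M) = exp (- x)"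
  using exponential_distributedD_gt[OF dist, of k j x]
  by (simp add: vimage_def Int_def conj_commute)

lemma prob_le: "k \<ge> 1 \<Longrightarrow> j \<ge> 1 \<Longrightarrow> x \<ge> 0 \<Longrightarrow> prob (\<epsilon> k j -` {..x} \<inter> space M) = 1 - exp (- x)"
  using exponential_distributedD_le[OF dist, of k j x]
  by (simp add: vimage_def Int_def conj_commute)

definition level :: "real \<Rightarrow> nat multiset \<Rightarrow> 'a set" where
  "level t p = {\<omega> \<in> space M. \<forall>k\<ge>1. enat (count p k) = rho (\<lambda>k j. \<epsilon> k j \<omega>) k t}"

text \<open>This event involves finitely many variables, so that independence applies;
  \<open>level\<close> is its decreasing limit in \<open>K\<close>.\<close>

definition level_upto :: "real \<Rightarrow> nat multiset \<Rightarrow> nat \<Rightarrow> 'a set" where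
  "level_upto t p K = {\<omega> \<in> space M. \<forall>k\<in>{1..K}. rho (\<lambda>k j. \<epsilon> k j \<omega>) k t = enat (count p k)}"

lemma level_upto_eq:
  assumes "K \<ge> 1"
  shows "level_upto t p K = (\<Inter>i\<in>Sigma {1..K} (\<lambda>k. {1..count p k + 1}).
    (\<lambda>(k, j). \<epsilon> k j) i -` (\<lambda>(k, j). if j \<le> count p k then {real k * t<..} else {..real k * t}) i \<inter> space M)"
    (is "_ = ?R")
proof (rule set_eqI)
  fix \<omega>
  have mem: "1 \<in> {1..K}" "\<And>k. 1 \<in> {1..count p k + 1}" using assms by simp_all
  have "\<omega> \<in> ?R \<longleftrightarrow> (\<forall>k\<in>{1..K}. \<forall>j\<in>{1..count p k + 1}.
      \<epsilon> k j \<omega> \<in> (if j \<le> count p k then {real k * t<..} else {..real k * t}) \<and> \<omega> \<in> space M)"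
    by (simp only: INT_iff split_paired_Ball_Sigma prod.case Int_iff vimage_eq)
  also have "\<dots> \<longleftrightarrow> \<omega> \<in> space M \<and> (\<forall>k\<in>{1..K}. \<forall>j\<in>{1..count p k + 1}.
      \<epsilon> k j \<omega> \<in> (if j \<le> count p k then {real k * t<..} else {..real k * t}))"
    using mem by blast
  also have "\<dots> \<longleftrightarrow> \<omega> \<in> space M \<and> (\<forall>k\<in>{1..K}. (\<forall>j<count p k. \<epsilon> k (j + 1) \<omega> > real k * t) \<and> \<epsilon> k (count p k + 1) \<omega> \<le> real k * t)"
  proof (intro conj_cong refl ball_cong)
    fix k
    show "(\<forall>j\<in>{1..count p k + 1}. \<epsilon> k j \<omega> \<in> (if j \<le> count p k then {real k * t<..} else {..real k * t}))
      \<longleftrightarrow> (\<forall>j<count p k. \<epsilon> k (j + 1) \<omega> > real k * t) \<and> \<epsilon> k (count p k + 1) \<omega> \<le> real k * t" (is "?A \<longleftrightarrow> ?B")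
    proof
      assume A: ?A
      show ?B
      proof (intro conjI allI impI)
        fix j assume "j < count p k"
        then show "\<epsilon> k (j + 1) \<omega> > real k * t" using bspec[OF A, of "j + 1"] by simp
      next
        show "\<epsilon> k (count p k + 1) \<omega> \<le> real k * t" using bspec[OF A, of "count p k + 1"] by simp
      qed
    next
      assume B: ?B
      show ?A
      proof
        fix j assume j: "j \<in> {1..count p k + 1}"
        show "\<epsilon> k j \<omega> \<in> (if j \<le> count p k then {real k * t<..} else {..real k * t})"
        proof (cases "j \<le> count p k")
          case True
          then show ?thesis using j B[THEN conjunct1, rule_format, of "j - 1"] by simp
        next
          case False
          then have "j = count p k + 1" using j by auto
          then show ?thesis using B by simp
        qed
      qed
    qed
  qed
  also have "\<dots> \<longleftrightarrow> \<omega> \<in> level_upto t p K" by (simp add: level_upto_def rho_eq_enat)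
  finally show "\<omega> \<in> level_upto t p K \<longleftrightarrow> \<omega> \<in> ?R" by simp
qed

lemma sets_level_upto: "level_upto t p K \<in> sets M"
proof (cases "K \<ge> 1")
  case True
  have "(1, 1) \<in> Sigma {1..K} (\<lambda>k. {1..count p k + 1})" using True by auto
  then have ne: "Sigma {1..K} (\<lambda>k. {1..count p k + 1}) \<noteq> {}" by blast
  show ?thesis unfolding level_upto_eq[OF True]
    by (intro sets.finite_INT) (use ne in \<open>auto intro!: measurable_sets[OF measurable_\<epsilon>]\<close>)
next
  case False
  then have "level_upto t p K = space M" by (auto simp: level_upto_def)
  then show ?thesis by simp
qed

text \<open>Each multiplicity is geometric: \<open>count p k\<close> variables exceed
  \<open>k * t\<close>, each with probability \<open>exp (- (k * t))\<close>, and the next one does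
  not. The case \<open>K = 0\<close> is separate because independence is applied to a nonempty index
  set.\<close>

lemma prob_level_upto:
  assumes t: "t > 0"
  shows "prob (level_upto t p K) = (\<Prod>k\<in>{1..K}. exp (- (real k * t)) ^ count p k * (1 - exp (- (real k * t))))"
proof (cases "K \<ge> 1")
  case True
  let ?I = "Sigma {1..K} (\<lambda>k. {1..count p k + 1})"
  let ?A = "\<lambda>(k, j). if j \<le> count p k then {real k * t<..} else {..real k * t}"
  have "(1, 1) \<in> ?I" using True by auto
  then have ne: "?I \<noteq> {}" by blast
  have "prob (level_upto t p K) = (\<Prod>i\<in>?I. prob ((\<lambda>(k, j). \<epsilon> k j) i -` ?A i \<inter> space M))"
    unfolding level_upto_eq[OF True]
  proof (rule indep_varsD[OF indep])
    show "?A i \<in> sets borel" for i by (cases i) auto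
  qed (use ne in auto)
  also have "\<dots> = (\<Prod>k\<in>{1..K}. \<Prod>j\<in>{1..count p k + 1}. prob ((\<lambda>(k, j). \<epsilon> k j) (k, j) -` ?A (k, j) \<inter> space M))"
    by (subst prod.Sigma) (auto intro!: prod.cong)
  also have "\<dots> = (\<Prod>k\<in>{1..K}. exp (- (real k * t)) ^ count p k * (1 - exp (- (real k * t))))"
  proof (rule prod.cong[OF refl])
    fix k assume k: "k \<in> {1..K}"
    have "(\<Prod>j\<in>{1..count p k + 1}. prob ((\<lambda>(k, j). \<epsilon> k j) (k, j) -` ?A (k, j) \<inter> space M))
        = (\<Prod>j\<in>{1..count p k + 1}. if j \<le> count p k then exp (- (real k * t)) else 1 - exp (- (real k * t)))"
      using k t by (intro prod.cong refl) (auto simp: prob_gt prob_le)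
    also have "\<dots> = exp (- (real k * t)) ^ count p k * (1 - exp (- (real k * t)))"
      by simp
    finally show "(\<Prod>j\<in>{1..count p k + 1}. prob ((\<lambda>(k, j). \<epsilon> k j) (k, j) -` ?A (k, j) \<inter> space M))
      = exp (- (real k * t)) ^ count p k * (1 - exp (- (real k * t)))" .
  qed
  finally show ?thesis .
next
  case False
  then have "level_upto t p K = space M" "{1..K} = {}" by (auto simp: level_upto_def)
  then show ?thesis by (simp add: prob_space)
qed

lemma level_eq: "level t p = (\<Inter>K. level_upto t p K)"
proof (rule set_eqI)
  fix \<omega>
  have "(\<forall>k\<ge>1. enat (count p k) = rho (\<lambda>k j. \<epsilon> k j \<omega>) k t)
    \<longleftrightarrow> (\<forall>K. \<forall>k\<in>{1..K}. rho (\<lambda>k j. \<epsilon> k j \<omega>) k t = enat (count p k))"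
    by (metis atLeastAtMost_iff order_refl)
  then show "\<omega> \<in> level t p \<longleftrightarrow> \<omega> \<in> (\<Inter>K. level_upto t p K)"
    unfolding level_def level_upto_def by blast
qed

lemma sets_level [measurable]: "level t p \<in> sets M"
  unfolding level_eq by (intro sets.countable_INT) (auto simp: sets_level_upto)

text \<open>As \<open>K\<close> grows, the product of the factors \<open>1 - exp (- (k * t))\<close>
  tends to \<open>exp (- F t)\<close>, and the exponent is constant as soon as \<open>K\<close> is
  at least every part of \<open>p\<close>.\<close>

lemma prob_level:
  assumes t: "t > 0" and p: "p \<in> partitions"
  shows "prob (level t p) = exp (- t * real (sum_mset p) - F t)"
proof -
  have d: "decseq (level_upto t p)" by (rule decseq_SucI) (auto simp: level_upto_def)
  have 1: "(\<lambda>K. prob (level_upto t p K)) \<longlonglongrightarrow> prob (level t p)"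
    unfolding level_eq using d sets_level_upto by (intro finite_Lim_measure_decseq) auto
  have eq: "prob (level_upto t p K) = exp (- t * real (\<Sum>k\<in>{1..K}. k * count p k) + (\<Sum>k<K. ln (1 - exp (- (real (Suc k) * t)))))" for K
  proof -
    have one: "exp (- (real k * t)) ^ count p k = exp (- t * real (k * count p k))" for k
      by (simp only: exp_of_nat_mult[symmetric] of_nat_mult mult_minus_left mult_minus_right ac_simps)
    have "exp (- t * real (\<Sum>k\<in>{1..K}. k * count p k)) = (\<Prod>k\<in>{1..K}. exp (- (real k * t)) ^ count p k)"
      unfolding one of_nat_sum sum_distrib_left by (rule exp_sum) simp
    moreover have "exp (\<Sum>k<K. ln (1 - exp (- (real (Suc k) * t)))) = (\<Prod>k<K. 1 - exp (- (real (Suc k) * t)))"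
      using t by (simp add: exp_sum)
    moreover have "(\<Prod>k<K. 1 - exp (- (real (Suc k) * t))) = (\<Prod>k\<in>{1..K}. 1 - exp (- (real k * t)))"
      by (rule prod.reindex_bij_witness[of _ "\<lambda>k. k - 1" Suc]) auto
    ultimately show ?thesis unfolding prob_level_upto[OF t] exp_add by (simp only: prod.distrib)
  qed
  have "(\<lambda>K. \<Sum>k<K. ln (1 - exp (- (real (Suc k) * t)))) \<longlonglongrightarrow> - F t"
    using summable_LIMSEQ[OF F_summable[OF t]] by (simp add: F_def)
  moreover have "\<forall>\<^sub>F K in sequentially. (\<Sum>k\<in>{1..K}. k * count p k) = sum_mset p"
    unfolding eventually_sequentially
  proof (intro exI[of _ "sum_mset p"] allI impI sum_count_parts ballI conjI)
    fix K x assume K: "sum_mset p \<le> K" and x: "x \<in># p"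
    have "x \<noteq> 0" using p x by (auto simp: partitions_def intro: ccontr)
    then show "1 \<le> x" by simp
    have "x \<le> sum_mset p" using sum_mset_mono_subset[of "{#x#}" p] x by simp
    then show "x \<le> K" using K by simp
  qed
  then have "(\<lambda>K. real (\<Sum>k\<in>{1..K}. k * count p k)) \<longlonglongrightarrow> real (sum_mset p)"
    by (intro tendsto_eventually) (erule eventually_mono, simp only:)
  ultimately have "(\<lambda>K. prob (level_upto t p K)) \<longlonglongrightarrow> exp (- t * real (sum_mset p) + - F t)"
    unfolding eq by (intro tendsto_intros)
  from LIMSEQ_unique[OF 1 this] show ?thesis by simp
qed

text \<open>The probabilities that a given part occurs are summable, so by Borel--Cantelli only
  finitely many parts occur. Each multiplicity is finite because long runs of exceedances have
  geometrically small probability.\<close>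

lemma AE_valid:
  assumes t: "t > 0"
  shows "AE \<omega> in M. \<exists>p. valid (\<lambda>k j. \<epsilon> k j \<omega>) t p"
proof -
  \<comment> \<open>On \<open>A n\<close> the part \<open>Suc n\<close> occurs.\<close>
  define A where "A n = \<epsilon> (Suc n) 1 -` {real (Suc n) * t<..} \<inter> space M" for n
  have A: "A n \<in> sets M" for n unfolding A_def by (intro measurable_sets[OF measurable_\<epsilon>]) auto
  have pA: "measure M (A n) = exp (- (t * real (Suc n)))" for n
    unfolding A_def using prob_gt[of "Suc n" 1 "real (Suc n) * t"] t by (simp add: mult.commute del: of_nat_Suc)
  have "summable (\<lambda>n. measure M (A n))"
    unfolding pA using geometric_moment(1)[OF t, of 0] by simp
  then have 1: "AE \<omega> in M. eventually (\<lambda>n. \<omega> \<in> space M - A n) sequentially"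
    using A by (intro borel_cantelli_AE1) (auto simp: emeasure_eq_measure)
  have 2: "AE \<omega> in M. \<forall>k. \<exists>j. \<epsilon> (Suc k) (j + 1) \<omega> \<le> real (Suc k) * t"
    unfolding AE_all_countable
  proof
    fix k
    \<comment> \<open>On \<open>B J\<close> the part \<open>Suc k\<close> has multiplicity greater
      than \<open>J\<close>.\<close>
    define B where "B J = (\<Inter>i\<in>{Suc k} \<times> {1..Suc J}. (\<lambda>(k, j). \<epsilon> k j) i -` {real (Suc k) * t<..} \<inter> space M)" for J
    have B: "B J \<in> sets M" for J unfolding B_def
      by (intro sets.finite_INT) (auto intro!: measurable_sets[OF measurable_\<epsilon>])
    have pB: "prob (B J) = exp (- (real (Suc k) * t)) ^ Suc J" for J
    proof -
      have "prob (B J) = (\<Prod>i\<in>{Suc k} \<times> {1..Suc J}. prob ((\<lambda>(k, j). \<epsilon> k j) i -` {real (Suc k) * t<..} \<inter> space M))"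
        unfolding B_def by (rule indep_varsD[OF indep]) auto
      also have "\<dots> = (\<Prod>i\<in>{Suc k} \<times> {1..Suc J}. exp (- (real (Suc k) * t)))"
        using t by (intro prod.cong refl) (auto simp: prob_gt simp del: of_nat_Suc)
      finally show ?thesis by simp
    qed
    have lim: "(\<lambda>J. prob (B J)) \<longlonglongrightarrow> 0"
      unfolding pB using t by (intro LIMSEQ_Suc LIMSEQ_power_zero) simp
    have "(\<Inter>J. B J) \<in> sets M" using B by auto
    moreover have "prob (\<Inter>J. B J) \<le> prob (B J)" for J by (intro finite_measure_mono B) auto
    then have "prob (\<Inter>J. B J) \<le> 0" by (intro LIMSEQ_le_const[OF lim]) auto
    then have "prob (\<Inter>J. B J) = 0" by (simp add: antisym)
    ultimately have "AE \<omega> in M. \<omega> \<notin> (\<Inter>J. B J)"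
      by (intro AE_not_in) (auto simp: emeasure_eq_measure null_sets_def)
    then show "AE \<omega> in M. \<exists>j. \<epsilon> (Suc k) (j + 1) \<omega> \<le> real (Suc k) * t"
    proof (rule AE_mp, intro AE_I2 impI)
      fix \<omega> assume w: "\<omega> \<in> space M" "\<omega> \<notin> (\<Inter>J. B J)"
      then obtain J where "\<omega> \<notin> B J" by auto
      then obtain j where "j \<in> {1..Suc J}" "\<not> \<epsilon> (Suc k) j \<omega> > real (Suc k) * t"
        using w(1) by (auto simp: B_def)
      then show "\<exists>j. \<epsilon> (Suc k) (j + 1) \<omega> \<le> real (Suc k) * t"
        by (intro exI[of _ "j - 1"]) auto
    qed
  qed
  show ?thesis
    using 1 2
  proof eventually_elim
    case (elim \<omega>)
    let ?e = "\<lambda>k j. \<epsilon> k j \<omega>"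
    obtain K where K: "\<And>n. n \<ge> K \<Longrightarrow> \<omega> \<notin> A n" "\<omega> \<in> space M"
      using elim(1) by (auto simp: eventually_sequentially)
    define c where "c k = (LEAST j. \<epsilon> k (j + 1) \<omega> \<le> real k * t)" for k
    have r: "rho ?e k t = enat (c k)" if "k \<ge> 1" for k
    proof -
      obtain k' where "k = Suc k'" using \<open>k \<ge> 1\<close> by (cases k) auto
      then have ex: "\<exists>j. \<epsilon> k (j + 1) \<omega> \<le> real k * t" using elim(2) by auto
      show ?thesis unfolding rho_eq_enat c_def
        using LeastI_ex[OF ex] not_less_Least[of _ "\<lambda>j. \<epsilon> k (j + 1) \<omega> \<le> real k * t"] by (auto simp: not_le)
    qed
    have c0: "c k = 0" if kK: "k \<ge> Suc K" for k
    proof -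
      obtain k' where k': "k = Suc k'" using kK by (cases k) simp_all
      then have "k' \<ge> K" using kK by simp
      then have "\<epsilon> k (0 + 1) \<omega> \<le> real k * t" using K(1)[of k'] K(2) \<open>k' \<ge> K\<close> by (auto simp: A_def not_less k')
      then show ?thesis unfolding c_def by (intro Least_eq_0)
    qed
    define p where "p = (\<Sum>k\<in>{1..K}. replicate_mset (c k) k)"
    have cnt: "count p k = (if k \<in> {1..K} then c k else 0)" for k
      unfolding p_def count_sum by simp
    have "valid ?e t p" unfolding valid_def
    proof (intro conjI allI impI)
      show "p \<in> partitions" using cnt[of 0] by (simp add: partitions_def not_in_iff)
      fix k :: nat assume k: "k \<ge> 1"
      then show "enat (count p k) = rho ?e k t" unfolding r[OF k] cnt using c0[of k] by auto
    qed
    then show ?case by blast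
  qed
qed

lemma sample_partition: "sample t \<omega> \<in> partitions"
  unfolding sample_def by (rule partition_at_partition)

lemma level_iff_valid:
  "\<omega> \<in> space M \<Longrightarrow> p \<in> partitions \<Longrightarrow> \<omega> \<in> level t p \<longleftrightarrow> valid (\<lambda>k j. \<epsilon> k j \<omega>) t p"
  by (auto simp: level_def valid_def)

lemma countable_multisets: "countable (UNIV :: nat multiset set)"
proof -
  have "(UNIV :: nat multiset set) = range mset" using ex_mset by (metis surjI surj_def)
  then show ?thesis by (metis countable_image countableI_type)
qed

text \<open>There are only countably many multisets, so preimages of points suffice. The preimage of
  the empty partition also contains the event \<open>bad\<close>, on which the default value is
  taken.\<close>

lemma measurable_sample [measurable]: "sample t \<in> measurable M (count_space UNIV)"
proof -
  have pre: "sample t -` {p} \<inter> space M \<in> sets M" for p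
  proof -
  define bad where "bad = space M - (\<Union>q\<in>partitions. level t q)"
  have bad: "bad \<in> sets M" unfolding bad_def
    by (intro sets.Diff sets.top sets.countable_UN' countable_subset[OF subset_UNIV countable_multisets] image_subsetI sets_level)
  have inv: "\<omega> \<in> bad \<longleftrightarrow> \<omega> \<in> space M \<and> (\<forall>q. \<not> valid (\<lambda>k j. \<epsilon> k j \<omega>) t q)" for \<omega>
    unfolding bad_def using level_iff_valid[of \<omega>] by (auto simp: valid_def)
  have "sample t -` {p} \<inter> space M = (if p \<in> partitions then level t p else {}) \<union> (if p = {#} then bad else {})"
  proof (rule set_eqI)
    fix \<omega>
    show "\<omega> \<in> sample t -` {p} \<inter> space M \<longleftrightarrow> \<omega> \<in> (if p \<in> partitions then level t p else {}) \<union> (if p = {#} then bad else {})"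
    proof (cases "\<omega> \<in> space M")
      case w: True
      show ?thesis
      proof (cases "\<exists>q. valid (\<lambda>k j. \<epsilon> k j \<omega>) t q")
        case True
        then obtain q where q: "valid (\<lambda>k j. \<epsilon> k j \<omega>) t q" by blast
        then have "sample t \<omega> = q" unfolding sample_def by (rule partition_at_valid)
        moreover have "\<omega> \<notin> bad" using inv q by blast
        moreover have "p \<in> partitions \<Longrightarrow> \<omega> \<in> level t p \<longleftrightarrow> q = p"
          using level_iff_valid[OF w, of p t] by (simp only: valid_iff[OF q])
        moreover have "q \<in> partitions" using q by (simp add: valid_def)
        ultimately show ?thesis using w by auto
      next
        case False
        then have "sample t \<omega> = {#}" unfolding sample_def by (intro partition_at_invalid) blast
        moreover have "\<omega> \<in> bad" using inv w False by blast
        moreover have "p \<in> partitions \<Longrightarrow> \<omega> \<notin> level t p" using level_iff_valid[OF w, of p t] False by blast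
        ultimately show ?thesis using w by auto
      qed
    qed (auto simp: level_def bad_def)
  qed
  then show ?thesis by (simp only:) (intro sets.Un, use bad in \<open>simp_all add: sets_level\<close>)
  qed
  show ?thesis
  proof (rule measurableI)
    fix A :: "nat multiset set"
    have "sample t -` A \<inter> space M = (\<Union>p\<in>A. sample t -` {p} \<inter> space M)" by auto
    also have "\<dots> \<in> sets M"
      using pre by (intro sets.countable_UN' countable_subset[OF subset_UNIV countable_multisets]) auto
    finally show "sample t -` A \<inter> space M \<in> sets M" .
  qed simp
qed

lemma prob_sample:
  assumes t: "t > 0" and p: "p \<in> partitions"
  shows "prob (sample t -` {p} \<inter> space M) = exp (- t * real (sum_mset p) - F t)"
proof -
  have "prob (sample t -` {p} \<inter> space M) = prob (level t p)"
  proof (rule finite_measure_eq_AE)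
    show "AE \<omega> in M. \<omega> \<in> sample t -` {p} \<inter> space M \<longleftrightarrow> \<omega> \<in> level t p"
      using AE_valid[OF t] AE_space
    proof eventually_elim
      case (elim \<omega>)
      then obtain q where q: "valid (\<lambda>k j. \<epsilon> k j \<omega>) t q" by blast
      then have "sample t \<omega> = q" unfolding sample_def by (rule partition_at_valid)
      then show ?case using level_iff_valid[OF elim(2) p, of t] elim(2) by (simp add: valid_iff[OF q])
    qed
    show "sample t -` {p} \<inter> space M \<in> sets M" by (rule measurable_sets[OF measurable_sample]) simp
  qed (rule sets_level)
  then show ?thesis using prob_level[OF t p] by simp
qed

lemma AE_sample_mono:
  assumes t: "0 < t" "t \<le> t'"
  shows "AE \<omega> in M. sample t' \<omega> \<subseteq># sample t \<omega>"
proof -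
  have "AE \<omega> in M. \<exists>p. valid (\<lambda>k j. \<epsilon> k j \<omega>) t' p" using t by (intro AE_valid) simp
  with AE_valid[OF t(1)] show ?thesis
  proof eventually_elim
    case (elim \<omega>)
    then obtain p q where pq: "valid (\<lambda>k j. \<epsilon> k j \<omega>) t p" "valid (\<lambda>k j. \<epsilon> k j \<omega>) t' q" by blast
    show ?case unfolding sample_def partition_at_valid[OF pq(1)] partition_at_valid[OF pq(2)]
      by (rule valid_mono[OF t(2) pq])
  qed
qed

text \<open>The probability of a partition depends only on its size, so \<open>g m\<close>, the
  restriction of \<open>f\<close> to samples of size \<open>m\<close>, integrates to a multiple of
  the uniform mean. As \<open>f\<close> is bounded, dominated convergence sums over
  \<open>m\<close>.\<close>

lemma sample_level_sums:
  assumes t: "t > 0" and f: "\<And>p. \<bar>f p\<bar> \<le> C"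
  shows "(\<lambda>m. real (card (partitions_of m)) * exp (- t * real m - F t) * partition_mean m f)
    sums (\<integral>\<omega>. f (sample t \<omega>) \<partial>M)"
proof -
  have mf: "(\<lambda>\<omega>. h (sample t \<omega>)) \<in> borel_measurable M" for h :: "nat multiset \<Rightarrow> real"
    by (rule measurable_compose[OF measurable_sample]) simp
  define g where "g m \<omega> = (if sum_mset (sample t \<omega>) = m then f (sample t \<omega>) else 0)" for m \<omega>
  have int: "integrable M (g m)" for m
    unfolding g_def
    by (intro integrable_const_bound[where B = C] mf[of "\<lambda>p. if sum_mset p = m then f p else 0"])
      (use f order_trans[OF abs_ge_zero f] in auto)
  have gm: "(\<integral>\<omega>. g m \<omega> \<partial>M) = real (card (partitions_of m)) * exp (- t * real m - F t) * partition_mean m f" for m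
  proof -
    have "g m \<omega> = (\<Sum>p\<in>partitions_of m. f p * indicator (sample t -` {p} \<inter> space M) \<omega>)" if "\<omega> \<in> space M" for \<omega>
    proof (cases "sum_mset (sample t \<omega>) = m")
      case True
      then have "sample t \<omega> \<in> partitions_of m" using sample_partition by (simp add: partitions_of_def)
      moreover have "(\<Sum>p\<in>partitions_of m. f p * indicator (sample t -` {p} \<inter> space M) \<omega>)
        = (\<Sum>p\<in>partitions_of m. if p = sample t \<omega> then f p else 0)"
        using that by (intro sum.cong) (auto simp: indicator_def)
      ultimately show ?thesis using True by (simp add: g_def finite_partitions_of)
    next
      case False
      then have "sample t \<omega> \<noteq> p" if "p \<in> partitions_of m" for p using that by (auto simp: partitions_of_def)
      then show ?thesis using False unfolding g_def
        by (subst sum.neutral) (auto simp: indicator_def)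
    qed
    then have "(\<integral>\<omega>. g m \<omega> \<partial>M) = (\<integral>\<omega>. (\<Sum>p\<in>partitions_of m. f p * indicator (sample t -` {p} \<inter> space M) \<omega>) \<partial>M)"
      by (intro Bochner_Integration.integral_cong) auto
    also have "\<dots> = (\<Sum>p\<in>partitions_of m. f p * prob (sample t -` {p} \<inter> space M))"
      by (subst Bochner_Integration.integral_sum)
        (auto intro!: integrable_mult_right integrable_real_indicator measurable_sets[OF measurable_sample] simp: emeasure_eq_measure)
    also have "\<dots> = (\<Sum>p\<in>partitions_of m. f p * exp (- t * real m - F t))"
      using t by (intro sum.cong refl) (auto simp: partitions_of_def prob_sample)
    also have "\<dots> = real (card (partitions_of m)) * exp (- t * real m - F t) * partition_mean m f"
      using card_partitions_of_pos[of m] by (simp add: partition_mean_def sum_distrib_right[symmetric])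
    finally show ?thesis .
  qed
  have s: "(\<Sum>m<K. g m \<omega>) = (if sum_mset (sample t \<omega>) < K then f (sample t \<omega>) else 0)" for K \<omega>
    by (simp add: g_def)
  have lim: "AE \<omega> in M. (\<lambda>K. \<Sum>m<K. g m \<omega>) \<longlonglongrightarrow> f (sample t \<omega>)"
  proof (intro AE_I2 tendsto_eventually)
    fix \<omega>
    show "\<forall>\<^sub>F K in sequentially. (\<Sum>m<K. g m \<omega>) = f (sample t \<omega>)"
      unfolding s eventually_sequentially by (intro exI[of _ "Suc (sum_mset (sample t \<omega>))"]) auto
  qed
  have C: "C \<ge> 0" using order_trans[OF abs_ge_zero f[of "{#}"]] .
  have bd: "AE \<omega> in M. norm (\<Sum>m<K. g m \<omega>) \<le> C" for K
    unfolding s using f C by (intro AE_I2) simp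
  have ms: "(\<lambda>\<omega>. \<Sum>m<K. g m \<omega>) \<in> borel_measurable M" for K
    by (intro borel_measurable_sum borel_measurable_integrable int)
  have iC: "integrable M (\<lambda>_. C)" by simp
  have conv: "(\<lambda>K. \<integral>\<omega>. (\<Sum>m<K. g m \<omega>) \<partial>M) \<longlonglongrightarrow> (\<integral>\<omega>. f (sample t \<omega>) \<partial>M)"
    by (rule integral_dominated_convergence[OF mf ms iC lim bd])
  have e: "(\<integral>\<omega>. (\<Sum>m<K. g m \<omega>) \<partial>M) = (\<Sum>m<K. \<integral>\<omega>. g m \<omega> \<partial>M)" for K
    by (rule Bochner_Integration.integral_sum) (rule int)
  have "(\<lambda>m. \<integral>\<omega>. g m \<omega> \<partial>M) sums (\<integral>\<omega>. f (sample t \<omega>) \<partial>M)"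
    unfolding sums_def using conv by (simp only: e)
  then show ?thesis by (simp only: gm)
qed

text \<open>Euler's product formula, read off from the total mass one of the law of the
  sample.\<close>

lemma partition_generating_function:
  assumes t: "t > 0"
  shows "(\<lambda>m. real (card (partitions_of m)) * exp (- t * real m)) sums exp (F t)"
proof -
  have "(\<lambda>m. real (card (partitions_of m)) * exp (- t * real m - F t)) sums 1"
    using sample_level_sums[OF t, of "\<lambda>_. 1" 1] by (simp add: partition_mean_const prob_space)
  from sums_mult[OF this, of "exp (F t)"] show ?thesis
    by (simp add: exp_diff)
qed

end

section \<open>The local limit theorem for the size\<close>

lemma exp_neg_mult_nat: "exp (- t * real m) = exp (- t :: real) ^ m"
  by (rule exp_of_nat2_mult)

lemma norm_of_real_mult_le:
  fixes B :: complex
  shows "a \<ge> 0 \<Longrightarrow> norm B \<le> c \<Longrightarrow> norm (complex_of_real a * B) \<le> a * c"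
  by (simp add: norm_mult mult_left_mono)

lemma summable_complex_powser:
  fixes a :: "nat \<Rightarrow> real" and z :: complex
  assumes a: "\<And>m. a m \<ge> 0" and s: "\<And>t. t > 0 \<Longrightarrow> summable (\<lambda>m. a m * exp (- t * real m))"
    and z: "norm z < 1"
  shows "summable (\<lambda>m. complex_of_real (a m) * z ^ m)"
proof -
  define r where "r = (1 + norm z) / 2"
  have r: "0 < r" "r < 1" "norm z \<le> r" using z norm_ge_zero[of z] by (auto simp: r_def field_simps add_pos_nonneg)
  define t where "t = - ln r"
  have t: "t > 0" "exp (- t) = r" using r by (simp_all add: t_def)
  show ?thesis
  proof (rule summable_comparison_test'[OF s[OF t(1)]])
    fix m :: nat
    have "norm z ^ m \<le> r ^ m" using r by (intro power_mono) auto
    then show "norm (complex_of_real (a m) * z ^ m) \<le> a m * exp (- t * real m)"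
      unfolding exp_neg_mult_nat t(2) using a[of m] by (simp add: norm_mult norm_power mult_left_mono)
  qed
qed

lemma holomorphic_powser:
  fixes a :: "nat \<Rightarrow> complex"
  assumes "\<And>z. norm z < r \<Longrightarrow> summable (\<lambda>m. a m * z ^ m)"
  shows "(\<lambda>z. \<Sum>m. a m * z ^ m) holomorphic_on ball 0 r"
  by (rule power_series_holomorphic[where a = a]) (use assms in \<open>auto intro: summable_sums\<close>)

section \<open>The characteristic function of the size\<close>

context exponential_array
begin

abbreviation pcount :: "nat \<Rightarrow> real" where
  "pcount m \<equiv> real (card (partitions_of m))"

definition level_prob :: "real \<Rightarrow> nat \<Rightarrow> real" where
  "level_prob t m = pcount m * exp (- t * real m - F t)"

lemma level_prob_nonneg: "level_prob t m \<ge> 0"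
  by (simp add: level_prob_def)

lemma level_prob_sums: "t > 0 \<Longrightarrow> level_prob t sums 1"
  unfolding level_prob_def[abs_def]
  using sample_level_sums[of t "\<lambda>_. 1" 1] by (simp add: partition_mean_const prob_space)

text \<open>Both sides are holomorphic in the unit disc and agree on the interval from 0 to 1, which
  accumulates at the interior point 0.\<close>

lemma complex_generating_function:
  fixes z :: complex
  assumes z: "norm z < 1"
  shows "(\<Sum>m. complex_of_real (pcount m) * z ^ m) = exp (\<Sum>m. complex_of_real (divisor_weight m) * z ^ m)"
proof -
  let ?G = "\<lambda>z. \<Sum>m. complex_of_real (pcount m) * z ^ m"
  let ?L = "\<lambda>z. \<Sum>m. complex_of_real (divisor_weight m) * z ^ m"
  have sN: "summable (\<lambda>m. complex_of_real (pcount m) * z ^ m)" if "norm z < 1" for z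
    by (rule summable_complex_powser[OF _ _ that]) (simp_all only: of_nat_0_le_iff sums_summable[OF partition_generating_function])
  have sL: "summable (\<lambda>m. complex_of_real (divisor_weight m) * z ^ m)" if "norm z < 1" for z
    by (rule summable_complex_powser[OF divisor_weight_nonneg _ that]) (rule sums_summable[OF F_sums])
  have holG: "?G holomorphic_on ball 0 1" by (rule holomorphic_powser[OF sN])
  have holL: "?L holomorphic_on ball 0 1" by (rule holomorphic_powser[OF sL])
  have "?G z - exp (?L z) = 0"
  proof (rule analytic_continuation[where f = "\<lambda>z. ?G z - exp (?L z)" and S = "ball 0 1" and U = "complex_of_real ` {0<..<1}" and \<xi> = 0])
    show "(\<lambda>z. ?G z - exp (?L z)) holomorphic_on ball 0 1"
      by (intro holomorphic_on_diff holG holomorphic_on_exp'[OF holL])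
    show "complex_of_real ` {0<..<1} \<subseteq> ball 0 1" by auto
    show "0 islimpt complex_of_real ` {0<..<1}"
      unfolding islimpt_approachable
    proof (intro allI impI)
      fix e :: real assume e: "e > 0"
      define x where "x = min (e / 2) (1 / 2)"
      have "0 < x" "x < 1" "x < e" using e by (auto simp: x_def)
      then show "\<exists>x'\<in>complex_of_real ` {0<..<1}. x' \<noteq> 0 \<and> dist x' 0 < e"
        by (intro bexI[of _ "complex_of_real x"]) auto
    qed
    fix w assume "w \<in> complex_of_real ` {0<..<1}"
    then obtain x where x: "w = complex_of_real x" "0 < x" "x < 1" by auto
    define t where "t = - ln x"
    have t: "t > 0" "exp (- t) = x" using x by (simp_all add: t_def)
    have "(\<lambda>m. pcount m * x ^ m) sums exp (F t)"
      using partition_generating_function[OF t(1)] unfolding exp_neg_mult_nat t(2) .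
    from sums_unique[OF sums_of_real[OF this, where ?'a = complex]]
    have "?G w = complex_of_real (exp (F t))" by (simp add: x)
    moreover have "(\<lambda>m. divisor_weight m * x ^ m) sums F t"
      using F_sums[OF t(1)] unfolding exp_neg_mult_nat t(2) .
    from sums_unique[OF sums_of_real[OF this, where ?'a = complex]]
    have "?L w = complex_of_real (F t)" by (simp add: x)
    ultimately show "?G w - exp (?L w) = 0" by (simp only: exp_of_real diff_self)
  qed (use z in auto)
  then show ?thesis by simp
qed

text \<open>The characteristic function of the size at time \<open>t\<close>.\<close>

definition level_char :: "real \<Rightarrow> real \<Rightarrow> complex" where
  "level_char t \<theta> = (\<Sum>m. complex_of_real (level_prob t m) * iexp (\<theta> * real m))"

lemma iexp_mult_nat: "iexp (\<theta> * real m) = iexp \<theta> ^ m"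
  by (simp add: exp_of_nat_mult[symmetric] mult_ac)

lemma weight_iexp_summable:
  "t > 0 \<Longrightarrow> summable (\<lambda>m. complex_of_real (divisor_weight m * exp (- t * real m)) * iexp (\<theta> * real m))"
  by (rule summable_norm_cancel)
    (simp add: norm_mult divisor_weight_nonneg sums_summable[OF F_sums, simplified])

text \<open>The generating function is evaluated at the point of modulus \<open>exp (- t)\<close>
  and argument \<theta>, inside the unit disc.\<close>

lemma level_char_eq:
  assumes t: "t > 0"
  shows "level_char t \<theta> = exp ((\<Sum>m. complex_of_real (divisor_weight m * exp (- t * real m)) * iexp (\<theta> * real m)) - complex_of_real (F t))"
proof -
  define z where "z = complex_of_real (exp (- t)) * iexp \<theta>"
  have z: "norm z < 1" using t by (simp add: z_def norm_mult)
  have zm: "z ^ m = complex_of_real (exp (- t * real m)) * iexp (\<theta> * real m)" for m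
    unfolding z_def power_mult_distrib exp_neg_mult_nat iexp_mult_nat of_real_power ..
  have sN: "summable (\<lambda>m. complex_of_real (pcount m) * z ^ m)"
    by (rule summable_complex_powser[OF _ _ z]) (simp_all only: of_nat_0_le_iff sums_summable[OF partition_generating_function])
  have "level_char t \<theta> = (\<Sum>m. complex_of_real (pcount m) * z ^ m * exp (- complex_of_real (F t)))"
    unfolding level_char_def zm level_prob_def
    by (rule suminf_cong) (simp add: exp_diff exp_minus exp_of_real[symmetric] field_simps)
  also have "\<dots> = (\<Sum>m. complex_of_real (pcount m) * z ^ m) * exp (- complex_of_real (F t))"
    by (rule suminf_mult2[OF sN, symmetric])
  also have "\<dots> = exp ((\<Sum>m. complex_of_real (divisor_weight m) * z ^ m) - complex_of_real (F t))"
    unfolding complex_generating_function[OF z] exp_diff exp_minus by (simp add: field_simps)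
  also have "(\<Sum>m. complex_of_real (divisor_weight m) * z ^ m)
      = (\<Sum>m. complex_of_real (divisor_weight m * exp (- t * real m)) * iexp (\<theta> * real m))"
    unfolding zm by (simp only: of_real_mult mult.assoc)
  finally show ?thesis .
qed

text \<open>Each \<open>iexp\<close> in the exponent is expanded to second order. The constant terms
  cancel \<open>F t\<close>, the linear term is the mean minus \<open>y\<close>, the quadratic one
  is Gaussian, and \<open>moment 3\<close> bounds the rest. The centre \<open>y\<close> is left free
  because the mean is only approximately \<open>n\<close>.\<close>

lemma level_char_expansion:
  assumes t: "t > 0"
  shows "\<exists>R. level_char t \<theta> * iexp (- \<theta> * y) =
      exp (complex_of_real (- (\<theta>\<^sup>2 / 2 * moment 2 t)) + R) \<and>
    norm R \<le> \<bar>\<theta>\<bar> * \<bar>moment 1 t - y\<bar> + \<bar>\<theta>\<bar> ^ 3 / 6 * moment 3 t"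
proof -
  let ?w = "\<lambda>m. divisor_weight m * exp (- t * real m)"
  let ?r = "\<lambda>m. complex_of_real (?w m) * (iexp (\<theta> * real m) - 1 - \<i> * of_real (\<theta> * real m) + of_real ((\<theta> * real m)\<^sup>2 / 2))"
  have s: "(\<lambda>m. complex_of_real (?w m) * iexp (\<theta> * real m)) sums
    (\<Sum>m. complex_of_real (?w m) * iexp (\<theta> * real m))"
    by (intro summable_sums weight_iexp_summable t)
  have s0: "(\<lambda>m. complex_of_real (?w m)) sums complex_of_real (F t)"
    by (intro sums_of_real F_sums t)
  have s1: "(\<lambda>m. \<i> * of_real \<theta> * complex_of_real (real m ^ 1 * divisor_weight m * exp (- t * real m))) sums (\<i> * of_real \<theta> * complex_of_real (moment 1 t))"
    by (intro sums_mult sums_of_real moment_sums t)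
  have s2: "(\<lambda>m. of_real (\<theta>\<^sup>2 / 2) * complex_of_real (real m ^ 2 * divisor_weight m * exp (- t * real m))) sums (of_real (\<theta>\<^sup>2 / 2) * complex_of_real (moment 2 t))"
    by (intro sums_mult sums_of_real moment_sums t)
  let ?S = "\<Sum>m. complex_of_real (?w m) * iexp (\<theta> * real m)"
  have sr: "?r sums (?S - complex_of_real (F t) - \<i> * of_real \<theta> * complex_of_real (moment 1 t) + of_real (\<theta>\<^sup>2 / 2) * complex_of_real (moment 2 t))"
  proof -
    have "?r m = complex_of_real (?w m) * iexp (\<theta> * real m) - complex_of_real (?w m)
        - \<i> * of_real \<theta> * complex_of_real (real m ^ 1 * divisor_weight m * exp (- t * real m))
        + of_real (\<theta>\<^sup>2 / 2) * complex_of_real (real m ^ 2 * divisor_weight m * exp (- t * real m))" for m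
      by (simp add: algebra_simps power2_eq_square)
    then show ?thesis using sums_add[OF sums_diff[OF sums_diff[OF s s0] s1] s2] by (simp only:)
  qed
  have b: "norm (?r m) \<le> \<bar>\<theta>\<bar> ^ 3 / 6 * (real m ^ 3 * divisor_weight m * exp (- t * real m))" for m
  proof -
    have "norm (iexp (\<theta> * real m) - 1 - \<i> * of_real (\<theta> * real m) + of_real ((\<theta> * real m)\<^sup>2 / 2)) \<le> \<bar>\<theta> * real m\<bar> ^ 3 / 6"
      using iexp_approx1[of "\<theta> * real m" 2]
      by (simp add: eval_nat_numeral algebra_simps)
    then have "norm (?r m) \<le> ?w m * (\<bar>\<theta> * real m\<bar> ^ 3 / 6)"
      by (intro norm_of_real_mult_le) (simp_all only: divisor_weight_nonneg mult_nonneg_nonneg exp_ge_zero)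
    then show ?thesis by (simp add: abs_mult power_mult_distrib mult_ac)
  qed
  have bs: "(\<lambda>m. \<bar>\<theta>\<bar> ^ 3 / 6 * (real m ^ 3 * divisor_weight m * exp (- t * real m))) sums (\<bar>\<theta>\<bar> ^ 3 / 6 * moment 3 t)"
    by (intro sums_mult moment_sums t)
  define R0 where "R0 = ?S - complex_of_real (F t) - \<i> * of_real \<theta> * complex_of_real (moment 1 t) + of_real (\<theta>\<^sup>2 / 2) * complex_of_real (moment 2 t)"
  have R0: "norm R0 \<le> \<bar>\<theta>\<bar> ^ 3 / 6 * moment 3 t"
  proof -
    have sn: "summable (\<lambda>m. norm (?r m))"
      by (rule summable_comparison_test'[OF sums_summable[OF bs], of 0]) (use b in simp)
    have "norm R0 = norm (\<Sum>m. ?r m)" using sums_unique[OF sr] by (simp add: R0_def)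
    also have "\<dots> \<le> (\<Sum>m. norm (?r m))" by (rule summable_norm[OF sn])
    also have "\<dots> \<le> \<bar>\<theta>\<bar> ^ 3 / 6 * moment 3 t"
      using suminf_le[OF b sn sums_summable[OF bs]] sums_unique[OF bs] by simp
    finally show ?thesis .
  qed
  define R where "R = \<i> * of_real (\<theta> * (moment 1 t - y)) + R0"
  have "level_char t \<theta> * iexp (- \<theta> * y) = exp (?S - complex_of_real (F t) + \<i> * of_real (- \<theta> * y))"
    unfolding level_char_eq[OF t] by (simp only: exp_add)
  also have "?S - complex_of_real (F t) + \<i> * of_real (- \<theta> * y) = complex_of_real (- (\<theta>\<^sup>2 / 2 * moment 2 t)) + R"
    unfolding R_def R0_def by (simp add: algebra_simps)
  finally have "level_char t \<theta> * iexp (- \<theta> * y) = exp (complex_of_real (- (\<theta>\<^sup>2 / 2 * moment 2 t)) + R)" .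
  moreover have "norm R \<le> norm (\<i> * of_real (\<theta> * (moment 1 t - y)) :: complex) + norm R0"
    unfolding R_def by (rule norm_triangle_ineq)
  then have "norm R \<le> \<bar>\<theta>\<bar> * \<bar>moment 1 t - y\<bar> + \<bar>\<theta>\<bar> ^ 3 / 6 * moment 3 t"
    using R0 by (simp only: norm_mult norm_ii norm_of_real abs_mult mult_1_left)
  ultimately show ?thesis by blast
qed

text \<open>The Taylor bound loses x^4 / 24, at most 10 x^2 / 24 because pi^2 <= 10, and 1/2 - 10/24
  = 1/12.\<close>

lemma one_minus_cos_ge:
  fixes x :: real assumes "\<bar>x\<bar> \<le> pi" shows "x\<^sup>2 / 12 \<le> 1 - cos x"
proof -
  obtain y where "cos x = (\<Sum>m<4. cos_coeff m * x ^ m) + (cos (y + 1/2 * real 4 * pi) / fact 4) * x ^ 4"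
    using Maclaurin_cos_expansion[of x 4] by auto
  moreover have "(\<Sum>m<4. cos_coeff m * x ^ m) = 1 - x\<^sup>2 / 2"
  proof -
    have "{..<4} = {0, 1, 2, 3 :: nat}" by auto
    then show ?thesis by (simp add: cos_coeff_def)
  qed
  moreover have "(cos (y + 1/2 * real 4 * pi) / fact 4) * x ^ 4 \<le> 1 / fact 4 * x ^ 4"
    by (intro mult_right_mono divide_right_mono) auto
  ultimately have c: "cos x \<le> 1 - x\<^sup>2 / 2 + x ^ 4 / 24" by (simp add: eval_nat_numeral)
  have "\<bar>x\<bar>\<^sup>2 \<le> pi\<^sup>2" using assms by (intro power_mono) auto
  also have "pi\<^sup>2 \<le> (3.15)\<^sup>2" using pi_approx by (intro power_mono) auto
  finally have "x\<^sup>2 \<le> 10" by (simp add: power2_eq_square)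
  then have "x\<^sup>2 * x\<^sup>2 \<le> 10 * x\<^sup>2" by (intro mult_right_mono) auto
  then have "x ^ 4 \<le> 10 * x\<^sup>2" by (simp add: eval_nat_numeral)
  with c show ?thesis by simp
qed

text \<open>Minus the logarithm of the modulus is a sum of nonnegative terms, weight times
  \<open>1 - cos (\<theta> * m)\<close>. Replacing divisor weights by one leaves an explicit
  function of \<open>w\<close>, and \<open>norm (1 - w)\<close> exceeds \<open>1 - q\<close> by a
  definite factor as soon as \<theta> is comparable with \<open>t\<close>.\<close>

lemma level_char_bound:
  assumes t: "0 < t" "t \<le> 1" and \<theta>: "\<bar>\<theta>\<bar> \<le> pi"
  shows "norm (level_char t \<theta>) \<le> exp (- (min (\<theta>\<^sup>2 / (18 * t\<^sup>2)) 1 / (12 * t)))"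
proof -
  let ?w = "\<lambda>m. divisor_weight m * exp (- t * real m)"
  define q where "q = exp (- t)"
  have q: "0 < q" "q < 1" "1 - q \<le> t" "1 / 3 \<le> q"
  proof -
    show "0 < q" "q < 1" using t by (simp_all add: q_def)
    show "1 - q \<le> t" using exp_ge_add_one_self[of "- t"] by (simp add: q_def)
    have "exp (- 1) \<le> q" using t by (simp add: q_def)
    moreover have "1 / 3 \<le> exp (- 1 :: real)" using exp_le by (simp add: exp_minus field_simps)
    ultimately show "1 / 3 \<le> q" by linarith
  qed
  define w where "w = complex_of_real q * iexp \<theta>"
  have nw: "norm w = q" using q by (simp add: w_def norm_mult)
  then have nw1: "norm w < 1" using q by simp
  have w1: "w \<noteq> 1" using nw1 by auto
  text \<open>Only the parts of multiplicity one are kept: their weights sum to geometric series.\<close>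
  have "(\<lambda>m. q ^ Suc m - Re (w ^ Suc m)) sums (q / (1 - q) - Re (w / (1 - w)))"
  proof (intro sums_diff sums_Re)
    show "(\<lambda>m. q ^ Suc m) sums (q / (1 - q))"
      using sums_mult[OF geometric_sums[of q], of q] q by simp
    show "(\<lambda>m. w ^ Suc m) sums (w / (1 - w))"
      using sums_mult[OF geometric_sums[of w], of w] nw1 by simp
  qed
  have Suc_term: "q ^ Suc m - Re (w ^ Suc m) = (if Suc m = 0 then 0 else exp (- t * real (Suc m)) * (1 - cos (\<theta> * real (Suc m))))" for m
    unfolding w_def power_mult_distrib iexp_mult_nat[symmetric] exp_neg_mult_nat q_def[symmetric] of_real_power[symmetric] Re_complex_of_real
    by (simp add: right_diff_distrib del: power_Suc of_nat_Suc) (simp add: Euler exp_Euler)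
  have geo: "(\<lambda>m. if m = 0 then 0 else exp (- t * real m) * (1 - cos (\<theta> * real m))) sums (q / (1 - q) - Re (w / (1 - w)))"
  proof -
    let ?f = "\<lambda>m. if m = 0 then 0 else exp (- t * real m) * (1 - cos (\<theta> * real m))"
    have "(\<lambda>m. ?f (Suc m)) sums (q / (1 - q) - Re (w / (1 - w)))"
      using \<open>(\<lambda>m. q ^ Suc m - Re (w ^ Suc m)) sums (q / (1 - q) - Re (w / (1 - w)))\<close> by (simp only: Suc_term)
    from sums_Suc[of ?f, OF this] show ?thesis by simp
  qed
  have re: "(\<lambda>m. ?w m - ?w m * cos (\<theta> * real m)) sums (F t - Re (\<Sum>m. complex_of_real (?w m) * iexp (\<theta> * real m)))"
  proof (intro sums_diff F_sums t)
    have "(\<lambda>m. Re (complex_of_real (?w m) * iexp (\<theta> * real m))) sums Re (\<Sum>m. complex_of_real (?w m) * iexp (\<theta> * real m))"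
      by (intro sums_Re summable_sums weight_iexp_summable t)
    then show "(\<lambda>m. ?w m * cos (\<theta> * real m)) sums Re (\<Sum>m. complex_of_real (?w m) * iexp (\<theta> * real m))"
      by (simp add: exp_Euler Euler)
  qed
  have le: "(if m = 0 then 0 else exp (- t * real m) * (1 - cos (\<theta> * real m))) \<le> ?w m - ?w m * cos (\<theta> * real m)" for m
  proof (cases "m = 0")
    case False
    then have "1 * (exp (- t * real m) * (1 - cos (\<theta> * real m))) \<le> divisor_weight m * (exp (- t * real m) * (1 - cos (\<theta> * real m)))"
      by (intro mult_right_mono divisor_weight_ge_1) auto
    then show ?thesis using False by (simp add: algebra_simps)
  qed simp
  have A: "q / (1 - q) - Re (w / (1 - w)) \<le> F t - Re (\<Sum>m. complex_of_real (?w m) * iexp (\<theta> * real m))"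
    by (rule sums_le[OF le geo re])
  define v where "v = \<theta>\<^sup>2 / (18 * t\<^sup>2)"
  have v: "v \<ge> 0" by (simp add: v_def)
  \<comment> \<open>The distance from \<open>w\<close> to the pole 1 splits into a radial and an
    angular contribution. The constant 18 comes from \<open>2 * q \<ge> 2 / 3\<close> and the 12 of
    \<open>one_minus_cos_ge\<close>.\<close>
  have "(norm (1 - w))\<^sup>2 = (1 - q * cos \<theta>)\<^sup>2 + (q * sin \<theta>)\<^sup>2"
    by (simp add: cmod_power2 w_def exp_Euler Euler)
  also have "\<dots> = (1 - q)\<^sup>2 + 2 * q * (1 - cos \<theta>)"
  proof -
    have "(q * sin \<theta>)\<^sup>2 = q\<^sup>2 * (1 - (cos \<theta>)\<^sup>2)" by (simp add: power_mult_distrib sin_squared_eq)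
    then show ?thesis by (simp add: power2_eq_square algebra_simps)
  qed
  also have "\<dots> \<ge> (1 - q)\<^sup>2 + 2 * (1 / 3) * (\<theta>\<^sup>2 / 12)"
    using q one_minus_cos_ge[OF \<theta>] by (intro add_left_mono mult_mono) auto
  finally have nw2: "(1 - q)\<^sup>2 + \<theta>\<^sup>2 / 18 \<le> (norm (1 - w))\<^sup>2" by simp
  have "(1 - q)\<^sup>2 * v \<le> t\<^sup>2 * v" using q v by (intro mult_right_mono power_mono) auto
  also have "\<dots> = \<theta>\<^sup>2 / 18" using t by (simp add: v_def)
  finally have nw3: "(1 - q)\<^sup>2 * (1 + v) \<le> (norm (1 - w))\<^sup>2" using nw2 by (simp add: distrib_left)
  \<comment> \<open>An upper bound for \<open>1 / sqrt (1 + v)\<close> that is linear in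
    \<open>min v 1\<close>, so that no root has to be handled.\<close>
  define k where "k = 1 - min v 1 / 4"
  have k: "k > 0" by (simp add: k_def)
  have kv: "1 \<le> k\<^sup>2 * (1 + v)"
  proof -
    define u where "u = min v 1"
    have u: "0 \<le> u" "u \<le> 1" "u \<le> v" using v by (auto simp: u_def)
    have "0 \<le> u * (8 - 7 * u + u\<^sup>2)" using u by (intro mult_nonneg_nonneg add_nonneg_nonneg) auto
    moreover have "(1 - u / 4)\<^sup>2 * (1 + u) = 1 + u * (8 - 7 * u + u\<^sup>2) / 16"
      by (simp add: power2_eq_square field_simps)
    ultimately have "1 \<le> (1 - u / 4)\<^sup>2 * (1 + u)" by simp
    also have "\<dots> \<le> (1 - u / 4)\<^sup>2 * (1 + v)" using u by (intro mult_left_mono) auto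
    finally show ?thesis by (simp add: k_def u_def)
  qed
  have "(1 - q)\<^sup>2 * 1 \<le> (1 - q)\<^sup>2 * (k\<^sup>2 * (1 + v))" by (intro mult_left_mono kv) auto
  also have "\<dots> = k\<^sup>2 * ((1 - q)\<^sup>2 * (1 + v))" by (simp only: ac_simps)
  also have "\<dots> \<le> k\<^sup>2 * (norm (1 - w))\<^sup>2" using nw3 by (intro mult_left_mono) auto
  finally have "(1 - q)\<^sup>2 \<le> (k * norm (1 - w))\<^sup>2" by (simp add: power_mult_distrib)
  then have kn: "1 - q \<le> k * norm (1 - w)" by (rule power2_le_imp_le) (use k in simp)
  have n0: "norm (1 - w) > 0" using w1 by simp
  have "Re (w / (1 - w)) \<le> norm (w / (1 - w))" by (rule complex_Re_le_cmod)
  also have "\<dots> = q / norm (1 - w)" by (simp add: norm_divide nw)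
  also have "\<dots> \<le> q / (1 - q) * k"
  proof -
    have "1 / norm (1 - w) \<le> k / (1 - q)" using kn n0 q by (simp add: field_simps)
    from mult_left_mono[OF this, of q] q show ?thesis by simp
  qed
  finally have "q / (1 - q) * (min v 1 / 4) \<le> q / (1 - q) - Re (w / (1 - w))"
    by (simp add: k_def algebra_simps)
  moreover have "min v 1 / (12 * t) \<le> q / (1 - q) * (min v 1 / 4)"
  proof -
    have "(1 / 3) / t \<le> q / (1 - q)" using q t by (intro frac_le) auto
    from mult_right_mono[OF this, of "min v 1 / 4"] v show ?thesis by simp
  qed
  ultimately have B: "min v 1 / (12 * t) \<le> F t - Re (\<Sum>m. complex_of_real (?w m) * iexp (\<theta> * real m))"
    using A by linarith
  have "norm (level_char t \<theta>) = exp (Re (\<Sum>m. complex_of_real (?w m) * iexp (\<theta> * real m)) - F t)"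
    unfolding level_char_eq[OF t(1)] by (simp only: norm_exp_eq_Re minus_complex.sel Re_complex_of_real)
  also have "\<dots> \<le> exp (- (min v 1 / (12 * t)))" using B by simp
  finally show ?thesis by (simp add: v_def)
qed

end

text \<open>The cube is the power needed against v^2 = O(t^(-3)) at large frequencies. The constant
  is 12^3 * 3! * 2^3.\<close>

lemma exp_neg_le_inverse_cube:
  fixes t :: real assumes t: "t > 0"
  shows "exp (- (1 / (12 * t))) \<le> 82944 * t ^ 3"
proof -
  define y where "y = 1 / (12 * t)"
  have y: "y > 0" using t by (simp add: y_def)
  have "y ^ 3 * exp (- y) \<le> fact 3 * 2 ^ 3 * exp (- (y / 2))" using y by (intro power_exp_bound) simp
  also have "\<dots> \<le> fact 3 * 2 ^ 3 * 1" using y by (intro mult_left_mono) auto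
  finally have "y ^ 3 * exp (- y) \<le> 48" by (simp add: fact_numeral)
  then have "(12 * t) ^ 3 * (y ^ 3 * exp (- y)) \<le> (12 * t) ^ 3 * 48" using t by (intro mult_left_mono) auto
  moreover have "(12 * t) ^ 3 * (y ^ 3 * exp (- y)) = exp (- y)"
    using t by (simp add: y_def power_divide power_mult_distrib)
  ultimately have "exp (- y) \<le> (12 * t) ^ 3 * 48" by linarith
  then show ?thesis by (simp add: y_def power_mult_distrib)
qed

context exponential_array
begin

definition sdev :: "real \<Rightarrow> real" where
  "sdev t = sqrt (moment 2 t)"

lemma sdev_bounds:
  assumes t: "0 < t" "t \<le> 1"
  shows "exp (- 4) / t ^ 3 \<le> (sdev t)\<^sup>2" "(sdev t)\<^sup>2 \<le> 32 / t ^ 3" "sdev t > 0"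
proof -
  have *: "(sdev t)\<^sup>2 = moment 2 t" by (simp add: sdev_def moment_nonneg[OF t(1)])
  show 1: "exp (- 4) / t ^ 3 \<le> (sdev t)\<^sup>2"
    unfolding * using moment_lower[OF t, of 2] by (simp add: eval_nat_numeral)
  show "(sdev t)\<^sup>2 \<le> 32 / t ^ 3"
    unfolding * using moment_upper[OF t(1), of 2] by (simp add: eval_nat_numeral)
  have "0 < exp (- 4) / t ^ 3" using t by simp
  then have "0 < moment 2 t" using 1 * by linarith
  then show "sdev t > 0" by (simp add: sdev_def)
qed

text \<open>One integrable majorant for the whole rescaled period. If \<theta> is at most of order
  \<open>t\<close>, the bound is Gaussian in \<open>v\<close> and is weakened to
  \<open>1 / (1 + w)\<close>; otherwise \<open>exp (- (1 / (12 * t)))\<close> outweighs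
  \<open>v^2\<close>, which is at most 320 / t^3. The constant \<open>10 ^ 8\<close> covers both
  cases.\<close>

lemma level_char_dominated:
  assumes t: "0 < t" "t \<le> 1" and v: "\<bar>v\<bar> \<le> pi * sdev t"
  shows "norm (level_char t (v / sdev t)) \<le> 10 ^ 8 / (1 + v\<^sup>2)"
proof -
  note s = sdev_bounds[OF t]
  define \<theta> where "\<theta> = v / sdev t"
  have \<theta>: "\<bar>\<theta>\<bar> \<le> pi" using v s by (simp add: \<theta>_def field_simps)
  have n: "norm (level_char t \<theta>) \<le> exp (- (min (\<theta>\<^sup>2 / (18 * t\<^sup>2)) 1 / (12 * t)))"
    by (rule level_char_bound[OF t \<theta>])
  have v2: "v\<^sup>2 \<le> 320 / t ^ 3"
  proof -
    have "v\<^sup>2 \<le> (pi * sdev t)\<^sup>2" using v by (metis power2_abs power_mono abs_ge_zero)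
    also have "\<dots> = pi\<^sup>2 * (sdev t)\<^sup>2" by (simp add: power_mult_distrib)
    also have "\<dots> \<le> 10 * (32 / t ^ 3)"
    proof (intro mult_mono s(2))
      have "pi\<^sup>2 \<le> (3.15)\<^sup>2" using pi_approx by (intro power_mono) auto
      then show "pi\<^sup>2 \<le> 10" by (simp add: power2_eq_square)
    qed auto
    finally show ?thesis by simp
  qed
  show ?thesis
  proof (cases "\<theta>\<^sup>2 / (18 * t\<^sup>2) \<le> 1")
    case True
    \<comment> \<open>6912 = 18 * 12 * 32, where 32 bounds \<open>(sdev t)^2 * t^3\<close>.\<close>
    define w where "w = v\<^sup>2 / 6912"
    have "\<theta>\<^sup>2 / (18 * t\<^sup>2) / (12 * t) = v\<^sup>2 / (216 * ((sdev t)\<^sup>2 * t ^ 3))"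
      by (simp add: \<theta>_def power_divide power2_eq_square power3_eq_cube)
    also have "\<dots> \<ge> w"
    proof -
      have "(sdev t)\<^sup>2 * t ^ 3 \<le> 32" using s(2) t by (simp add: field_simps)
      moreover have "(sdev t)\<^sup>2 * t ^ 3 > 0" using s(3) t by simp
      ultimately have "0 < 216 * ((sdev t)\<^sup>2 * t ^ 3)" "216 * ((sdev t)\<^sup>2 * t ^ 3) \<le> 6912" by linarith+
      then show ?thesis unfolding w_def using s(3) t by (intro divide_left_mono mult_pos_pos) auto
    qed
    finally have "norm (level_char t \<theta>) \<le> exp (- w)"
      using n True by (auto simp: min_def intro: order_trans)
    also have "\<dots> \<le> 1 / (1 + w)"
    proof -
      have "0 < 1 + w" "1 + w \<le> exp w" using exp_ge_add_one_self[of w] by (auto simp: w_def intro: add_pos_nonneg)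
      then have "1 / exp w \<le> 1 / (1 + w)" by (intro divide_left_mono) auto
      then show ?thesis by (simp add: exp_minus inverse_eq_divide)
    qed
    also have "\<dots> \<le> 10 ^ 8 / (1 + v\<^sup>2)"
    proof -
      have "1 + v\<^sup>2 \<le> 10 ^ 8 * (1 + w)"
      proof -
        have "v\<^sup>2 \<le> 99999999 + 390625 * v\<^sup>2 / 27" using zero_le_power2[of v] by linarith
        then show ?thesis by (simp add: w_def)
      qed
      moreover have "0 < 1 + v\<^sup>2" "0 < 1 + w" by (auto simp: w_def intro: add_pos_nonneg)
      ultimately show ?thesis by (simp add: field_simps)
    qed
    finally show ?thesis by (simp add: \<theta>_def)
  next
    case False
    then have b: "norm (level_char t \<theta>) \<le> exp (- (1 / (12 * t)))" using n by (simp add: min_def)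
    have "(1 + v\<^sup>2) * exp (- (1 / (12 * t))) \<le> 1 * 1 + v\<^sup>2 * exp (- (1 / (12 * t)))"
      using t by (simp add: distrib_right)
    also have "v\<^sup>2 * exp (- (1 / (12 * t))) \<le> 320 / t ^ 3 * (82944 * t ^ 3)"
      using v2 exp_neg_le_inverse_cube[OF t(1)] t by (intro mult_mono) auto
    also have "320 / t ^ 3 * (82944 * t ^ 3) = 26542080" using t by simp
    finally have "(1 + v\<^sup>2) * exp (- (1 / (12 * t))) \<le> 10 ^ 8" by simp
    moreover have "0 < 1 + v\<^sup>2" by (auto intro: add_pos_nonneg)
    ultimately have "exp (- (1 / (12 * t))) \<le> 10 ^ 8 / (1 + v\<^sup>2)" by (simp add: field_simps)
    then show ?thesis using b by (simp add: \<theta>_def)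
  qed
qed

section \<open>Fourier inversion for the probability of a single size\<close>

lemma level_prob_summable: "t > 0 \<Longrightarrow> summable (level_prob t)"
  by (rule sums_summable[OF level_prob_sums])

lemma level_char_summable: "t > 0 \<Longrightarrow> summable (\<lambda>m. complex_of_real (level_prob t m) * iexp (\<theta> * real m))"
  by (rule summable_norm_cancel) (simp add: norm_mult level_prob_nonneg level_prob_summable)

lemma Re_level_char_sums:
  assumes t: "t > 0"
  shows "(\<lambda>k. level_prob t k * cos (\<theta> * (real k - y))) sums Re (level_char t \<theta> * iexp (- \<theta> * y))"
proof -
  have "(\<lambda>k. complex_of_real (level_prob t k) * iexp (\<theta> * real k) * iexp (- \<theta> * y)) sums (level_char t \<theta> * iexp (- \<theta> * y))"
    unfolding level_char_def by (intro sums_mult2 summable_sums level_char_summable t)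
  from sums_Re[OF this]
  have "(\<lambda>k. Re (complex_of_real (level_prob t k) * (iexp (\<theta> * real k) * iexp (- \<theta> * y)))) sums Re (level_char t \<theta> * iexp (- \<theta> * y))"
    by (simp only: mult.assoc)
  moreover have "iexp (\<theta> * real k) * iexp (- \<theta> * y) = iexp (\<theta> * (real k - y))" for k
    unfolding exp_add[symmetric] by (simp add: algebra_simps)
  ultimately have "(\<lambda>k. Re (complex_of_real (level_prob t k) * iexp (\<theta> * (real k - y)))) sums Re (level_char t \<theta> * iexp (- \<theta> * y))"
    by (simp only:)
  moreover have "Re (complex_of_real a * iexp x) = a * cos x" for a x :: real
    by (simp add: exp_Euler Euler)
  ultimately show ?thesis by (simp only:)
qed

lemma borel_measurable_level_char:
  assumes "t > 0"
  shows "(\<lambda>\<theta>. Re (level_char t \<theta> * iexp (- \<theta> * y))) \<in> borel_measurable borel"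
proof -
  have "(\<lambda>\<theta>. \<Sum>k. level_prob t k * cos (\<theta> * (real k - y))) \<in> borel_measurable borel" by measurable
  then show ?thesis by (simp only: sums_unique[OF Re_level_char_sums[OF assms]])
qed

lemma integral_cos_period:
  fixes k m :: nat
  shows "(\<integral>x. indicator {-pi..pi} x * cos (x * (real k - real m)) \<partial>lborel) = (if k = m then 2 * pi else 0)"
proof (cases "k = m")
  case True
  then show ?thesis by simp
next
  case False
  define c where "c = real k - real m"
  have c: "c \<noteq> 0" using False by (simp add: c_def)
  have "has_bochner_integral lborel (\<lambda>x. indicator {-pi..pi} x *\<^sub>R cos (x * c)) (sin (pi * c) / c - sin (- pi * c) / c)"
  proof (rule has_bochner_integral_FTC_Icc)
    show "((\<lambda>x. sin (x * c) / c) has_vector_derivative cos (x * c)) (at x within {-pi..pi})" for x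
      using c by (auto simp: has_real_derivative_iff_has_vector_derivative[symmetric] intro!: derivative_eq_intros)
    show "continuous_on {-pi..pi} (\<lambda>x. cos (x * c))" by (intro continuous_intros)
  qed simp
  moreover have "sin (pi * c) = 0"
  proof -
    have "c = of_int (int k - int m)" by (simp add: c_def)
    then show ?thesis by (simp only: sin_npi_int)
  qed
  ultimately have "has_bochner_integral lborel (\<lambda>x. indicator {-pi..pi} x *\<^sub>R cos (x * c)) 0" by simp
  from has_bochner_integral_integral_eq[OF this] show ?thesis using False by (simp add: c_def)
qed

text \<open>Orthogonality of the cosines over a period isolates the term \<open>k = m\<close>; the
  partial sums are bounded by the total mass one, so limit and integral may be exchanged.\<close>

lemma level_prob_inversion:
  assumes t: "t > 0"
  shows "2 * pi * level_prob t m = (\<integral>x. indicator {-pi..pi} x * Re (level_char t x * iexp (- x * real m)) \<partial>lborel)"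
proof -
  let ?s = "\<lambda>K x. indicator {-pi..pi} x * (\<Sum>k<K. level_prob t k * cos (x * (real k - real m)))"
  have iw: "integrable lborel (\<lambda>x. indicator {-pi..pi} x :: real)" by simp
  have ms: "?s K \<in> borel_measurable lborel" for K by measurable
  have mf: "(\<lambda>x. indicator {-pi..pi} x * Re (level_char t x * iexp (- x * real m))) \<in> borel_measurable lborel"
    using borel_measurable_level_char[OF t, of "real m"] by simp
  have lim: "AE x in lborel. (\<lambda>K. ?s K x) \<longlonglongrightarrow> indicator {-pi..pi} x * Re (level_char t x * iexp (- x * real m))"
    using Re_level_char_sums[OF t] unfolding sums_def by (intro AE_I2 tendsto_intros)
  have bd: "AE x in lborel. norm (?s K x) \<le> indicator {-pi..pi} x" for K
  proof (intro AE_I2)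
    fix x
    have "\<bar>\<Sum>k<K. level_prob t k * cos (x * (real k - real m))\<bar> \<le> (\<Sum>k<K. \<bar>level_prob t k * cos (x * (real k - real m))\<bar>)"
      by (rule sum_abs)
    also have "\<dots> \<le> (\<Sum>k<K. level_prob t k)"
      by (intro sum_mono) (simp add: abs_mult level_prob_nonneg mult_left_le)
    also have "\<dots> \<le> 1"
      using sum_le_suminf[OF level_prob_summable[OF t], of "{..<K}"] level_prob_nonneg sums_unique[OF level_prob_sums[OF t]] by simp
    finally show "norm (?s K x) \<le> indicator {-pi..pi} x" by (simp add: indicator_def)
  qed
  have "(\<lambda>K. \<integral>x. ?s K x \<partial>lborel) \<longlonglongrightarrow> (\<integral>x. indicator {-pi..pi} x * Re (level_char t x * iexp (- x * real m)) \<partial>lborel)"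
    by (rule integral_dominated_convergence[OF mf ms iw lim bd])
  moreover have "(\<integral>x. ?s K x \<partial>lborel) = (\<Sum>k<K. level_prob t k * (if k = m then 2 * pi else 0))" for K
  proof -
    have int: "integrable lborel (\<lambda>x. indicator {-pi..pi} x * cos (x * (real k - real m)))" for k
      by (rule Bochner_Integration.integrable_bound[OF iw]) (auto simp: indicator_def)
    have "(\<integral>x. ?s K x \<partial>lborel) = (\<integral>x. (\<Sum>k<K. level_prob t k * (indicator {-pi..pi} x * cos (x * (real k - real m)))) \<partial>lborel)"
      by (intro Bochner_Integration.integral_cong refl) (simp add: sum_distrib_left mult_ac)
    also have "\<dots> = (\<Sum>k<K. \<integral>x. level_prob t k * (indicator {-pi..pi} x * cos (x * (real k - real m))) \<partial>lborel)"
      by (rule Bochner_Integration.integral_sum) (intro integrable_mult_right int)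
    also have "\<dots> = (\<Sum>k<K. level_prob t k * (if k = m then 2 * pi else 0))"
      by (intro sum.cong refl) (subst integral_mult_right_zero, simp only: integral_cos_period)
    finally show ?thesis .
  qed
  moreover have "(\<lambda>K. \<Sum>k<K. level_prob t k * (if k = m then 2 * pi else 0)) \<longlonglongrightarrow> 2 * pi * level_prob t m"
  proof (rule tendsto_eventually)
    show "\<forall>\<^sub>F K in sequentially. (\<Sum>k<K. level_prob t k * (if k = m then 2 * pi else 0)) = 2 * pi * level_prob t m"
      unfolding eventually_sequentially
      by (intro exI[of _ "Suc m"]) (auto simp: if_distrib[of "\<lambda>u. _ * u"] cong: if_cong)
  qed
  ultimately show ?thesis using LIMSEQ_unique by (simp only:) blast
qed

end

section \<open>The critical time and the Gaussian approximation\<close>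

lemma gauss_fourier:
  "(\<integral>v. exp (- (v\<^sup>2 / 2)) * cos (v * x) \<partial>lborel) = sqrt (2 * pi) * exp (- (x\<^sup>2 / 2))"
proof -
  have "complex_of_real (exp (- (x\<^sup>2) / 2)) = (CLINT v|std_normal_distribution. iexp (x * v))"
    using char_std_normal_distribution by (metis char_def)
  also have "\<dots> = (CLINT v|lborel. std_normal_density v *\<^sub>R iexp (x * v))"
    by (subst integral_density) (auto simp: normal_density_nonneg)
  finally have "exp (- (x\<^sup>2) / 2) = Re (CLINT v|lborel. std_normal_density v *\<^sub>R iexp (x * v))"
    by (metis Re_complex_of_real)
  also have "\<dots> = (\<integral>v. Re (std_normal_density v *\<^sub>R iexp (x * v)) \<partial>lborel)"
  proof (rule integral_Re[symmetric])
    have "integrable lborel std_normal_density" by (rule integrable_normal_density) simp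
    then show "integrable lborel (\<lambda>v. std_normal_density v *\<^sub>R iexp (x * v))"
      by (rule Bochner_Integration.integrable_bound) (auto simp: normal_density_nonneg)
  qed
  also have "\<dots> = (\<integral>v. (1 / sqrt (2 * pi)) * (exp (- (v\<^sup>2 / 2)) * cos (v * x)) \<partial>lborel)"
    by (intro Bochner_Integration.integral_cong refl)
      (simp add: std_normal_density_def exp_Euler Euler mult_ac)
  also have "\<dots> = (1 / sqrt (2 * pi)) * (\<integral>v. exp (- (v\<^sup>2 / 2)) * cos (v * x) \<partial>lborel)"
    by (rule integral_mult_right_zero)
  finally show ?thesis by (simp add: field_simps)
qed

lemma integrable_inverse_1_plus_square':
  "integrable lborel (\<lambda>x::real. 1 / (1 + x\<^sup>2))"
  using integrable_inverse_1_plus_square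
  by (simp add: set_integrable_def inverse_eq_divide)

lemma exp_neg_square_le: "exp (- (v\<^sup>2 / 2)) \<le> 2 / (1 + (v::real)\<^sup>2)"
proof -
  have "0 < 1 + v\<^sup>2" by (auto intro: add_pos_nonneg)
  moreover have "(1 + v\<^sup>2) / 2 \<le> exp (v\<^sup>2 / 2)" using exp_ge_add_one_self[of "v\<^sup>2 / 2"]
    by (intro order_trans[OF _ exp_ge_add_one_self]) (simp add: field_simps)
  ultimately have "1 / exp (v\<^sup>2 / 2) \<le> 1 / ((1 + v\<^sup>2) / 2)" by (intro divide_left_mono) auto
  then show ?thesis by (simp add: exp_minus inverse_eq_divide)
qed

text \<open>The time at which the main term pi^2 / (6 t^2) of the mean size equals
  \<open>n\<close>.\<close>

definition crit :: "nat \<Rightarrow> real" where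
  "crit n = pi / sqrt (6 * real n)"

lemma crit_bounds: "n \<ge> 2 \<Longrightarrow> 0 < crit n" "n \<ge> 2 \<Longrightarrow> crit n \<le> 1"
proof -
  assume n: "n \<ge> 2"
  then show "0 < crit n" by (simp add: crit_def)
  have "pi\<^sup>2 \<le> (3.2)\<^sup>2" using pi_approx by (intro power_mono) auto
  then have "pi\<^sup>2 \<le> 6 * real n" using n by (simp add: power2_eq_square)
  then have "pi \<le> sqrt (6 * real n)" by (intro real_le_rsqrt) simp
  then show "crit n \<le> 1" using n by (simp add: crit_def)
qed

lemma crit_tendsto: "crit \<longlonglongrightarrow> 0"
  unfolding crit_def by real_asymp

lemma crit_square: "n \<ge> 1 \<Longrightarrow> pi\<^sup>2 / (6 * (crit n)\<^sup>2) = real n"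
  by (simp add: crit_def power_divide)

lemma crit_mean: "n \<ge> 2 \<Longrightarrow> \<bar>moment 1 (crit n) - real n\<bar> \<le> 4 / crit n"
  using moment_1_estimate[OF crit_bounds(1)] by (simp add: crit_square)

lemma tendsto_comparison_power:
  fixes f g :: "nat \<Rightarrow> real"
  assumes "\<And>n. n \<ge> N \<Longrightarrow> \<bar>f n\<bar> \<le> g n" "g \<longlonglongrightarrow> 0" shows "f \<longlonglongrightarrow> 0"
proof (rule Lim_null_comparison[of f g sequentially])
  show "\<forall>\<^sub>F n in sequentially. norm (f n) \<le> g n"
    unfolding eventually_sequentially by (intro exI[of _ N]) (simp add: assms(1))
qed (rule assms(2))

context exponential_array
begin

abbreviation sd :: "nat \<Rightarrow> real" where "sd n \<equiv> sdev (crit n)"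

lemma sd_lower: "n \<ge> 2 \<Longrightarrow> exp (- 2) / (crit n * sqrt (crit n)) \<le> sd n"
proof -
  assume n: "n \<ge> 2"
  note c = crit_bounds(1)[OF n] crit_bounds(2)[OF n]
  have "(exp (- 2) / (crit n * sqrt (crit n)))\<^sup>2 = exp (- 4) / crit n ^ 3"
    using c by (simp add: power_divide power_mult_distrib power2_eq_square[of "exp _"] exp_add[symmetric] eval_nat_numeral)
  also have "\<dots> \<le> (sd n)\<^sup>2" by (rule sdev_bounds(1)[OF c])
  finally show ?thesis by (rule power2_le_imp_le) (use sdev_bounds(3)[OF c] in simp)
qed

lemma inverse_sd_upper: "n \<ge> 2 \<Longrightarrow> 1 / sd n \<le> exp 2 * (crit n * sqrt (crit n))"
proof -
  assume n: "n \<ge> 2"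
  note c = crit_bounds(1)[OF n] crit_bounds(2)[OF n]
  have p: "0 < crit n * sqrt (crit n)" using c by simp
  then have "1 / sd n \<le> 1 / (exp (- 2) / (crit n * sqrt (crit n)))"
    using sd_lower[OF n] by (intro divide_left_mono mult_pos_pos sdev_bounds(3)[OF c]) simp_all
  then show ?thesis by (simp add: exp_minus field_simps)
qed

text \<open>The mean is off by at most 4/t, which is smaller by a factor of order sqrt t than the
  standard deviation, of order t^(-3/2).\<close>

lemma centering_tendsto: "(\<lambda>n. (moment 1 (crit n) - real n) / sd n) \<longlonglongrightarrow> 0"
proof (rule tendsto_comparison_power)
  fix n :: nat assume n: "n \<ge> 2"
  note c = crit_bounds(1)[OF n] crit_bounds(2)[OF n]
  have "\<bar>(moment 1 (crit n) - real n) / sd n\<bar> = \<bar>moment 1 (crit n) - real n\<bar> * (1 / sd n)"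
    using sdev_bounds(3)[OF c] by simp
  also have "\<dots> \<le> 4 / crit n * (exp 2 * (crit n * sqrt (crit n)))"
    using crit_mean[OF n] inverse_sd_upper[OF n] c sdev_bounds(3)[OF c] by (intro mult_mono) auto
  also have "\<dots> = 4 * exp 2 * sqrt (crit n)" using c by simp
  finally show "\<bar>(moment 1 (crit n) - real n) / sd n\<bar> \<le> 4 * exp 2 * sqrt (crit n)" .
next
  have "(\<lambda>n. 4 * exp 2 * sqrt (crit n)) \<longlonglongrightarrow> 4 * exp 2 * sqrt 0"
    by (intro tendsto_intros crit_tendsto)
  then show "(\<lambda>n. 4 * exp 2 * sqrt (crit n)) \<longlonglongrightarrow> 0" by simp
qed

text \<open>The order is t^(-4) * t^(9/2). This removes the cubic error of
  \<open>level_char_expansion\<close> after rescaling.\<close>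

lemma third_moment_tendsto: "(\<lambda>n. moment 3 (crit n) / sd n ^ 3) \<longlonglongrightarrow> 0"
proof (rule tendsto_comparison_power)
  fix n :: nat assume n: "n \<ge> 2"
  note c = crit_bounds(1)[OF n] crit_bounds(2)[OF n]
  have "\<bar>moment 3 (crit n) / sd n ^ 3\<bar> = moment 3 (crit n) * (1 / sd n) ^ 3"
    using sdev_bounds(3)[OF c] moment_nonneg[OF c(1)] by (simp add: power_divide)
  also have "\<dots> \<le> 192 / crit n ^ 4 * (exp 2 * (crit n * sqrt (crit n))) ^ 3"
    using moment_upper[OF c(1), of 3] inverse_sd_upper[OF n] c sdev_bounds(3)[OF c] moment_nonneg[OF c(1), of 3]
    by (intro mult_mono power_mono) (auto simp: fact_numeral)
  also have "\<dots> = 192 * exp 2 ^ 3 * sqrt (crit n)"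
  proof -
    define r where "r = sqrt (crit n)"
    have r: "r > 0" "crit n = r\<^sup>2" using c by (simp_all add: r_def)
    have "192 / (r\<^sup>2) ^ 4 * (exp 2 * (r\<^sup>2 * r)) ^ 3 = 192 * exp 2 ^ 3 * r"
      using r(1) by (simp add: field_simps eval_nat_numeral)
    then show ?thesis by (simp only: r(2) r_def[symmetric] real_sqrt_abs abs_of_pos[OF r(1)])
  qed
  finally show "\<bar>moment 3 (crit n) / sd n ^ 3\<bar> \<le> 192 * exp 2 ^ 3 * sqrt (crit n)" .
next
  have "(\<lambda>n. 192 * exp 2 ^ 3 * sqrt (crit n)) \<longlonglongrightarrow> 192 * exp 2 ^ 3 * sqrt 0"
    by (intro tendsto_intros crit_tendsto)
  then show "(\<lambda>n. 192 * exp 2 ^ 3 * sqrt (crit n)) \<longlonglongrightarrow> 0" by simp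
qed

definition scaled_char :: "nat \<Rightarrow> real \<Rightarrow> complex" where
  "scaled_char n v = level_char (crit n) (v / sd n) * iexp (- (v / sd n) * real n)"

lemma scaled_char_tendsto:
  "(\<lambda>n. scaled_char n v) \<longlonglongrightarrow> complex_of_real (exp (- (v\<^sup>2 / 2)))"
proof -
  define bd where "bd n = \<bar>v\<bar> * \<bar>(moment 1 (crit n) - real n) / sd n\<bar> + \<bar>v\<bar> ^ 3 / 6 * (moment 3 (crit n) / sd n ^ 3)" for n
  have "\<exists>R. scaled_char n v = exp (complex_of_real (- (v\<^sup>2 / 2)) + R) \<and> norm R \<le> bd n" if n: "n \<ge> 2" for n
  proof -
    note c = crit_bounds(1)[OF n] crit_bounds(2)[OF n]
    have s: "sd n > 0" by (rule sdev_bounds(3)[OF c])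
    have m2: "moment 2 (crit n) = (sd n)\<^sup>2" by (simp add: sdev_def moment_nonneg[OF c(1)])
    obtain R where R: "scaled_char n v = exp (complex_of_real (- ((v / sd n)\<^sup>2 / 2 * moment 2 (crit n))) + R)"
      "norm R \<le> \<bar>v / sd n\<bar> * \<bar>moment 1 (crit n) - real n\<bar> + \<bar>v / sd n\<bar> ^ 3 / 6 * moment 3 (crit n)"
      using level_char_expansion[OF c(1), of "v / sd n" "real n"] unfolding scaled_char_def by blast
    have "(v / sd n)\<^sup>2 / 2 * moment 2 (crit n) = v\<^sup>2 / 2" using s by (simp add: m2 power_divide)
    moreover have "\<bar>v / sd n\<bar> * \<bar>moment 1 (crit n) - real n\<bar> + \<bar>v / sd n\<bar> ^ 3 / 6 * moment 3 (crit n) = bd n"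
      using s by (simp add: bd_def abs_divide power_divide)
    ultimately show ?thesis using R by auto
  qed
  then obtain R where R: "\<And>n. n \<ge> 2 \<Longrightarrow> scaled_char n v = exp (complex_of_real (- (v\<^sup>2 / 2)) + R n)"
    "\<And>n. n \<ge> 2 \<Longrightarrow> norm (R n) \<le> bd n" by metis
  have "bd \<longlonglongrightarrow> \<bar>v\<bar> * \<bar>0\<bar> + \<bar>v\<bar> ^ 3 / 6 * 0"
    unfolding bd_def by (intro tendsto_intros centering_tendsto third_moment_tendsto)
  then have "bd \<longlonglongrightarrow> 0" by simp
  then have "R \<longlonglongrightarrow> 0"
    by (rule Lim_null_comparison[rotated]) (auto simp: eventually_sequentially intro!: exI[of _ 2] R(2))
  then have "(\<lambda>n. exp (complex_of_real (- (v\<^sup>2 / 2)) + R n)) \<longlonglongrightarrow> exp (complex_of_real (- (v\<^sup>2 / 2)) + 0)"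
    by (intro tendsto_intros)
  moreover have "\<forall>\<^sub>F n in sequentially. exp (complex_of_real (- (v\<^sup>2 / 2)) + R n) = scaled_char n v"
    unfolding eventually_sequentially by (intro exI[of _ 2]) (simp add: R(1))
  ultimately have "(\<lambda>n. scaled_char n v) \<longlonglongrightarrow> exp (complex_of_real (- (v\<^sup>2 / 2)) + 0)"
    by (rule Lim_transform_eventually)
  then show ?thesis by (simp only: add_0_right exp_of_real)
qed

text \<open>Cut off outside one period of the unscaled frequency, the domain of the inversion
  integral, so that it can be compared with the Gaussian on the whole line.\<close>

definition window_char :: "nat \<Rightarrow> real \<Rightarrow> complex" where
  "window_char n v = (if \<bar>v\<bar> \<le> pi * sd n then scaled_char n v else 0)"

text \<open>An L1 distance of characteristic functions: by inversion it bounds the error of the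
  local limit theorem for all sizes \<open>m\<close> at once.\<close>

definition lclt_error :: "nat \<Rightarrow> real" where
  "lclt_error n = (\<integral>v. norm (window_char n v - complex_of_real (exp (- (v\<^sup>2 / 2)))) \<partial>lborel)"

lemma borel_measurable_scaled_char:
  assumes n: "n \<ge> 2" shows "scaled_char n \<in> borel_measurable borel"
proof -
  note c = crit_bounds(1)[OF n]
  have "(\<lambda>v. \<Sum>m. complex_of_real (level_prob (crit n) m) * iexp (v / sd n * real m)) \<in> borel_measurable borel"
    by measurable
  then show ?thesis unfolding scaled_char_def level_char_def by measurable
qed

lemma window_char_bound:
  assumes n: "n \<ge> 2" shows "norm (window_char n v) \<le> 10 ^ 8 / (1 + v\<^sup>2)"
proof (cases "\<bar>v\<bar> \<le> pi * sd n")
  case True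
  have "norm (window_char n v) = norm (level_char (crit n) (v / sd n))"
    using True by (simp add: window_char_def scaled_char_def norm_mult del: of_real_mult of_real_minus of_real_divide)
  then show ?thesis using level_char_dominated[OF crit_bounds(1)[OF n] crit_bounds(2)[OF n] True] by simp
next
  case False
  then show ?thesis by (simp add: window_char_def)
qed

lemma borel_measurable_window_char:
  assumes n: "n \<ge> 2" shows "window_char n \<in> borel_measurable borel"
  unfolding window_char_def using borel_measurable_scaled_char[OF n] by measurable

lemma lclt_difference_bound:
  assumes n: "n \<ge> 2"
  shows "norm (window_char n v - complex_of_real (exp (- (v\<^sup>2 / 2)))) \<le> (10 ^ 8 + 2) * (1 / (1 + v\<^sup>2))"
proof -
  have "norm (window_char n v - complex_of_real (exp (- (v\<^sup>2 / 2)))) \<le> norm (window_char n v) + norm (complex_of_real (exp (- (v\<^sup>2 / 2))))"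
    by (rule norm_triangle_ineq4)
  also have "\<dots> \<le> 10 ^ 8 / (1 + v\<^sup>2) + 2 / (1 + v\<^sup>2)"
    using window_char_bound[OF n] exp_neg_square_le[of v] by (intro add_mono) (simp_all only: norm_of_real abs_exp_cancel)
  also have "\<dots> = (10 ^ 8 + 2) * (1 / (1 + v\<^sup>2))" by (simp add: add_divide_distrib)
  finally show ?thesis .
qed

text \<open>Dominated convergence with the majorant of \<open>level_char_dominated\<close>; for
  fixed \<open>v\<close> the cutoff is eventually inactive. The index is shifted by two because the
  bounds require \<open>n \<ge> 2\<close>.\<close>

lemma lclt_error_tendsto: "lclt_error \<longlonglongrightarrow> 0"
proof -
  let ?f = "\<lambda>n v. norm (window_char (n + 2) v - complex_of_real (exp (- (v\<^sup>2 / 2))))"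
  have ms: "?f n \<in> borel_measurable lborel" for n
    using borel_measurable_window_char[of "n + 2"] by simp
  have int: "integrable lborel (\<lambda>v::real. (10 ^ 8 + 2) * (1 / (1 + v\<^sup>2)))"
    by (intro integrable_mult_right integrable_inverse_1_plus_square')
  have lim: "AE v in lborel. (\<lambda>n. ?f n v) \<longlonglongrightarrow> 0"
  proof (intro AE_I2)
    fix v :: real
    have "\<forall>\<^sub>F n in sequentially. \<bar>v\<bar> \<le> pi * sd n"
    proof -
      have l: "(\<lambda>n. exp 2 * (crit n * sqrt (crit n)) * \<bar>v\<bar>) \<longlonglongrightarrow> exp 2 * (0 * sqrt 0) * \<bar>v\<bar>"
        by (intro tendsto_intros crit_tendsto)
      have "\<forall>\<^sub>F n in sequentially. exp 2 * (crit n * sqrt (crit n)) * \<bar>v\<bar> < 1"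
        by (rule order_tendstoD(2)[OF l]) simp
      moreover have "\<forall>\<^sub>F n in sequentially. n \<ge> (2::nat)" by (rule eventually_ge_at_top)
      ultimately show ?thesis
      proof eventually_elim
        case (elim n)
        note s = sdev_bounds(3)[OF crit_bounds(1)[OF elim(2)] crit_bounds(2)[OF elim(2)]]
        have "1 / sd n * \<bar>v\<bar> \<le> exp 2 * (crit n * sqrt (crit n)) * \<bar>v\<bar>"
          by (intro mult_right_mono inverse_sd_upper elim(2)) simp
        then have "1 / sd n * \<bar>v\<bar> \<le> 1" using elim(1) by linarith
        then have "\<bar>v\<bar> \<le> sd n" using s by (simp add: field_simps)
        also have "\<dots> \<le> pi * sd n" using s pi_gt3 by simp
        finally show ?case .
      qed
    qed
    then have "\<forall>\<^sub>F n in sequentially. scaled_char n v = window_char n v"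
      by eventually_elim (simp add: window_char_def)
    from Lim_transform_eventually[OF scaled_char_tendsto this]
    have "(\<lambda>n. window_char n v) \<longlonglongrightarrow> complex_of_real (exp (- (v\<^sup>2 / 2)))" .
    then have "(\<lambda>n. window_char (n + 2) v) \<longlonglongrightarrow> complex_of_real (exp (- (v\<^sup>2 / 2)))"
      by (rule LIMSEQ_ignore_initial_segment)
    then have "(\<lambda>n. ?f n v) \<longlonglongrightarrow> norm (complex_of_real (exp (- (v\<^sup>2 / 2))) - complex_of_real (exp (- (v\<^sup>2 / 2))))"
      by (intro tendsto_intros)
    then show "(\<lambda>n. ?f n v) \<longlonglongrightarrow> 0" by simp
  qed
  have bd: "AE v in lborel. norm (?f n v) \<le> (10 ^ 8 + 2) * (1 / (1 + v\<^sup>2))" for n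
    using lclt_difference_bound[of "n + 2"] by (intro AE_I2) simp
  have z: "(\<lambda>v::real. 0::real) \<in> borel_measurable lborel" by simp
  have "(\<lambda>n. \<integral>v. ?f n v \<partial>lborel) \<longlonglongrightarrow> (\<integral>v. 0 \<partial>(lborel :: real measure))"
    by (rule integral_dominated_convergence[OF z ms int lim bd])
  then have "(\<lambda>n. lclt_error (n + 2)) \<longlonglongrightarrow> 0" by (simp add: lclt_error_def)
  then show ?thesis by (rule LIMSEQ_offset)
qed

text \<open>Rescaling the inversion formula by \<open>sd n\<close> and writing the Gaussian through
  its own Fourier transform puts both terms under one integral. The oscillating factor has modulus
  one, hence the uniformity in \<open>m\<close>.\<close>

lemma local_clt:
  assumes n: "n \<ge> 2"
  shows "\<bar>2 * pi * (sd n * level_prob (crit n) m) - sqrt (2 * pi) * exp (- (((real m - real n) / sd n)\<^sup>2 / 2))\<bar> \<le> lclt_error n"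
proof -
  note c = crit_bounds(1)[OF n] crit_bounds(2)[OF n]
  define \<sigma> where "\<sigma> = sd n"
  have s: "\<sigma> > 0" unfolding \<sigma>_def by (rule sdev_bounds(3)[OF c])
  define x where "x = (real m - real n) / \<sigma>"
  let ?h = "\<lambda>y. indicator {-pi..pi} y * Re (level_char (crit n) y * iexp (- y * real m))"
  have "2 * pi * level_prob (crit n) m = (\<integral>y. ?h y \<partial>lborel)" by (rule level_prob_inversion[OF c(1)])
  also have "\<dots> = \<bar>1 / \<sigma>\<bar> * (\<integral>v. ?h (0 + 1 / \<sigma> * v) \<partial>lborel)"
    using lborel_integral_real_affine[of "1 / \<sigma>" ?h 0] s by simp
  also have "(\<integral>v. ?h (0 + 1 / \<sigma> * v) \<partial>lborel) = (\<integral>v. Re (window_char n v * iexp (- (v * x))) \<partial>lborel)"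
  proof (intro Bochner_Integration.integral_cong refl)
    fix v
    have i: "indicator {-pi..pi} (0 + 1 / \<sigma> * v) = (if \<bar>v\<bar> \<le> pi * \<sigma> then 1 else 0 :: real)"
      using s by (auto simp: indicator_def field_simps abs_le_iff)
    have "- (v / \<sigma>) * real n + - (v * x) = - (1 / \<sigma> * v) * real m"
      using s by (simp add: x_def field_simps)
    then have e: "iexp (- (v / \<sigma>) * real n) * iexp (- (v * x)) = iexp (- (1 / \<sigma> * v) * real m)"
      unfolding exp_add[symmetric] distrib_left[symmetric] of_real_add[symmetric] by (simp only:)
    show "?h (0 + 1 / \<sigma> * v) = Re (window_char n v * iexp (- (v * x)))"
      unfolding i window_char_def scaled_char_def \<sigma>_def[symmetric]
      by (simp only: mult.assoc e add_0_left if_True if_False split: if_split) (simp add: mult.commute)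
  qed
  finally have eq: "2 * pi * (\<sigma> * level_prob (crit n) m) = (\<integral>v. Re (window_char n v * iexp (- (v * x))) \<partial>lborel)"
    using s by (simp add: field_simps)
  have int1: "integrable lborel (\<lambda>v::real. 10 ^ 8 * (1 / (1 + v\<^sup>2)))" "integrable lborel (\<lambda>v::real. 2 * (1 / (1 + v\<^sup>2)))"
    "integrable lborel (\<lambda>v::real. (10 ^ 8 + 2) * (1 / (1 + v\<^sup>2)))"
    by (intro integrable_mult_right integrable_inverse_1_plus_square')+
  have mw [measurable]: "window_char n \<in> borel_measurable borel" by (rule borel_measurable_window_char[OF n])
  have iw: "integrable lborel (\<lambda>v. Re (window_char n v * iexp (- (v * x))))"
  proof (rule Bochner_Integration.integrable_bound[OF int1(1)])
    show "AE v in lborel. norm (Re (window_char n v * iexp (- (v * x)))) \<le> norm (10 ^ 8 * (1 / (1 + v\<^sup>2)))"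
    proof (intro AE_I2)
      fix v :: real
      have "norm (Re (window_char n v * iexp (- (v * x)))) \<le> norm (window_char n v * iexp (- (v * x)))"
        unfolding real_norm_def by (rule abs_Re_le_cmod)
      also have "\<dots> = norm (window_char n v)" by (simp only: norm_mult norm_exp_i_times mult_1_right)
      also have "\<dots> \<le> norm (10 ^ 8 * (1 / (1 + v\<^sup>2)))" using window_char_bound[OF n, of v] by simp
      finally show "norm (Re (window_char n v * iexp (- (v * x)))) \<le> norm (10 ^ 8 * (1 / (1 + v\<^sup>2)))" .
    qed
  qed measurable
  have ig: "integrable lborel (\<lambda>v. exp (- (v\<^sup>2 / 2)) * cos (v * x))"
  proof (rule Bochner_Integration.integrable_bound[OF int1(2)])
    show "AE v in lborel. norm (exp (- (v\<^sup>2 / 2)) * cos (v * x)) \<le> norm (2 * (1 / (1 + v\<^sup>2)))"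
    proof (intro AE_I2)
      fix v :: real
      have "norm (exp (- (v\<^sup>2 / 2)) * cos (v * x)) \<le> exp (- (v\<^sup>2 / 2)) * 1"
        by (simp add: abs_mult)
      also have "\<dots> \<le> norm (2 * (1 / (1 + v\<^sup>2)))" using exp_neg_square_le[of v] by simp
      finally show "norm (exp (- (v\<^sup>2 / 2)) * cos (v * x)) \<le> norm (2 * (1 / (1 + v\<^sup>2)))" .
    qed
  qed measurable
  have id: "integrable lborel (\<lambda>v. norm (window_char n v - complex_of_real (exp (- (v\<^sup>2 / 2)))))"
    by (rule Bochner_Integration.integrable_bound[OF int1(3)])
      (use lclt_difference_bound[OF n] in \<open>auto intro!: AE_I2 order_trans[OF _ abs_ge_self]\<close>)
  have "2 * pi * (\<sigma> * level_prob (crit n) m) - sqrt (2 * pi) * exp (- (x\<^sup>2 / 2))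
      = (\<integral>v. Re (window_char n v * iexp (- (v * x))) - exp (- (v\<^sup>2 / 2)) * cos (v * x) \<partial>lborel)"
    unfolding eq gauss_fourier[symmetric] by (rule Bochner_Integration.integral_diff[OF iw ig, symmetric])
  also have "\<bar>\<dots>\<bar> \<le> (\<integral>v. \<bar>Re (window_char n v * iexp (- (v * x))) - exp (- (v\<^sup>2 / 2)) * cos (v * x)\<bar> \<partial>lborel)"
    by (rule integral_abs_bound)
  also have "\<dots> \<le> (\<integral>v. norm (window_char n v - complex_of_real (exp (- (v\<^sup>2 / 2)))) \<partial>lborel)"
  proof (rule integral_mono)
    show "integrable lborel (\<lambda>v. \<bar>Re (window_char n v * iexp (- (v * x))) - exp (- (v\<^sup>2 / 2)) * cos (v * x)\<bar>)"
      by (intro integrable_abs Bochner_Integration.integrable_diff iw ig)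
    show "integrable lborel (\<lambda>v. norm (window_char n v - complex_of_real (exp (- (v\<^sup>2 / 2)))))" by (rule id)
    fix v :: real
    have "Re (complex_of_real a * iexp (- (v * x))) = a * cos (v * x)" for a
      by (simp add: exp_Euler Euler)
    then have "Re (window_char n v * iexp (- (v * x))) - exp (- (v\<^sup>2 / 2)) * cos (v * x)
        = Re ((window_char n v - complex_of_real (exp (- (v\<^sup>2 / 2)))) * iexp (- (v * x)))"
      by (simp only: left_diff_distrib minus_complex.sel)
    also have "\<bar>\<dots>\<bar> \<le> norm ((window_char n v - complex_of_real (exp (- (v\<^sup>2 / 2)))) * iexp (- (v * x)))"
      by (rule abs_Re_le_cmod)
    also have "\<dots> = norm (window_char n v - complex_of_real (exp (- (v\<^sup>2 / 2))))"
      by (simp only: norm_mult norm_exp_i_times mult_1_right)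
    finally show "\<bar>Re (window_char n v * iexp (- (v * x))) - exp (- (v\<^sup>2 / 2)) * cos (v * x)\<bar>
      \<le> norm (window_char n v - complex_of_real (exp (- (v\<^sup>2 / 2))))" .
  qed
  finally show ?thesis by (simp add: lclt_error_def x_def \<sigma>_def)
qed

end

section \<open>Tilting and averages over windows of sizes\<close>

lemma exp_cmod: "norm (exp (z :: complex)) = exp (Re z)"
  by (rule norm_exp_eq_Re)

lemma
  fixes a b l p g x :: "'a :: comm_semiring_1"
  assumes "a * x = l * b"
  shows mult_swap: "p * a * x = l * (p * b)" and mult_swap': "a * g * x = l * (b * g)"
proof -
  have "p * a * x = p * (a * x)" by (rule mult.assoc)
  also have "\<dots> = l * (p * b)" unfolding assms by (rule mult.left_commute)
  finally show "p * a * x = l * (p * b)" .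
  have "a * g * x = a * x * g" by (simp add: ac_simps)
  also have "\<dots> = l * (b * g)" unfolding assms by (rule mult.assoc)
  finally show "a * g * x = l * (b * g)" .
qed

lemma not_tendsto_0_subseq:
  fixes X :: "nat \<Rightarrow> complex"
  assumes "\<not> X \<longlonglongrightarrow> 0"
  obtains e q where "e > 0" "strict_mono (q :: nat \<Rightarrow> nat)" "\<And>k. q k \<ge> N" "\<And>k. e \<le> norm (X (q k))"
proof -
  have "\<exists>e>0. \<not> (\<forall>\<^sub>F n in sequentially. norm (X n) < e)"
    using assms by (simp add: tendsto_iff)
  then obtain e where e: "e > 0" "\<not> (\<forall>\<^sub>F n in sequentially. norm (X n) < e)" by (elim exE conjE)
  define S where "S = {n. n \<ge> N \<and> e \<le> norm (X n)}"
  have inf: "infinite S"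
  proof
    assume "finite S"
    then have "\<exists>B. \<forall>n\<in>S. n \<le> B" by (simp only: finite_nat_set_iff_bounded_le)
    then obtain B where B: "\<forall>n\<in>S. n \<le> B" ..
    have "\<forall>n\<ge>max N (Suc B). norm (X n) < e"
    proof (intro allI impI)
      fix n assume n: "n \<ge> max N (Suc B)"
      then have "n \<notin> S" using B by fastforce
      then show "norm (X n) < e" using n by (simp add: S_def)
    qed
    then have "\<forall>\<^sub>F n in sequentially. norm (X n) < e" unfolding eventually_sequentially ..
    then show False using e(2) by simp
  qed
  obtain q where q: "strict_mono (q :: nat \<Rightarrow> nat) \<and> (\<forall>k. q k \<in> S)" using infinite_enumerate[OF inf] ..
  show ?thesis
  proof (rule that[OF e(1)])
    show "strict_mono q" using q ..
    show "q k \<ge> N" "e \<le> norm (X (q k))" for k using q unfolding S_def by simp_all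
  qed
qed

section \<open>Exponential tilts and their Laplace transforms\<close>

context exponential_array
begin

definition xi :: "nat \<Rightarrow> nat \<Rightarrow> real" where
  "xi n m = (real m - real n) / sd n"

text \<open>For regular \<open>n\<close> and \<open>|y| \<le> 2\<close>, the Laplace transform at
  \<open>y\<close> of the standardised size \<open>xi n\<close>.\<close>

definition laplace :: "nat \<Rightarrow> real \<Rightarrow> real" where
  "laplace n y = exp (F (crit n + y / sd n) - F (crit n) + y * real n / sd n)"

text \<open>All shifts \<open>y / sd n\<close> with \<open>|y| \<le> 2\<close> stay within half of
  \<open>crit n\<close>. The range reaches 2, although tilts are used only up to 1, because the
  density of a tilt is squared in \<open>contiguous_tilt\<close>.\<close>

definition regular :: "nat \<Rightarrow> bool" where
  "regular n \<longleftrightarrow> n \<ge> 2 \<and> 2 / sd n \<le> crit n / 2 \<and> \<bar>(moment 1 (crit n) - real n) / sd n\<bar> \<le> 1"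

lemma regular_pos: "regular n \<Longrightarrow> 0 < crit n" "regular n \<Longrightarrow> crit n \<le> 1" "regular n \<Longrightarrow> 0 < sd n"
proof -
  assume "regular n"
  then have n: "n \<ge> 2" by (simp add: regular_def)
  show c: "0 < crit n" "crit n \<le> 1" using crit_bounds[OF n] .
  show "0 < sd n" by (rule sdev_bounds(3)[OF c])
qed

lemma eventually_regular: "\<forall>\<^sub>F n in sequentially. regular n"
proof -
  have "(\<lambda>n. 4 * exp 2 * sqrt (crit n)) \<longlonglongrightarrow> 4 * exp 2 * sqrt 0"
    by (intro tendsto_intros crit_tendsto)
  then have 1: "\<forall>\<^sub>F n in sequentially. 4 * exp 2 * sqrt (crit n) < 1" by (rule order_tendstoD) simp
  have "(\<lambda>n. \<bar>(moment 1 (crit n) - real n) / sd n\<bar>) \<longlonglongrightarrow> \<bar>0\<bar>"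
    by (intro tendsto_intros centering_tendsto)
  then have 2: "\<forall>\<^sub>F n in sequentially. \<bar>(moment 1 (crit n) - real n) / sd n\<bar> < 1" by (rule order_tendstoD) simp
  show ?thesis using 1 2 eventually_ge_at_top[of 2]
  proof eventually_elim
    case (elim n)
    have c: "crit n > 0" by (rule crit_bounds(1)[OF elim(3)])
    have "2 / sd n = 2 * (1 / sd n)" by simp
    also have "\<dots> \<le> 2 * (exp 2 * (crit n * sqrt (crit n)))"
      by (intro mult_left_mono inverse_sd_upper elim(3)) simp
    also have "\<dots> = (4 * exp 2 * sqrt (crit n)) * (crit n / 2)" by simp
    also have "\<dots> \<le> 1 * (crit n / 2)" using elim(1) c by (intro mult_right_mono) auto
    finally show ?case using elim unfolding regular_def by simp
  qed
qed

lemma shift_small: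
  assumes n: "regular n" and y: "\<bar>y\<bar> \<le> 2"
  shows "\<bar>y / sd n\<bar> \<le> crit n / 2" "crit n + y / sd n > 0"
proof -
  have "\<bar>y / sd n\<bar> = \<bar>y\<bar> / sd n" using regular_pos(3)[OF n] by simp
  also have "\<dots> \<le> 2 / sd n" using y regular_pos(3)[OF n] by (intro divide_right_mono) auto
  also have "\<dots> \<le> crit n / 2" using n unfolding regular_def by blast
  finally show 1: "\<bar>y / sd n\<bar> \<le> crit n / 2" .
  show "crit n + y / sd n > 0" using 1 regular_pos(1)[OF n] by linarith
qed

text \<open>A change of time multiplies the weight of size \<open>m\<close> by an exponential in
  \<open>m\<close>; centering at \<open>n\<close> and the two normalising constants make up
  \<open>laplace n y\<close>.\<close>

lemma level_prob_tilt:
  assumes n: "regular n"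
  shows "level_prob (crit n) m * exp (- y * xi n m) = laplace n y * level_prob (crit n + y / sd n) m"
proof -
  have s: "sd n > 0" by (rule regular_pos(3)[OF n])
  have "- crit n * real m - F (crit n) + - y * xi n m
      = F (crit n + y / sd n) - F (crit n) + y * real n / sd n + (- (crit n + y / sd n) * real m - F (crit n + y / sd n))"
    using s by (simp add: xi_def field_simps)
  then have "exp (- crit n * real m - F (crit n)) * exp (- y * xi n m)
      = laplace n y * exp (- (crit n + y / sd n) * real m - F (crit n + y / sd n))"
    unfolding laplace_def exp_add[symmetric] by (simp only:)
  then show ?thesis unfolding level_prob_def by (rule mult_swap)
qed

lemma laplace_sums:
  assumes n: "regular n" and y: "\<bar>y\<bar> \<le> 2"
  shows "(\<lambda>m. level_prob (crit n) m * exp (- y * xi n m)) sums laplace n y"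
  unfolding level_prob_tilt[OF n]
  using sums_mult[OF level_prob_sums[OF shift_small(2)[OF n y]], of "laplace n y"] by simp

text \<open>In the exponent, 2 bounds the first order term of \<open>F_expand_upper\<close>. The
  second order term is at most \<open>128 * y^2 * exp 4\<close> with \<open>y^2 \<le> 4\<close>,
  from \<open>moment 2 (crit n / 2) \<le> 256 / crit n ^ 3\<close> and
  \<open>sdev_bounds\<close>.\<close>

definition laplace_bound :: real where
  "laplace_bound = exp (2 + 512 * exp 4)"

lemma laplace_upper:
  assumes n: "regular n" and y: "\<bar>y\<bar> \<le> 2"
  shows "laplace n y \<le> laplace_bound"
proof -
  note c = regular_pos[OF n]
  define x where "x = y / sd n"
  have x: "\<bar>x\<bar> \<le> crit n / 2" unfolding x_def by (rule shift_small(1)[OF n y])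
  have x2: "x\<^sup>2 = y\<^sup>2 / (sd n)\<^sup>2" by (simp add: x_def power_divide)
  have "moment 2 (crit n - \<bar>x\<bar>) \<le> moment 2 (crit n / 2)" using x c by (intro moment_antimono) auto
  also have "\<dots> \<le> fact 2 * 2 ^ (2 + 2) / (crit n / 2) ^ Suc 2" using c by (intro moment_upper) simp
  also have "\<dots> = 256 / crit n ^ 3" by (simp add: eval_nat_numeral field_simps)
  finally have m2: "moment 2 (crit n - \<bar>x\<bar>) \<le> 256 / crit n ^ 3" .
  have "x\<^sup>2 / 2 * moment 2 (crit n - \<bar>x\<bar>) \<le> x\<^sup>2 / 2 * (256 / crit n ^ 3)"
    using m2 by (intro mult_left_mono) auto
  also have "\<dots> = 128 * (y\<^sup>2 * (1 / ((sd n)\<^sup>2 * crit n ^ 3)))" using c unfolding x2 by (simp add: field_simps)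
  also have "\<dots> \<le> 128 * (2\<^sup>2 * exp 4)"
  proof (intro mult_left_mono mult_mono)
    show "y\<^sup>2 \<le> 2\<^sup>2" using y by (metis power2_abs power_mono abs_ge_zero)
    have "exp (- 4) \<le> (sd n)\<^sup>2 * crit n ^ 3"
      using sdev_bounds(1)[OF c(1,2)] c by (simp add: field_simps)
    then have "exp 4 * exp (- 4) \<le> exp 4 * ((sd n)\<^sup>2 * crit n ^ 3)" by (intro mult_left_mono) auto
    then have "1 \<le> exp 4 * ((sd n)\<^sup>2 * crit n ^ 3)" by (simp add: exp_add[symmetric])
    then show "1 / ((sd n)\<^sup>2 * crit n ^ 3) \<le> exp 4"
      using c by (subst pos_divide_le_eq) (auto intro!: mult_pos_pos)
  qed (use c in auto)
  finally have A: "x\<^sup>2 / 2 * moment 2 (crit n - \<bar>x\<bar>) \<le> 512 * exp 4" by simp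
  have "F (crit n + x) - F (crit n) + y * real n / sd n
      \<le> - x * moment 1 (crit n) + x\<^sup>2 / 2 * moment 2 (crit n - \<bar>x\<bar>) + y * real n / sd n"
    using F_expand_upper[of x "crit n"] x c by simp
  also have "\<dots> = - y * ((moment 1 (crit n) - real n) / sd n) + x\<^sup>2 / 2 * moment 2 (crit n - \<bar>x\<bar>)"
    using c by (simp add: x_def field_simps)
  also have "- y * ((moment 1 (crit n) - real n) / sd n) \<le> \<bar>y\<bar> * \<bar>(moment 1 (crit n) - real n) / sd n\<bar>"
    using abs_ge_minus_self[of "y * ((moment 1 (crit n) - real n) / sd n)"] by (simp only: abs_mult mult_minus_left)
  also have "\<dots> \<le> 2 * 1" using n y by (intro mult_mono) (auto simp: regular_def)
  finally have "F (crit n + x) - F (crit n) + y * real n / sd n \<le> 2 + 512 * exp 4" using A by linarith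
  then show ?thesis by (simp add: laplace_def laplace_bound_def x_def)
qed

text \<open>\<open>F\<close> lies above its tangent, and the first order term is at most 2 in
  modulus.\<close>

lemma laplace_lower:
  assumes n: "regular n" and y: "\<bar>y\<bar> \<le> 2"
  shows "exp (- 2) \<le> laplace n y"
proof -
  note c = regular_pos[OF n]
  define x where "x = y / sd n"
  have "- x * moment 1 (crit n) \<le> F (crit n + x) - F (crit n)"
    using shift_small(2)[OF n y] c by (intro F_expand_lower) (auto simp: x_def)
  moreover have "- y * ((moment 1 (crit n) - real n) / sd n) = - x * moment 1 (crit n) + y * real n / sd n"
    using c by (simp add: x_def field_simps)
  moreover have "\<bar>y * ((moment 1 (crit n) - real n) / sd n)\<bar> \<le> 2 * 1"
    unfolding abs_mult using n y by (intro mult_mono) (auto simp: regular_def)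
  ultimately have "- 2 \<le> F (crit n + x) - F (crit n) + y * real n / sd n" by linarith
  then show ?thesis by (simp add: laplace_def x_def)
qed

text \<open>The complex Laplace transform of the signed measure with mass
  \<open>level_prob (crit n) m * \<gamma> n m\<close> at \<open>xi n m\<close>; on the imaginary
  axis it is a Fourier transform.\<close>

definition ctransform :: "(nat \<Rightarrow> nat \<Rightarrow> real) \<Rightarrow> nat \<Rightarrow> complex \<Rightarrow> complex" where
  "ctransform \<gamma> n z = (\<Sum>m. complex_of_real (level_prob (crit n) m * \<gamma> n m) * exp (- z * complex_of_real (xi n m)))"

definition strip :: "complex set" where
  "strip = {z. \<bar>Re z\<bar> < 2}"

lemma open_strip: "open strip"
  unfolding strip_def by (intro open_Collect_less continuous_intros)

lemma connected_strip: "connected strip"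
proof -
  have eq: "strip = {z. Re z < 2} \<inter> {z. Re z > - 2}" by (auto simp: strip_def abs_less_iff)
  then have "convex strip"
    unfolding eq by (intro convex_Int convex_halfspace_Re_lt convex_halfspace_Re_gt)
  then show ?thesis by (rule convex_connected)
qed

context
  fixes \<gamma> :: "nat \<Rightarrow> nat \<Rightarrow> real"
  assumes \<gamma>: "\<And>n m. \<bar>\<gamma> n m\<bar> \<le> 1"
begin

lemma ctransform_term_bound:
  "norm (complex_of_real (level_prob (crit n) m * \<gamma> n m) * exp (- z * complex_of_real (xi n m)))
    \<le> level_prob (crit n) m * exp (- Re z * xi n m)"
proof -
  have "norm (exp (- z * complex_of_real (xi n m))) = exp (- Re z * xi n m)"
    unfolding exp_cmod by simp
  moreover have "\<bar>level_prob (crit n) m * \<gamma> n m\<bar> \<le> level_prob (crit n) m * 1"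
    unfolding abs_mult using \<gamma> level_prob_nonneg by (intro mult_mono) auto
  ultimately show ?thesis unfolding norm_mult norm_of_real by (simp add: mult_right_mono)
qed

lemma ctransform_summable:
  assumes n: "regular n" and z: "\<bar>Re z\<bar> \<le> 2"
  shows "summable (\<lambda>m. norm (complex_of_real (level_prob (crit n) m * \<gamma> n m) * exp (- z * complex_of_real (xi n m))))"
  by (rule summable_comparison_test'[OF sums_summable[OF laplace_sums[OF n z]], of 0])
    (simp only: real_norm_def abs_norm_cancel ctransform_term_bound)

lemma ctransform_bound:
  assumes n: "regular n" and z: "\<bar>Re z\<bar> \<le> 2"
  shows "norm (ctransform \<gamma> n z) \<le> laplace_bound"
proof -
  have "norm (ctransform \<gamma> n z) \<le> (\<Sum>m. norm (complex_of_real (level_prob (crit n) m * \<gamma> n m) * exp (- z * complex_of_real (xi n m))))"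
    unfolding ctransform_def by (rule summable_norm[OF ctransform_summable[OF n z]])
  also have "\<dots> \<le> (\<Sum>m. level_prob (crit n) m * exp (- Re z * xi n m))"
    by (rule suminf_le[OF ctransform_term_bound ctransform_summable[OF n z] sums_summable[OF laplace_sums[OF n z]]])
  also have "\<dots> = laplace n (Re z)" using sums_unique[OF laplace_sums[OF n z]] by simp
  also have "\<dots> \<le> laplace_bound" by (rule laplace_upper[OF n z])
  finally show ?thesis .
qed

text \<open>Up to an exponential factor the transform is a power series in
  \<open>exp (- z / sd n)\<close>. It converges in the disc of radius
  \<open>exp (crit n / 2)\<close>, since the partition series still converges at time
  \<open>crit n / 2\<close>, and \<open>regular\<close> keeps the image of the strip inside this
  disc.\<close>

lemma ctransform_holomorphic:
  assumes n: "regular n" shows "ctransform \<gamma> n holomorphic_on strip"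
proof -
  note c = regular_pos[OF n]
  define \<rho> where "\<rho> = exp (crit n / 2)"
  let ?a = "\<lambda>m. complex_of_real (level_prob (crit n) m * \<gamma> n m)"
  have summ: "summable (\<lambda>m. ?a m * w ^ m)" if w: "norm w < \<rho>" for w
  proof (rule summable_comparison_test')
    have "summable (\<lambda>m. exp (- F (crit n)) * (pcount m * exp (- (crit n / 2) * real m)))"
      using c by (intro summable_mult sums_summable[OF partition_generating_function]) simp
    moreover have "exp (- F (crit n)) * (pcount m * exp (- (crit n / 2) * real m)) = level_prob (crit n) m * \<rho> ^ m" for m
    proof -
      have "\<rho> ^ m = exp (crit n / 2 * real m)" unfolding \<rho>_def by (rule exp_of_nat2_mult[symmetric])
      moreover have "exp (- crit n * real m - F (crit n)) * exp (crit n / 2 * real m) = exp (- F (crit n)) * exp (- (crit n / 2) * real m)"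
        unfolding exp_add[symmetric] by (simp add: field_simps)
      ultimately show ?thesis unfolding level_prob_def by (simp only:) (rule mult_swap[symmetric])
    qed
    ultimately show "summable (\<lambda>m. level_prob (crit n) m * \<rho> ^ m)" by (simp only:)
    fix m
    have "\<bar>level_prob (crit n) m * \<gamma> n m\<bar> \<le> level_prob (crit n) m * 1"
      unfolding abs_mult using \<gamma> level_prob_nonneg by (intro mult_mono) auto
    moreover have "norm w ^ m \<le> \<rho> ^ m" using w by (intro power_mono) auto
    ultimately show "norm (?a m * w ^ m) \<le> level_prob (crit n) m * \<rho> ^ m"
      unfolding norm_mult norm_power norm_of_real using level_prob_nonneg by (intro mult_mono) auto
  qed
  have hol: "(\<lambda>w. \<Sum>m. ?a m * w ^ m) holomorphic_on ball 0 \<rho>" by (rule holomorphic_powser[OF summ])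
  let ?w = "\<lambda>z. exp (- z / complex_of_real (sd n))"
  have "?w holomorphic_on strip" by (intro holomorphic_intros) (use c in auto)
  moreover have img: "norm (?w z) < \<rho>" if "z \<in> strip" for z
  proof -
    have "norm (?w z) = exp (- Re z / sd n)" unfolding exp_cmod by simp
    have "- Re z / sd n < 2 / sd n" using that c by (intro divide_strict_right_mono) (auto simp: strip_def)
    also have "2 / sd n \<le> crit n / 2" using n unfolding regular_def by blast
    finally have "exp (- Re z / sd n) < \<rho>" unfolding \<rho>_def by (simp only: exp_less_mono)
    then show ?thesis using \<open>norm (?w z) = exp (- Re z / sd n)\<close> by (simp only:)
  qed
  then have "?w ` strip \<subseteq> ball 0 \<rho>" by auto
  ultimately have "((\<lambda>w. \<Sum>m. ?a m * w ^ m) \<circ> ?w) holomorphic_on strip"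
    by (rule holomorphic_on_compose_gen[OF _ hol])
  then have "(\<lambda>z. exp (z * of_real (real n / sd n)) * ((\<lambda>w. \<Sum>m. ?a m * w ^ m) \<circ> ?w) z) holomorphic_on strip"
    by (intro holomorphic_on_mult holomorphic_intros)
  moreover have "exp (z * of_real (real n / sd n)) * ((\<lambda>w. \<Sum>m. ?a m * w ^ m) \<circ> ?w) z = ctransform \<gamma> n z" if z: "z \<in> strip" for z
  proof -
    have "exp (z * of_real (real n / sd n)) * (?a m * ?w z ^ m) = ?a m * exp (- z * complex_of_real (xi n m))" for m
    proof -
      have "?w z ^ m = exp (- z / complex_of_real (sd n) * of_nat m)" by (rule exp_of_nat2_mult[symmetric])
      moreover have "z * of_real (real n / sd n) + - z / complex_of_real (sd n) * of_nat m = - z * complex_of_real (xi n m)"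
        using c by (simp add: xi_def field_simps)
      ultimately have "exp (z * of_real (real n / sd n)) * ?w z ^ m = exp (- z * complex_of_real (xi n m))"
        by (simp only: exp_add[symmetric])
      then show ?thesis by (simp only: mult.left_commute)
    qed
    then show ?thesis unfolding ctransform_def o_def
      using suminf_mult[OF summ[OF img[OF z]], of "exp (z * of_real (real n / sd n))"] by (simp only:)
  qed
  ultimately show ?thesis by (rule holomorphic_transform)
qed

text \<open>
  The exponential family sees \<open>\<gamma>\<close> only through its Laplace transform on a real segment; normality of
  the transforms on the strip propagates the convergence to the imaginary axis.
\<close>

lemma ctransform_imaginary_tendsto:
  assumes conv: "\<And>y. 0 \<le> y \<Longrightarrow> y \<le> 1 \<Longrightarrow> (\<lambda>n. \<Sum>m. level_prob (crit n + y / sd n) m * \<gamma> n m) \<longlonglongrightarrow> 0"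
  shows "(\<lambda>n. ctransform \<gamma> n (\<i> * of_real v)) \<longlonglongrightarrow> 0"
proof (rule ccontr)
  \<comment> \<open>Montel's theorem gives limits along subsequences only, so a subsequence bounded
    away from zero is fixed first.\<close>
  assume no: "\<not> (\<lambda>n. ctransform \<gamma> n (\<i> * of_real v)) \<longlonglongrightarrow> 0"
  obtain N where N: "\<And>n. n \<ge> N \<Longrightarrow> regular n" using eventually_regular unfolding eventually_sequentially by blast
  obtain e q where e: "e > 0" and q: "strict_mono (q :: nat \<Rightarrow> nat)" "\<And>k. q k \<ge> N"
    and big: "\<And>k. e \<le> norm (ctransform \<gamma> (q k) (\<i> * of_real v))"
  proof (rule not_tendsto_0_subseq[OF no, of N])
    fix e q
    assume a: "e > 0" "strict_mono (q :: nat \<Rightarrow> nat)" "\<And>k. q k \<ge> N"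
      "\<And>k. e \<le> norm (ctransform \<gamma> (q k) (\<i> * of_real v))"
    show thesis by (rule that[OF a])
  qed
  have reg: "regular (q k)" for k by (rule N[OF q(2)])
  define \<H> where "\<H> = {h. h holomorphic_on strip \<and> (\<forall>z\<in>strip. norm (h z) \<le> laplace_bound)}"
  have hol: "h holomorphic_on strip" if "h \<in> \<H>" for h using that by (simp add: \<H>_def)
  have bdd: "\<exists>B. \<forall>h\<in>\<H>. \<forall>z\<in>K. norm (h z) \<le> B" if "compact K" "K \<subseteq> strip" for K
    using that(2) unfolding \<H>_def by (intro exI[of _ laplace_bound]) blast
  have rng: "range (\<lambda>k. ctransform \<gamma> (q k)) \<subseteq> \<H>"
  proof (rule image_subsetI)
    fix k
    show "ctransform \<gamma> (q k) \<in> \<H>" unfolding \<H>_def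
      using ctransform_holomorphic[OF reg[of k]] ctransform_bound[OF reg[of k]] by (auto simp: strip_def)
  qed
  obtain g r where g: "g holomorphic_on strip" and r: "strict_mono (r :: nat \<Rightarrow> nat)"
    and lim: "\<And>x. x \<in> strip \<Longrightarrow> (\<lambda>k. ctransform \<gamma> (q (r k)) x) \<longlonglongrightarrow> g x"
  proof (rule Montel[OF open_strip hol bdd rng])
    fix g r
    assume a: "g holomorphic_on strip" "strict_mono (r :: nat \<Rightarrow> nat)"
      and l: "\<And>x. x \<in> strip \<Longrightarrow> (\<lambda>n. ctransform \<gamma> (q (r n)) x) \<longlonglongrightarrow> g x"
    show thesis by (rule that[OF a l])
  qed assumption+
  have g0: "g (of_real y) = 0" if y: "0 \<le> y" "y \<le> 1" for y
  proof -
    \<comment> \<open>The hypothesis \<open>conv\<close> concerns the tilted laws; the bounded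
      factor \<open>laplace n y\<close> turns it into a statement on the transform at the real point
      \<open>y\<close>.\<close>
    have "(\<lambda>n. laplace n y * (\<Sum>m. level_prob (crit n + y / sd n) m * \<gamma> n m)) \<longlonglongrightarrow> 0"
    proof (rule Lim_null_comparison)
      show "\<forall>\<^sub>F n in sequentially. norm (laplace n y * (\<Sum>m. level_prob (crit n + y / sd n) m * \<gamma> n m))
          \<le> laplace_bound * \<bar>\<Sum>m. level_prob (crit n + y / sd n) m * \<gamma> n m\<bar>"
        using eventually_regular
      proof eventually_elim
        case (elim n)
        have "laplace n y \<le> laplace_bound" "0 \<le> laplace n y"
          using laplace_upper[OF elim, of y] y by (auto simp: laplace_def)
        then show ?case by (simp add: abs_mult mult_right_mono)
      qed
      have "(\<lambda>n. laplace_bound * \<bar>\<Sum>m. level_prob (crit n + y / sd n) m * \<gamma> n m\<bar>) \<longlonglongrightarrow> laplace_bound * \<bar>0\<bar>"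
        by (intro tendsto_intros conv y)
      then show "(\<lambda>n. laplace_bound * \<bar>\<Sum>m. level_prob (crit n + y / sd n) m * \<gamma> n m\<bar>) \<longlonglongrightarrow> 0" by simp
    qed
    from tendsto_of_real[OF this]
    have l0: "(\<lambda>n. complex_of_real (laplace n y * (\<Sum>m. level_prob (crit n + y / sd n) m * \<gamma> n m))) \<longlonglongrightarrow> 0" by simp
    have eq: "complex_of_real (laplace n y * (\<Sum>m. level_prob (crit n + y / sd n) m * \<gamma> n m)) = ctransform \<gamma> n (of_real y)"
      if n: "regular n" for n
    proof -
      have y2: "\<bar>y\<bar> \<le> 2" using y by simp
      have sm: "summable (\<lambda>m. level_prob (crit n + y / sd n) m * \<gamma> n m)"
      proof (rule summable_comparison_test'[OF level_prob_summable[OF shift_small(2)[OF n y2]], of 0])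
        show "norm (level_prob (crit n + y / sd n) m * \<gamma> n m) \<le> level_prob (crit n + y / sd n) m" for m
          using \<gamma>[of n m] by (simp add: abs_mult level_prob_nonneg mult_left_le)
      qed
      have "complex_of_real (level_prob (crit n) m * \<gamma> n m) * exp (- complex_of_real y * complex_of_real (xi n m))
          = complex_of_real (laplace n y * (level_prob (crit n + y / sd n) m * \<gamma> n m))" for m
      proof -
        have "exp (- complex_of_real y * complex_of_real (xi n m)) = complex_of_real (exp (- y * xi n m))"
          by (simp only: of_real_minus[symmetric] of_real_mult[symmetric] exp_of_real)
        then show ?thesis by (simp only: of_real_mult[symmetric] mult_swap'[OF level_prob_tilt[OF n]])
      qed
      then have "ctransform \<gamma> n (of_real y) = (\<Sum>m. complex_of_real (laplace n y * (level_prob (crit n + y / sd n) m * \<gamma> n m)))"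
        unfolding ctransform_def by (simp only:)
      also have "\<dots> = complex_of_real (\<Sum>m. laplace n y * (level_prob (crit n + y / sd n) m * \<gamma> n m))"
        by (rule suminf_of_real[symmetric]) (intro summable_mult sm)
      also have "\<dots> = complex_of_real (laplace n y * (\<Sum>m. level_prob (crit n + y / sd n) m * \<gamma> n m))"
        by (simp only: suminf_mult[OF sm])
      finally show ?thesis by simp
    qed
    have "strict_mono (q \<circ> r)" using q(1) r by (rule strict_mono_o)
    from LIMSEQ_subseq_LIMSEQ[OF l0 this]
    have "(\<lambda>k. ctransform \<gamma> (q (r k)) (of_real y)) \<longlonglongrightarrow> 0" by (simp only: o_def eq[OF reg])
    moreover have "of_real y \<in> strip" using y by (simp add: strip_def)
    ultimately show ?thesis using lim LIMSEQ_unique by blast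
  qed
  have "g (\<i> * of_real v) = 0"
  proof (rule analytic_continuation[OF g open_strip connected_strip])
    show "complex_of_real ` {0..1} \<subseteq> strip" by (auto simp: strip_def)
    show "0 \<in> strip" by (simp add: strip_def)
    show "0 islimpt complex_of_real ` {0..1}"
      unfolding islimpt_approachable
    proof (intro allI impI)
      fix e :: real assume e: "e > 0"
      define x where "x = min (e / 2) (1 / 2)"
      have "0 < x" "x < 1" "x < e" using e by (auto simp: x_def)
      then show "\<exists>x'\<in>complex_of_real ` {0..1}. x' \<noteq> 0 \<and> dist x' 0 < e"
        by (intro bexI[of _ "complex_of_real x"]) auto
    qed
    show "g z = 0" if "z \<in> complex_of_real ` {0..1}" for z using that g0 by auto
    show "\<i> * of_real v \<in> strip" by (simp add: strip_def)
  qed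
  then have "(\<lambda>k. norm (ctransform \<gamma> (q (r k)) (\<i> * of_real v))) \<longlonglongrightarrow> norm (0 :: complex)"
    using lim[of "\<i> * of_real v"] by (intro tendsto_norm) (simp add: strip_def)
  then have "e \<le> norm (0 :: complex)"
    by (rule LIMSEQ_le_const) (use big in blast)
  then show False using e by simp
qed

end

end

section \<open>Levy continuity and averages over windows\<close>

lemma std_normal_Ioc_pos:
  assumes "x < y" shows "measure std_normal_distribution {x<..y} > 0"
proof -
  interpret real_distribution std_normal_distribution by (rule real_dist_normal_dist)
  have "measure std_normal_distribution {x<..y} \<noteq> 0"
  proof
    assume "measure std_normal_distribution {x<..y} = 0"
    then have "emeasure std_normal_distribution {x<..y} = 0" by (simp add: emeasure_eq_measure)
    then have "(\<integral>\<^sup>+ v. ennreal (std_normal_density v) * indicator {x<..y} v \<partial>lborel) = 0"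
      by (simp add: emeasure_density)
    then have "AE v in lborel. ennreal (std_normal_density v) * indicator {x<..y} v = 0"
      by (subst (asm) nn_integral_0_iff_AE) auto
    then have "AE v in lborel. v \<notin> {x<..y}"
    proof eventually_elim
      case (elim v)
      have "std_normal_density v > 0" by (rule normal_density_pos) simp
      then show ?case using elim by (auto simp: indicator_def)
    qed
    moreover have "{v \<in> space lborel. \<not> v \<notin> {x<..y}} = {x<..y}" by auto
    ultimately have "emeasure lborel {x<..y} = 0" using AE_iff_measurable[of "{x<..y}" lborel "\<lambda>v. v \<notin> {x<..y}"] by simp
    then show False using assms by simp
  qed
  then show ?thesis using measure_nonneg[of std_normal_distribution "{x<..y}"] by linarith
qed

lemma isCont_cdf_std_normal: "isCont (cdf std_normal_distribution) x"
proof -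
  interpret real_distribution std_normal_distribution by (rule real_dist_normal_dist)
  have "emeasure std_normal_distribution {x} = (\<integral>\<^sup>+ v. ennreal (std_normal_density v) * indicator {x} v \<partial>lborel)"
    by (simp add: emeasure_density)
  also have "\<dots> = 0" by (subst nn_integral_0_iff_AE) (auto intro!: AE_I'[of "{x}"] simp: null_sets_def indicator_def)
  finally show ?thesis unfolding isCont_cdf by (simp add: measure_def)
qed

text \<open>Levy's theorem for the laws with mass \<open>w n m\<close> at \<open>x n m\<close>. The
  normal distribution has no atoms, so its distribution function is the limit at every point and the
  masses of all half-open intervals converge.\<close>

lemma weighted_points_levy:
  fixes w :: "nat \<Rightarrow> nat \<Rightarrow> real" and x :: "nat \<Rightarrow> nat \<Rightarrow> real"
  assumes nn: "\<And>n m. w n m \<ge> 0" and one: "\<And>n. w n sums 1"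
    and char: "\<And>v. (\<lambda>n. \<Sum>m. complex_of_real (w n m) * iexp (v * x n m)) \<longlonglongrightarrow> complex_of_real (exp (- (v\<^sup>2 / 2)))"
    and fin: "\<And>n. finite {m. a < x n m \<and> x n m \<le> b}" and ab: "a < b"
  shows "(\<lambda>n. \<Sum>m | a < x n m \<and> x n m \<le> b. w n m) \<longlonglongrightarrow> measure std_normal_distribution {a<..b}"
proof -
  define P where "P n = embed_pmf (w n)" for n
  have pmf: "pmf (P n) m = w n m" for n m
    unfolding P_def
  proof (rule pmf_embed_pmf[OF nn])
    have "(\<integral>\<^sup>+ m. ennreal (w n m) \<partial>count_space UNIV) = (\<Sum>m. ennreal (w n m))" by (rule nn_integral_count_space_nat)
    also have "\<dots> = ennreal (\<Sum>m. w n m)" by (rule suminf_ennreal2[OF nn sums_summable[OF one]])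
    finally show "(\<integral>\<^sup>+ m. ennreal (w n m) \<partial>count_space UNIV) = 1" using sums_unique[OF one[of n]] by simp
  qed
  define N where "N n = distr (measure_pmf (P n)) borel (x n)" for n
  have rd: "real_distribution (N n)" for n
    unfolding N_def real_distribution_def real_distribution_axioms_def
    by (auto intro!: measure_pmf.prob_space_distr)
  have "char (N n) v = (\<Sum>m. complex_of_real (w n m) * iexp (v * x n m))" for n v
  proof -
    have "char (N n) v = (\<integral>m. iexp (v * x n m) \<partial>measure_pmf (P n))"
      unfolding char_def N_def by (subst integral_distr) auto
    also have "\<dots> = (\<integral>m. pmf (P n) m *\<^sub>R iexp (v * x n m) \<partial>count_space UNIV)"
      unfolding measure_pmf_eq_density by (subst integral_density) auto
    also have "\<dots> = (\<Sum>m. pmf (P n) m *\<^sub>R iexp (v * x n m))"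
    proof (rule integral_count_space_nat)
      have "integrable (count_space UNIV) (w n)"
        unfolding integrable_count_space_nat_iff using nn sums_summable[OF one[of n]] by simp
      then show "integrable (count_space UNIV) (\<lambda>m. pmf (P n) m *\<^sub>R iexp (v * x n m))"
        by (rule Bochner_Integration.integrable_bound) (auto simp: pmf)
    qed
    also have "\<dots> = (\<Sum>m. complex_of_real (w n m) * iexp (v * x n m))" by (simp only: pmf scaleR_conv_of_real)
    finally show ?thesis .
  qed
  then have "(\<lambda>n. char (N n) v) \<longlonglongrightarrow> char std_normal_distribution v" for v
    using char[of v] by (simp add: char_std_normal_distribution)
  then have wc: "weak_conv_m N std_normal_distribution"
    by (rule levy_continuity[OF rd real_dist_normal_dist])
  have cdf: "(\<lambda>n. cdf (N n) y) \<longlonglongrightarrow> cdf std_normal_distribution y" for y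
    using wc isCont_cdf_std_normal unfolding weak_conv_m_def weak_conv_def by blast
  have fb: "finite_borel_measure (N n)" for n
    using rd[of n] by (rule real_distribution.finite_borel_measure_M)
  have fs: "finite_borel_measure std_normal_distribution"
    using real_dist_normal_dist by (rule real_distribution.finite_borel_measure_M)
  have "(\<lambda>n. cdf (N n) b - cdf (N n) a) \<longlonglongrightarrow> cdf std_normal_distribution b - cdf std_normal_distribution a"
    by (intro tendsto_diff cdf)
  then have "(\<lambda>n. measure (N n) {a<..b}) \<longlonglongrightarrow> measure std_normal_distribution {a<..b}"
    by (simp only: finite_borel_measure.cdf_diff_eq[OF fb ab] finite_borel_measure.cdf_diff_eq[OF fs ab])
  moreover have "measure (N n) {a<..b} = (\<Sum>m | a < x n m \<and> x n m \<le> b. w n m)" for n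
  proof -
    have "measure (N n) {a<..b} = measure (measure_pmf (P n)) {m. a < x n m \<and> x n m \<le> b}"
      unfolding N_def by (subst measure_distr) (auto simp: vimage_def)
    also have "\<dots> = (\<Sum>m | a < x n m \<and> x n m \<le> b. w n m)"
      using measure_measure_pmf_finite[OF fin, of "P n" n] by (simp add: pmf[abs_def])
    finally show ?thesis .
  qed
  ultimately show ?thesis by simp
qed

context exponential_array
begin

definition window :: "nat \<Rightarrow> real \<Rightarrow> real \<Rightarrow> nat set" where
  "window n a b = {m. a < xi n m \<and> xi n m \<le> b}"

lemma finite_window: "finite (window n a b)" if "n \<ge> 2"
proof -
  have s: "sd n > 0" using sdev_bounds(3)[OF crit_bounds(1)[OF that] crit_bounds(2)[OF that]] .
  have "m \<le> nat \<lceil>real n + b * sd n\<rceil>" if "m \<in> window n a b" for m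
  proof -
    have "real m - real n \<le> b * sd n" using that s by (simp add: window_def xi_def field_simps)
    then show ?thesis by linarith
  qed
  then show ?thesis by (intro finite_subset[of "window n a b" "{..nat \<lceil>real n + b * sd n\<rceil>}"]) auto
qed

lemma scaled_char_sums:
  assumes n: "n \<ge> 2"
  shows "(\<lambda>m. complex_of_real (level_prob (crit n) m) * iexp (v * xi n m)) sums scaled_char n v"
proof -
  have c: "crit n > 0" by (rule crit_bounds(1)[OF n])
  have "(\<lambda>m. complex_of_real (level_prob (crit n) m) * iexp (v / sd n * real m) * iexp (- (v / sd n) * real n)) sums scaled_char n v"
    unfolding scaled_char_def level_char_def
    by (intro sums_mult2 summable_sums level_char_summable c)
  moreover have "complex_of_real (level_prob (crit n) m) * iexp (v / sd n * real m) * iexp (- (v / sd n) * real n)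
      = complex_of_real (level_prob (crit n) m) * iexp (v * xi n m)" for m
  proof -
    have "v / sd n * real m + - (v / sd n) * real n = v * xi n m" by (simp add: xi_def right_diff_distrib diff_divide_distrib)
    then have "iexp (v / sd n * real m) * iexp (- (v / sd n) * real n) = iexp (v * xi n m)"
      unfolding exp_add[symmetric] distrib_left[symmetric] of_real_add[symmetric] by (simp only:)
    then show ?thesis by (simp only: mult.assoc)
  qed
  ultimately show ?thesis by (simp only:)
qed

text \<open>The weights \<open>1 + \<beta>\<close> keep the total mass \<open>T\<close> at least
  one, so that it can be normalised even if \<open>b = 0\<close>. The transform tends to
  \<open>1 + b\<close> times the Gaussian one, as the contribution of \<open>\<beta> - b\<close>
  vanishes on the imaginary axis.\<close>

lemma window_sum_weighted:
  assumes \<beta>: "\<And>n m. 0 \<le> \<beta> n m" "\<And>n m. \<beta> n m \<le> 1" and b: "0 \<le> b" "b \<le> 1"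
    and conv: "\<And>y. 0 \<le> y \<Longrightarrow> y \<le> 1 \<Longrightarrow> (\<lambda>n. \<Sum>m. level_prob (crit n + y / sd n) m * (\<beta> n m - b)) \<longlonglongrightarrow> 0"
    and xy: "x < y"
  shows "(\<lambda>n. \<Sum>m\<in>window n x y. level_prob (crit n) m * (1 + \<beta> n m)) \<longlonglongrightarrow> (1 + b) * measure std_normal_distribution {x<..y}"
proof -
  define \<gamma> where "\<gamma> n m = \<beta> n m - b" for n m
  have \<gamma>: "\<bar>\<gamma> n m\<bar> \<le> 1" for n m using \<beta>(1)[of n m] \<beta>(2)[of n m] b unfolding \<gamma>_def by linarith
  have conv': "\<And>y. 0 \<le> y \<Longrightarrow> y \<le> 1 \<Longrightarrow> (\<lambda>n. \<Sum>m. level_prob (crit n + y / sd n) m * \<gamma> n m) \<longlonglongrightarrow> 0"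
    unfolding \<gamma>_def by (rule conv)
  have H: "(\<lambda>n. ctransform \<gamma> n (\<i> * of_real v)) \<longlonglongrightarrow> 0" for v
    by (rule ctransform_imaginary_tendsto[OF \<gamma> conv'])
  obtain N0 where N0: "\<And>n. n \<ge> N0 \<Longrightarrow> regular n" using eventually_regular unfolding eventually_sequentially by blast
  define N where "N = max N0 2"
  \<comment> \<open>\<open>weighted_points_levy\<close> takes a full sequence of probability laws,
    so an initial segment of sizes is skipped.\<close>
  define k where "k n = n + N" for n :: nat
  have reg: "regular (k n)" "k n \<ge> 2" for n using N0[of "k n"] by (auto simp: k_def N_def)
  \<comment> \<open>The sign of \<open>v\<close> is reversed because the kernel of
    \<open>ctransform\<close> is \<open>exp (- z * xi)\<close>.\<close>
  define W where "W n v = (1 + complex_of_real b) * scaled_char n v + ctransform \<gamma> n (\<i> * of_real (- v))" for n v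
  have Wsum: "(\<lambda>m. complex_of_real (level_prob (crit (k n)) m * (1 + \<beta> (k n) m)) * iexp (v * xi (k n) m)) sums W (k n) v" for n v
  proof -
    have "summable (\<lambda>m. complex_of_real (level_prob (crit (k n)) m * \<gamma> (k n) m) * exp (- (\<i> * of_real (- v)) * complex_of_real (xi (k n) m)))"
      by (rule summable_norm_cancel[OF ctransform_summable[OF \<gamma> reg(1)]]) simp
    then have "(\<lambda>m. complex_of_real (level_prob (crit (k n)) m * \<gamma> (k n) m) * exp (- (\<i> * of_real (- v)) * complex_of_real (xi (k n) m))) sums ctransform \<gamma> (k n) (\<i> * of_real (- v))"
      unfolding ctransform_def by (rule summable_sums)
    moreover have "exp (- (\<i> * of_real (- v)) * complex_of_real (xi (k n) m)) = iexp (v * xi (k n) m)" for m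
      by (simp add: mult.assoc)
    ultimately have "(\<lambda>m. complex_of_real (level_prob (crit (k n)) m * \<gamma> (k n) m) * iexp (v * xi (k n) m)) sums ctransform \<gamma> (k n) (\<i> * of_real (- v))"
      by (simp only:)
    from sums_add[OF sums_mult[OF scaled_char_sums[OF reg(2)[of n], of v], of "1 + complex_of_real b"] this]
    show ?thesis unfolding W_def by (simp add: \<gamma>_def algebra_simps)
  qed
  define T where "T n = (\<Sum>m. level_prob (crit (k n)) m * (1 + \<beta> (k n) m))" for n
  have sT: "summable (\<lambda>m. level_prob (crit (k n)) m * (1 + \<beta> (k n) m))" for n
  proof (rule summable_comparison_test')
    show "summable (\<lambda>m. level_prob (crit (k n)) m * 2)"
      by (intro summable_mult2 level_prob_summable regular_pos(1) reg)
    show "norm (level_prob (crit (k n)) m * (1 + \<beta> (k n) m)) \<le> level_prob (crit (k n)) m * 2" for m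
      using \<beta>(1)[of "k n" m] \<beta>(2)[of "k n" m] level_prob_nonneg by (simp add: abs_mult mult_left_mono)
  qed
  have T1: "1 \<le> T n" for n
  proof -
    have "1 = (\<Sum>m. level_prob (crit (k n)) m)" using sums_unique[OF level_prob_sums[OF regular_pos(1)[OF reg(1)]]] .
    also have "\<dots> \<le> T n" unfolding T_def
      using \<beta>(1) level_prob_nonneg
      by (intro suminf_le sT level_prob_summable regular_pos(1) reg) (simp add: distrib_left)
    finally show ?thesis .
  qed
  have TW: "complex_of_real (T n) = W (k n) 0" for n
    using sums_unique[OF Wsum[of n 0]] sums_unique[OF sums_of_real[OF summable_sums[OF sT[of n]], where ?'a = complex]]
    by (simp add: T_def)
  have ktend: "filterlim k sequentially sequentially"
    unfolding k_def by (rule filterlim_add_const_nat_at_top)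
  have Wlim: "(\<lambda>n. W (k n) v) \<longlonglongrightarrow> complex_of_real ((1 + b) * exp (- (v\<^sup>2 / 2)))" for v
  proof -
    have "(\<lambda>n. W n v) \<longlonglongrightarrow> (1 + complex_of_real b) * complex_of_real (exp (- (v\<^sup>2 / 2))) + 0"
      unfolding W_def by (intro tendsto_intros scaled_char_tendsto H)
    then show ?thesis using filterlim_compose[OF _ ktend] by fastforce
  qed
  have Tlim: "T \<longlonglongrightarrow> 1 + b"
    using tendsto_Re[OF Wlim[of 0]] unfolding TW[symmetric] by simp
  define w where "w n m = level_prob (crit (k n)) m * (1 + \<beta> (k n) m) / T n" for n m
  have "(\<lambda>n. \<Sum>m | x < xi (k n) m \<and> xi (k n) m \<le> y. w n m) \<longlonglongrightarrow> measure std_normal_distribution {x<..y}"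
  proof (rule weighted_points_levy[OF _ _ _ _ xy])
    show "w n m \<ge> 0" for n m
      using T1[of n] \<beta>(1)[of "k n" m] level_prob_nonneg[of "crit (k n)" m] by (simp add: w_def)
    show "w n sums 1" for n
    proof -
      have "w n sums (T n / T n)" unfolding w_def T_def by (intro sums_divide summable_sums sT)
      then show ?thesis using T1[of n] by simp
    qed
    show "finite {m. x < xi (k n) m \<and> xi (k n) m \<le> y}" for n
      using finite_window[OF reg(2)[of n], of x y] by (simp add: window_def)
    fix v
    have "(\<Sum>m. complex_of_real (w n m) * iexp (v * xi (k n) m)) = W (k n) v / complex_of_real (T n)" for n
    proof -
      have "(\<lambda>m. complex_of_real (level_prob (crit (k n)) m * (1 + \<beta> (k n) m)) * iexp (v * xi (k n) m) / complex_of_real (T n)) sums (W (k n) v / complex_of_real (T n))"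
        by (intro sums_divide Wsum)
      from sums_unique[OF this] show ?thesis unfolding w_def of_real_divide by (simp only: times_divide_eq_left)
    qed
    moreover have "(\<lambda>n. W (k n) v / complex_of_real (T n)) \<longlonglongrightarrow> complex_of_real ((1 + b) * exp (- (v\<^sup>2 / 2))) / complex_of_real (1 + b)"
    proof (intro tendsto_divide Wlim tendsto_of_real Tlim)
      have "1 + b \<noteq> 0" using b by simp
      then show "complex_of_real (1 + b) \<noteq> 0" unfolding of_real_eq_0_iff .
    qed
    moreover have "complex_of_real ((1 + b) * exp (- (v\<^sup>2 / 2))) / complex_of_real (1 + b) = complex_of_real (exp (- (v\<^sup>2 / 2)))"
    proof -
      have "1 + b \<noteq> 0" using b by simp
      then show ?thesis unfolding of_real_divide[symmetric] by simp
    qed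
    ultimately show "(\<lambda>n. \<Sum>m. complex_of_real (w n m) * iexp (v * xi (k n) m)) \<longlonglongrightarrow> complex_of_real (exp (- (v\<^sup>2 / 2)))"
      by (simp only:)
  qed
  from tendsto_mult[OF Tlim this]
  have "(\<lambda>n. T n * (\<Sum>m\<in>window (k n) x y. w n m)) \<longlonglongrightarrow> (1 + b) * measure std_normal_distribution {x<..y}"
    by (simp only: window_def)
  moreover have "T n * (\<Sum>m\<in>window (k n) x y. w n m) = (\<Sum>m\<in>window (k n) x y. level_prob (crit (k n)) m * (1 + \<beta> (k n) m))" for n
    unfolding sum_distrib_left w_def using T1[of n] by (intro sum.cong refl) simp
  ultimately have "(\<lambda>n. \<Sum>m\<in>window (n + N) x y. level_prob (crit (n + N)) m * (1 + \<beta> (n + N) m)) \<longlonglongrightarrow> (1 + b) * measure std_normal_distribution {x<..y}"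
    by (simp only: k_def)
  then show ?thesis by (rule LIMSEQ_offset)
qed

lemma window_sum:
  assumes xy: "x < y"
  shows "(\<lambda>n. \<Sum>m\<in>window n x y. level_prob (crit n) m) \<longlonglongrightarrow> measure std_normal_distribution {x<..y}"
  using window_sum_weighted[of "\<lambda>_ _. 0" 0, OF _ _ _ _ _ xy] by simp

theorem window_sum_tendsto:
  assumes \<beta>: "\<And>n m. 0 \<le> \<beta> n m" "\<And>n m. \<beta> n m \<le> 1" and b: "0 \<le> b" "b \<le> 1"
    and conv: "\<And>y. 0 \<le> y \<Longrightarrow> y \<le> 1 \<Longrightarrow> (\<lambda>n. \<Sum>m. level_prob (crit n + y / sd n) m * (\<beta> n m - b)) \<longlonglongrightarrow> 0"
    and xy: "x < y"
  shows "(\<lambda>n. \<Sum>m\<in>window n x y. level_prob (crit n) m * \<beta> n m) \<longlonglongrightarrow> b * measure std_normal_distribution {x<..y}"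
proof -
  have "(\<lambda>n. (\<Sum>m\<in>window n x y. level_prob (crit n) m * (1 + \<beta> n m)) - (\<Sum>m\<in>window n x y. level_prob (crit n) m))
    \<longlonglongrightarrow> (1 + b) * measure std_normal_distribution {x<..y} - measure std_normal_distribution {x<..y}"
    by (rule tendsto_diff[OF window_sum_weighted[OF \<beta> b conv xy] window_sum[OF xy]])
  then show ?thesis by (simp add: sum_subtractf[symmetric] algebra_simps)
qed

end

section \<open>Stability of the scaling under tilting\<close>

text \<open>
  The uniform convergence theorem of Karamata. Averaging the truncated increments over an interval
  of lengths makes dominated convergence applicable, which is where measurability enters.
\<close>

lemma slowly_varying_increments:
  fixes f :: "real \<Rightarrow> real" and x x' :: "nat \<Rightarrow> real"
  assumes f [measurable]: "f \<in> borel_measurable borel"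
    and lim: "\<And>y. ((\<lambda>x. f (x + y) - f x) \<longlongrightarrow> 0) at_top"
    and x: "filterlim x at_top sequentially" and d: "(\<lambda>n. x' n - x n) \<longlonglongrightarrow> 0"
  shows "(\<lambda>n. f (x' n) - f (x n)) \<longlonglongrightarrow> 0"
proof -
  \<comment> \<open>A bounded substitute for the absolute value that still satisfies the triangle
    inequality (\<open>msub\<close>); the integrals over lengths then exist for every measurable
    \<open>f\<close>.\<close>
  define m where "m u = min 1 \<bar>u\<bar>" for u :: real
  have m0: "m u \<ge> 0" "m u \<le> 1" for u by (auto simp: m_def)
  have msub: "m (u - v) \<le> m (w - u) + m (w - v)" for u v w by (auto simp: m_def min_def)
  have mm [measurable]: "m \<in> borel_measurable borel" unfolding m_def by measurable
  define I where "I z = (\<integral>y. indicator {0..2} y * m (f (z + y) - f z) \<partial>lborel)" for z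
  have int: "integrable lborel (\<lambda>y. indicator {0..2} y * m (f (z + y) - f z))" for z
    by (rule Bochner_Integration.integrable_bound[where f = "indicator {0..2} :: real \<Rightarrow> real"])
      (use m0 in \<open>auto simp: indicator_def\<close>)
  have I0: "(\<lambda>n. I (z n)) \<longlonglongrightarrow> 0" if z: "filterlim z at_top sequentially" for z :: "nat \<Rightarrow> real"
  proof -
    have zero: "(\<lambda>_::real. 0::real) \<in> borel_measurable lborel" by simp
    have ms: "(\<lambda>y. indicator {0..2} y * m (f (z n + y) - f (z n))) \<in> borel_measurable lborel" for n
      by measurable
    have iw: "integrable lborel (indicator {0..2} :: real \<Rightarrow> real)" by simp
    have l: "AE y in lborel. (\<lambda>n. indicator {0..2} y * m (f (z n + y) - f (z n))) \<longlonglongrightarrow> 0"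
    proof (intro AE_I2)
      fix y :: real
      have "(\<lambda>n. f (z n + y) - f (z n)) \<longlonglongrightarrow> 0" by (rule filterlim_compose[OF lim z])
      then have "(\<lambda>n. indicator {0..2} y * min 1 \<bar>f (z n + y) - f (z n)\<bar>) \<longlonglongrightarrow> indicator {0..2} y * min 1 \<bar>0\<bar>"
        by (intro tendsto_intros)
      then show "(\<lambda>n. indicator {0..2} y * m (f (z n + y) - f (z n))) \<longlonglongrightarrow> 0" by (simp add: m_def)
    qed
    have bd: "AE y in lborel. norm (indicator {0..2} y * m (f (z n + y) - f (z n))) \<le> indicator {0..2} y" for n
      using m0 by (intro AE_I2) (auto simp: indicator_def)
    have "(\<lambda>n. I (z n)) \<longlonglongrightarrow> (\<integral>y. 0 \<partial>(lborel :: real measure))"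
      unfolding I_def by (rule integral_dominated_convergence[OF zero ms iw l bd])
    then show ?thesis by simp
  qed
  have x': "filterlim x' at_top sequentially"
  proof -
    have "filterlim (\<lambda>n. (x' n - x n) + x n) at_top sequentially"
      by (rule filterlim_tendsto_add_at_top[OF d x])
    then show ?thesis by simp
  qed
  \<comment> \<open>For a length \<open>y\<close> between 1/2 and 1 both \<open>y\<close> and
    \<open>y - \<delta>\<close> lie in \<open>{0..2}\<close>, and they lead from \<open>x n\<close>
    and \<open>x' n\<close> to the same point. Integrating the triangle inequality through that
    point bounds the increment.\<close>
  have key: "m (f (x n) - f (x' n)) / 2 \<le> I (x n) + I (x' n)" if dn: "\<bar>x' n - x n\<bar> \<le> 1 / 2" for n
  proof -
    define \<delta> where "\<delta> = x' n - x n"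
    let ?g = "\<lambda>y. indicator {0..2} y * m (f (x n + y) - f (x n))"
    let ?h = "\<lambda>y. indicator {0..2} y * m (f (x' n + y) - f (x' n))"
    have ih: "integrable lborel (\<lambda>y. ?h (- \<delta> + 1 * y))"
      by (rule lborel_integrable_real_affine[OF int]) simp
    have Ih: "I (x' n) = (\<integral>y. ?h (- \<delta> + 1 * y) \<partial>lborel)"
      unfolding I_def using lborel_integral_real_affine[of 1 ?h "- \<delta>"] by simp
    have "m (f (x n) - f (x' n)) / 2 = (\<integral>y. indicator {1/2..1::real} y * m (f (x n) - f (x' n)) \<partial>lborel)"
      by (simp add: content_real)
    also have "\<dots> \<le> (\<integral>y. ?g y + ?h (- \<delta> + 1 * y) \<partial>lborel)"
    proof (rule integral_mono)
      show "integrable lborel (\<lambda>y. indicator {1/2..1::real} y * m (f (x n) - f (x' n)))"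
        by (intro integrable_mult_left integrable_real_indicator emeasure_bounded_finite bounded_closed_interval) auto
      show "integrable lborel (\<lambda>y. ?g y + ?h (- \<delta> + 1 * y))"
        by (intro Bochner_Integration.integrable_add int ih)
      fix y :: real
      have nn: "?g y \<ge> 0" "?h (- \<delta> + 1 * y) \<ge> 0" using m0(1) by (auto simp: indicator_def)
      show "indicator {1/2..1::real} y * m (f (x n) - f (x' n)) \<le> ?g y + ?h (- \<delta> + 1 * y)"
      proof (cases "y \<in> {1/2..1}")
        case True
        have "- \<delta> + 1 * y \<in> {0..2}" "y \<in> {0..2}"
          using True dn abs_ge_self[of "x' n - x n"] abs_ge_minus_self[of "x' n - x n"]
          unfolding \<delta>_def atLeastAtMost_iff by linarith+
        moreover have "f (x' n + (- \<delta> + 1 * y)) = f (x n + y)" by (simp add: \<delta>_def)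
        ultimately have "?g y = m (f (x n + y) - f (x n))" "?h (- \<delta> + 1 * y) = m (f (x n + y) - f (x' n))"
          by simp_all
        then show ?thesis using True msub[of "f (x n)" "f (x' n)" "f (x n + y)"] by simp
      next
        case False
        then have "indicator {1/2..1::real} y = (0 :: real)" by (simp add: indicator_def)
        then show ?thesis using nn by simp
      qed
    qed
    also have "\<dots> = I (x n) + I (x' n)"
      unfolding Ih by (subst Bochner_Integration.integral_add[OF int ih]) (simp add: I_def)
    finally show ?thesis .
  qed
  have "(\<lambda>n. m (f (x n) - f (x' n))) \<longlonglongrightarrow> 0"
  proof (rule Lim_null_comparison)
    have "(\<lambda>n. \<bar>x' n - x n\<bar>) \<longlonglongrightarrow> \<bar>0\<bar>" by (intro tendsto_intros d)
    then have "\<forall>\<^sub>F n in sequentially. \<bar>x' n - x n\<bar> < 1 / 2" by (rule order_tendstoD) simp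
    then show "\<forall>\<^sub>F n in sequentially. norm (m (f (x n) - f (x' n))) \<le> 2 * (I (x n) + I (x' n))"
    proof eventually_elim
      case (elim n)
      then show ?case using key[of n] m0(1)[of "f (x n) - f (x' n)"] by simp
    qed
    have "(\<lambda>n. 2 * (I (x n) + I (x' n))) \<longlonglongrightarrow> 2 * (0 + 0)"
      by (intro tendsto_intros I0 x x')
    then show "(\<lambda>n. 2 * (I (x n) + I (x' n))) \<longlonglongrightarrow> 0" by simp
  qed
  then have ml: "(\<lambda>n. m (f (x n) - f (x' n))) \<longlonglongrightarrow> 0" .
  \<comment> \<open>Once below one, the truncation is inactive and \<open>m\<close> is the absolute
    value.\<close>
  then have "\<forall>\<^sub>F n in sequentially. m (f (x n) - f (x' n)) < 1" by (rule order_tendstoD) simp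
  then have "\<forall>\<^sub>F n in sequentially. norm (f (x' n) - f (x n)) \<le> m (f (x n) - f (x' n))"
    by eventually_elim (auto simp: m_def min_def abs_minus_commute split: if_splits)
  from Lim_null_comparison[OF this ml] show ?thesis .
qed

text \<open>In logarithmic coordinates, with the power of index \<open>r\<close> divided out,
  regular variation becomes the vanishing of all increments over fixed lengths, and a ratio of
  arguments near one becomes a length near zero.\<close>

lemma regularly_varying_measurable_ratio:
  fixes D :: "real \<Rightarrow> real" and s s' :: "nat \<Rightarrow> real"
  assumes D: "(\<lambda>x. D (exp x)) \<in> borel_measurable borel"
    and pos: "\<forall>\<^sub>F x in at_top. D x > 0"
    and rv: "\<And>c. c > 0 \<Longrightarrow> ((\<lambda>x. D (c * x) / D x) \<longlongrightarrow> c powr r) at_top"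
    and s: "filterlim s at_top sequentially" and s': "(\<lambda>n. s' n / s n) \<longlonglongrightarrow> 1"
  shows "(\<lambda>n. D (s' n) / D (s n)) \<longlonglongrightarrow> 1"
proof -
  define f where "f x = ln (D (exp x)) - r * x" for x
  have fm: "f \<in> borel_measurable borel" unfolding f_def using D by measurable
  have lim: "((\<lambda>x. f (x + y) - f x) \<longlongrightarrow> 0) at_top" for y
  proof -
    have "((\<lambda>x. D (exp y * exp x) / D (exp x)) \<longlongrightarrow> exp y powr r) at_top"
      by (rule filterlim_compose[OF rv exp_at_top]) simp
    then have "((\<lambda>x. ln (D (exp y * exp x) / D (exp x)) - r * y) \<longlongrightarrow> ln (exp y powr r) - r * y) at_top"
      by (intro tendsto_intros) simp_all
    then have l: "((\<lambda>x. ln (D (exp y * exp x) / D (exp x)) - r * y) \<longlongrightarrow> 0) at_top" by (simp add: ln_powr)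
    have e1: "\<forall>\<^sub>F x in at_top. D (exp x) > 0"
      by (rule eventually_compose_filterlim[OF pos exp_at_top])
    have "filterlim (\<lambda>x. y + x) at_top at_top" by (rule filterlim_tendsto_add_at_top[OF tendsto_const filterlim_ident])
    then have "filterlim (\<lambda>x. exp (y + x)) at_top at_top" by (rule filterlim_compose[OF exp_at_top])
    then have e2: "\<forall>\<^sub>F x in at_top. D (exp (y + x)) > 0"
      by (rule eventually_compose_filterlim[OF pos])
    have "\<forall>\<^sub>F x in at_top. ln (D (exp y * exp x) / D (exp x)) - r * y = f (x + y) - f x"
      using e1 e2
    proof eventually_elim
      case (elim x)
      then have "ln (D (exp y * exp x) / D (exp x)) = ln (D (exp (y + x))) - ln (D (exp x))"
        by (simp add: exp_add ln_div)
      then show ?case by (simp add: f_def algebra_simps)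
    qed
    from Lim_transform_eventually[OF l this] show ?thesis .
  qed
  have spos: "\<forall>\<^sub>F n in sequentially. s n > 0" using s by (simp add: filterlim_at_top_dense)
  have xs: "filterlim (\<lambda>n. ln (s n)) at_top sequentially" by (rule filterlim_compose[OF ln_at_top s])
  have s'pos: "\<forall>\<^sub>F n in sequentially. s' n / s n > 1 / 2" by (rule order_tendstoD(1)[OF s']) simp
  have "(\<lambda>n. ln (s' n / s n)) \<longlonglongrightarrow> ln 1" by (intro tendsto_intros s') simp
  then have l1: "(\<lambda>n. ln (s' n / s n)) \<longlonglongrightarrow> 0" by simp
  have pp: "\<forall>\<^sub>F n in sequentially. s n > 0 \<and> s' n > 0"
    using spos s'pos
  proof eventually_elim
    case (elim n)
    then have "0 < s' n / s n" by linarith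
    then show ?case using elim by (simp add: zero_less_divide_iff)
  qed
  then have "\<forall>\<^sub>F n in sequentially. ln (s' n / s n) = ln (s' n) - ln (s n)"
    by eventually_elim (simp add: ln_div)
  from Lim_transform_eventually[OF l1 this]
  have dl: "(\<lambda>n. ln (s' n) - ln (s n)) \<longlonglongrightarrow> 0" .
  have "(\<lambda>n. f (ln (s' n)) - f (ln (s n))) \<longlonglongrightarrow> 0"
    by (rule slowly_varying_increments[OF fm lim xs dl])
  then have "(\<lambda>n. exp ((f (ln (s' n)) - f (ln (s n))) + r * (ln (s' n) - ln (s n)))) \<longlonglongrightarrow> exp (0 + r * 0)"
    by (intro tendsto_intros dl)
  then have el: "(\<lambda>n. exp ((f (ln (s' n)) - f (ln (s n))) + r * (ln (s' n) - ln (s n)))) \<longlonglongrightarrow> 1" by simp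
  have s'top: "filterlim s' at_top sequentially"
  proof -
    have "filterlim (\<lambda>n. (s' n / s n) * s n) at_top sequentially"
      by (rule filterlim_tendsto_pos_mult_at_top[OF s' _ s]) simp
    moreover have "\<forall>\<^sub>F n in sequentially. s' n / s n * s n = s' n" using spos by eventually_elim simp
    ultimately show ?thesis using filterlim_cong[OF refl refl, of "\<lambda>n. s' n / s n * s n" s' sequentially at_top] by simp
  qed
  have "\<forall>\<^sub>F n in sequentially. D (s n) > 0" "\<forall>\<^sub>F n in sequentially. D (s' n) > 0"
    by (rule eventually_compose_filterlim[OF pos s], rule eventually_compose_filterlim[OF pos s'top])
  with pp have "\<forall>\<^sub>F n in sequentially. exp ((f (ln (s' n)) - f (ln (s n))) + r * (ln (s' n) - ln (s n))) = D (s' n) / D (s n)"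
  proof eventually_elim
    case (elim n)
    then have "(f (ln (s' n)) - f (ln (s n))) + r * (ln (s' n) - ln (s n)) = ln (D (s' n)) - ln (D (s n))"
      by (simp add: f_def algebra_simps)
    then show ?case using elim by (simp add: exp_diff)
  qed
  from Lim_transform_eventually[OF el this] show ?thesis .
qed

section \<open>Quantiles of a scaled family determine its scale\<close>

definition quantile :: "real measure \<Rightarrow> real \<Rightarrow> real" where
  "quantile N \<alpha> = Inf {x. \<alpha> \<le> cdf N x}"

context real_distribution
begin

lemma cdf_level_nonempty:
  assumes "\<alpha> < 1" shows "{x. \<alpha> \<le> cdf M x} \<noteq> {}"
proof -
  have "\<forall>\<^sub>F x in at_top. \<alpha> < cdf M x" by (rule order_tendstoD(1)[OF cdf_lim_at_top_prob assms])
  from eventually_happens[OF this] obtain x where "\<alpha> < cdf M x" by auto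
  then have "\<alpha> \<le> cdf M x" by simp
  then show ?thesis by (intro notI) (simp add: set_eq_iff)
qed

lemma cdf_level_bdd_below:
  assumes "0 < \<alpha>" shows "bdd_below {x. \<alpha> \<le> cdf M x}"
proof -
  have "\<forall>\<^sub>F x in at_bot. cdf M x < \<alpha>" by (rule order_tendstoD(2)[OF cdf_lim_at_bot assms])
  from eventually_happens[OF this] obtain z where z: "cdf M z < \<alpha>" by auto
  show ?thesis
  proof (rule bdd_belowI)
    fix x assume "x \<in> {x. \<alpha> \<le> cdf M x}"
    then have "\<alpha> \<le> cdf M x" by simp
    then show "z \<le> x" using z cdf_nondecreasing[of x z] by (meson leI less_imp_le not_le order_trans)
  qed
qed

lemma quantile_le: "0 < \<alpha> \<Longrightarrow> \<alpha> \<le> cdf M x \<Longrightarrow> quantile M \<alpha> \<le> x"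
  unfolding quantile_def by (rule cInf_lower[OF _ cdf_level_bdd_below]) simp_all

lemma le_quantile:
  assumes "\<alpha> < 1" "cdf M y < \<alpha>" shows "y \<le> quantile M \<alpha>"
  unfolding quantile_def
proof (rule cInf_greatest[OF cdf_level_nonempty[OF assms(1)]])
  fix x assume "x \<in> {x. \<alpha> \<le> cdf M x}"
  then have "\<alpha> \<le> cdf M x" by simp
  then show "y \<le> x" using assms(2) cdf_nondecreasing[of x y] by (meson leI less_imp_le not_le order_trans)
qed

lemma cdf_less_quantile:
  assumes "0 < \<alpha>" "y < quantile M \<alpha>" shows "cdf M y < \<alpha>"
  using quantile_le[OF assms(1), of y] assms(2) by (meson not_le)

text \<open>All but countably many levels are crossed by the distribution function without a flat stretch.\<close>

lemma sharp_level_exists: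
  assumes p: "0 \<le> p" "p < q" "q \<le> 1"
  shows "\<exists>\<alpha>>p. \<alpha> < q \<and> (\<forall>\<delta>>0. cdf M (quantile M \<alpha> - \<delta>) < \<alpha>) \<and> (\<forall>\<delta>>0. \<alpha> < cdf M (quantile M \<alpha> + \<delta>))"
proof -
  \<comment> \<open>A flat stretch at level \<alpha> would contain a rational point, so it is enough
    to avoid the countably many values at rationals.\<close>
  have "countable (cdf M ` \<rat>)" by (intro countable_image countable_rat)
  then have "\<not> {p<..<q} \<subseteq> cdf M ` \<rat>" using countable_subset uncountable_open_interval[of p q] p by metis
  then obtain \<alpha> where a: "\<alpha> \<in> {p<..<q}" "\<alpha> \<notin> cdf M ` \<rat>" by blast
  then have a01: "0 < \<alpha>" "\<alpha> < 1" using p by auto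
  have ge: "\<alpha> \<le> cdf M x" if x: "quantile M \<alpha> < x" for x
    using le_quantile[OF a01(2), of x] x by (meson not_le)
  show ?thesis
  proof (intro exI[of _ \<alpha>] conjI allI impI)
    show "p < \<alpha>" "\<alpha> < q" using a by auto
    show "cdf M (quantile M \<alpha> - \<delta>) < \<alpha>" if "\<delta> > 0" for \<delta>
      using that by (intro cdf_less_quantile a01) simp
    show "\<alpha> < cdf M (quantile M \<alpha> + \<delta>)" if d: "\<delta> > 0" for \<delta>
    proof -
      obtain r where r: "r \<in> \<rat>" "quantile M \<alpha> < r" "r < quantile M \<alpha> + \<delta>"
        using Rats_dense_in_real[of "quantile M \<alpha>" "quantile M \<alpha> + \<delta>"] d by auto
      have "\<alpha> \<noteq> cdf M r" using a(2) r(1) by (metis imageI)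
      then have "\<alpha> < cdf M r" using ge[OF r(2)] by simp
      also have "\<dots> \<le> cdf M (quantile M \<alpha> + \<delta>)" using r(3) by (intro cdf_nondecreasing) simp
      finally show ?thesis .
    qed
  qed
qed

end

lemma quantile_mono_cdf:
  assumes "real_distribution N" "real_distribution N'" "0 < \<alpha>" "\<alpha> < 1"
    and le: "\<And>x. cdf N' x \<le> cdf N x"
  shows "quantile N \<alpha> \<le> quantile N' \<alpha>"
  unfolding quantile_def
proof (rule cInf_superset_mono)
  show "{x. \<alpha> \<le> cdf N' x} \<noteq> {}" by (rule real_distribution.cdf_level_nonempty[OF assms(2,4)])
  show "bdd_below {x. \<alpha> \<le> cdf N x}" by (rule real_distribution.cdf_level_bdd_below[OF assms(1,3)])
  show "{x. \<alpha> \<le> cdf N' x} \<subseteq> {x. \<alpha> \<le> cdf N x}"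
    by (rule subsetI) (use order_trans[OF _ le] in simp)
qed

text \<open>\<open>L s\<close> is the law before scaling. By \<open>increasing\<close> these laws
  grow stochastically with \<open>s\<close>, so their quantiles are monotone in \<open>s\<close>,
  and therefore measurable whatever \<open>a\<close> and \<open>b\<close> are.\<close>

locale scaled_family =
  fixes L :: "real \<Rightarrow> real measure" and N :: "real measure" and a b :: "real \<Rightarrow> real"
  assumes L: "s > 0 \<Longrightarrow> real_distribution (L s)" and N: "real_distribution N"
    and b: "s > 0 \<Longrightarrow> b s > 0"
    and W: "weak_limit (\<lambda>s. distr (L s) borel (\<lambda>x. b s * (x - a s))) N at_top"
    and increasing: "0 < s \<Longrightarrow> s \<le> s' \<Longrightarrow> cdf (L s') x \<le> cdf (L s) x"
begin

lemma
  assumes s: "s > 0"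
  shows scaled_distribution: "real_distribution (distr (L s) borel (\<lambda>x. b s * (x - a s)))"
    and cdf_scaled: "cdf (distr (L s) borel (\<lambda>x. b s * (x - a s))) q = cdf (L s) (a s + q / b s)"
proof -
  interpret L: real_distribution "L s" by (rule L[OF s])
  have m [measurable]: "(\<lambda>x. b s * (x - a s)) \<in> borel_measurable (L s)"
    unfolding measurable_cong_sets[OF L.events_eq_borel refl] by measurable
  show "real_distribution (distr (L s) borel (\<lambda>x. b s * (x - a s)))"
    by (rule L.real_distribution_distr[OF m])
  have "(\<lambda>x. b s * (x - a s)) -` {..q} \<inter> space (L s) = {..a s + q / b s}"
    using b[OF s] by (auto simp: field_simps)
  then show "cdf (distr (L s) borel (\<lambda>x. b s * (x - a s))) q = cdf (L s) (a s + q / b s)"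
    unfolding cdf_def by (subst measure_distr[OF m]) simp_all
qed

lemma step_tendsto:
  assumes "x < y"
  shows "((\<lambda>s. \<integral>z. cts_step x y z \<partial>distr (L s) borel (\<lambda>x. b s * (x - a s))) \<longlongrightarrow> (\<integral>z. cts_step x y z \<partial>N)) at_top"
proof -
  have "continuous_on UNIV (cts_step x y)"
    by (rule uniformly_continuous_imp_continuous[OF cts_step_uniformly_continuous[OF assms]])
  moreover have "bounded (range (cts_step x y))"
    by (rule boundedI[of _ 1]) (use assms in \<open>auto simp: cts_step_def divide_simps\<close>)
  ultimately show ?thesis using W unfolding weak_limit_def by (elim allE impE[OF _ conjI])
qed

text \<open>Sharpness on both sides gives strict inequalities between \<alpha> and limiting
  integrals of continuous steps near the quantile; strict inequalities persist for large
  \<open>s\<close> and locate the scaled quantile.\<close>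

lemma quantile_tendsto:
  assumes \<alpha>: "0 < \<alpha>" "\<alpha> < 1"
    and below: "\<And>\<delta>. \<delta> > 0 \<Longrightarrow> cdf N (quantile N \<alpha> - \<delta>) < \<alpha>"
    and above: "\<And>\<delta>. \<delta> > 0 \<Longrightarrow> \<alpha> < cdf N (quantile N \<alpha> + \<delta>)"
  shows "((\<lambda>s. b s * (quantile (L s) \<alpha> - a s)) \<longlongrightarrow> quantile N \<alpha>) at_top"
proof (rule tendstoI)
  fix e :: real assume e: "e > 0"
  define \<zeta> where "\<zeta> = quantile N \<alpha>"
  have "(\<integral>z. cts_step (\<zeta> - e / 2) (\<zeta> - e / 4) z \<partial>N) \<le> cdf N (\<zeta> - e / 4)"
    using e by (intro real_distribution.cdf_cts_step(2)[OF N]) simp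
  also have "\<dots> < \<alpha>" unfolding \<zeta>_def using e by (intro below) simp
  finally have "\<forall>\<^sub>F s in at_top. (\<integral>z. cts_step (\<zeta> - e / 2) (\<zeta> - e / 4) z \<partial>distr (L s) borel (\<lambda>x. b s * (x - a s))) < \<alpha>"
    using e by (intro order_tendstoD(2)[OF step_tendsto]) simp_all
  then have e1: "\<forall>\<^sub>F s in at_top. \<zeta> - e / 2 \<le> b s * (quantile (L s) \<alpha> - a s)"
    using eventually_gt_at_top[of 0]
  proof eventually_elim
    case (elim s)
    interpret L: real_distribution "L s" by (rule L[OF elim(2)])
    have "cdf (distr (L s) borel (\<lambda>x. b s * (x - a s))) (\<zeta> - e / 2) < \<alpha>"
      using elim(1) real_distribution.cdf_cts_step(1)[OF scaled_distribution[OF elim(2)], of "\<zeta> - e / 2" "\<zeta> - e / 4"] e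
      by simp
    then have "a s + (\<zeta> - e / 2) / b s \<le> quantile (L s) \<alpha>"
      unfolding cdf_scaled[OF elim(2)] by (rule L.le_quantile[OF \<alpha>(2)])
    then show ?case using b[OF elim(2)] by (simp add: field_simps)
  qed
  have "\<alpha> < cdf N (\<zeta> + e / 4)" unfolding \<zeta>_def using e by (intro above) simp
  also have "\<dots> \<le> (\<integral>z. cts_step (\<zeta> + e / 4) (\<zeta> + e / 2) z \<partial>N)"
    using e by (intro real_distribution.cdf_cts_step(1)[OF N]) simp
  finally have "\<forall>\<^sub>F s in at_top. \<alpha> < (\<integral>z. cts_step (\<zeta> + e / 4) (\<zeta> + e / 2) z \<partial>distr (L s) borel (\<lambda>x. b s * (x - a s)))"
    using e by (intro order_tendstoD(1)[OF step_tendsto]) simp_all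
  then have e2: "\<forall>\<^sub>F s in at_top. b s * (quantile (L s) \<alpha> - a s) \<le> \<zeta> + e / 2"
    using eventually_gt_at_top[of 0]
  proof eventually_elim
    case (elim s)
    interpret L: real_distribution "L s" by (rule L[OF elim(2)])
    have "\<alpha> \<le> cdf (distr (L s) borel (\<lambda>x. b s * (x - a s))) (\<zeta> + e / 2)"
      using elim(1) real_distribution.cdf_cts_step(2)[OF scaled_distribution[OF elim(2)], of "\<zeta> + e / 4" "\<zeta> + e / 2"] e
      by simp
    then have "quantile (L s) \<alpha> \<le> a s + (\<zeta> + e / 2) / b s"
      unfolding cdf_scaled[OF elim(2)] by (rule L.quantile_le[OF \<alpha>(1)])
    then show ?case using b[OF elim(2)] by (simp add: field_simps)
  qed
  show "\<forall>\<^sub>F s in at_top. dist (b s * (quantile (L s) \<alpha> - a s)) (quantile N \<alpha>) < e"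
    using e1 e2 by eventually_elim (use e in \<open>simp add: dist_real_def abs_less_iff \<zeta>_def[symmetric]\<close>)
qed

lemma quantile_exp_measurable:
  assumes "0 < \<alpha>" "\<alpha> < 1"
  shows "(\<lambda>x. quantile (L (exp x)) \<alpha>) \<in> borel_measurable borel"
  by (intro borel_measurable_mono monoI quantile_mono_cdf L increasing assms) simp_all

text \<open>In the difference \<open>D\<close> of two quantiles the centering drops out, and
  \<open>b s * D s\<close> tends to a positive constant. So \<open>D\<close> varies regularly with
  index \<open>- r\<close>, is measurable as a difference of monotone functions, and its ratio at
  nearby arguments is inverse to that of \<open>b\<close> in the limit.\<close>

lemma scale_ratio_tendsto:
  assumes rv: "regularly_varying b"
    and nondegenerate: "0 < cdf N x" "cdf N x < 1"
    and s: "filterlim s at_top sequentially" and s': "(\<lambda>n. s' n / s n) \<longlonglongrightarrow> 1"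
  shows "(\<lambda>n. b (s n) / b (s' n)) \<longlonglongrightarrow> 1"
proof -
  interpret N: real_distribution N by (rule N)
  from rv obtain r where r: "\<And>c. c > 0 \<Longrightarrow> ((\<lambda>s. b (c * s) / b s) \<longlongrightarrow> c powr r) at_top"
    unfolding regularly_varying_def by (elim exE) metis
  \<comment> \<open>Sharp levels are taken on either side of \<open>cdf N x\<close>, so that
    \<open>x\<close> separates the two quantiles and \<kappa> is positive.\<close>
  obtain \<alpha> where \<alpha>: "0 < \<alpha>" "\<alpha> < cdf N x" "\<forall>\<delta>>0. cdf N (quantile N \<alpha> - \<delta>) < \<alpha>"
    "\<forall>\<delta>>0. \<alpha> < cdf N (quantile N \<alpha> + \<delta>)"
    using N.sharp_level_exists[OF order.refl nondegenerate(1) less_imp_le[OF nondegenerate(2)]] by (elim exE conjE)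
  obtain \<beta> where \<beta>: "cdf N x < \<beta>" "\<beta> < 1" "\<forall>\<delta>>0. cdf N (quantile N \<beta> - \<delta>) < \<beta>"
    "\<forall>\<delta>>0. \<beta> < cdf N (quantile N \<beta> + \<delta>)"
    using N.sharp_level_exists[OF less_imp_le[OF nondegenerate(1)] nondegenerate(2) order.refl] by (elim exE conjE)
  have \<alpha>1: "\<alpha> < 1" and \<beta>0: "0 < \<beta>" using \<alpha>(1,2) \<beta>(1,2) by linarith+
  define \<kappa> where "\<kappa> = quantile N \<beta> - quantile N \<alpha>"
  have "quantile N \<alpha> \<le> x" using \<alpha>(1,2) by (intro N.quantile_le) simp_all
  moreover have "x < quantile N \<beta>"
  proof -
    \<comment> \<open>Right continuity is needed to separate the upper quantile strictly from
      \<open>x\<close>.\<close>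
    have "(cdf N \<longlongrightarrow> cdf N x) (at_right x)" using N.cdf_is_right_cont[of x] by (simp add: continuous_within)
    then have "\<forall>\<^sub>F y in at_right x. cdf N y < \<beta>" by (rule order_tendstoD(2)) (rule \<beta>(1))
    then have "\<forall>\<^sub>F y in at_right x. cdf N y < \<beta> \<and> y > x"
      by (intro eventually_conj) (simp_all add: eventually_at_right_less)
    from eventually_happens[OF this] obtain y where y: "cdf N y < \<beta>" "y > x"
      by (auto simp: trivial_limit_at_right_real)
    then show ?thesis using N.le_quantile[OF \<beta>(2) y(1)] by linarith
  qed
  ultimately have \<kappa>: "\<kappa> > 0" by (simp add: \<kappa>_def)
  define D where "D s = quantile (L s) \<beta> - quantile (L s) \<alpha>" for s
  have "((\<lambda>s. b s * (quantile (L s) \<beta> - a s) - b s * (quantile (L s) \<alpha> - a s)) \<longlongrightarrow> \<kappa>) at_top"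
    unfolding \<kappa>_def
    by (intro tendsto_diff quantile_tendsto \<alpha>(1) \<alpha>(3,4)[rule_format] \<beta>(2) \<beta>(3,4)[rule_format] \<alpha>1 \<beta>0)
  then have bD: "((\<lambda>s. b s * D s) \<longlongrightarrow> \<kappa>) at_top" by (simp add: D_def algebra_simps)
  have "\<forall>\<^sub>F s in at_top. b s * D s > 0" by (rule order_tendstoD(1)[OF bD \<kappa>])
  then have Dpos: "\<forall>\<^sub>F s in at_top. D s > 0"
    using eventually_gt_at_top[of 0]
  proof eventually_elim
    case (elim s)
    then show ?case using b[OF elim(2)] by (simp add: zero_less_mult_iff)
  qed
  have Dm: "(\<lambda>x. D (exp x)) \<in> borel_measurable borel" unfolding D_def
    by (intro borel_measurable_diff quantile_exp_measurable \<alpha>(1) \<alpha>1 \<beta>0 \<beta>(2))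
  have rvD: "((\<lambda>x. D (c * x) / D x) \<longlongrightarrow> c powr (- r)) at_top" if c: "c > 0" for c
  proof -
    have ct: "filterlim (\<lambda>x. c * x) at_top at_top"
      using filterlim_tendsto_pos_mult_at_top[OF tendsto_const c filterlim_ident] .
    have "((\<lambda>x. (b (c * x) * D (c * x)) / (b x * D x) / (b (c * x) / b x)) \<longlongrightarrow> \<kappa> / \<kappa> / (c powr r)) at_top"
      using \<kappa> c by (intro tendsto_divide filterlim_compose[OF bD ct] bD r) simp_all
    moreover have "\<kappa> / \<kappa> / (c powr r) = c powr (- r)" using \<kappa> by (simp add: powr_minus divide_inverse)
    moreover have "\<forall>\<^sub>F x in at_top. (b (c * x) * D (c * x)) / (b x * D x) / (b (c * x) / b x) = D (c * x) / D x"
      using eventually_gt_at_top[of 0]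
    proof eventually_elim
      case (elim x)
      then have "b x > 0" "b (c * x) > 0" using c by (intro b; simp)+
      then show ?case by (simp add: field_simps)
    qed
    ultimately show ?thesis by (simp add: tendsto_cong)
  qed
  have ratio: "(\<lambda>n. D (s' n) / D (s n)) \<longlonglongrightarrow> 1"
    by (rule regularly_varying_measurable_ratio[OF Dm Dpos rvD s s'])
  have s't: "filterlim s' at_top sequentially"
  proof -
    have "filterlim (\<lambda>n. (s' n / s n) * s n) at_top sequentially"
      by (rule filterlim_tendsto_pos_mult_at_top[OF s' _ s]) simp
    moreover have "\<forall>\<^sub>F n in sequentially. s' n / s n * s n = s' n"
      using eventually_compose_filterlim[OF eventually_gt_at_top[of 0] s] by eventually_elim simp
    ultimately show ?thesis
      using filterlim_cong[OF refl refl, of "\<lambda>n. s' n / s n * s n" s' sequentially at_top] by simp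
  qed
  have "(\<lambda>n. (b (s n) * D (s n)) / (b (s' n) * D (s' n)) * (D (s' n) / D (s n))) \<longlonglongrightarrow> \<kappa> / \<kappa> * 1"
    using \<kappa> by (intro tendsto_mult tendsto_divide filterlim_compose[OF bD s] filterlim_compose[OF bD s't] ratio) simp
  then have lim: "(\<lambda>n. (b (s n) * D (s n)) / (b (s' n) * D (s' n)) * (D (s' n) / D (s n))) \<longlonglongrightarrow> 1"
    using \<kappa> by simp
  have "\<forall>\<^sub>F n in sequentially. (b (s n) * D (s n)) / (b (s' n) * D (s' n)) * (D (s' n) / D (s n)) = b (s n) / b (s' n)"
    using eventually_compose_filterlim[OF Dpos s] eventually_compose_filterlim[OF Dpos s't]
    by eventually_elim (simp add: field_simps)
  from Lim_transform_eventually[OF lim this] show ?thesis .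
qed

end

text \<open>The derivative of \<open>arctan (c * x)\<close> in \<open>c\<close> is
  \<open>x / (1 + (c * x)^2)\<close>, at most one in modulus for \<open>c \<ge> 1/2\<close>. A
  change of scale thus costs the same for all \<open>x\<close>, however large.\<close>

lemma arctan_affine_bound:
  assumes "\<beta> \<ge> 1 / 2"
  shows "\<bar>arctan (\<beta> * x + d) - arctan x\<bar> \<le> \<bar>d\<bar> + \<bar>\<beta> - 1\<bar>"
proof -
  have lip: "\<bar>arctan u - arctan v\<bar> \<le> \<bar>u - v\<bar>" for u v :: real
  proof -
    have "norm (arctan u - arctan v) \<le> 1 * norm (u - v)"
      by (rule field_differentiable_bound[where S = UNIV and f' = "\<lambda>x. inverse (1 + x\<^sup>2)"])
        (auto intro!: derivative_eq_intros simp: inverse_le_1_iff abs_inverse)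
    then show ?thesis by simp
  qed
  have "norm (arctan (\<beta> * x) - arctan (1 * x)) \<le> 1 * norm (\<beta> - 1)"
  proof (rule field_differentiable_bound[where S = "{1/2..}" and f = "\<lambda>c. arctan (c * x)" and f' = "\<lambda>c. x / (1 + (c * x)\<^sup>2)"])
    fix c :: real assume c: "c \<in> {1/2..}"
    show "((\<lambda>c. arctan (c * x)) has_field_derivative x / (1 + (c * x)\<^sup>2)) (at c within {1 / 2..})"
      by (auto intro!: derivative_eq_intros simp: field_simps)
    have "(1 / 2 * \<bar>x\<bar>)\<^sup>2 \<le> (c * \<bar>x\<bar>)\<^sup>2" using c by (intro power_mono mult_right_mono) auto
    then have "\<bar>x\<bar> * \<bar>x\<bar> / 4 \<le> (c * x)\<^sup>2" by (simp add: power_mult_distrib power2_eq_square)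
    moreover have "0 \<le> (\<bar>x\<bar> / 2 - 1) * (\<bar>x\<bar> / 2 - 1)" by simp
    ultimately have "\<bar>x\<bar> \<le> 1 + (c * x)\<^sup>2" by (simp add: algebra_simps)
    moreover have "0 < 1 + (c * x)\<^sup>2" by (simp add: add_pos_nonneg)
    ultimately show "norm (x / (1 + (c * x)\<^sup>2)) \<le> 1" by (simp add: abs_of_pos)
  qed (use assms in auto)
  then show ?thesis using lip[of "\<beta> * x + d" "\<beta> * x"] by simp
qed

text \<open>Such a distribution function jumps from 0 to 1 at its median.\<close>

lemma (in real_distribution) degenerate_AE_const:
  assumes "\<And>x. cdf M x = 0 \<or> cdf M x = 1"
  shows "\<exists>c. AE x in M. x = c"
proof -
  define c where "c = quantile M (1 / 2)"
  have lo: "cdf M (c - \<delta>) = 0" if "\<delta> > 0" for \<delta>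
    using cdf_less_quantile[of "1/2" "c - \<delta>"] assms[of "c - \<delta>"] that by (auto simp: c_def)
  have hi: "cdf M (c + \<delta>) = 1" if "\<delta> > 0" for \<delta>
  proof (rule ccontr)
    assume "cdf M (c + \<delta>) \<noteq> 1"
    then have "cdf M (c + \<delta>) < 1 / 2" using assms[of "c + \<delta>"] by auto
    then have "c + \<delta> \<le> c" unfolding c_def[of] by (intro le_quantile) (simp_all add: c_def)
    then show False using that by simp
  qed
  have "AE x in M. c - 1 / real (Suc k) < x \<and> x \<le> c + 1 / real (Suc k)" for k
  proof -
    have "AE x in M. x \<notin> {..c - 1 / real (Suc k)}"
      using lo[of "1 / real (Suc k)"] by (subst prob_eq_0[symmetric]) (simp_all add: cdf_def)
    moreover have "AE x in M. x \<in> {..c + 1 / real (Suc k)}"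
      using hi[of "1 / real (Suc k)"] by (subst prob_eq_1[symmetric]) (simp_all add: cdf_def)
    ultimately show ?thesis by eventually_elim auto
  qed
  then have "AE x in M. \<forall>k. c - 1 / real (Suc k) < x \<and> x \<le> c + 1 / real (Suc k)"
    by (simp add: AE_all_countable)
  then have "AE x in M. x = c"
  proof eventually_elim
    case (elim x)
    show ?case
    proof (rule ccontr)
      assume "x \<noteq> c"
      then have "\<bar>x - c\<bar> > 0" by simp
      then obtain k where "inverse (real (Suc k)) < \<bar>x - c\<bar>" using reals_Archimedean by blast
      moreover have "\<bar>x - c\<bar> \<le> 1 / real (Suc k)" using elim[rule_format, of k] by (intro abs_leI) linarith+
      ultimately show False by (simp add: inverse_eq_divide)
    qed
  qed
  then show ?thesis ..
qed

section \<open>Tilted laws of a single coordinate\<close>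

context exponential_array
begin

lemma borel_measurable_sample: "(\<lambda>\<omega>. g (sample t \<omega>)) \<in> borel_measurable M"
  by (rule measurable_compose[OF measurable_sample]) simp

lemma integrable_sample:
  fixes g :: "nat multiset \<Rightarrow> real"
  assumes "\<And>p. \<bar>g p\<bar> \<le> C" shows "integrable M (\<lambda>\<omega>. g (sample t \<omega>))"
  by (rule integrable_const_bound[of _ C]) (use assms borel_measurable_sample in auto)

lemma level_prob_mean_sums:
  assumes "t > 0" "\<And>p. \<bar>f p\<bar> \<le> C"
  shows "(\<lambda>m. level_prob t m * partition_mean m f) sums (\<integral>\<omega>. f (sample t \<omega>) \<partial>M)"
  using sample_level_sums[OF assms] unfolding level_prob_def .

lemma expectation_sample_antimono:
  fixes g :: "nat multiset \<Rightarrow> real"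
  assumes t: "0 < t" "t \<le> t'" and g: "monotone_on partitions (\<subseteq>#) (\<le>) g" "\<And>p. \<bar>g p\<bar> \<le> C"
  shows "(\<integral>\<omega>. g (sample t' \<omega>) \<partial>M) \<le> (\<integral>\<omega>. g (sample t \<omega>) \<partial>M)"
proof (rule integral_mono_AE)
  show "AE \<omega> in M. g (sample t' \<omega>) \<le> g (sample t \<omega>)"
    using AE_sample_mono[OF t] by eventually_elim (rule monotone_onD[OF g(1) sample_partition sample_partition])
qed (rule integrable_sample[OF g(2)])+

text \<open>With e the tilting density before normalisation and \<open>0 \<le> h \<le> 4\<close>,
  one has e h <= (l/2) e^2 + (2/l) h. The second moment of e is \<open>laplace n (2 * y)\<close>,
  which is bounded; \<open>l\<close> is made small first, then \<open>n\<close> large.\<close>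

lemma contiguous_tilt:
  fixes h :: "nat \<Rightarrow> nat multiset \<Rightarrow> real"
  assumes h: "\<And>n p. 0 \<le> h n p" "\<And>n p. h n p \<le> 4" and y: "\<bar>y\<bar> \<le> 1"
    and lim: "(\<lambda>n. \<integral>\<omega>. h n (sample (crit n) \<omega>) \<partial>M) \<longlonglongrightarrow> 0"
  shows "(\<lambda>n. \<integral>\<omega>. h n (sample (crit n + y / sd n) \<omega>) \<partial>M) \<longlonglongrightarrow> 0"
proof -
  have habs: "\<bar>h n p\<bar> \<le> 4" for n p using h[of n p] by simp
  define E where "E n z = (\<integral>\<omega>. h n (sample (crit n + z / sd n) \<omega>) \<partial>M)" for n z
  have E0: "E n z \<ge> 0" for n z unfolding E_def by (intro integral_nonneg_AE AE_I2 h)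
  have bound: "E n y \<le> exp 2 * (l / 2 * laplace_bound + 2 / l * E n 0)" if n: "regular n" and l: "l > 0" for n l
  proof -
    have y1: "\<bar>y\<bar> \<le> 2" and y2: "\<bar>2 * y\<bar> \<le> 2" using y by auto
    have t: "0 < crit n + y / sd n" by (rule shift_small(2)[OF n y1])
    have "(\<lambda>m. laplace n y * (level_prob (crit n + y / sd n) m * partition_mean m (h n))) sums (laplace n y * E n y)"
      unfolding E_def by (intro sums_mult level_prob_mean_sums[OF t habs])
    then have s1: "(\<lambda>m. level_prob (crit n) m * exp (- y * xi n m) * partition_mean m (h n)) sums (laplace n y * E n y)"
      unfolding level_prob_tilt[OF n] by (simp only: mult.assoc)
    have E0s: "(\<lambda>m. level_prob (crit n) m * partition_mean m (h n)) sums E n 0"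
      using level_prob_mean_sums[OF regular_pos(1)[OF n], of "h n" 4] habs by (simp add: E_def)
    have s2: "(\<lambda>m. l / 2 * (level_prob (crit n) m * exp (- (2 * y) * xi n m)) + 2 / l * (level_prob (crit n) m * partition_mean m (h n)))
      sums (l / 2 * laplace n (2 * y) + 2 / l * E n 0)"
      by (intro sums_add sums_mult laplace_sums[OF n y2] E0s)
    have le: "level_prob (crit n) m * exp (- y * xi n m) * partition_mean m (h n)
      \<le> l / 2 * (level_prob (crit n) m * exp (- (2 * y) * xi n m)) + 2 / l * (level_prob (crit n) m * partition_mean m (h n))" for m
    proof -
      define e H where "e = exp (- y * xi n m)" and "H = partition_mean m (h n)"
      have e2: "exp (- (2 * y) * xi n m) = e * e" by (simp add: e_def exp_add[symmetric])
      have H: "0 \<le> H" "H \<le> 4"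
        using partition_mean_mono[of m "\<lambda>_. 0" "h n"] partition_mean_mono[of m "h n" "\<lambda>_. 4"] h
        by (simp_all add: H_def partition_mean_const)
      have "0 \<le> (l * e - H) * (l * e - H) / (2 * l)" using l by simp
      also have "\<dots> = l / 2 * (e * e) - e * H + H * H / (2 * l)" using l by (simp add: field_simps)
      finally have "e * H \<le> l / 2 * (e * e) + H * H / (2 * l)" by simp
      also have "H * H / (2 * l) \<le> 4 * H / (2 * l)" using H l by (intro divide_right_mono mult_right_mono) auto
      finally have "e * H \<le> l / 2 * (e * e) + 2 / l * H" by simp
      then have "level_prob (crit n) m * (e * H) \<le> level_prob (crit n) m * (l / 2 * (e * e) + 2 / l * H)"
        by (rule mult_left_mono[OF _ level_prob_nonneg])
      then show ?thesis unfolding e2 e_def[symmetric] H_def[symmetric] by (simp add: algebra_simps)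
    qed
    have "laplace n y * E n y \<le> l / 2 * laplace n (2 * y) + 2 / l * E n 0" by (rule sums_le[OF le s1 s2])
    also have "\<dots> \<le> l / 2 * laplace_bound + 2 / l * E n 0"
      using laplace_upper[OF n y2] l by (intro add_right_mono mult_left_mono) auto
    finally have "exp (- 2) * E n y \<le> l / 2 * laplace_bound + 2 / l * E n 0"
      using mult_right_mono[OF laplace_lower[OF n y1] E0[of n y]] by linarith
    then have "exp 2 * (exp (- 2) * E n y) \<le> exp 2 * (l / 2 * laplace_bound + 2 / l * E n 0)" by simp
    then show ?thesis by (simp add: mult.assoc[symmetric] exp_add[symmetric])
  qed
  have lim0: "(\<lambda>n. E n 0) \<longlonglongrightarrow> 0" using lim by (simp add: E_def)
  have "(\<lambda>n. E n y) \<longlonglongrightarrow> 0"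
  proof (rule tendstoI)
    fix r :: real assume r: "r > 0"
    define l where "l = r / (exp 2 * laplace_bound)"
    have l: "l > 0" using r by (simp add: l_def laplace_bound_def)
    have "(\<lambda>n. exp 2 * (l / 2 * laplace_bound + 2 / l * E n 0)) \<longlonglongrightarrow> exp 2 * (l / 2 * laplace_bound + 2 / l * 0)"
      by (intro tendsto_intros lim0)
    moreover have "exp 2 * (l / 2 * laplace_bound + 2 / l * 0) < r"
      using r by (simp add: l_def laplace_bound_def)
    ultimately have "\<forall>\<^sub>F n in sequentially. exp 2 * (l / 2 * laplace_bound + 2 / l * E n 0) < r"
      by (rule order_tendstoD(2))
    then show "\<forall>\<^sub>F n in sequentially. dist (E n y) 0 < r"
      using eventually_regular
    proof eventually_elim
      case (elim n)
      then show ?case using bound[OF elim(2) l] E0[of n y] by (simp add: dist_real_def)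
    qed
  qed
  then show ?thesis by (simp add: E_def)
qed

lemma F_crit_at_top: "filterlim (\<lambda>n. F (crit n)) at_top sequentially"
proof (rule filterlim_at_top_mono)
  show "filterlim (\<lambda>n. exp (- 4) / crit n) at_top sequentially" unfolding crit_def by real_asymp
  show "\<forall>\<^sub>F n in sequentially. exp (- 4) / crit n \<le> F (crit n)"
    using eventually_ge_at_top[of 2] by eventually_elim (rule F_lower[OF crit_bounds])
qed

text \<open>The loss is at most \<open>moment 1 (crit n) / sd n\<close>, of order t^(-2) * t^(3/2) =
  t^(-1/2), the order of sqrt F. In the constant, 8 comes from \<open>moment_upper\<close>, one
  \<open>exp 2\<close> from \<open>inverse_sd_upper\<close> and the other from the square root of
  \<open>F_lower\<close>.\<close>

lemma F_tilt_bound: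
  assumes n: "n \<ge> 2" and y: "0 \<le> y" "y \<le> 1" and v: "8 * exp 4 \<le> v"
  shows "F (crit n) - v * sqrt (F (crit n)) \<le> F (crit n + y / sd n)"
proof -
  note c = crit_bounds(1)[OF n] crit_bounds(2)[OF n]
  have "F (crit n) - F (crit n + y / sd n) \<le> y / sd n * moment 1 (crit n)"
    using y sdev_bounds(3)[OF c] by (intro F_diff_le c) simp
  also have "\<dots> \<le> (exp 2 * (crit n * sqrt (crit n))) * (8 / crit n ^ 2)"
  proof (rule mult_mono)
    have "y / sd n \<le> 1 / sd n" using y sdev_bounds(3)[OF c] by (intro divide_right_mono) auto
    then show "y / sd n \<le> exp 2 * (crit n * sqrt (crit n))" using inverse_sd_upper[OF n] by linarith
    show "moment 1 (crit n) \<le> 8 / (crit n)\<^sup>2" using moment_upper[OF c(1), of 1] by (simp add: eval_nat_numeral)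
  qed (use c moment_nonneg in auto)
  also have "\<dots> = 8 * exp 2 * (sqrt (crit n) / crit n)" using c by (simp add: power2_eq_square)
  also have "sqrt (crit n) / crit n = 1 / sqrt (crit n)" using c by (simp add: field_simps)
  also have "8 * exp 2 * (1 / sqrt (crit n)) = (8 * exp 4) * (exp (- 2) / sqrt (crit n))"
  proof -
    have "exp 4 = exp 2 * (exp 2 :: real)" by (simp add: exp_add[symmetric])
    then show ?thesis by (simp add: exp_minus field_simps)
  qed
  also have "\<dots> \<le> v * sqrt (F (crit n))"
  proof (rule mult_mono)
    have "exp (- 2) / sqrt (crit n) = sqrt (exp (- 4) / crit n)"
    proof -
      have "sqrt (exp (- 4)) = exp (- 2 :: real)" by (rule real_sqrt_unique) (simp_all add: power2_eq_square exp_add[symmetric])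
      then show ?thesis by (simp add: real_sqrt_divide)
    qed
    also have "\<dots> \<le> sqrt (F (crit n))" using F_lower[OF c] by (rule real_sqrt_le_mono)
    finally show "exp (- 2) / sqrt (crit n) \<le> sqrt (F (crit n))" .
  qed (use v c in \<open>auto intro: order_trans[OF _ v]\<close>)
  finally show ?thesis by simp
qed

end

locale scaled_coordinate = exponential_array +
  fixes X :: "nat multiset \<Rightarrow> real" and a b :: "real \<Rightarrow> real" and N :: "real measure" and u :: "real \<Rightarrow> real"
  assumes X_mono: "monotone_on partitions (\<subseteq>#) (\<le>) X"
    and b_rv: "regularly_varying b" and b_pos: "s > 0 \<Longrightarrow> b s > 0"
    and N: "real_distribution N"
    and limit_law: "weak_limit (\<lambda>s. distr M borel (\<lambda>\<omega>. b s * (X (sample (F_inv s) \<omega>) - a s))) N at_top"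
    and u_small: "u \<in> o[at_top](\<lambda>s. s powr (1/4))" and u_top: "filterlim u at_top at_top"
    and centering: "((\<lambda>s. b s * (a s - a (s - u s * sqrt s))) \<longlongrightarrow> 0) at_top"
begin

definition Y :: "nat \<Rightarrow> nat multiset \<Rightarrow> real" where
  "Y n p = b (F (crit n)) * (X p - a (F (crit n)))"

lemma integral_tendsto:
  fixes f :: "real \<Rightarrow> real"
  assumes f: "continuous_on UNIV f" "bounded (range f)"
  shows "((\<lambda>s. \<integral>\<omega>. f (b s * (X (sample (F_inv s) \<omega>) - a s)) \<partial>M) \<longlongrightarrow> (\<integral>x. f x \<partial>N)) at_top"
proof -
  have "((\<lambda>s. \<integral>x. f x \<partial>distr M borel (\<lambda>\<omega>. b s * (X (sample (F_inv s) \<omega>) - a s))) \<longlongrightarrow> (\<integral>x. f x \<partial>N)) at_top"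
    using limit_law f unfolding weak_limit_def by (elim allE impE[OF _ conjI])
  moreover have "(\<integral>x. f x \<partial>distr M borel (\<lambda>\<omega>. b s * (X (sample (F_inv s) \<omega>) - a s)))
    = (\<integral>\<omega>. f (b s * (X (sample (F_inv s) \<omega>) - a s)) \<partial>M)" for s
    by (intro integral_distr borel_measurable_sample borel_measurable_continuous_onI f)
  ultimately show ?thesis by simp
qed

lemma Y_integral_tendsto:
  fixes f :: "real \<Rightarrow> real"
  assumes f: "continuous_on UNIV f" "bounded (range f)"
  shows "(\<lambda>n. \<integral>\<omega>. f (Y n (sample (crit n) \<omega>)) \<partial>M) \<longlonglongrightarrow> (\<integral>x. f x \<partial>N)"
proof (rule Lim_transform_eventually)
  show "(\<lambda>n. \<integral>\<omega>. f (b (F (crit n)) * (X (sample (F_inv (F (crit n))) \<omega>) - a (F (crit n)))) \<partial>M) \<longlonglongrightarrow> (\<integral>x. f x \<partial>N)"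
    by (rule filterlim_compose[OF integral_tendsto[OF f] F_crit_at_top])
  show "\<forall>\<^sub>F n in sequentially. (\<integral>\<omega>. f (b (F (crit n)) * (X (sample (F_inv (F (crit n))) \<omega>) - a (F (crit n)))) \<partial>M)
      = (\<integral>\<omega>. f (Y n (sample (crit n) \<omega>)) \<partial>M)"
    using eventually_ge_at_top[of 2] by eventually_elim (simp add: Y_def F_inv_F crit_bounds)
qed

lemma arctan_abs_le: "\<bar>arctan x\<bar> \<le> 2"
proof -
  have "\<bar>arctan x\<bar> \<le> pi / 2" using arctan_bounded[of x] by (intro abs_leI) linarith+
  then show ?thesis using pi_less_4 by linarith
qed

lemma continuous_bounded_arctan: "continuous_on UNIV (arctan :: real \<Rightarrow> real)" "bounded (range (arctan :: real \<Rightarrow> real))"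
proof -
  show "continuous_on UNIV (arctan :: real \<Rightarrow> real)" by (intro continuous_intros)
  show "bounded (range (arctan :: real \<Rightarrow> real))"
    by (rule boundedI[of _ 2]) (use arctan_abs_le in auto)
qed

lemma arctan_Y_mono:
  assumes "n \<ge> 2" shows "monotone_on partitions (\<subseteq>#) (\<le>) (\<lambda>p. arctan (Y n p))"
proof (rule monotone_onI)
  fix p q assume pq: "p \<in> partitions" "q \<in> partitions" "p \<subseteq># q"
  have "X p \<le> X q" by (rule monotone_onD[OF X_mono pq])
  then show "arctan (Y n p) \<le> arctan (Y n q)"
    unfolding Y_def arctan_le_iff using b_pos[OF F_pos[OF crit_bounds(1)[OF assms]]]
    by (intro mult_left_mono) auto
qed

text \<open>The smaller argument s - u(s) sqrt s of the centering hypothesis at s =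
  \<open>F (crit n)\<close>.\<close>

definition lag :: "nat \<Rightarrow> real" where
  "lag n = F (crit n) - u (F (crit n)) * sqrt (F (crit n))"

lemma lag_ratio: "(\<lambda>n. lag n / F (crit n)) \<longlonglongrightarrow> 1"
proof -
  have "((\<lambda>s. u s / s powr (1/4)) \<longlongrightarrow> 0) at_top" by (rule smalloD_tendsto[OF u_small])
  moreover have "((\<lambda>s::real. s powr (- 1/4)) \<longlongrightarrow> 0) at_top" by real_asymp
  ultimately have "((\<lambda>s. 1 - u s / s powr (1/4) * s powr (- 1/4)) \<longlongrightarrow> 1 - 0 * 0) at_top"
    by (intro tendsto_diff tendsto_mult tendsto_const)
  moreover have "\<forall>\<^sub>F s in at_top. 1 - u s / s powr (1/4) * s powr (- 1/4) = (s - u s * sqrt s) / s"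
    using eventually_gt_at_top[of 0]
  proof eventually_elim
    case (elim s)
    have "s powr (- 1/4) / s powr (1/4) = s powr (- 1 / 2)" by (simp add: powr_diff[symmetric])
    also have "\<dots> = inverse (sqrt s)" using elim by (simp add: powr_minus powr_half_sqrt)
    finally have "u s / s powr (1/4) * s powr (- 1/4) = u s * inverse (sqrt s)"
      by (metis times_divide_eq_left times_divide_eq_right)
    also have "inverse (sqrt s) = sqrt s / s" using elim by (simp add: field_simps)
    finally show ?case using elim by (simp add: diff_divide_distrib)
  qed
  ultimately have "((\<lambda>s. (s - u s * sqrt s) / s) \<longlongrightarrow> 1) at_top" by (simp add: tendsto_cong)
  from filterlim_compose[OF this F_crit_at_top] show ?thesis by (simp add: lag_def)
qed

lemma lag_at_top: "filterlim lag at_top sequentially"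
proof -
  have "filterlim (\<lambda>n. (lag n / F (crit n)) * F (crit n)) at_top sequentially"
    by (rule filterlim_tendsto_pos_mult_at_top[OF lag_ratio _ F_crit_at_top]) simp
  moreover have "\<forall>\<^sub>F n in sequentially. lag n / F (crit n) * F (crit n) = lag n"
    using eventually_compose_filterlim[OF eventually_gt_at_top[of 0] F_crit_at_top] by eventually_elim simp
  ultimately show ?thesis
    using filterlim_cong[OF refl refl, of "\<lambda>n. lag n / F (crit n) * F (crit n)" lag sequentially at_top] by simp
qed

text \<open>Along the tilts \<open>F\<close> falls by O(sqrt F) only, while \<open>u\<close> tends
  to infinity, so the lag eventually lies below all tilted values of \<open>F\<close>;
  \<open>F_inv\<close> reverses the order.\<close>

lemma tilt_before_lag:
  "\<forall>\<^sub>F n in sequentially. \<forall>y. 0 \<le> y \<and> y \<le> 1 \<longrightarrow> 0 < crit n \<and> crit n \<le> crit n + y / sd n \<and> crit n + y / sd n \<le> F_inv (lag n)"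
proof -
  have "\<forall>\<^sub>F n in sequentially. 8 * exp 4 \<le> u (F (crit n))"
    by (rule eventually_compose_filterlim[OF _ F_crit_at_top]) (use u_top in \<open>simp add: filterlim_at_top\<close>)
  moreover have "\<forall>\<^sub>F n in sequentially. lag n > 0"
    by (rule eventually_compose_filterlim[OF eventually_gt_at_top lag_at_top])
  ultimately show ?thesis using eventually_ge_at_top[of 2]
  proof eventually_elim
    case (elim n)
    show ?case
    proof (intro allI impI conjI)
      fix y :: real assume y: "0 \<le> y \<and> y \<le> 1"
      show c: "0 < crit n" by (rule crit_bounds(1)[OF elim(3)])
      show le: "crit n \<le> crit n + y / sd n"
        using y sdev_bounds(3)[OF crit_bounds(1,2)[OF elim(3)]] by simp
      have "lag n \<le> F (crit n + y / sd n)"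
        unfolding lag_def using y by (intro F_tilt_bound elim) auto
      then have "F_inv (F (crit n + y / sd n)) \<le> F_inv (lag n)" by (rule F_inv_antimono[OF elim(2)])
      then show "crit n + y / sd n \<le> F_inv (lag n)" using c le by (simp add: F_inv_F)
    qed
  qed
qed

sublocale scaled_family "\<lambda>s. distr M borel (\<lambda>\<omega>. X (sample (F_inv s) \<omega>))" N a b
proof (rule scaled_family.intro)
  show "real_distribution (distr M borel (\<lambda>\<omega>. X (sample (F_inv s) \<omega>)))" for s
    by (rule real_distribution_distr[OF borel_measurable_sample])
  show "real_distribution N" by (rule N)
  show "b s > 0" if "s > 0" for s by (rule b_pos[OF that])
  have "distr (distr M borel (\<lambda>\<omega>. X (sample (F_inv s) \<omega>))) borel (\<lambda>x. b s * (x - a s))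
    = distr M borel (\<lambda>\<omega>. b s * (X (sample (F_inv s) \<omega>) - a s))" for s
    by (subst distr_distr) (auto simp: o_def intro!: borel_measurable_sample)
  then show "weak_limit (\<lambda>s. distr (distr M borel (\<lambda>\<omega>. X (sample (F_inv s) \<omega>))) borel (\<lambda>x. b s * (x - a s))) N at_top"
    using limit_law by simp
  show "cdf (distr M borel (\<lambda>\<omega>. X (sample (F_inv s') \<omega>))) x \<le> cdf (distr M borel (\<lambda>\<omega>. X (sample (F_inv s) \<omega>))) x"
    if s: "0 < s" "s \<le> s'" for s s' x
  proof -
    have s': "0 < s'" using s by simp
    have "AE \<omega> in M. X (sample (F_inv s) \<omega>) \<le> X (sample (F_inv s') \<omega>)"
      using AE_sample_mono[OF F_inv_pos[OF s'] F_inv_antimono[OF s]]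
      by eventually_elim (rule monotone_onD[OF X_mono sample_partition sample_partition])
    then have "AE \<omega> in M. \<omega> \<in> (\<lambda>\<omega>. X (sample (F_inv s') \<omega>)) -` {..x} \<inter> space M
        \<longrightarrow> \<omega> \<in> (\<lambda>\<omega>. X (sample (F_inv s) \<omega>)) -` {..x} \<inter> space M"
      by eventually_elim auto
    then have "prob ((\<lambda>\<omega>. X (sample (F_inv s') \<omega>)) -` {..x} \<inter> space M) \<le> prob ((\<lambda>\<omega>. X (sample (F_inv s) \<omega>)) -` {..x} \<inter> space M)"
      by (rule finite_measure_mono_AE) (rule measurable_sets[OF borel_measurable_sample], simp)
    then show ?thesis
      unfolding cdf_def by (simp add: measure_distr[OF borel_measurable_sample])
  qed
qed

text \<open>
  A nondegenerate limit fixes the scale: it forces the regularly varying factor \<open>b\<close> to be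
  comparable at \<open>s\<close> and at \<open>s - u(s) \<surd>s\<close>, although regular variation alone gives this only when the
  function is measurable. A degenerate limit says nothing about \<open>b\<close>, but then contiguity of
  the tilted laws is enough.
\<close>

lemma nondegenerate_tilt:
  assumes nd: "0 < cdf N x" "cdf N x < 1" and y: "0 \<le> y" "y \<le> 1"
  shows "(\<lambda>n. (\<integral>\<omega>. arctan (Y n (sample (crit n + y / sd n) \<omega>)) \<partial>M)) \<longlonglongrightarrow> (\<integral>x. arctan x \<partial>N)"
proof -
  \<comment> \<open>The scaling at \<open>F (crit n)\<close> is an affine function, with factor
    \<open>\<beta> n\<close> and shift \<open>d n\<close>, of the scaling at the lag. The centering
    hypothesis sends the shift to zero, and \<open>scale_ratio_tendsto\<close> the factor to
    one.\<close>
  define \<beta> d where "\<beta> n = b (F (crit n)) / b (lag n)" and "d n = b (F (crit n)) * (a (lag n) - a (F (crit n)))" for n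
  have \<beta>: "\<beta> \<longlonglongrightarrow> 1" unfolding \<beta>_def[abs_def]
    by (rule scale_ratio_tendsto[OF b_rv nd F_crit_at_top lag_ratio])
  have "(\<lambda>n. - (b (F (crit n)) * (a (F (crit n)) - a (lag n)))) \<longlonglongrightarrow> - 0"
    unfolding lag_def by (intro tendsto_minus filterlim_compose[OF centering F_crit_at_top])
  then have d: "d \<longlonglongrightarrow> 0" by (simp add: d_def[abs_def] algebra_simps)
  define V where "V n p = b (lag n) * (X p - a (lag n))" for n p
  have lim1: "(\<lambda>n. \<integral>\<omega>. arctan (V n (sample (F_inv (lag n)) \<omega>)) \<partial>M) \<longlonglongrightarrow> (\<integral>x. arctan x \<partial>N)"
    unfolding V_def by (rule filterlim_compose[OF integral_tendsto[OF continuous_bounded_arctan] lag_at_top])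
  have "\<forall>\<^sub>F n in sequentially. \<bar>d n\<bar> + \<bar>\<beta> n - 1\<bar> \<ge> norm
     ((\<integral>\<omega>. arctan (Y n (sample (F_inv (lag n)) \<omega>)) \<partial>M) - (\<integral>\<omega>. arctan (V n (sample (F_inv (lag n)) \<omega>)) \<partial>M))"
    using order_tendstoD(1)[OF \<beta>, of "1/2", simplified] eventually_compose_filterlim[OF eventually_gt_at_top[of 0] lag_at_top]
  proof eventually_elim
    case (elim n)
    have Yn: "Y n p = \<beta> n * V n p + d n" for p
      using b_pos[OF elim(2)] by (simp add: Y_def \<beta>_def V_def d_def algebra_simps)
    have "norm ((\<integral>\<omega>. arctan (Y n (sample (F_inv (lag n)) \<omega>)) - arctan (V n (sample (F_inv (lag n)) \<omega>)) \<partial>M))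
        \<le> (\<integral>\<omega>. norm (arctan (Y n (sample (F_inv (lag n)) \<omega>)) - arctan (V n (sample (F_inv (lag n)) \<omega>))) \<partial>M)"
      by (rule integral_norm_bound)
    also have "\<dots> \<le> (\<integral>\<omega>. \<bar>d n\<bar> + \<bar>\<beta> n - 1\<bar> \<partial>M)"
    proof (rule integral_mono)
      show "integrable M (\<lambda>\<omega>. norm (arctan (Y n (sample (F_inv (lag n)) \<omega>)) - arctan (V n (sample (F_inv (lag n)) \<omega>))))"
        by (intro integrable_norm Bochner_Integration.integrable_diff integrable_sample[OF arctan_abs_le])
      show "norm (arctan (Y n (sample (F_inv (lag n)) \<omega>)) - arctan (V n (sample (F_inv (lag n)) \<omega>))) \<le> \<bar>d n\<bar> + \<bar>\<beta> n - 1\<bar>" for \<omega>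
        unfolding Yn using arctan_affine_bound[of "\<beta> n"] elim(1) by simp
    qed simp
    finally show ?case
      by (subst (asm) Bochner_Integration.integral_diff)
        (simp_all add: prob_space integrable_sample[OF arctan_abs_le])
  qed
  then have "(\<lambda>n. (\<integral>\<omega>. arctan (Y n (sample (F_inv (lag n)) \<omega>)) \<partial>M) - (\<integral>\<omega>. arctan (V n (sample (F_inv (lag n)) \<omega>)) \<partial>M)) \<longlonglongrightarrow> 0"
  proof (rule Lim_null_comparison)
    have "(\<lambda>n. \<bar>d n\<bar> + \<bar>\<beta> n - 1\<bar>) \<longlonglongrightarrow> \<bar>0\<bar> + \<bar>1 - 1\<bar>" by (intro tendsto_intros d \<beta>)
    then show "(\<lambda>n. \<bar>d n\<bar> + \<bar>\<beta> n - 1\<bar>) \<longlonglongrightarrow> 0" by simp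
  qed
  from tendsto_add[OF this lim1]
  have lo: "(\<lambda>n. \<integral>\<omega>. arctan (Y n (sample (F_inv (lag n)) \<omega>)) \<partial>M) \<longlonglongrightarrow> (\<integral>x. arctan x \<partial>N)" by simp
  \<comment> \<open>A later time gives a smaller partition, so the mean at the tilted time lies
    between those at the lag and at \<open>crit n\<close>.\<close>
  show ?thesis
  proof (rule tendsto_sandwich[OF _ _ lo Y_integral_tendsto[OF continuous_bounded_arctan]])
    show "\<forall>\<^sub>F n in sequentially. (\<integral>\<omega>. arctan (Y n (sample (F_inv (lag n)) \<omega>)) \<partial>M)
        \<le> (\<integral>\<omega>. arctan (Y n (sample (crit n + y / sd n) \<omega>)) \<partial>M)"
      using tilt_before_lag eventually_ge_at_top[of 2]
    proof eventually_elim
      case (elim n)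
      from elim(1)[rule_format, OF conjI[OF y]] show ?case
        by (intro expectation_sample_antimono[where C = 2] arctan_Y_mono[OF elim(2)]) (linarith | rule arctan_abs_le)+
    qed
    show "\<forall>\<^sub>F n in sequentially. (\<integral>\<omega>. arctan (Y n (sample (crit n + y / sd n) \<omega>)) \<partial>M)
        \<le> (\<integral>\<omega>. arctan (Y n (sample (crit n) \<omega>)) \<partial>M)"
      using tilt_before_lag eventually_ge_at_top[of 2]
    proof eventually_elim
      case (elim n)
      from elim(1)[rule_format, OF conjI[OF y]] show ?case
        by (intro expectation_sample_antimono[where C = 2] arctan_Y_mono[OF elim(2)]) (linarith | rule arctan_abs_le)+
    qed
  qed
qed

lemma degenerate_tilt:
  assumes dg: "\<And>x. cdf N x = 0 \<or> cdf N x = 1" and y: "0 \<le> y" "y \<le> 1"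
  shows "(\<lambda>n. (\<integral>\<omega>. arctan (Y n (sample (crit n + y / sd n) \<omega>)) \<partial>M)) \<longlonglongrightarrow> (\<integral>x. arctan x \<partial>N)"
proof -
  interpret N: real_distribution N by (rule N)
  obtain c where c: "AE x in N. x = c" using N.degenerate_AE_const[OF dg] ..
  \<comment> \<open>Convergence to a constant means that the mean of this bounded distance vanishes,
    a property that contiguity passes on to the tilted laws.\<close>
  define f where "f x = \<bar>arctan x - arctan c\<bar>" for x
  have f4: "\<bar>f x\<bar> \<le> 4" for x
    using arctan_abs_le[of x] arctan_abs_le[of c] abs_triangle_ineq4[of "arctan x" "arctan c"] unfolding f_def by simp
  have fc: "continuous_on UNIV f" unfolding f_def by (intro continuous_intros)
  have fb: "bounded (range f)" by (rule boundedI[of _ 4]) (use f4 in auto)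
  have "(\<integral>x. f x \<partial>N) = (\<integral>x. 0 \<partial>N)"
    by (rule integral_cong_AE) (use c in \<open>auto simp: f_def intro!: borel_measurable_continuous_onI fc[unfolded f_def]\<close>)
  then have z: "(\<lambda>n. \<integral>\<omega>. f (Y n (sample (crit n) \<omega>)) \<partial>M) \<longlonglongrightarrow> 0"
    using Y_integral_tendsto[OF fc fb] by simp
  have m: "(\<integral>x. arctan x \<partial>N) = arctan c"
  proof -
    have "(\<integral>x. arctan x \<partial>N) = (\<integral>x. arctan c \<partial>N)"
      by (rule integral_cong_AE) (use c in \<open>auto intro!: borel_measurable_continuous_onI continuous_bounded_arctan\<close>)
    then show ?thesis using N.prob_space by simp
  qed
  have f0: "0 \<le> f (Y n p)" and f4': "f (Y n p) \<le> 4" for n p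
    using f4[of "Y n p"] by (simp_all add: f_def)
  have tl: "(\<lambda>n. \<integral>\<omega>. f (Y n (sample (crit n + y / sd n) \<omega>)) \<partial>M) \<longlonglongrightarrow> 0"
    by (rule contiguous_tilt[of "\<lambda>n p. f (Y n p)" y, OF f0 f4' _ z]) (use y in simp)
  have "norm ((\<integral>\<omega>. arctan (Y n (sample t \<omega>)) \<partial>M) - arctan c) \<le> (\<integral>\<omega>. f (Y n (sample t \<omega>)) \<partial>M)" for n t
  proof -
    have "(\<integral>\<omega>. arctan (Y n (sample t \<omega>)) \<partial>M) - arctan c = (\<integral>\<omega>. arctan (Y n (sample t \<omega>)) - arctan c \<partial>M)"
      by (subst Bochner_Integration.integral_diff) (simp_all add: prob_space integrable_sample[OF arctan_abs_le])
    also have "norm \<dots> \<le> (\<integral>\<omega>. norm (arctan (Y n (sample t \<omega>)) - arctan c) \<partial>M)" by (rule integral_norm_bound)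
    finally show ?thesis by (simp add: f_def)
  qed
  then have "(\<lambda>n. (\<integral>\<omega>. arctan (Y n (sample (crit n + y / sd n) \<omega>)) \<partial>M) - arctan c) \<longlonglongrightarrow> 0"
    by (intro Lim_null_comparison[OF _ tl] always_eventually allI)
  then show ?thesis unfolding m by (simp add: LIM_zero_iff)
qed

lemma arctan_tilt:
  assumes y: "0 \<le> y" "y \<le> 1"
  shows "(\<lambda>n. (\<integral>\<omega>. arctan (Y n (sample (crit n + y / sd n) \<omega>)) \<partial>M)) \<longlonglongrightarrow> (\<integral>x. arctan x \<partial>N)"
proof (cases "\<exists>x. 0 < cdf N x \<and> cdf N x < 1")
  case True
  then obtain x where "0 < cdf N x" "cdf N x < 1" by (elim exE conjE)
  then show ?thesis by (rule nondegenerate_tilt[OF _ _ y])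
next
  case False
  interpret N: real_distribution N by (rule N)
  have "cdf N x = 0 \<or> cdf N x = 1" for x
  proof (rule ccontr)
    assume "\<not> (cdf N x = 0 \<or> cdf N x = 1)"
    then have "0 < cdf N x \<and> cdf N x < 1"
      using N.cdf_nonneg[of x] N.cdf_bounded_prob[of x] by (simp add: order_less_le)
    then show False using False by (rule notE[OF _ exI, rotated])
  qed
  then show ?thesis by (rule degenerate_tilt[OF _ y])
qed

end

section \<open>From windows of sizes to a single size\<close>

text \<open>A random addition of total \<open>j\<close> carries the uniform law of size
  \<open>n\<close> to within \<eta> of the uniform law of size \<open>n + j\<close>, tested against
  functions bounded by one. The family is hidden by the quantifier; only its effect on means matters
  from here on.\<close>

definition coupled :: "nat \<Rightarrow> nat \<Rightarrow> real \<Rightarrow> bool" where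
  "coupled n j \<eta> \<longleftrightarrow> (\<exists>(\<Omega> :: (nat \<Rightarrow> nat) set) S. finite \<Omega> \<and> \<Omega> \<noteq> {} \<and> (\<forall>x\<in>\<Omega>. S x \<in> partitions_of j) \<and>
    (\<forall>\<psi>. (\<forall>p\<in>partitions_of (n + j). \<bar>\<psi> p\<bar> \<le> 1) \<longrightarrow>
      \<bar>(\<Sum>x\<in>\<Omega>. partition_mean n (\<lambda>p. \<psi> (p + S x))) / card \<Omega> - partition_mean (n + j) \<psi>\<bar> \<le> \<eta>))"

text \<open>The error of \<open>coupled_neighbours\<close> is continuous in \<delta> and vanishes at
  zero.\<close>

lemma small_scale_exists:
  fixes \<eta> :: real assumes "\<eta> > 0"
  obtains \<delta> where "0 < \<delta>" "\<delta> < 1 / 2" "sqrt ((1 + \<delta>) * exp (4 * exp 16 * \<delta>\<^sup>2) - 1) < \<eta>"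
proof -
  have "((\<lambda>\<delta>::real. sqrt ((1 + \<delta>) * exp (4 * exp 16 * \<delta>\<^sup>2) - 1)) \<longlongrightarrow> sqrt ((1 + 0) * exp (4 * exp 16 * 0\<^sup>2) - 1)) (at_right 0)"
    by (intro tendsto_intros)
  then have "\<forall>\<^sub>F \<delta> in at_right (0::real). sqrt ((1 + \<delta>) * exp (4 * exp 16 * \<delta>\<^sup>2) - 1) < \<eta>"
    by (rule order_tendstoD(2)) (use assms in simp)
  moreover have "\<forall>\<^sub>F \<delta> in at_right (0::real). \<delta> \<in> {0<..<1/2}" by (rule eventually_at_right_real) simp
  ultimately have "\<forall>\<^sub>F \<delta> in at_right (0::real). sqrt ((1 + \<delta>) * exp (4 * exp 16 * \<delta>\<^sup>2) - 1) < \<eta> \<and> \<delta> \<in> {0<..<1/2}"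
    by (rule eventually_conj)
  from eventually_happens[OF this] obtain \<delta> :: real
    where "sqrt ((1 + \<delta>) * exp (4 * exp 16 * \<delta>\<^sup>2) - 1) < \<eta> \<and> \<delta> \<in> {0<..<1/2}"
    by (auto simp: trivial_limit_at_right_real)
  then show ?thesis using that[of \<delta>] by simp
qed

context exponential_array
begin

text \<open>The hypothesis \<open>flat\<close> of \<open>partition_mean_shift\<close> comes from the
  local limit theorem: up to a vanishing error, scaled probabilities are at most \<open>A\<close>
  everywhere and at least \<open>A * exp (- (\<delta>^2 / 2))\<close> within
  \<open>\<delta> * sd n\<close> of \<open>n\<close>; the slack \<open>1 + \<delta>\<close> exceeds
  \<open>exp (\<delta>^2)\<close>. In the exponent, \<open>j \<le> \<delta> * sd n\<close> and
  \<open>(sd n)^2 \<le> 32 / t^3\<close> turn j^2 t^3 / 8 into at most 4 \<delta>^2.\<close>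

lemma coupled_neighbours:
  assumes \<delta>: "0 < \<delta>" "\<delta> < 1 / 2"
  defines "\<eta> \<equiv> sqrt ((1 + \<delta>) * exp (4 * exp 16 * \<delta>\<^sup>2) - 1)"
  shows "\<forall>\<^sub>F n in sequentially. \<forall>j. \<delta> / 2 * sd n \<le> real j \<and> real j \<le> \<delta> * sd n \<longrightarrow>
    j \<le> n \<and> coupled n j \<eta> \<and> coupled (n - j) j \<eta>"
proof -
  define A where "A = sqrt (2 * pi)"
  have A: "A > 0" by (simp add: A_def)
  have "(\<lambda>n. (1 + \<delta>) * (A * exp (- (\<delta>\<^sup>2 / 2)) - lclt_error n)\<^sup>2 - (A + lclt_error n)\<^sup>2)
      \<longlonglongrightarrow> (1 + \<delta>) * (A * exp (- (\<delta>\<^sup>2 / 2)) - 0)\<^sup>2 - (A + 0)\<^sup>2"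
    by (intro tendsto_intros lclt_error_tendsto)
  moreover have "0 < (1 + \<delta>) * (A * exp (- (\<delta>\<^sup>2 / 2)) - 0)\<^sup>2 - (A + 0)\<^sup>2"
  proof -
    have "1 - \<delta>\<^sup>2 \<le> exp (- \<delta>\<^sup>2)" using exp_ge_add_one_self[of "- \<delta>\<^sup>2"] by simp
    then have "(1 + \<delta>) * (1 - \<delta>\<^sup>2) \<le> (1 + \<delta>) * exp (- \<delta>\<^sup>2)" using \<delta> by (intro mult_left_mono) auto
    moreover have "1 < (1 + \<delta>) * (1 - \<delta>\<^sup>2)"
    proof -
      have "\<delta> * \<delta> < 1 / 2 * (1 / 2)" using \<delta> by (intro mult_strict_mono) auto
      then have "0 < \<delta> * (1 - \<delta> - \<delta> * \<delta>)" using \<delta> by (intro mult_pos_pos) auto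
      then show ?thesis by (simp add: power2_eq_square algebra_simps)
    qed
    ultimately have "A\<^sup>2 * 1 < A\<^sup>2 * ((1 + \<delta>) * exp (- \<delta>\<^sup>2))" using A by (intro mult_strict_left_mono) auto
    moreover have "(exp (- (\<delta>\<^sup>2 / 2)))\<^sup>2 = exp (- \<delta>\<^sup>2)"
      by (simp add: exp_double[symmetric])
    ultimately show ?thesis by (simp add: power_mult_distrib algebra_simps)
  qed
  ultimately have e1: "\<forall>\<^sub>F n in sequentially. 0 < (1 + \<delta>) * (A * exp (- (\<delta>\<^sup>2 / 2)) - lclt_error n)\<^sup>2 - (A + lclt_error n)\<^sup>2"
    by (rule order_tendstoD(1))
  have "0 < A * exp (- (\<delta>\<^sup>2 / 2))" using A by simp
  then have e2: "\<forall>\<^sub>F n in sequentially. lclt_error n < A * exp (- (\<delta>\<^sup>2 / 2))"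
    by (rule order_tendstoD(2)[OF lclt_error_tendsto])
  \<comment> \<open>The bound 1/6 gives \<open>sd n \<le> 1 / t^2\<close>, hence
    \<open>j \<le> n\<close> and the upper bound required of \<open>j\<close>; the other one gives
    \<open>8 / t \<le> \<delta> / 2 * sd n\<close>, the lower bound.\<close>
  have "(\<lambda>n. sqrt (crit n)) \<longlonglongrightarrow> sqrt 0" by (intro tendsto_intros crit_tendsto)
  moreover have "min (1 / 6) (\<delta> * exp (- 2) / 16) > sqrt 0" using \<delta> by simp
  ultimately have e3: "\<forall>\<^sub>F n in sequentially. sqrt (crit n) < min (1 / 6) (\<delta> * exp (- 2) / 16)"
    by (rule order_tendstoD(2))
  show ?thesis using e1 e2 e3 eventually_ge_at_top[of 2]
  proof eventually_elim
    case (elim n)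
    define t where "t = crit n"
    define \<sigma> where "\<sigma> = sd n"
    have t: "0 < t" "t \<le> 1" using crit_bounds[OF elim(4)] by (simp_all add: t_def)
    have \<sigma>: "\<sigma> > 0" "\<sigma>\<^sup>2 \<le> 32 / t ^ 3" "exp (- 2) / (t * sqrt t) \<le> \<sigma>"
      using sdev_bounds[OF t] sd_lower[OF elim(4)] by (simp_all add: \<sigma>_def t_def)
    have rt: "sqrt t \<le> 1 / 6" "sqrt t \<le> \<delta> * exp (- 2) / 16" "0 < sqrt t" using elim(3) t by (simp_all add: t_def)
    have \<sigma>u: "\<sigma> \<le> 6 / (t * sqrt t)"
    proof (rule power2_le_imp_le)
      have "\<sigma>\<^sup>2 \<le> 36 / t ^ 3" 
      proof -
        have "32 / t ^ 3 \<le> 36 / t ^ 3" using t by (intro divide_right_mono) auto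
        then show ?thesis using \<sigma>(2) by linarith
      qed
      also have "\<dots> = (6 / (t * sqrt t))\<^sup>2" using t by (simp add: power_divide power_mult_distrib eval_nat_numeral)
      finally show "\<sigma>\<^sup>2 \<le> (6 / (t * sqrt t))\<^sup>2" .
    qed (use t in simp)
    have \<sigma>t: "\<sigma> \<le> 1 / t\<^sup>2"
    proof -
      have "6 / (t * sqrt t) = 6 * sqrt t / t\<^sup>2" using t by (simp add: field_simps power2_eq_square)
      also have "\<dots> \<le> 1 / t\<^sup>2" using rt(1) t by (intro divide_right_mono) auto
      finally show ?thesis using \<sigma>u by simp
    qed
    have up: "2 * pi * (\<sigma> * level_prob t k) \<le> A + lclt_error n" for k
    proof -
      have "A * exp (- (((real k - real n) / \<sigma>)\<^sup>2 / 2)) \<le> A * 1" using A by (intro mult_left_mono) auto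
      then show ?thesis using local_clt[OF elim(4), of k] unfolding A_def t_def \<sigma>_def abs_le_iff by linarith
    qed
    have low: "A * exp (- (\<delta>\<^sup>2 / 2)) - lclt_error n \<le> 2 * pi * (\<sigma> * level_prob t m)"
      if m: "\<bar>real m - real n\<bar> \<le> \<delta> * \<sigma>" for m
    proof -
      have "\<bar>(real m - real n) / \<sigma>\<bar> \<le> \<delta>" using m \<sigma>(1) by (simp add: field_simps)
      then have "((real m - real n) / \<sigma>)\<^sup>2 \<le> \<delta>\<^sup>2" by (metis abs_ge_zero power2_abs power_mono)
      then have "A * exp (- (\<delta>\<^sup>2 / 2)) \<le> A * exp (- (((real m - real n) / \<sigma>)\<^sup>2 / 2))"
        using A by (intro mult_left_mono) auto
      then show ?thesis using local_clt[OF elim(4), of m] unfolding A_def t_def \<sigma>_def abs_le_iff by linarith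
    qed
    have flat: "level_prob t k * level_prob t l \<le> (1 + \<delta>) * (level_prob t m)\<^sup>2"
      if m: "\<bar>real m - real n\<bar> \<le> \<delta> * \<sigma>" for k l m
    proof -
      define c where "c = 2 * pi * \<sigma>"
      have c: "c > 0" using \<sigma>(1) by (simp add: c_def)
      have "(c * level_prob t k) * (c * level_prob t l) \<le> (A + lclt_error n) * (A + lclt_error n)"
      proof (rule mult_mono)
        show "c * level_prob t k \<le> A + lclt_error n" "c * level_prob t l \<le> A + lclt_error n"
          using up[of k] up[of l] by (simp_all add: c_def mult.assoc)
        show nn: "0 \<le> c * level_prob t l" using c level_prob_nonneg by simp
        show "0 \<le> A + lclt_error n" using nn up[of l] by (simp add: c_def mult.assoc)
      qed
      also have "\<dots> \<le> (1 + \<delta>) * (A * exp (- (\<delta>\<^sup>2 / 2)) - lclt_error n)\<^sup>2"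
        using elim(1) by (simp add: power2_eq_square)
      also have "\<dots> \<le> (1 + \<delta>) * (c * level_prob t m)\<^sup>2"
        using low[OF m] elim(2) \<delta> by (intro mult_left_mono power_mono) (auto simp: c_def mult.assoc)
      finally have "c\<^sup>2 * (level_prob t k * level_prob t l) \<le> c\<^sup>2 * ((1 + \<delta>) * (level_prob t m)\<^sup>2)"
        by (simp add: power2_eq_square mult_ac)
      then show ?thesis using c by simp
    qed
    show ?case
    proof (intro allI impI)
      fix j assume j: "\<delta> / 2 * sd n \<le> real j \<and> real j \<le> \<delta> * sd n"
      then have j1: "\<delta> / 2 * \<sigma> \<le> real j" and j2: "real j \<le> \<delta> * \<sigma>" by (simp_all add: \<sigma>_def)
      have "\<delta> * \<sigma> \<le> 1 * \<sigma>" using \<delta> \<sigma>(1) by (intro mult_right_mono) auto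
      then have j3: "real j \<le> 1 / t\<^sup>2" using j2 \<sigma>t by linarith
      have jn: "j \<le> n"
      proof -
        have "real n = pi\<^sup>2 / (6 * t\<^sup>2)" using crit_square[of n] elim(4) by (simp add: t_def)
        also have "\<dots> = pi\<^sup>2 / 6 / t\<^sup>2" by simp
        also have "\<dots> \<ge> 1 / t\<^sup>2"
        proof (rule divide_right_mono)
          have "3\<^sup>2 \<le> pi\<^sup>2" using pi_gt3 by (intro power_mono) auto
          then show "1 \<le> pi\<^sup>2 / 6" by simp
        qed simp
        finally show ?thesis using j3 by linarith
      qed
      have c1: "8 / t \<le> real j"
      proof -
        have "8 / t = (16 * sqrt t) / 2 / (t * sqrt t)" using rt(3) t by (simp add: field_simps)
        also have "\<dots> \<le> (\<delta> * exp (- 2)) / 2 / (t * sqrt t)"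
          using rt(2) t by (intro divide_right_mono) auto
        also have "\<dots> = \<delta> / 2 * (exp (- 2) / (t * sqrt t))" by simp
        also have "\<dots> \<le> \<delta> / 2 * \<sigma>" using \<sigma>(3) \<delta> by (intro mult_left_mono) auto
        finally show ?thesis using j1 by linarith
      qed
      have c2: "real j \<le> 4 / t\<^sup>2"
      proof -
        have "1 / t\<^sup>2 \<le> 4 / t\<^sup>2" by (rule divide_right_mono) auto
        then show ?thesis using j3 by linarith
      qed
      have err: "sqrt ((1 + \<delta>) * exp (exp 16 * (real j)\<^sup>2 * t ^ 3 / 8) - 1) \<le> \<eta>"
      proof -
        have "(real j)\<^sup>2 \<le> (\<delta> * \<sigma>)\<^sup>2" using j2 by (intro power_mono) auto
        also have "\<dots> = \<delta>\<^sup>2 * \<sigma>\<^sup>2" by (simp add: power_mult_distrib)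
        also have "\<dots> \<le> \<delta>\<^sup>2 * (32 / t ^ 3)" using \<sigma>(2) by (intro mult_left_mono) auto
        finally have "(real j)\<^sup>2 * t ^ 3 \<le> \<delta>\<^sup>2 * (32 / t ^ 3) * t ^ 3" using t by (intro mult_right_mono) auto
        then have "(real j)\<^sup>2 * t ^ 3 \<le> 32 * \<delta>\<^sup>2" using t by simp
        then have "exp 16 * ((real j)\<^sup>2 * t ^ 3) \<le> exp 16 * (32 * \<delta>\<^sup>2)" by (intro mult_left_mono) auto
        then have "exp 16 * (real j)\<^sup>2 * t ^ 3 / 8 \<le> 4 * exp 16 * \<delta>\<^sup>2" by (simp add: mult.assoc)
        then have "(1 + \<delta>) * exp (exp 16 * (real j)\<^sup>2 * t ^ 3 / 8) \<le> (1 + \<delta>) * exp (4 * exp 16 * \<delta>\<^sup>2)"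
          using \<delta> by (intro mult_left_mono) auto
        then show ?thesis unfolding \<eta>_def by (intro real_sqrt_le_mono) simp
      qed
      have main: "coupled m j \<eta>" if m: "\<bar>real m - real n\<bar> \<le> \<delta> * \<sigma>" for m
      proof -
        have fl: "real (card (partitions_of k)) * exp (- t * k)
          * (real (card (partitions_of (m + j))) * exp (- t * (m + j)))
          \<le> (1 + \<delta>) * (real (card (partitions_of m)) * exp (- t * m))\<^sup>2" for k
        proof -
          have lp: "level_prob t k = real (card (partitions_of k)) * exp (- t * k) * exp (- F t)" for k
            unfolding level_prob_def by (simp only: diff_conv_add_uminus exp_add mult.assoc)
          define e where "e = exp (- F t)"
          have e: "e\<^sup>2 > 0" by (simp add: e_def)
          have "e\<^sup>2 * (real (card (partitions_of k)) * exp (- t * k) * (real (card (partitions_of (m + j))) * exp (- t * (m + j))))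
            \<le> e\<^sup>2 * ((1 + \<delta>) * (real (card (partitions_of m)) * exp (- t * m))\<^sup>2)"
            using flat[OF m, of k "m + j"] unfolding lp e_def[symmetric]
            by (simp add: power2_eq_square mult_ac)
          then show ?thesis using e by (simp only: mult_le_cancel_left_pos)
        qed
        from partition_mean_shift[OF t less_imp_le[OF \<delta>(1)] c1 c2 fl]
        obtain \<Omega> :: "(nat \<Rightarrow> nat) set" and S where OS: "finite \<Omega>" "\<Omega> \<noteq> {}" "\<forall>x\<in>\<Omega>. S x \<in> partitions_of j"
          "\<forall>\<psi>. (\<forall>p\<in>partitions_of (m + j). \<bar>\<psi> p\<bar> \<le> 1) \<longrightarrow>
            \<bar>(\<Sum>x\<in>\<Omega>. partition_mean m (\<lambda>p. \<psi> (p + S x))) / card \<Omega> - partition_mean (m + j) \<psi>\<bar>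
              \<le> sqrt ((1 + \<delta>) * exp (exp 16 * (real j)\<^sup>2 * t ^ 3 / 8) - 1)"
          by (elim exE conjE)
        show ?thesis unfolding coupled_def
          by (rule exI[of _ \<Omega>], rule exI[of _ S]) (use OS(1-3) order_trans[OF OS(4)[rule_format] err] in simp)
      qed
      have "\<bar>real n - real n\<bar> \<le> \<delta> * \<sigma>" using \<delta> \<sigma>(1) by simp
      moreover have "\<bar>real (n - j) - real n\<bar> \<le> \<delta> * \<sigma>" using jn j2 by (simp add: of_nat_diff)
      ultimately show "j \<le> n \<and> coupled n j \<eta> \<and> coupled (n - j) j \<eta>" using jn main by simp
    qed
  qed
qed

end

lemma partitions_of_partition: "p \<in> partitions_of n \<Longrightarrow> p \<in> partitions"
  by (simp add: partitions_of_def)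

lemma partition_mean_abs_le_1:
  assumes "\<And>p. \<bar>f p\<bar> \<le> 1" shows "\<bar>partition_mean n f\<bar> \<le> 1"
proof -
  have "partition_mean n (\<lambda>p. \<bar>f p\<bar>) \<le> partition_mean n (\<lambda>_. 1)" by (rule partition_mean_mono) (rule assms)
  then show ?thesis using partition_mean_abs_le[of n f] by (simp add: partition_mean_const)
qed

text \<open>An addition can only increase \<open>g\<close>; \<eta> pays for the sum not being
  exactly uniform.\<close>

lemma coupled_monotone:
  assumes c: "coupled n j \<eta>" and g: "monotone_on partitions (\<subseteq>#) (\<le>) g" "\<And>p. \<bar>g p\<bar> \<le> 1"
  shows "partition_mean n g \<le> partition_mean (n + j) g + \<eta>"
proof -
  from c obtain \<Omega> :: "(nat \<Rightarrow> nat) set" and S where O: "finite \<Omega>" "\<Omega> \<noteq> {}"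
    and S: "\<forall>x\<in>\<Omega>. S x \<in> partitions_of j"
    and av: "\<forall>\<psi>. (\<forall>p\<in>partitions_of (n + j). \<bar>\<psi> p\<bar> \<le> 1) \<longrightarrow>
      \<bar>(\<Sum>x\<in>\<Omega>. partition_mean n (\<lambda>p. \<psi> (p + S x))) / card \<Omega> - partition_mean (n + j) \<psi>\<bar> \<le> \<eta>"
    unfolding coupled_def by (elim exE conjE)
  have k: "0 < real (card \<Omega>)" using O by (simp add: card_gt_0_iff)
  have "(\<Sum>x\<in>\<Omega>. partition_mean n g) \<le> (\<Sum>x\<in>\<Omega>. partition_mean n (\<lambda>p. g (p + S x)))"
  proof (intro sum_mono partition_mean_mono monotone_onD[OF g(1)])
    fix x p assume x: "x \<in> \<Omega>" and p: "p \<in> partitions_of n"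
    show "p \<in> partitions" by (rule partitions_of_partition[OF p])
    show "p + S x \<in> partitions" by (rule partitions_of_partition[OF partitions_of_add[OF S[rule_format, OF x] p]])
  qed simp
  then have "partition_mean n g \<le> (\<Sum>x\<in>\<Omega>. partition_mean n (\<lambda>p. g (p + S x))) / card \<Omega>"
    using k by (simp add: field_simps)
  moreover have "\<bar>(\<Sum>x\<in>\<Omega>. partition_mean n (\<lambda>p. g (p + S x))) / card \<Omega> - partition_mean (n + j) g\<bar> \<le> \<eta>"
    using g(2) by (intro av[rule_format]) simp
  ultimately show ?thesis by (simp add: abs_le_iff)
qed

text \<open>Each addition changes \<open>f\<close> by at most \<open>e\<close> plus \<open>C\<close>
  times the increments of the \<open>g i\<close> along the same addition. Averaged, these become
  differences of means at the two sizes, at the price of \<eta> for \<open>f\<close> and for each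
  \<open>g i\<close>.\<close>

lemma coupled_controlled:
  fixes f :: "nat multiset \<Rightarrow> real" and g :: "'i \<Rightarrow> nat multiset \<Rightarrow> real"
  assumes c: "coupled n j \<eta>" and f: "\<And>p. \<bar>f p\<bar> \<le> 1" and g: "\<And>i p. \<bar>g i p\<bar> \<le> 1" and C: "0 \<le> C"
    and fg: "\<And>p q. p \<in> partitions \<Longrightarrow> q \<in> partitions \<Longrightarrow> p \<subseteq># q \<Longrightarrow> \<bar>f p - f q\<bar> \<le> e + C * (\<Sum>i\<in>I. g i q - g i p)"
  shows "\<bar>partition_mean n f - partition_mean (n + j) f\<bar>
    \<le> e + \<eta> + C * (\<Sum>i\<in>I. partition_mean (n + j) (g i) - partition_mean n (g i) + \<eta>)"
proof -
  from c obtain \<Omega> :: "(nat \<Rightarrow> nat) set" and S where O: "finite \<Omega>" "\<Omega> \<noteq> {}"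
    and S: "\<forall>x\<in>\<Omega>. S x \<in> partitions_of j"
    and av: "\<forall>\<psi>. (\<forall>p\<in>partitions_of (n + j). \<bar>\<psi> p\<bar> \<le> 1) \<longrightarrow>
      \<bar>(\<Sum>x\<in>\<Omega>. partition_mean n (\<lambda>p. \<psi> (p + S x))) / card \<Omega> - partition_mean (n + j) \<psi>\<bar> \<le> \<eta>"
    unfolding coupled_def by (elim exE conjE)
  define k where "k = real (card \<Omega>)"
  have k: "0 < k" using O by (simp add: card_gt_0_iff k_def)
  define A where "A \<psi> = (\<Sum>x\<in>\<Omega>. partition_mean n (\<lambda>p. \<psi> (p + S x))) / k" for \<psi> :: "nat multiset \<Rightarrow> real"
  have Af: "\<bar>A f - partition_mean (n + j) f\<bar> \<le> \<eta>" unfolding A_def k_def using f by (intro av[rule_format]) simp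
  have Ag: "\<bar>A (g i) - partition_mean (n + j) (g i)\<bar> \<le> \<eta>" for i
    unfolding A_def k_def using g by (intro av[rule_format]) simp
  have "k * \<bar>partition_mean n f - A f\<bar> = \<bar>\<Sum>x\<in>\<Omega>. partition_mean n f - partition_mean n (\<lambda>p. f (p + S x))\<bar>"
    using k by (simp add: A_def sum_subtractf k_def[symmetric] abs_mult[of k, simplified abs_of_pos[OF k], symmetric] right_diff_distrib)
  also have "\<dots> \<le> (\<Sum>x\<in>\<Omega>. \<bar>partition_mean n f - partition_mean n (\<lambda>p. f (p + S x))\<bar>)" by (rule sum_abs)
  also have "\<dots> \<le> (\<Sum>x\<in>\<Omega>. e + C * (\<Sum>i\<in>I. partition_mean n (\<lambda>p. g i (p + S x)) - partition_mean n (g i)))"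
  proof (rule sum_mono)
    fix x assume x: "x \<in> \<Omega>"
    have "\<bar>partition_mean n f - partition_mean n (\<lambda>p. f (p + S x))\<bar> \<le> partition_mean n (\<lambda>p. \<bar>f p - f (p + S x)\<bar>)"
      unfolding partition_mean_diff[symmetric] by (rule partition_mean_abs_le)
    also have "\<dots> \<le> partition_mean n (\<lambda>p. e + C * (\<Sum>i\<in>I. g i (p + S x) - g i p))"
    proof (intro partition_mean_mono fg)
      fix p assume p: "p \<in> partitions_of n"
      show "p \<in> partitions" by (rule partitions_of_partition[OF p])
      show "p + S x \<in> partitions" by (rule partitions_of_partition[OF partitions_of_add[OF S[rule_format, OF x] p]])
    qed simp
    also have "\<dots> = e + C * (\<Sum>i\<in>I. partition_mean n (\<lambda>p. g i (p + S x)) - partition_mean n (g i))"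
      by (simp only: partition_mean_add partition_mean_const partition_mean_cmult partition_mean_sum partition_mean_diff)
    finally show "\<bar>partition_mean n f - partition_mean n (\<lambda>p. f (p + S x))\<bar>
      \<le> e + C * (\<Sum>i\<in>I. partition_mean n (\<lambda>p. g i (p + S x)) - partition_mean n (g i))" .
  qed
  also have "\<dots> = k * e + C * (\<Sum>i\<in>I. \<Sum>x\<in>\<Omega>. partition_mean n (\<lambda>p. g i (p + S x)) - partition_mean n (g i))"
    by (subst sum.swap) (simp add: sum.distrib sum_distrib_left k_def)
  also have "\<dots> = k * (e + C * (\<Sum>i\<in>I. A (g i) - partition_mean n (g i)))"
  proof -
    have "(\<Sum>x\<in>\<Omega>. partition_mean n (\<lambda>p. g i (p + S x)) - partition_mean n (g i)) = k * (A (g i) - partition_mean n (g i))" for i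
      using k by (simp add: A_def sum_subtractf k_def[symmetric] right_diff_distrib)
    then show ?thesis by (simp add: sum_distrib_left[symmetric] distrib_left mult_ac)
  qed
  finally have "\<bar>partition_mean n f - A f\<bar> \<le> e + C * (\<Sum>i\<in>I. A (g i) - partition_mean n (g i))"
    using k by (simp only: mult_le_cancel_left_pos)
  also have "\<dots> \<le> e + C * (\<Sum>i\<in>I. partition_mean (n + j) (g i) - partition_mean n (g i) + \<eta>)"
  proof (intro add_left_mono mult_left_mono sum_mono C)
    fix i show "A (g i) - partition_mean n (g i) \<le> partition_mean (n + j) (g i) - partition_mean n (g i) + \<eta>"
      using Ag[of i] by (simp add: abs_le_iff)
  qed
  finally show ?thesis using Af by linarith
qed

context exponential_array
begin

lemma window_mean_tendsto:
  fixes \<phi> :: "nat \<Rightarrow> nat multiset \<Rightarrow> real"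
  assumes \<phi>: "\<And>n p. \<bar>\<phi> n p\<bar> \<le> 1"
    and lim: "\<And>y. 0 \<le> y \<Longrightarrow> y \<le> 1 \<Longrightarrow> (\<lambda>n. \<integral>\<omega>. \<phi> n (sample (crit n + y / sd n) \<omega>) \<partial>M) \<longlonglongrightarrow> l"
    and xy: "x < y"
  shows "(\<lambda>n. \<Sum>m\<in>window n x y. level_prob (crit n) m * partition_mean m (\<phi> n)) \<longlonglongrightarrow> l * measure std_normal_distribution {x<..y}"
proof -
  \<comment> \<open>\<open>window_sum_tendsto\<close> takes weights between 0 and 1, so means
    between -1 and 1 are transformed affinely.\<close>
  define \<beta> where "\<beta> n m = (1 + partition_mean m (\<phi> n)) / 2" for n m
  define c where "c = (1 + l) / 2"
  have le: "\<bar>\<integral>\<omega>. \<phi> n (sample t \<omega>) \<partial>M\<bar> \<le> 1" for n t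
  proof -
    have "norm (\<integral>\<omega>. \<phi> n (sample t \<omega>) \<partial>M) \<le> (\<integral>\<omega>. norm (\<phi> n (sample t \<omega>)) \<partial>M)" by (rule integral_norm_bound)
    also have "\<dots> \<le> (\<integral>\<omega>. 1 \<partial>M)"
      using \<phi> by (intro integral_mono integrable_norm integrable_sample[OF \<phi>]) simp_all
    finally show ?thesis by (simp add: prob_space)
  qed
  have l: "-1 \<le> l" "l \<le> 1"
    using tendsto_lowerbound[OF lim[of 0], of "-1"] tendsto_upperbound[OF lim[of 0], of 1] le
    by (simp_all add: abs_le_iff minus_le_iff)
  have \<beta>: "0 \<le> \<beta> n m" "\<beta> n m \<le> 1" for n m
    using partition_mean_abs_le_1[of "\<phi> n" m, OF \<phi>] by (simp_all add: \<beta>_def abs_le_iff)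
  have "(\<lambda>n. \<Sum>m\<in>window n x y. level_prob (crit n) m * \<beta> n m) \<longlonglongrightarrow> c * measure std_normal_distribution {x<..y}"
  proof (rule window_sum_tendsto[OF \<beta> _ _ _ xy])
    show "0 \<le> c" "c \<le> 1" using l by (simp_all add: c_def)
    fix z :: real assume z: "0 \<le> z" "z \<le> 1"
    have "(\<lambda>n. ((\<integral>\<omega>. \<phi> n (sample (crit n + z / sd n) \<omega>) \<partial>M) - l) / 2) \<longlonglongrightarrow> (l - l) / 2"
      by (intro tendsto_divide tendsto_diff lim z tendsto_const) simp
    then have 0: "(\<lambda>n. ((\<integral>\<omega>. \<phi> n (sample (crit n + z / sd n) \<omega>) \<partial>M) - l) / 2) \<longlonglongrightarrow> 0" by simp
    have "\<forall>\<^sub>F n in sequentially. ((\<integral>\<omega>. \<phi> n (sample (crit n + z / sd n) \<omega>) \<partial>M) - l) / 2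
      = (\<Sum>m. level_prob (crit n + z / sd n) m * (\<beta> n m - c))"
      using eventually_regular
    proof eventually_elim
      case (elim n)
      have t: "crit n + z / sd n > 0" by (rule shift_small(2)[OF elim]) (use z in simp)
      have "(\<lambda>m. (level_prob (crit n + z / sd n) m * partition_mean m (\<phi> n) - l * level_prob (crit n + z / sd n) m) / 2)
        sums (((\<integral>\<omega>. \<phi> n (sample (crit n + z / sd n) \<omega>) \<partial>M) - l * 1) / 2)"
        by (intro sums_divide sums_diff sums_mult level_prob_sums level_prob_mean_sums[OF t \<phi>] t)
      moreover have "(level_prob (crit n + z / sd n) m * partition_mean m (\<phi> n) - l * level_prob (crit n + z / sd n) m) / 2
        = level_prob (crit n + z / sd n) m * (\<beta> n m - c)" for m
        by (simp add: \<beta>_def c_def field_simps)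
      ultimately show ?case by (simp add: sums_iff)
    qed
    from Lim_transform_eventually[OF 0 this]
    show "(\<lambda>n. \<Sum>m. level_prob (crit n + z / sd n) m * (\<beta> n m - c)) \<longlonglongrightarrow> 0" .
  qed
  from tendsto_diff[OF tendsto_mult[OF tendsto_const[of 2] this] window_sum[OF xy]]
  have "(\<lambda>n. 2 * (\<Sum>m\<in>window n x y. level_prob (crit n) m * \<beta> n m) - (\<Sum>m\<in>window n x y. level_prob (crit n) m))
    \<longlonglongrightarrow> 2 * (c * measure std_normal_distribution {x<..y}) - measure std_normal_distribution {x<..y}" .
  moreover have "2 * (\<Sum>m\<in>window n x y. level_prob (crit n) m * \<beta> n m) - (\<Sum>m\<in>window n x y. level_prob (crit n) m)
    = (\<Sum>m\<in>window n x y. level_prob (crit n) m * partition_mean m (\<phi> n))" for n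
    unfolding sum_distrib_left sum_subtractf[symmetric] by (rule sum.cong) (simp_all add: \<beta>_def field_simps)
  moreover have "2 * (c * w) - w = l * w" for w :: real by (simp add: c_def field_simps)
  ultimately show ?thesis by simp
qed

text \<open>The windows keep a distance from \<open>n\<close> because an addition must be large
  enough to contain a pair of parts. Additions only enlarge, so the coupling starts from
  \<open>n\<close> for the right window and from \<open>m\<close> for the left one.\<close>

lemma window_coupled:
  assumes d: "0 < \<delta>" "\<delta> < 1 / 2" "sqrt ((1 + \<delta>) * exp (4 * exp 16 * \<delta>\<^sup>2) - 1) = \<eta>"
  shows "\<forall>\<^sub>F n in sequentially. (\<forall>m\<in>window n (\<delta> / 2) \<delta>. \<exists>j. m = n + j \<and> coupled n j \<eta>) \<and>
    (\<forall>m\<in>window n (- \<delta>) (- (\<delta> / 2)). \<exists>j. n = m + j \<and> coupled m j \<eta>)"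
  using coupled_neighbours[OF d(1,2)] eventually_regular
proof eventually_elim
  case (elim n)
  note s = regular_pos(3)[OF elim(2)]
  show ?case
  proof (intro conjI ballI)
    fix m assume "m \<in> window n (\<delta> / 2) \<delta>"
    then have m: "\<delta> / 2 * sd n < real m - real n" "real m - real n \<le> \<delta> * sd n"
      using s by (simp_all add: window_def xi_def pos_less_divide_eq pos_divide_le_eq)
    have "0 < \<delta> / 2 * sd n" using d s by simp
    then have nm: "n \<le> m" using m by linarith
    have "coupled n (m - n) \<eta>"
      using elim(1)[rule_format, of "m - n"] m nm unfolding d(3) by (simp add: of_nat_diff)
    then show "\<exists>j. m = n + j \<and> coupled n j \<eta>" using nm by (intro exI[of _ "m - n"]) simp
  next
    fix m assume "m \<in> window n (- \<delta>) (- (\<delta> / 2))"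
    then have m: "- \<delta> * sd n < real m - real n" "real m - real n \<le> - (\<delta> / 2) * sd n"
      using s by (simp_all add: window_def xi_def pos_less_divide_eq pos_divide_le_eq)
    have "0 < \<delta> / 2 * sd n" using d s by simp
    then have nm: "m \<le> n" using m by linarith
    have "coupled (n - (n - m)) (n - m) \<eta>"
      using elim(1)[rule_format, of "n - m"] m nm unfolding d(3) by (simp add: of_nat_diff)
    then show "\<exists>j. n = m + j \<and> coupled m j \<eta>" using nm by (intro exI[of _ "n - m"]) simp
  qed
qed

lemma monotone_mean_tendsto:
  fixes g :: "nat \<Rightarrow> nat multiset \<Rightarrow> real"
  assumes g: "\<And>n p. \<bar>g n p\<bar> \<le> 1" "\<And>n. n \<ge> 2 \<Longrightarrow> monotone_on partitions (\<subseteq>#) (\<le>) (g n)"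
    and lim: "\<And>y. 0 \<le> y \<Longrightarrow> y \<le> 1 \<Longrightarrow> (\<lambda>n. \<integral>\<omega>. g n (sample (crit n + y / sd n) \<omega>) \<partial>M) \<longlonglongrightarrow> l"
  shows "(\<lambda>n. partition_mean n (g n)) \<longlonglongrightarrow> l"
proof (rule tendstoI)
  fix r :: real assume r: "r > 0"
  obtain \<delta> where d: "0 < \<delta>" "\<delta> < 1 / 2" and dr: "sqrt ((1 + \<delta>) * exp (4 * exp 16 * \<delta>\<^sup>2) - 1) < r"
    by (rule small_scale_exists[OF r])
  define \<eta> where "\<eta> = sqrt ((1 + \<delta>) * exp (4 * exp 16 * \<delta>\<^sup>2) - 1)"
  define W S where "W n x y = (\<Sum>m\<in>window n x y. level_prob (crit n) m)"
    and "S n x y = (\<Sum>m\<in>window n x y. level_prob (crit n) m * partition_mean m (g n))" for n x y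
  have quot: "(\<lambda>n. S n x y / W n x y) \<longlonglongrightarrow> l" and Wpos: "\<forall>\<^sub>F n in sequentially. W n x y > 0" if xy: "x < y" for x y
  proof -
    have "(\<lambda>n. S n x y / W n x y) \<longlonglongrightarrow> l * measure std_normal_distribution {x<..y} / measure std_normal_distribution {x<..y}"
      unfolding S_def W_def using std_normal_Ioc_pos[OF xy]
      by (intro tendsto_divide window_mean_tendsto[OF g(1) lim xy] window_sum[OF xy]) simp_all
    then show "(\<lambda>n. S n x y / W n x y) \<longlonglongrightarrow> l" using std_normal_Ioc_pos[OF xy] by simp
    show "\<forall>\<^sub>F n in sequentially. W n x y > 0"
      unfolding W_def by (rule order_tendstoD(1)[OF window_sum[OF xy] std_normal_Ioc_pos[OF xy]])
  qed
  have xy1: "\<delta> / 2 < \<delta>" and xy2: "- \<delta> < - (\<delta> / 2)" using d by simp_all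
  \<comment> \<open>The coupling error, smaller than \<open>r\<close>, is spent once; the window
    averages are therefore asked to be within \<open>r - \<eta>\<close> of the limit.\<close>
  have "\<forall>\<^sub>F n in sequentially. S n (\<delta> / 2) \<delta> / W n (\<delta> / 2) \<delta> < l + (r - \<eta>)"
    using dr by (intro order_tendstoD(2)[OF quot[OF xy1]]) (simp add: \<eta>_def)
  moreover have "\<forall>\<^sub>F n in sequentially. l - (r - \<eta>) < S n (- \<delta>) (- (\<delta> / 2)) / W n (- \<delta>) (- (\<delta> / 2))"
    using dr by (intro order_tendstoD(1)[OF quot[OF xy2]]) (simp add: \<eta>_def)
  ultimately show "\<forall>\<^sub>F n in sequentially. dist (partition_mean n (g n)) l < r"
    using Wpos[OF xy1] Wpos[OF xy2] window_coupled[OF d \<eta>_def[symmetric]] eventually_ge_at_top[of 2]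
  proof eventually_elim
    case (elim n)
    note gm = g(2)[OF elim(6)]
    have "partition_mean n (g n) * W n (\<delta> / 2) \<delta> \<le> S n (\<delta> / 2) \<delta> + \<eta> * W n (\<delta> / 2) \<delta>"
      unfolding W_def S_def sum_distrib_left sum.distrib[symmetric]
    proof (rule sum_mono)
      fix m assume m: "m \<in> window n (\<delta> / 2) \<delta>"
      obtain j where j: "m = n + j" "coupled n j \<eta>"
        using bspec[OF conjunct1[OF elim(5)] m] by (elim exE conjE)
      have "partition_mean n (g n) \<le> partition_mean m (g n) + \<eta>"
        unfolding j(1) by (rule coupled_monotone[OF j(2) gm g(1)])
      from mult_left_mono[OF this level_prob_nonneg[of "crit n" m]]
      show "partition_mean n (g n) * level_prob (crit n) m \<le> level_prob (crit n) m * partition_mean m (g n) + \<eta> * level_prob (crit n) m"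
        by (simp add: algebra_simps)
    qed
    then have "partition_mean n (g n) \<le> S n (\<delta> / 2) \<delta> / W n (\<delta> / 2) \<delta> + \<eta>" using elim(3) by (simp add: field_simps)
    then have up: "partition_mean n (g n) < l + r" using elim(1) by linarith
    have "S n (- \<delta>) (- (\<delta> / 2)) \<le> (partition_mean n (g n) + \<eta>) * W n (- \<delta>) (- (\<delta> / 2))"
      unfolding W_def S_def sum_distrib_left
    proof (rule sum_mono)
      fix m assume m: "m \<in> window n (- \<delta>) (- (\<delta> / 2))"
      obtain j where j: "n = m + j" "coupled m j \<eta>"
        using bspec[OF conjunct2[OF elim(5)] m] by (elim exE conjE)
      have "partition_mean m (g n) \<le> partition_mean (m + j) (g n) + \<eta>"
        by (rule coupled_monotone[OF j(2) gm g(1)])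
      then have "partition_mean m (g n) \<le> partition_mean n (g n) + \<eta>" by (simp add: j(1)[symmetric])
      from mult_left_mono[OF this level_prob_nonneg[of "crit n" m]]
      show "level_prob (crit n) m * partition_mean m (g n) \<le> (partition_mean n (g n) + \<eta>) * level_prob (crit n) m"
        by (simp add: algebra_simps)
    qed
    then have "S n (- \<delta>) (- (\<delta> / 2)) / W n (- \<delta>) (- (\<delta> / 2)) \<le> partition_mean n (g n) + \<eta>"
      using elim(4) by (simp add: field_simps)
    then have "l - r < partition_mean n (g n)" using elim(2) by linarith
    with up show ?case by (simp add: dist_real_def abs_less_iff)
  qed
qed

text \<open>The control by the \<open>g i\<close> is used twice: along the tilts, to give
  \<open>f\<close> the same limit at all tilted times and so over windows, and along the additions
  that lead from a window below \<open>n\<close> to \<open>n\<close>. Each time the mean increments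
  of the \<open>g i\<close> vanish, because both ends have the same limit.\<close>

lemma controlled_mean_tendsto:
  fixes f :: "nat \<Rightarrow> nat multiset \<Rightarrow> real" and g :: "'i \<Rightarrow> nat \<Rightarrow> nat multiset \<Rightarrow> real"
  assumes I: "finite I" and f: "\<And>n p. \<bar>f n p\<bar> \<le> 1"
    and g: "\<And>i n p. \<bar>g i n p\<bar> \<le> 1" "\<And>i n. n \<ge> 2 \<Longrightarrow> monotone_on partitions (\<subseteq>#) (\<le>) (g i n)"
    and glim: "\<And>i y. 0 \<le> y \<Longrightarrow> y \<le> 1 \<Longrightarrow> (\<lambda>n. \<integral>\<omega>. g i n (sample (crit n + y / sd n) \<omega>) \<partial>M) \<longlonglongrightarrow> \<gamma> i"
    and flim: "(\<lambda>n. \<integral>\<omega>. f n (sample (crit n) \<omega>) \<partial>M) \<longlonglongrightarrow> l"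
    and fg: "\<And>e. e > 0 \<Longrightarrow> \<exists>C\<ge>0. \<forall>n\<ge>2. \<forall>p\<in>partitions. \<forall>q\<in>partitions. p \<subseteq># q \<longrightarrow>
      \<bar>f n p - f n q\<bar> \<le> e + C * (\<Sum>i\<in>I. g i n q - g i n p)"
  shows "(\<lambda>n. partition_mean n (f n)) \<longlonglongrightarrow> l"
proof -
  have glim0: "(\<lambda>n. \<integral>\<omega>. g i n (sample (crit n) \<omega>) \<partial>M) \<longlonglongrightarrow> \<gamma> i" for i
    using glim[of 0 i] by simp
  have tilt: "(\<lambda>n. \<integral>\<omega>. f n (sample (crit n + y / sd n) \<omega>) \<partial>M) \<longlonglongrightarrow> l" if y: "0 \<le> y" "y \<le> 1" for y
  proof -
    define Ef where "Ef n z = (\<integral>\<omega>. f n (sample (crit n + z / sd n) \<omega>) \<partial>M)" for n z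
    define Eg where "Eg i n z = (\<integral>\<omega>. g i n (sample (crit n + z / sd n) \<omega>) \<partial>M)" for i n z
    have "(\<lambda>n. Ef n y - Ef n 0) \<longlonglongrightarrow> 0"
    proof (rule tendstoI)
      fix r :: real assume r: "r > 0"
      then have "r / 2 > 0" by simp
      from fg[OF this] obtain C where C: "C \<ge> 0" "\<forall>n\<ge>2. \<forall>p\<in>partitions. \<forall>q\<in>partitions. p \<subseteq># q \<longrightarrow>
          \<bar>f n p - f n q\<bar> \<le> r / 2 + C * (\<Sum>i\<in>I. g i n q - g i n p)" by (elim exE conjE)
      have "(\<lambda>n. r / 2 + C * (\<Sum>i\<in>I. Eg i n 0 - Eg i n y)) \<longlonglongrightarrow> r / 2 + C * (\<Sum>i\<in>I. \<gamma> i - \<gamma> i)"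
        unfolding Eg_def by (intro tendsto_intros glim y) simp_all
      then have "\<forall>\<^sub>F n in sequentially. r / 2 + C * (\<Sum>i\<in>I. Eg i n 0 - Eg i n y) < r"
        by (rule order_tendstoD(2)) (use r in simp)
      then show "\<forall>\<^sub>F n in sequentially. dist (Ef n y - Ef n 0) 0 < r"
        using eventually_regular
      proof eventually_elim
        case (elim n)
        have n: "n \<ge> 2" using elim(2) by (simp add: regular_def)
        have t: "0 < crit n" "crit n \<le> crit n + y / sd n" using regular_pos[OF elim(2)] y by simp_all
        have ig: "integrable M (\<lambda>\<omega>. g i n (sample t \<omega>))" for i t by (rule integrable_sample[OF g(1)])
        have if': "integrable M (\<lambda>\<omega>. f n (sample t \<omega>))" for t by (rule integrable_sample[OF f])
        have "Ef n y - Ef n 0 = (\<integral>\<omega>. f n (sample (crit n + y / sd n) \<omega>) - f n (sample (crit n) \<omega>) \<partial>M)"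
          unfolding Ef_def by (simp add: if')
        also have "norm \<dots> \<le> (\<integral>\<omega>. norm (f n (sample (crit n + y / sd n) \<omega>) - f n (sample (crit n) \<omega>)) \<partial>M)"
          by (rule integral_norm_bound)
        also have "\<dots> \<le> (\<integral>\<omega>. r / 2 + C * (\<Sum>i\<in>I. g i n (sample (crit n) \<omega>) - g i n (sample (crit n + y / sd n) \<omega>)) \<partial>M)"
        proof (rule integral_mono_AE)
          show "integrable M (\<lambda>\<omega>. norm (f n (sample (crit n + y / sd n) \<omega>) - f n (sample (crit n) \<omega>)))"
            by (intro integrable_norm Bochner_Integration.integrable_diff if')
          show "integrable M (\<lambda>\<omega>. r / 2 + C * (\<Sum>i\<in>I. g i n (sample (crit n) \<omega>) - g i n (sample (crit n + y / sd n) \<omega>)))"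
            by (intro Bochner_Integration.integrable_add integrable_const integrable_mult_right
                Bochner_Integration.integrable_sum Bochner_Integration.integrable_diff ig)
          show "AE \<omega> in M. norm (f n (sample (crit n + y / sd n) \<omega>) - f n (sample (crit n) \<omega>))
              \<le> r / 2 + C * (\<Sum>i\<in>I. g i n (sample (crit n) \<omega>) - g i n (sample (crit n + y / sd n) \<omega>))"
            using AE_sample_mono[OF t]
          proof eventually_elim
            case (elim \<omega>)
            then show ?case
              using C(2)[rule_format, OF n sample_partition sample_partition elim] by simp
          qed
        qed
        also have "\<dots> = r / 2 + C * (\<Sum>i\<in>I. Eg i n 0 - Eg i n y)"
          unfolding Eg_def by (simp add: ig prob_space)
        finally show ?case using elim(1) by simp
      qed
    qed
    from tendsto_add[OF this, of "\<lambda>n. Ef n 0" l] show ?thesis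
      using flim by (simp add: Ef_def)
  qed
  have gmean: "(\<lambda>n. partition_mean n (g i n)) \<longlonglongrightarrow> \<gamma> i" for i
    by (rule monotone_mean_tendsto[OF g glim])
  show ?thesis
  proof (rule tendstoI)
    fix r :: real assume r: "r > 0"
    then have "r / 4 > 0" by simp
    from fg[OF this] obtain C where C: "C \<ge> 0" "\<forall>n\<ge>2. \<forall>p\<in>partitions. \<forall>q\<in>partitions. p \<subseteq># q \<longrightarrow>
        \<bar>f n p - f n q\<bar> \<le> r / 4 + C * (\<Sum>i\<in>I. g i n q - g i n p)" by (elim exE conjE)
    \<comment> \<open>The coupling error enters once through \<open>f\<close> and once, with factor
      \<open>C\<close>, through each \<open>g i\<close>.\<close>
    define K where "K = 1 + C * real (card I)"
    have K: "K > 0" unfolding K_def using C(1) by (intro add_pos_nonneg) auto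
    then have "r / (4 * K) > 0" using r by simp
    from small_scale_exists[OF this] obtain \<delta> where d: "0 < \<delta>" "\<delta> < 1 / 2"
      and dr: "sqrt ((1 + \<delta>) * exp (4 * exp 16 * \<delta>\<^sup>2) - 1) < r / (4 * K)" .
    define \<eta> where "\<eta> = sqrt ((1 + \<delta>) * exp (4 * exp 16 * \<delta>\<^sup>2) - 1)"
    have \<eta>: "K * \<eta> < r / 4" using dr K by (simp add: \<eta>_def pos_less_divide_eq mult_ac)
    \<comment> \<open>One window suffices, since the difference of the means of \<open>f\<close> is
      bounded in modulus.\<close>
    define wn where "wn n = window n (- \<delta>) (- (\<delta> / 2))" for n
    define \<mu> where "\<mu> = measure std_normal_distribution {- \<delta><..- (\<delta> / 2)}"
    have xy: "- \<delta> < - (\<delta> / 2)" using d by simp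
    have \<mu>: "\<mu> > 0" unfolding \<mu>_def by (rule std_normal_Ioc_pos[OF xy])
    define W where "W n = (\<Sum>m\<in>wn n. level_prob (crit n) m)" for n
    define Sf where "Sf n = (\<Sum>m\<in>wn n. level_prob (crit n) m * partition_mean m (f n))" for n
    define Sg where "Sg i n = (\<Sum>m\<in>wn n. level_prob (crit n) m * partition_mean m (g i n))" for i n
    have W: "W \<longlonglongrightarrow> \<mu>" unfolding W_def[abs_def] wn_def \<mu>_def by (rule window_sum[OF xy])
    have Sf: "Sf \<longlonglongrightarrow> l * \<mu>" unfolding Sf_def[abs_def] wn_def \<mu>_def by (rule window_mean_tendsto[OF f tilt xy])
    have Sg: "Sg i \<longlonglongrightarrow> \<gamma> i * \<mu>" for i
      unfolding Sg_def[abs_def] wn_def \<mu>_def by (rule window_mean_tendsto[OF g(1) glim xy])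
    have Wpos: "\<forall>\<^sub>F n in sequentially. W n > 0" by (rule order_tendstoD(1)[OF W \<mu>])
    have "(\<lambda>n. r / 4 + \<eta> + C * (\<Sum>i\<in>I. partition_mean n (g i n) - Sg i n / W n + \<eta>))
      \<longlonglongrightarrow> r / 4 + \<eta> + C * (\<Sum>i\<in>I. \<gamma> i - \<gamma> i * \<mu> / \<mu> + \<eta>)"
      using \<mu> by (intro tendsto_intros gmean Sg W) simp
    moreover have "r / 4 + \<eta> + C * (\<Sum>i\<in>I. \<gamma> i - \<gamma> i * \<mu> / \<mu> + \<eta>) < r / 2"
    proof -
      have "r / 4 + \<eta> + C * (\<Sum>i\<in>I. \<gamma> i - \<gamma> i * \<mu> / \<mu> + \<eta>) = r / 4 + K * \<eta>"
        using \<mu> by (simp add: K_def algebra_simps)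
      then show ?thesis using \<eta> by simp
    qed
    ultimately have b1: "\<forall>\<^sub>F n in sequentially. r / 4 + \<eta> + C * (\<Sum>i\<in>I. partition_mean n (g i n) - Sg i n / W n + \<eta>) < r / 2"
      by (rule order_tendstoD(2))
    have "(\<lambda>n. Sf n / W n) \<longlonglongrightarrow> l * \<mu> / \<mu>" using \<mu> by (intro tendsto_divide Sf W) simp
    then have "(\<lambda>n. Sf n / W n) \<longlonglongrightarrow> l" using \<mu> by simp
    from tendstoD[OF this, of "r / 2"] have b2: "\<forall>\<^sub>F n in sequentially. dist (Sf n / W n) l < r / 2" using r by simp
    show "\<forall>\<^sub>F n in sequentially. dist (partition_mean n (f n)) l < r"
      using b1 b2 Wpos window_coupled[OF d \<eta>_def[symmetric]] eventually_ge_at_top[of 2]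
    proof eventually_elim
      case (elim n)
      define P where "P = level_prob (crit n)"
      have "\<bar>partition_mean n (f n) * W n - Sf n\<bar> = \<bar>\<Sum>m\<in>wn n. P m * (partition_mean n (f n) - partition_mean m (f n))\<bar>"
        by (simp add: W_def Sf_def P_def sum_distrib_left right_diff_distrib sum_subtractf mult.commute)
      also have "\<dots> \<le> (\<Sum>m\<in>wn n. \<bar>P m * (partition_mean n (f n) - partition_mean m (f n))\<bar>)" by (rule sum_abs)
      also have "\<dots> \<le> (\<Sum>m\<in>wn n. P m * (r / 4 + \<eta> + C * (\<Sum>i\<in>I. partition_mean n (g i n) - partition_mean m (g i n) + \<eta>)))"
      proof (rule sum_mono)
        fix m assume m: "m \<in> wn n"
        obtain j where j: "n = m + j" "coupled m j \<eta>"
          using bspec[OF conjunct2[OF elim(4)] m[unfolded wn_def]] by (elim exE conjE)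
        have "\<bar>partition_mean m (f n) - partition_mean (m + j) (f n)\<bar>
          \<le> r / 4 + \<eta> + C * (\<Sum>i\<in>I. partition_mean (m + j) (g i n) - partition_mean m (g i n) + \<eta>)"
          by (rule coupled_controlled[OF j(2) f g(1) C(1) C(2)[rule_format, OF elim(5)]])
        then have "\<bar>partition_mean n (f n) - partition_mean m (f n)\<bar>
          \<le> r / 4 + \<eta> + C * (\<Sum>i\<in>I. partition_mean n (g i n) - partition_mean m (g i n) + \<eta>)"
          unfolding j(1)[symmetric] by (simp only: abs_minus_commute)
        then show "\<bar>P m * (partition_mean n (f n) - partition_mean m (f n))\<bar>
          \<le> P m * (r / 4 + \<eta> + C * (\<Sum>i\<in>I. partition_mean n (g i n) - partition_mean m (g i n) + \<eta>))"
          unfolding abs_mult P_def abs_of_nonneg[OF level_prob_nonneg] by (rule mult_left_mono[OF _ level_prob_nonneg])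
      qed
      also have "\<dots> = W n * (r / 4 + \<eta>) + C * (\<Sum>i\<in>I. \<Sum>m\<in>wn n. P m * (partition_mean n (g i n) - partition_mean m (g i n) + \<eta>))"
        by (subst sum.swap) (simp add: W_def P_def distrib_left sum.distrib sum_distrib_left sum_distrib_right mult_ac)
      also have "\<dots> = W n * (r / 4 + \<eta>) + C * (\<Sum>i\<in>I. W n * (partition_mean n (g i n) - Sg i n / W n + \<eta>))"
      proof -
        have "(\<Sum>m\<in>wn n. P m * (partition_mean n (g i n) - partition_mean m (g i n) + \<eta>))
          = W n * (partition_mean n (g i n) - Sg i n / W n + \<eta>)" for i
        proof -
          have "(\<Sum>m\<in>wn n. P m * (partition_mean n (g i n) - partition_mean m (g i n) + \<eta>))
            = W n * (partition_mean n (g i n) + \<eta>) - Sg i n"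
            unfolding W_def Sg_def P_def sum_distrib_right sum_subtractf[symmetric]
            by (rule sum.cong) (simp_all add: algebra_simps)
          also have "\<dots> = W n * (partition_mean n (g i n) - Sg i n / W n + \<eta>)" using elim(3) by (simp add: field_simps)
          finally show ?thesis .
        qed
        then show ?thesis by simp
      qed
      also have "\<dots> = W n * (r / 4 + \<eta> + C * (\<Sum>i\<in>I. partition_mean n (g i n) - Sg i n / W n + \<eta>))"
      proof -
        have "w * x + C * (w * y) = w * (x + C * y)" for w x y :: real by (simp add: algebra_simps)
        then show ?thesis by (simp only: sum_distrib_left[symmetric])
      qed
      also have "\<dots> < W n * (r / 2)" using elim(1,3) by (intro mult_strict_left_mono)
      finally have "\<bar>partition_mean n (f n) * W n - Sf n\<bar> < W n * (r / 2)" .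
      moreover have "partition_mean n (f n) * W n - Sf n = (partition_mean n (f n) - Sf n / W n) * W n"
        using elim(3) by (simp add: left_diff_distrib)
      ultimately have "\<bar>partition_mean n (f n) - Sf n / W n\<bar> < r / 2" using elim(3) by (simp add: abs_mult)
      then show ?case using elim(2) unfolding dist_real_def by linarith
    qed
  qed
qed

end

section \<open>Test functions on vectors and conclusion\<close>

lemma arctan_diff_lower:
  assumes v: "\<bar>v\<bar> \<le> R" and r: "0 < r" "r \<le> 1" "r \<le> \<bar>v - w\<bar>"
  shows "r / (1 + (R + 1)\<^sup>2) \<le> \<bar>arctan v - arctan w\<bar>"
proof -
  \<comment> \<open>Only one point is bounded; monotonicity of \<open>arctan\<close> lets a point at
    distance \<open>r\<close> stand for all points further away, and the mean value theorem settles
    that case.\<close>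
  have step: "r / (1 + (R + 1)\<^sup>2) \<le> arctan (x + r) - arctan x" if x: "\<bar>x\<bar> \<le> R" for x
  proof -
    have "\<exists>z>x. z < x + r \<and> arctan (x + r) - arctan x = (x + r - x) * inverse (1 + z\<^sup>2)"
      using r by (intro MVT2 DERIV_arctan) simp
    then obtain z where z: "x < z" "z < x + r" "arctan (x + r) - arctan x = (x + r - x) * inverse (1 + z\<^sup>2)"
      by (elim exE conjE)
    have "\<bar>z\<bar> \<le> R + 1" using z(1,2) x r by (simp add: abs_le_iff)
    then have "\<bar>z\<bar>\<^sup>2 \<le> (R + 1)\<^sup>2" by (intro power_mono) auto
    then have "r / (1 + (R + 1)\<^sup>2) \<le> r / (1 + z\<^sup>2)"
      using r by (intro divide_left_mono mult_pos_pos) (auto simp: add_pos_nonneg)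
    also have "\<dots> = arctan (x + r) - arctan x" using z(3) by (simp add: divide_inverse)
    finally show ?thesis .
  qed
  show ?thesis
  proof (cases "v \<le> w")
    case True
    then have "arctan (v + r) \<le> arctan w" using r by (simp add: arctan_le_iff)
    then show ?thesis using step[OF v] by linarith
  next
    case False
    then have "arctan (- v + r) \<le> arctan (- w)" using r by (simp only: arctan_le_iff)
    then show ?thesis using step[of "- v"] v by (simp add: arctan_minus)
  qed
qed

text \<open>If one point lies in the support ball and the other is close, uniform continuity bounds
  the difference. If it is not close, some coordinate moves by at least \<open>r\<close>, its
  \<open>arctan\<close> by at least \<kappa>, and \<open>2 / \<kappa>\<close> times this exceeds any
  difference of values. Far out, where \<open>arctan\<close> is flat, \<open>f\<close>
  vanishes.\<close>

lemma arctan_control: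
  fixes f :: "real ^ 'd \<Rightarrow> real"
  assumes f: "continuous_on UNIV f" "\<And>z. \<bar>f z\<bar> \<le> 1" "\<And>z. norm z \<ge> R \<Longrightarrow> f z = 0" and R: "R > 0" and e: "e > 0"
  shows "\<exists>C\<ge>0. \<forall>y z. \<bar>f y - f z\<bar> \<le> e + C * (\<Sum>i\<in>UNIV. \<bar>arctan (y $ i) - arctan (z $ i)\<bar>)"
proof -
  have "uniformly_continuous_on (cball 0 (R + 1)) f"
    by (rule compact_uniformly_continuous[OF continuous_on_subset[OF f(1)]]) auto
  then obtain d where d: "d > 0"
    "\<forall>x\<in>cball 0 (R + 1). \<forall>x'\<in>cball 0 (R + 1). dist x' x < d \<longrightarrow> dist (f x') (f x) < e"
    unfolding uniformly_continuous_on_def using e by (elim allE[of _ e] impE exE conjE)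
  define \<delta> where "\<delta> = min d 1"
  \<comment> \<open>If all coordinates differed by less than \<open>r\<close>, the norm of the
    difference would be below \<delta>.\<close>
  define r where "r = \<delta> / real CARD('d)"
  have \<delta>: "\<delta> > 0" "\<delta> \<le> 1" "\<delta> \<le> d" using d(1) by (auto simp: \<delta>_def)
  have r: "r > 0" "r \<le> 1"
    using \<delta> by (simp_all add: r_def divide_le_eq order_trans[OF \<delta>(2)])
  define \<kappa> where "\<kappa> = r / (1 + (R + 1)\<^sup>2)"
  have \<kappa>: "\<kappa> > 0" unfolding \<kappa>_def using r by (intro divide_pos_pos) (auto simp: add_pos_nonneg)
  define T where "T y z = (\<Sum>i\<in>UNIV. \<bar>arctan (y $ i) - arctan (z $ i)\<bar>)" for y z :: "real ^ 'd"
  have T0: "T y z \<ge> 0" for y z unfolding T_def by (intro sum_nonneg) simp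
  have core: "\<bar>f y - f z\<bar> \<le> e + 2 / \<kappa> * T y z" if y: "norm y \<le> R" for y z
  proof (cases "norm (y - z) < \<delta>")
    case True
    then have "norm z \<le> R + 1" using y \<delta>(2) norm_triangle_sub[of z y] by (simp add: norm_minus_commute)
    then have "dist (f y) (f z) < e"
      using d(2)[rule_format, of z y] True y \<delta>(3) by (simp add: dist_norm)
    moreover have "0 \<le> 2 / \<kappa> * T y z" using T0 \<kappa> by simp
    ultimately show ?thesis by (simp add: dist_real_def)
  next
    case False
    have "\<exists>i. r \<le> \<bar>y $ i - z $ i\<bar>"
    proof (rule ccontr)
      assume "\<not> (\<exists>i. r \<le> \<bar>y $ i - z $ i\<bar>)"
      then have "\<bar>(y - z) $ i\<bar> < r" for i by (simp add: not_le)
      then have "(\<Sum>i\<in>UNIV. \<bar>(y - z) $ i\<bar>) < of_nat CARD('d) * r"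
        by (intro sum_bounded_above_strict) simp_all
      then have "norm (y - z) < \<delta>" using norm_le_l1_cart[of "y - z"] by (simp add: r_def)
      then show False using False by simp
    qed
    then obtain i where i: "r \<le> \<bar>y $ i - z $ i\<bar>" ..
    have "\<bar>y $ i\<bar> \<le> R" using component_le_norm_cart[of y i] y by simp
    then have "\<kappa> \<le> \<bar>arctan (y $ i) - arctan (z $ i)\<bar>" unfolding \<kappa>_def by (rule arctan_diff_lower[OF _ r i])
    also have "\<dots> \<le> T y z" unfolding T_def by (rule member_le_sum) auto
    finally have "2 \<le> 2 / \<kappa> * T y z" using \<kappa> by (simp add: field_simps)
    moreover have "\<bar>f y - f z\<bar> \<le> 2" using f(2)[of y] f(2)[of z] by linarith
    ultimately show ?thesis using e by linarith
  qed
  show ?thesis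
  proof (intro exI[of _ "2 / \<kappa>"] conjI allI)
    show "0 \<le> 2 / \<kappa>" using \<kappa> by simp
    fix y z
    have "\<bar>f y - f z\<bar> \<le> e + 2 / \<kappa> * T y z"
    proof -
      consider "norm y \<le> R" | "norm z \<le> R" | "norm y \<ge> R" "norm z \<ge> R" by linarith
      then show ?thesis
      proof cases
        case 1
        then show ?thesis by (rule core)
      next
        case 2
        have "T z y = T y z" unfolding T_def by (simp only: abs_minus_commute)
        then show ?thesis using core[OF 2, of y] by (simp only: abs_minus_commute)
      next
        case 3
        have "0 \<le> 2 / \<kappa> * T y z" using T0 \<kappa> by simp
        then show ?thesis using f(3)[OF 3(1)] f(3)[OF 3(2)] e by simp
      qed
    qed
    then show "\<bar>f y - f z\<bar> \<le> e + 2 / \<kappa> * (\<Sum>i\<in>UNIV. \<bar>arctan (y $ i) - arctan (z $ i)\<bar>)" by (simp only: T_def)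
  qed
qed

definition cutoff :: "nat \<Rightarrow> real ^ 'd \<Rightarrow> real" where
  "cutoff k z = max 0 (min 1 (real k + 1 - norm z))"

lemma cutoff_bounds: "0 \<le> cutoff k z" "cutoff k z \<le> 1" "norm z \<ge> real k + 1 \<Longrightarrow> cutoff k z = 0"
  by (auto simp: cutoff_def)

lemma continuous_cutoff: "continuous_on UNIV (cutoff k)"
  unfolding cutoff_def by (intro continuous_intros)

lemma cutoff_integral_tendsto:
  fixes Q :: "(real ^ 'd) measure"
  assumes "prob_space Q" "sets Q = sets borel"
  shows "(\<lambda>k. \<integral>z. cutoff k z \<partial>Q) \<longlonglongrightarrow> 1"
proof -
  interpret Q: prob_space Q by fact
  have m: "cutoff k \<in> borel_measurable Q" for k
    unfolding measurable_cong_sets[OF assms(2) refl] by (rule borel_measurable_continuous_onI[OF continuous_cutoff])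
  have "(\<lambda>k. cutoff k z) \<longlonglongrightarrow> 1" for z :: "real ^ 'd"
  proof (rule tendsto_eventually)
    have "\<forall>\<^sub>F k in sequentially. norm z \<le> real k"
      using filterlim_real_sequentially by (simp add: filterlim_at_top)
    then show "\<forall>\<^sub>F k in sequentially. cutoff k z = 1" by eventually_elim (simp add: cutoff_def)
  qed
  then have l: "AE z in Q. (\<lambda>k. cutoff k z) \<longlonglongrightarrow> 1" by (intro AE_I2)
  have bd: "AE z in Q. norm (cutoff k z) \<le> 1" for k
    by (intro AE_I2) (simp add: cutoff_bounds abs_of_nonneg)
  have "(\<lambda>k. \<integral>z. cutoff k z \<partial>Q) \<longlonglongrightarrow> (\<integral>z. 1 \<partial>Q)"
    by (rule integral_dominated_convergence[where w = "\<lambda>_. 1", OF _ m _ l bd]) simp_all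
  then show ?thesis by (simp add: Q.prob_space)
qed

theorem theorem7p2:
  fixes M :: "'a measure" and \<epsilon> :: "nat \<Rightarrow> nat \<Rightarrow> 'a \<Rightarrow> real"
    and M' :: "'b measure" and Z :: "'b \<Rightarrow> real ^ 'd"
    and X :: "'d::finite \<Rightarrow> nat multiset \<Rightarrow> real"
    and a b :: "'d \<Rightarrow> real \<Rightarrow> real" and u :: "real \<Rightarrow> real"
  assumes "prob_space M"
    and "prob_space.indep_vars M (\<lambda>_. borel) (\<lambda>(k, j). \<epsilon> k j) ({1..} \<times> {1..})"
    and "\<And>k j. k \<ge> 1 \<Longrightarrow> j \<ge> 1 \<Longrightarrow> distributed M lborel (\<epsilon> k j) (exponential_density 1)"
    and "\<And>i. monotone_on partitions (\<subseteq>#) (\<le>) (X i)"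
    and "\<And>i. regularly_varying (a i)"
    and "\<And>i. regularly_varying (b i)"
    and "\<And>i s. s > 0 \<Longrightarrow> b i s > 0"
    and "prob_space M'" and "Z \<in> borel_measurable M'"
    and "weak_limit
           (\<lambda>s. distr M borel (\<lambda>\<omega>. rescaled X a b s (partition_tilde (\<lambda>k j. \<epsilon> k j \<omega>) s)))
           (distr M' borel Z) at_top"
    and "u \<in> o[at_top](\<lambda>s. s powr (1/4))"
    and "filterlim u at_top at_top"
    and "\<And>i. ((\<lambda>s. b i s * (a i s - a i (s - u s * sqrt s))) \<longlongrightarrow> 0) at_top"
  shows "weak_limit
           (\<lambda>n. distr (measure_pmf (pmf_of_set (partitions_of n))) borel
                  (rescaled X a b (F (pi / sqrt (6 * real n)))))
           (distr M' borel Z) sequentially"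
proof -
  interpret exponential_array M \<epsilon>
    by (intro exponential_array.intro exponential_array_axioms.intro assms(1-3))
  define Q where "Q = distr M' borel Z"
  interpret Q: prob_space Q unfolding Q_def by (rule prob_space.prob_space_distr[OF assms(8,9)])
  have sQ: "sets Q = sets borel" by (simp add: Q_def)
  have tilde: "partition_tilde (\<lambda>k j. \<epsilon> k j \<omega>) s = sample (F_inv s) \<omega>" for \<omega> s
    by (simp add: partition_tilde_def sample_def)
  define V where "V n = rescaled X a b (F (crit n))" for n
  have mr: "(\<lambda>\<omega>. rescaled X a b s (sample t \<omega>)) \<in> borel_measurable M" for s t
    by (rule measurable_compose[OF measurable_sample]) simp
  have vec: "((\<lambda>s. \<integral>\<omega>. f (rescaled X a b s (sample (F_inv s) \<omega>)) \<partial>M) \<longlongrightarrow> (\<integral>z. f z \<partial>Q)) at_top"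
    if f: "continuous_on UNIV f" "bounded (range f)" for f :: "real ^ 'd \<Rightarrow> real"
  proof -
    have "((\<lambda>s. \<integral>x. f x \<partial>distr M borel (\<lambda>\<omega>. rescaled X a b s (sample (F_inv s) \<omega>))) \<longlongrightarrow> (\<integral>z. f z \<partial>Q)) at_top"
      using assms(10) f unfolding weak_limit_def tilde Q_def[symmetric] by (elim allE impE[OF _ conjI])
    then show ?thesis
      by (subst (asm) integral_distr[OF mr borel_measurable_continuous_onI[OF f(1)]])
  qed
  have vecn: "(\<lambda>n. \<integral>\<omega>. f (V n (sample (crit n) \<omega>)) \<partial>M) \<longlonglongrightarrow> (\<integral>z. f z \<partial>Q)"
    if f: "continuous_on UNIV f" "bounded (range f)" for f :: "real ^ 'd \<Rightarrow> real"
  proof (rule Lim_transform_eventually)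
    show "(\<lambda>n. \<integral>\<omega>. f (rescaled X a b (F (crit n)) (sample (F_inv (F (crit n))) \<omega>)) \<partial>M) \<longlonglongrightarrow> (\<integral>z. f z \<partial>Q)"
      by (rule filterlim_compose[OF vec[OF f] F_crit_at_top])
    show "\<forall>\<^sub>F n in sequentially. (\<integral>\<omega>. f (rescaled X a b (F (crit n)) (sample (F_inv (F (crit n))) \<omega>)) \<partial>M)
        = (\<integral>\<omega>. f (V n (sample (crit n) \<omega>)) \<partial>M)"
      using eventually_ge_at_top[of 2] by eventually_elim (simp add: V_def F_inv_F crit_bounds)
  qed
  have mc: "(\<lambda>z. z $ i) \<in> borel_measurable Q" for i
    unfolding measurable_cong_sets[OF sQ refl] by (intro borel_measurable_continuous_onI continuous_intros)
  \<comment> \<open>A coordinate is a continuous function of the vector, so its scaled law converges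
    to the marginal of \<open>Q\<close>.\<close>
  have coord: "scaled_coordinate M \<epsilon> (X i) (a i) (b i) (distr Q borel (\<lambda>z. z $ i)) u" for i
  proof (intro scaled_coordinate.intro scaled_coordinate_axioms.intro exponential_array_axioms assms(4,6,7,11-13))
    show "real_distribution (distr Q borel (\<lambda>z. z $ i))" by (rule Q.real_distribution_distr[OF mc])
    show "weak_limit (\<lambda>s. distr M borel (\<lambda>\<omega>. b i s * (X i (sample (F_inv s) \<omega>) - a i s))) (distr Q borel (\<lambda>z. z $ i)) at_top"
      unfolding weak_limit_def
    proof (intro allI impI)
      fix f :: "real \<Rightarrow> real" assume f: "continuous_on UNIV f \<and> bounded (range f)"
      note fm = borel_measurable_continuous_onI[OF conjunct1[OF f]]
      have "continuous_on UNIV (\<lambda>z :: real ^ 'd. f (z $ i))"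
        by (rule continuous_on_compose2[OF conjunct1[OF f]]) (auto intro: continuous_intros)
      moreover have "bounded (range (\<lambda>z :: real ^ 'd. f (z $ i)))"
        by (rule bounded_subset[OF conjunct2[OF f]]) auto
      ultimately have "((\<lambda>s. \<integral>\<omega>. f (rescaled X a b s (sample (F_inv s) \<omega>) $ i) \<partial>M) \<longlongrightarrow> (\<integral>z. f (z $ i) \<partial>Q)) at_top"
        by (rule vec)
      moreover have "(\<integral>x. f x \<partial>distr M borel (\<lambda>\<omega>. b i s * (X i (sample (F_inv s) \<omega>) - a i s)))
          = (\<integral>\<omega>. f (rescaled X a b s (sample (F_inv s) \<omega>) $ i) \<partial>M)" for s
        by (subst integral_distr[OF borel_measurable_sample fm]) (simp add: rescaled_def)
      ultimately show "((\<lambda>s. \<integral>x. f x \<partial>distr M borel (\<lambda>\<omega>. b i s * (X i (sample (F_inv s) \<omega>) - a i s)))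
          \<longlongrightarrow> (\<integral>x. f x \<partial>distr Q borel (\<lambda>z. z $ i))) at_top"
        by (simp add: integral_distr[OF mc fm])
    qed
  qed
  \<comment> \<open>Halving brings \<open>arctan\<close>, bounded here by 2, within the bound one of
    \<open>controlled_mean_tendsto\<close>.\<close>
  define g where "g i n p = arctan (V n p $ i) / 2" for i n p
  define \<gamma> where "\<gamma> i = (\<integral>x. arctan x \<partial>distr Q borel (\<lambda>z. z $ i)) / 2" for i
  have g1: "\<bar>g i n p\<bar> \<le> 1" for i n p
    using scaled_coordinate.arctan_abs_le[OF coord[of i], of "V n p $ i"] by (simp add: g_def)
  have gm: "monotone_on partitions (\<subseteq>#) (\<le>) (g i n)" if n: "n \<ge> 2" for i n
  proof -
    interpret C: scaled_coordinate M \<epsilon> "X i" "a i" "b i" "distr Q borel (\<lambda>z. z $ i)" u by (rule coord)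
    have eq: "g i n p = arctan (C.Y n p) / 2" for p by (simp add: g_def V_def rescaled_def C.Y_def)
    show ?thesis
      by (rule monotone_onI) (use monotone_onD[OF C.arctan_Y_mono[OF n]] in \<open>simp add: eq\<close>)
  qed
  have gl: "(\<lambda>n. \<integral>\<omega>. g i n (sample (crit n + y / sd n) \<omega>) \<partial>M) \<longlonglongrightarrow> \<gamma> i" if y: "0 \<le> y" "y \<le> 1" for i y
  proof -
    interpret C: scaled_coordinate M \<epsilon> "X i" "a i" "b i" "distr Q borel (\<lambda>z. z $ i)" u by (rule coord)
    have eq: "g i n p = arctan (C.Y n p) / 2" for n p by (simp add: g_def V_def rescaled_def C.Y_def)
    show ?thesis unfolding eq \<gamma>_def
      using tendsto_divide[OF C.arctan_tilt[OF y] tendsto_const[of 2]] by simp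
  qed
  have core: "(\<lambda>n. partition_mean n (\<lambda>p. f (V n p))) \<longlonglongrightarrow> (\<integral>z. f z \<partial>Q)"
    if f: "continuous_on UNIV f" "\<And>z. \<bar>f z\<bar> \<le> 1" and R: "R > 0" "\<And>z. norm z \<ge> R \<Longrightarrow> f z = 0"
    for f :: "real ^ 'd \<Rightarrow> real" and R
  proof (rule controlled_mean_tendsto[where g = g and \<gamma> = \<gamma> and I = UNIV])
    show "(\<lambda>n. \<integral>\<omega>. f (V n (sample (crit n) \<omega>)) \<partial>M) \<longlonglongrightarrow> (\<integral>z. f z \<partial>Q)"
      by (rule vecn[OF f(1)]) (rule boundedI[of _ 1], use f(2) in auto)
    fix e :: real assume e: "e > 0"
    have "\<exists>C\<ge>0. \<forall>y z. \<bar>f y - f z\<bar> \<le> e + C * (\<Sum>i\<in>UNIV. \<bar>arctan (y $ i) - arctan (z $ i)\<bar>)"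
      by (rule arctan_control[OF f(1) f(2) _ R(1) e]) (rule R(2))
    then obtain C where C: "C \<ge> 0"
      "\<forall>y z. \<bar>f y - f z\<bar> \<le> e + C * (\<Sum>i\<in>UNIV. \<bar>arctan (y $ i) - arctan (z $ i)\<bar>)" by (elim exE conjE)
    show "\<exists>C\<ge>0. \<forall>n\<ge>2. \<forall>p\<in>partitions. \<forall>q\<in>partitions. p \<subseteq># q \<longrightarrow>
        \<bar>f (V n p) - f (V n q)\<bar> \<le> e + C * (\<Sum>i\<in>UNIV. g i n q - g i n p)"
    proof (intro exI[of _ "2 * C"] conjI allI impI ballI)
      show "0 \<le> 2 * C" using C(1) by simp
      fix n :: nat and p q assume n: "2 \<le> n" and pq: "p \<in> partitions" "q \<in> partitions" "p \<subseteq># q"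
      have "\<bar>arctan (V n p $ i) - arctan (V n q $ i)\<bar> = 2 * (g i n q - g i n p)" for i
        using monotone_onD[OF gm[OF n, of i] pq] by (simp add: g_def)
      then have eq: "C * (\<Sum>i\<in>UNIV. \<bar>arctan (V n p $ i) - arctan (V n q $ i)\<bar>) = 2 * C * (\<Sum>i\<in>UNIV. g i n q - g i n p)"
        by (simp only: sum_distrib_left[symmetric])
      show "\<bar>f (V n p) - f (V n q)\<bar> \<le> e + 2 * C * (\<Sum>i\<in>UNIV. g i n q - g i n p)"
        using C(2)[rule_format, of "V n p" "V n q"] unfolding eq .
    qed
  qed (use f g1 gm gl in auto)
  have "(\<lambda>n. partition_mean n (\<lambda>p. f (V n p))) \<longlonglongrightarrow> (\<integral>z. f z \<partial>Q)"
    if f: "continuous_on UNIV f" "bounded (range f)" for f :: "real ^ 'd \<Rightarrow> real"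
  proof (rule tendstoI)
    fix e :: real assume e: "e > 0"
    \<comment> \<open>A bounded \<open>f\<close> is split into a compactly supported part
      \<open>K * h\<close> and a remainder of at most \<open>K * (1 - cutoff k)\<close>.\<close>
    obtain K where K: "K > 0" "\<And>z. \<bar>f z\<bar> \<le> K"
      using f(2) unfolding bounded_pos by auto
    have "(\<lambda>k. K * (1 - (\<integral>z. cutoff k z \<partial>Q)) + K * (1 - (\<integral>z. cutoff k z \<partial>Q))) \<longlonglongrightarrow> K * (1 - 1) + K * (1 - 1)"
      by (intro tendsto_intros cutoff_integral_tendsto Q.prob_space_axioms sQ)
    then have "\<forall>\<^sub>F k in sequentially. K * (1 - (\<integral>z. cutoff k z \<partial>Q)) + K * (1 - (\<integral>z. cutoff k z \<partial>Q)) < e"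
      by (rule order_tendstoD(2)) (use e in simp)
    from eventually_happens[OF this]
    obtain k where k: "K * (1 - (\<integral>z. cutoff k z \<partial>Q)) + K * (1 - (\<integral>z. cutoff k z \<partial>Q)) < e" by auto
    define h where "h z = f z * cutoff k z / K" for z
    have hc: "continuous_on UNIV h"
      unfolding h_def using K(1) by (intro continuous_intros f continuous_cutoff) simp
    have h1: "\<bar>h z\<bar> \<le> 1" for z
    proof -
      have "\<bar>f z\<bar> * cutoff k z \<le> K * 1" using K cutoff_bounds[of k z] by (intro mult_mono) auto
      then show ?thesis using K(1) cutoff_bounds[of k z] by (simp add: h_def abs_mult)
    qed
    have fh: "\<bar>f z - K * h z\<bar> \<le> K * (1 - cutoff k z)" for z
    proof -
      have "f z - K * h z = f z * (1 - cutoff k z)" using K(1) by (simp add: h_def right_diff_distrib)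
      then show ?thesis using K(2)[of z] cutoff_bounds(2)[of k z] by (simp add: abs_mult mult_right_mono)
    qed
    have lim_h: "(\<lambda>n. partition_mean n (\<lambda>p. h (V n p))) \<longlonglongrightarrow> (\<integral>z. h z \<partial>Q)"
      by (rule core[OF hc h1, of "real k + 1"]) (simp_all add: h_def cutoff_bounds)
    \<comment> \<open>Applied to the cutoff itself, \<open>core\<close> supplies tightness: in the
      limit the uniform laws leave no more mass outside the cutoff than \<open>Q\<close>
      does.\<close>
    have lim_c: "(\<lambda>n. partition_mean n (\<lambda>p. cutoff k (V n p))) \<longlonglongrightarrow> (\<integral>z. cutoff k z \<partial>Q)"
      by (rule core[OF continuous_cutoff, of _ "real k + 1"]) (simp_all add: cutoff_bounds)
    have meas: "w \<in> borel_measurable Q" if "continuous_on UNIV w" for w :: "real ^ 'd \<Rightarrow> real"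
      unfolding measurable_cong_sets[OF sQ refl] by (rule borel_measurable_continuous_onI[OF that])
    have int: "integrable Q f" "integrable Q h" "integrable Q (cutoff k)"
    proof -
      show "integrable Q f" by (rule Q.integrable_const_bound[of _ K]) (simp_all add: K(2) meas f(1))
      show "integrable Q h" by (rule Q.integrable_const_bound[of _ 1]) (simp_all add: h1 meas hc)
      show "integrable Q (cutoff k)"
        by (rule Q.integrable_const_bound[of _ 1]) (simp_all add: cutoff_bounds abs_of_nonneg meas continuous_cutoff)
    qed
    have Qb: "\<bar>(\<integral>z. f z \<partial>Q) - K * (\<integral>z. h z \<partial>Q)\<bar> \<le> K * (1 - (\<integral>z. cutoff k z \<partial>Q))"
    proof -
      have "(\<integral>z. f z \<partial>Q) - K * (\<integral>z. h z \<partial>Q) = (\<integral>z. f z - K * h z \<partial>Q)" by (simp add: int)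
      also have "norm \<dots> \<le> (\<integral>z. norm (f z - K * h z) \<partial>Q)" by (rule integral_norm_bound)
      also have "\<dots> \<le> (\<integral>z. K * (1 - cutoff k z) \<partial>Q)"
        by (rule integral_mono) (use fh in \<open>simp_all add: int\<close>)
      also have "\<dots> = K * (1 - (\<integral>z. cutoff k z \<partial>Q))" by (simp add: int Q.prob_space)
      finally show ?thesis by simp
    qed
    have Pb: "\<bar>partition_mean n (\<lambda>p. f (V n p)) - K * partition_mean n (\<lambda>p. h (V n p))\<bar>
        \<le> K * (1 - partition_mean n (\<lambda>p. cutoff k (V n p)))" for n
    proof -
      have "\<bar>partition_mean n (\<lambda>p. f (V n p) - K * h (V n p))\<bar> \<le> partition_mean n (\<lambda>p. \<bar>f (V n p) - K * h (V n p)\<bar>)"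
        by (rule partition_mean_abs_le)
      also have "\<dots> \<le> partition_mean n (\<lambda>p. K * (1 - cutoff k (V n p)))" by (rule partition_mean_mono) (rule fh)
      finally show ?thesis
        by (simp only: partition_mean_diff partition_mean_cmult partition_mean_const)
    qed
    have "(\<lambda>n. K * (1 - partition_mean n (\<lambda>p. cutoff k (V n p)))
          + K * \<bar>partition_mean n (\<lambda>p. h (V n p)) - (\<integral>z. h z \<partial>Q)\<bar> + K * (1 - (\<integral>z. cutoff k z \<partial>Q)))
        \<longlonglongrightarrow> K * (1 - (\<integral>z. cutoff k z \<partial>Q)) + K * \<bar>(\<integral>z. h z \<partial>Q) - (\<integral>z. h z \<partial>Q)\<bar> + K * (1 - (\<integral>z. cutoff k z \<partial>Q))"
      by (intro tendsto_intros lim_h lim_c)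
    then have "\<forall>\<^sub>F n in sequentially. K * (1 - partition_mean n (\<lambda>p. cutoff k (V n p)))
          + K * \<bar>partition_mean n (\<lambda>p. h (V n p)) - (\<integral>z. h z \<partial>Q)\<bar> + K * (1 - (\<integral>z. cutoff k z \<partial>Q)) < e"
      by (rule order_tendstoD(2)) (use k in simp)
    then show "\<forall>\<^sub>F n in sequentially. dist (partition_mean n (\<lambda>p. f (V n p))) (\<integral>z. f z \<partial>Q) < e"
    proof eventually_elim
      case (elim n)
      have "\<bar>K * partition_mean n (\<lambda>p. h (V n p)) - K * (\<integral>z. h z \<partial>Q)\<bar>
        = K * \<bar>partition_mean n (\<lambda>p. h (V n p)) - (\<integral>z. h z \<partial>Q)\<bar>"
        using K(1) by (simp add: right_diff_distrib[symmetric] abs_mult)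
      then show ?case using elim Pb[of n] Qb unfolding dist_real_def by linarith
    qed
  qed
  then show ?thesis
    unfolding weak_limit_def Q_def[symmetric]
    by (auto simp: integral_distr borel_measurable_continuous_onI integral_uniform_partition V_def crit_def)
qed

end
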